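(* Let $X$ be a locally compact Hausdorff space and let $\kappa$ be a perfect kernel on $X$ satisfying the domination principle and the $h$-Ugaheri maximum principle for some $h\in[1,\infty)$. Let $A\subset X$ be an arbitrary set with $\mathrm{cap}_*A>0$, and let $\omega\in\mathfrak M^+$, $\omega\neq0$, be bounded ($\omega(X)<\infty$) and such that $U^\omega$ is continuous on every compact subset of $A$ and $\sup_{x\in A}U^\omega(x)<\infty$. Put $H:=h\,\omega(X)$ and $f:=-U^\omega$. Then the inner balayage $\omega^A$ of $\omega$ to $A$ exists, is unique, and can alternatively be characterized by any one of the following equivalent assertions (i)--(iv). (i) $\omega^A$ is the only measure in $\mathcal E'_H(A)$ having the property $U^{\omega^A}=U^\omega$ n.e. on $A$. (ii) $\omega^A$ is uniquely determined within $\mathcal E'_H(A)$ by any one of the limit relations $$\omega^K\to\omega^A\ \text{ strongly in }\mathcal E^+\text{ as }K\uparrow A,$$ $$\omega^K\to\omega^A\ \text{ vaguely in }\mathfrak M^+\text{ as }K\uparrow A,$$ $$U^{\omega^K}\uparrow U^{\omega^A}\ \text{ pointwise on }X\text{ as }K\uparrow A,$$ where, for compact $K\subset A$, $\omega^K$ denotes the only measure in $\mathcal E^+(K)$ having the property $U^{\omega^K}=U^\omega$ n.e. on $K$, or equivalently $$I_f(\omega^K)=\min_{\mu\in\mathcal E^+(K)}I_f(\mu)=\min_{\mu\in\mathcal E^+_H(K)}I_f(\mu).$$ (iii) $\omega^A$ is the only measure in the class $\Gamma_{A,\omega}:=\{\nu\in\mathcal E^+:\ U^\nu\geqslant U^\omega\text{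 n.e. on }A\}$ having the property $$U^{\omega^A}=\min_{\nu\in\Gamma_{A,\omega}}U^\nu\quad\text{on }X.$$ (iv) $\omega^A$ is the only measure in the class $\Gamma_{A,\omega}$ having the property $$\|\omega^A\|=\min_{\nu\in\Gamma_{A,\omega}}\|\nu\|.$$
   Context: Measures and energies. $\mathfrak M$ is the space of (signed, real-valued) Radon measures on $X$ with the vague topology (pointwise convergence on $C_0(X)$, the continuous functions $X\to\mathbb R$ of compact support); $\mathfrak M^+$ is the cone of positive ones. A kernel on $X$ is a symmetric lower semicontinuous function $\kappa:X\times X\to[0,\infty]$. For $\mu,\nu\in\mathfrak M$, $I(\mu,\nu):=\int\kappa(x,y)\,d(\mu\otimes\nu)(x,y)$ and $U^\mu(x):=\int\kappa(x,y)\,d\mu(y)$, whenever well defined as a finite number or $\pm\infty$; $I(\mu):=I(\mu,\mu)$. $\mathcal E$ is the set of $\mu\in\mathfrak M$ with $I(\mu)$ finite, $\mathcal E^+:=\mathcal E\cap\mathfrak M^+$. The kernel satisfies the energy principle (is strictly positive definite) if $I(\mu)\geqslant0$ for all signed $\mu$ (whenever defined), with $I(\mu)=0$ only for $\mu=0$; then $\mathcal E$ is a pre-Hilbert space with inner product $I(\mu,\nu)$ and norm $\|\mu\|:=\sqrt{I(\mu)}$, whose topology is called strong. The kernel is perfect if it satisfies the energy principle, $\mathcal E^+$ is strongly complete, and the strong topology on $\mathcal E^+$ is finer than the induced vague topology. Domination principle: for $\mu\in\mathcal E^+$, $\nu\in\mathfrak M^+$ with $U^\mu\leqslant U^\nu$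 $\mu$-a.e., one has $U^\mu\leqslant U^\nu$ on $X$. $h$-Ugaheri maximum principle: for each $\mu\in\mathcal E^+$ with $U^\mu\leqslant c$ $\mu$-a.e., where $c\in(0,\infty)$, one has $U^\mu\leqslant hc$ on $X$. Capacity. For compact $K$, $\mathrm{cap}\,K:=1/\inf\{I(\mu):\mu\in\mathfrak M^+,\ \mathrm{Supp}(\mu)\subset K,\ \mu(X)=1\}$ (with $1/\infty:=0$); $\mathrm{cap}_*A:=\sup\{\mathrm{cap}\,K: K\subset A\text{ compact}\}$ (inner capacity). A property holds n.e. (nearly everywhere) on $Q$ if the set of points of $Q$ where it fails has inner capacity zero. Classes. $\mu\in\mathfrak M^+$ is concentrated on $A$ if $X\setminus A$ is locally $\mu$-negligible (equivalently, $A$ is $\mu$-measurable and $\mu=1_A\cdot\mu$); $\mathfrak M^+(A)$ is the set of these, $\mathcal E^+(A):=\mathcal E\cap\mathfrak M^+(A)$, and $\mathcal E'(A)$ is the strong closure of $\mathcal E^+(A)$ in $\mathcal E^+$. Further $\mathcal E^+_H(A):=\{\mu\in\mathcal E^+(A):\mu(X)\leqslant H\}$, and $\mathcal E'_H(A)$ is its strong closure in $\mathcal E^+$. The Gauss functional is $I_f(\mu):=\|\mu\|^2+2\int f\,d\mu=\|\mu\|^2-2\int U^\omega\,d\mu$. Balayage. For $\lambda\in\mathcal E^+$, $\lambda^A$ denotes the only measure in $\mathcal E'(A)$ with $U^{\lambda^A}=U^\lambda$ n.e. on $A$ (known to exist and be unique for perfect kernels satisfying the domination principle). The inner balayage of $\omega\in\mathfrak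 M^+$ to $A$ is defined as a measure $\omega^A\in\mathcal E'(A)$ such that $I(\omega^A,\lambda)=I(\lambda^A,\omega)$ for all $\lambda\in\mathcal E^+$. Nets. "As $K\uparrow A$" refers to nets indexed by the compact subsets $K$ of $A$, directed upward by inclusion. *)

theory Defs
  imports "HOL-Analysis.Analysis"
begin

section \<open>Radon measures\<close>

text \<open>
  \<open>X\<close> is the type \<open>'a\<close>; local compactness and the Hausdorff property are assumed where needed.
  Radon measures are taken in the sense of Bourbaki, as linear functionals on the space \<open>C\<^sub>c\<close> of
  continuous functions of compact support (written \<open>C\<^sub>0(X)\<close> in the potential-theoretic literature).
  On a space that is not \<open>\<sigma>\<close>-compact a signed Radon measure need not be a set function (its positive
  and negative part may both be infinite), so the library type of measures cannot be used.
  The functionals are \<open>extensional\<close> on \<open>C\<^sub>c\<close>, so that equality of measures is equality of functions.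
\<close>

definition supp :: "('a::topological_space \<Rightarrow> real) \<Rightarrow> 'a set" where
  "supp \<phi> = closure {x. \<phi> x \<noteq> 0}"

definition Cc :: "('a::topological_space \<Rightarrow> real) set" where
  "Cc = {\<phi>. continuous_on UNIV \<phi> \<and> compact (supp \<phi>)}"

type_synonym 'a functional = "('a \<Rightarrow> real) \<Rightarrow> real"

definition radon :: "'a::topological_space functional set" where
  "radon = {\<mu> \<in> extensional Cc.
     (\<forall>\<phi>\<in>Cc. \<forall>\<psi>\<in>Cc. \<mu> (\<lambda>x. \<phi> x + \<psi> x) = \<mu> \<phi> + \<mu> \<psi>) \<and>
     (\<forall>c. \<forall>\<phi>\<in>Cc. \<mu> (\<lambda>x. c * \<phi> x) = c * \<mu> \<phi>) \<and>
     (\<forall>K. compact K \<longrightarrow> (\<exists>M. \<forall>\<phi>\<in>Cc. supp \<phi> \<subseteq> K \<longrightarrow> \<bar>\<mu> \<phi>\<bar> \<le> M * (SUP x. \<bar>\<phi> x\<bar>)))}"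

definition radon_pos :: "'a::topological_space functional set" where
  "radon_pos = {\<mu> \<in> radon. \<forall>\<phi>\<in>Cc. (\<forall>x. 0 \<le> \<phi> x) \<longrightarrow> 0 \<le> \<mu> \<phi>}"

definition radon_zero :: "'a::topological_space functional" where
  "radon_zero = (\<lambda>\<phi>\<in>Cc. 0)"

definition radon_diff :: "'a::topological_space functional \<Rightarrow> 'a functional \<Rightarrow> 'a functional" where
  "radon_diff \<mu> \<nu> = (\<lambda>\<phi>\<in>Cc. \<mu> \<phi> - \<nu> \<phi>)"

text \<open>The Jordan decomposition: \<open>\<mu>\<^sup>+(\<phi>) = sup {\<mu>(\<psi>) | 0 \<le> \<psi> \<le> \<phi>}\<close> for \<open>\<phi> \<ge> 0\<close>, extended linearly.\<close>

definition pos_part :: "'a::topological_space functional \<Rightarrow> 'a functional" where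
  "pos_part \<mu> = (\<lambda>\<phi>\<in>Cc.
     (SUP \<psi>\<in>{\<psi>\<in>Cc. \<forall>x. 0 \<le> \<psi> x \<and> \<psi> x \<le> max 0 (\<phi> x)}. \<mu> \<psi>) -
     (SUP \<psi>\<in>{\<psi>\<in>Cc. \<forall>x. 0 \<le> \<psi> x \<and> \<psi> x \<le> max 0 (- \<phi> x)}. \<mu> \<psi>))"

definition neg_part :: "'a::topological_space functional \<Rightarrow> 'a functional" where
  "neg_part \<mu> = pos_part (radon_diff radon_zero \<mu>)"

text \<open>The product measure \<open>\<mu> \<otimes> \<nu>\<close>, a Radon measure on \<open>X \<times> X\<close>.\<close>

definition radon_product ::
    "'a::topological_space functional \<Rightarrow> 'a functional \<Rightarrow> ('a \<times> 'a) functional" where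
  "radon_product \<mu> \<nu> = (\<lambda>\<phi>\<in>Cc. \<mu> (\<lambda>x. \<nu> (\<lambda>y. \<phi> (x, y))))"

definition vague_topology :: "'a::topological_space functional topology" where
  "vague_topology = subtopology (product_topology (\<lambda>_. euclideanreal) Cc) radon"


section \<open>Integration\<close>

definition lower_semicont :: "('a::topological_space \<Rightarrow> ennreal) \<Rightarrow> bool" where
  "lower_semicont g \<longleftrightarrow> (\<forall>a. open {x. a < g x})"

text \<open>
  The integral of a lower semicontinuous \<open>g \<ge> 0\<close> against a positive measure (Bourbaki), and
  the upper integral of an arbitrary function with values in \<open>[0,\<infinity>]\<close>, which extends it.
\<close>

definition pos_integral :: "'a::topological_space functional \<Rightarrow> ('a \<Rightarrow> ennreal) \<Rightarrow> ennreal" where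
  "pos_integral \<mu> g = (SUP \<phi>\<in>{\<phi>\<in>Cc. \<forall>x. 0 \<le> \<phi> x \<and> ennreal (\<phi> x) \<le> g x}. ennreal (\<mu> \<phi>))"

definition upper_integral :: "'a::topological_space functional \<Rightarrow> ('a \<Rightarrow> ennreal) \<Rightarrow> ennreal" where
  "upper_integral \<mu> f = (INF g\<in>{g. lower_semicont g \<and> (\<forall>x. f x \<le> g x)}. pos_integral \<mu> g)"

text \<open>
  The integral of a lower semicontinuous \<open>g \<ge> 0\<close> against a signed measure. It is meaningful only
  under \<open>integral_defined\<close>, since \<open>\<infinity> - \<infinity> = \<infinity>\<close> in \<open>ereal\<close>; for positive measures it is
  always meaningful, as then the negative part vanishes.
\<close>

definition integral_defined :: "'a::topological_space functional \<Rightarrow> ('a \<Rightarrow> ennreal) \<Rightarrow> bool" where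
  "integral_defined \<mu> g \<longleftrightarrow>
     pos_integral (pos_part \<mu>) g < \<infinity> \<or> pos_integral (neg_part \<mu>) g < \<infinity>"

definition signed_integral :: "'a::topological_space functional \<Rightarrow> ('a \<Rightarrow> ennreal) \<Rightarrow> ereal" where
  "signed_integral \<mu> g =
     enn2ereal (pos_integral (pos_part \<mu>) g) - enn2ereal (pos_integral (neg_part \<mu>) g)"

text \<open>
  The integral of an extended real-valued \<open>f\<close> against a positive measure, as the difference of the
  integrals of \<open>f\<^sup>+\<close> and \<open>f\<^sup>-\<close> (\<open>e2ennreal\<close> sends negative numbers to \<open>0\<close>). It is only
  used for Borel functions \<open>f\<close> of constant sign.
\<close>

definition ext_integral :: "'a::topological_space functional \<Rightarrow> ('a \<Rightarrow> ereal) \<Rightarrow> ereal" where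
  "ext_integral \<mu> f =
     enn2ereal (upper_integral \<mu> (\<lambda>x. e2ennreal (f x))) -
     enn2ereal (upper_integral \<mu> (\<lambda>x. e2ennreal (- f x)))"

definition mass :: "'a::topological_space functional \<Rightarrow> ennreal" where
  "mass \<mu> = pos_integral \<mu> (\<lambda>_. 1)"

definition Supp :: "'a::topological_space functional \<Rightarrow> 'a set" where
  "Supp \<mu> = - \<Union>{G. open G \<and> (\<forall>\<phi>\<in>Cc. supp \<phi> \<subseteq> G \<longrightarrow> \<mu> \<phi> = 0)}"

definition negligible_for :: "'a::topological_space functional \<Rightarrow> 'a set \<Rightarrow> bool" where
  "negligible_for \<mu> N \<longleftrightarrow> upper_integral \<mu> (indicator N) = 0"

definition locally_negligible_for :: "'a::topological_space functional \<Rightarrow> 'a set \<Rightarrow> bool" where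
  "locally_negligible_for \<mu> N \<longleftrightarrow> (\<forall>K. compact K \<longrightarrow> negligible_for \<mu> (N \<inter> K))"

definition radon_pos_on :: "'a::topological_space set \<Rightarrow> 'a functional set" where
  "radon_pos_on A = {\<mu> \<in> radon_pos. locally_negligible_for \<mu> (- A)}"


section \<open>Kernels, energies and potentials\<close>

definition kernel :: "('a::topological_space \<times> 'a \<Rightarrow> ennreal) \<Rightarrow> bool" where
  "kernel \<kappa> \<longleftrightarrow> (\<forall>x y. \<kappa> (x, y) = \<kappa> (y, x)) \<and> lower_semicont \<kappa>"

definition mutual_energy ::
    "('a::topological_space \<times> 'a \<Rightarrow> ennreal) \<Rightarrow> 'a functional \<Rightarrow> 'a functional \<Rightarrow> ereal" where
  "mutual_energy \<kappa> \<mu> \<nu> = signed_integral (radon_product \<mu> \<nu>) \<kappa>"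

abbreviation energy :: "('a::topological_space \<times> 'a \<Rightarrow> ennreal) \<Rightarrow> 'a functional \<Rightarrow> ereal" where
  "energy \<kappa> \<mu> \<equiv> mutual_energy \<kappa> \<mu> \<mu>"

definition energy_defined :: "('a::topological_space \<times> 'a \<Rightarrow> ennreal) \<Rightarrow> 'a functional \<Rightarrow> bool" where
  "energy_defined \<kappa> \<mu> \<longleftrightarrow> integral_defined (radon_product \<mu> \<mu>) \<kappa>"

definition potential ::
    "('a::topological_space \<times> 'a \<Rightarrow> ennreal) \<Rightarrow> 'a functional \<Rightarrow> 'a \<Rightarrow> ereal" where
  "potential \<kappa> \<mu> x = signed_integral \<mu> (\<lambda>y. \<kappa> (x, y))"

definition finite_energy ::
    "('a::topological_space \<times> 'a \<Rightarrow> ennreal) \<Rightarrow> 'a functional set" where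
  "finite_energy \<kappa> = {\<mu> \<in> radon. energy_defined \<kappa> \<mu> \<and> \<bar>energy \<kappa> \<mu>\<bar> \<noteq> \<infinity>}"

definition finite_energy_pos ::
    "('a::topological_space \<times> 'a \<Rightarrow> ennreal) \<Rightarrow> 'a functional set" where
  "finite_energy_pos \<kappa> = finite_energy \<kappa> \<inter> radon_pos"

definition finite_energy_on ::
    "('a::topological_space \<times> 'a \<Rightarrow> ennreal) \<Rightarrow> 'a set \<Rightarrow> 'a functional set" where
  "finite_energy_on \<kappa> A = finite_energy \<kappa> \<inter> radon_pos_on A"

definition finite_energy_mass_on ::
    "('a::topological_space \<times> 'a \<Rightarrow> ennreal) \<Rightarrow> ennreal \<Rightarrow> 'a set \<Rightarrow> 'a functional set" where
  "finite_energy_mass_on \<kappa> H A = {\<mu> \<in> finite_energy_on \<kappa> A. mass \<mu> \<le> H}"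

definition energy_norm :: "('a::topological_space \<times> 'a \<Rightarrow> ennreal) \<Rightarrow> 'a functional \<Rightarrow> real" where
  "energy_norm \<kappa> \<mu> = sqrt (real_of_ereal (energy \<kappa> \<mu>))"

definition energy_principle :: "('a::topological_space \<times> 'a \<Rightarrow> ennreal) \<Rightarrow> bool" where
  "energy_principle \<kappa> \<longleftrightarrow>
     (\<forall>\<mu>\<in>radon. energy_defined \<kappa> \<mu> \<longrightarrow>
        0 \<le> energy \<kappa> \<mu> \<and> (energy \<kappa> \<mu> = 0 \<longrightarrow> \<mu> = radon_zero))"

text \<open>
  The value \<open>0\<close> off the energy space is irrelevant; it makes the axioms of \<^locale>\<open>Metric_space\<close>,
  some of which are not relativised to the carrier, satisfiable.
\<close>

definition strong_dist ::
    "('a::topological_space \<times> 'a \<Rightarrow> ennreal) \<Rightarrow> 'a functional \<Rightarrow> 'a functional \<Rightarrow> real" where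
  "strong_dist \<kappa> \<mu> \<nu> =
     (if \<mu> \<in> finite_energy \<kappa> \<and> \<nu> \<in> finite_energy \<kappa> then energy_norm \<kappa> (radon_diff \<mu> \<nu>) else 0)"

definition strong_topology ::
    "('a::topological_space \<times> 'a \<Rightarrow> ennreal) \<Rightarrow> 'a functional topology" where
  "strong_topology \<kappa> = Metric_space.mtopology (finite_energy \<kappa>) (strong_dist \<kappa>)"

definition strong_topology_pos ::
    "('a::topological_space \<times> 'a \<Rightarrow> ennreal) \<Rightarrow> 'a functional topology" where
  "strong_topology_pos \<kappa> = subtopology (strong_topology \<kappa>) (finite_energy_pos \<kappa>)"

definition perfect :: "('a::topological_space \<times> 'a \<Rightarrow> ennreal) \<Rightarrow> bool" where
  "perfect \<kappa> \<longleftrightarrow> kernel \<kappa> \<and> energy_principle \<kappa> \<and>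
     Metric_space.mcomplete (finite_energy_pos \<kappa>) (strong_dist \<kappa>) \<and>
     (\<forall>S. openin (subtopology vague_topology (finite_energy_pos \<kappa>)) S
          \<longrightarrow> openin (strong_topology_pos \<kappa>) S)"

definition domination_principle :: "('a::topological_space \<times> 'a \<Rightarrow> ennreal) \<Rightarrow> bool" where
  "domination_principle \<kappa> \<longleftrightarrow>
     (\<forall>\<mu>\<in>finite_energy_pos \<kappa>. \<forall>\<nu>\<in>radon_pos.
        negligible_for \<mu> {x. \<not> potential \<kappa> \<mu> x \<le> potential \<kappa> \<nu> x} \<longrightarrow>
        (\<forall>x. potential \<kappa> \<mu> x \<le> potential \<kappa> \<nu> x))"

definition ugaheri_principle :: "real \<Rightarrow> ('a::topological_space \<times> 'a \<Rightarrow> ennreal) \<Rightarrow> bool" where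
  "ugaheri_principle h \<kappa> \<longleftrightarrow>
     (\<forall>\<mu>\<in>finite_energy_pos \<kappa>. \<forall>c>0.
        negligible_for \<mu> {x. \<not> potential \<kappa> \<mu> x \<le> ereal c} \<longrightarrow>
        (\<forall>x. potential \<kappa> \<mu> x \<le> ereal (h * c)))"


section \<open>Capacity\<close>

definition cap :: "('a::topological_space \<times> 'a \<Rightarrow> ennreal) \<Rightarrow> 'a set \<Rightarrow> ereal" where
  "cap \<kappa> K = 1 / (INF \<mu>\<in>{\<mu> \<in> radon_pos. Supp \<mu> \<subseteq> K \<and> mass \<mu> = 1}. energy \<kappa> \<mu>)"

definition inner_cap :: "('a::topological_space \<times> 'a \<Rightarrow> ennreal) \<Rightarrow> 'a set \<Rightarrow> ereal" where
  "inner_cap \<kappa> A = (SUP K\<in>{K. compact K \<and> K \<subseteq> A}. cap \<kappa> K)"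

definition nearly_everywhere ::
    "('a::topological_space \<times> 'a \<Rightarrow> ennreal) \<Rightarrow> 'a set \<Rightarrow> ('a \<Rightarrow> bool) \<Rightarrow> bool" where
  "nearly_everywhere \<kappa> Q P \<longleftrightarrow> inner_cap \<kappa> {x \<in> Q. \<not> P x} = 0"


section \<open>Classes of measures, the Gauss functional and balayage\<close>

definition closure_on ::
    "('a::topological_space \<times> 'a \<Rightarrow> ennreal) \<Rightarrow> 'a set \<Rightarrow> 'a functional set" where
  "closure_on \<kappa> A = strong_topology_pos \<kappa> closure_of finite_energy_on \<kappa> A"

definition closure_mass_on ::
    "('a::topological_space \<times> 'a \<Rightarrow> ennreal) \<Rightarrow> ennreal \<Rightarrow> 'a set \<Rightarrow> 'a functional set" where
  "closure_mass_on \<kappa> H A = strong_topology_pos \<kappa> closure_of finite_energy_mass_on \<kappa> H A"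

definition gauss_functional ::
    "('a::topological_space \<times> 'a \<Rightarrow> ennreal) \<Rightarrow> ('a \<Rightarrow> ereal) \<Rightarrow> 'a functional \<Rightarrow> ereal" where
  "gauss_functional \<kappa> f \<mu> = ereal ((energy_norm \<kappa> \<mu>)\<^sup>2) + 2 * ext_integral \<mu> f"

text \<open>\<open>\<lambda>\<^sup>A\<close> for \<open>\<lambda>\<close> of finite energy; unique existence is a known theorem for perfect kernels
  satisfying the domination principle.\<close>

definition energy_balayage ::
    "('a::topological_space \<times> 'a \<Rightarrow> ennreal) \<Rightarrow> 'a set \<Rightarrow> 'a functional \<Rightarrow> 'a functional" where
  "energy_balayage \<kappa> A l =
     (THE \<nu>. \<nu> \<in> closure_on \<kappa> A \<and> nearly_everywhere \<kappa> A (\<lambda>x. potential \<kappa> \<nu> x = potential \<kappa> l x))"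

definition is_inner_balayage ::
    "('a::topological_space \<times> 'a \<Rightarrow> ennreal) \<Rightarrow> 'a set \<Rightarrow> 'a functional \<Rightarrow> 'a functional \<Rightarrow> bool" where
  "is_inner_balayage \<kappa> A \<omega> \<nu> \<longleftrightarrow> \<nu> \<in> closure_on \<kappa> A \<and>
     (\<forall>l\<in>finite_energy_pos \<kappa>. mutual_energy \<kappa> \<nu> l = mutual_energy \<kappa> (energy_balayage \<kappa> A l) \<omega>)"

definition is_compact_balayage ::
    "('a::topological_space \<times> 'a \<Rightarrow> ennreal) \<Rightarrow> 'a functional \<Rightarrow> 'a set \<Rightarrow> 'a functional \<Rightarrow> bool" where
  "is_compact_balayage \<kappa> \<omega> K \<mu> \<longleftrightarrow> \<mu> \<in> finite_energy_on \<kappa> K \<and>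
     nearly_everywhere \<kappa> K (\<lambda>x. potential \<kappa> \<mu> x = potential \<kappa> \<omega> x)"

definition compact_balayage ::
    "('a::topological_space \<times> 'a \<Rightarrow> ennreal) \<Rightarrow> 'a functional \<Rightarrow> 'a set \<Rightarrow> 'a functional" where
  "compact_balayage \<kappa> \<omega> K = (THE \<mu>. is_compact_balayage \<kappa> \<omega> K \<mu>)"

definition majorant_class ::
    "('a::topological_space \<times> 'a \<Rightarrow> ennreal) \<Rightarrow> 'a set \<Rightarrow> 'a functional \<Rightarrow> 'a functional set" where
  "majorant_class \<kappa> A \<omega> = {\<nu> \<in> finite_energy_pos \<kappa>.
     nearly_everywhere \<kappa> A (\<lambda>x. potential \<kappa> \<omega> x \<le> potential \<kappa> \<nu> x)}"

text \<open>The filter of the net of compact subsets of \<open>A\<close> directed by inclusion.\<close>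

definition compacts_at_top :: "'a::topological_space set \<Rightarrow> 'a set filter" where
  "compacts_at_top A =
     (INF K\<in>{K. compact K \<and> K \<subseteq> A}. principal {K'. compact K' \<and> K \<subseteq> K' \<and> K' \<subseteq> A})"

text \<open>\<open>F K \<up> g\<close> pointwise as \<open>K \<up> A\<close>.\<close>

definition increases_pointwise_to ::
    "'a::topological_space set \<Rightarrow> ('a set \<Rightarrow> 'a \<Rightarrow> ereal) \<Rightarrow> ('a \<Rightarrow> ereal) \<Rightarrow> bool" where
  "increases_pointwise_to A F g \<longleftrightarrow>
     (\<forall>K K'. compact K \<and> compact K' \<and> K \<subseteq> K' \<and> K' \<subseteq> A \<longrightarrow> (\<forall>x. F K x \<le> F K' x)) \<and>
     (\<forall>x. ((\<lambda>K. F K x) \<longlongrightarrow> g x) (compacts_at_top A))"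

end

theory Submission
  imports Defs
begin

text \<open>
  For compact \<open>K \<subseteq> A\<close> the potential \<open>U\<^sup>\<omega>\<close> agrees on \<open>K\<close> with some \<open>\<phi> \<in> C\<^sub>c\<close>, and the functional
  \<open>a \<mapsto> a(\<phi>)\<close> is continuous on the strongly closed convex cone \<open>\<E>\<^sup>+(K)\<close>. Its Riesz representation
  \<open>\<omega>\<^sup>K\<close> has \<open>U\<^sup>\<omega>\<close> as its potential n.e. on \<open>K\<close>, and the domination principle gives \<open>\<le>\<close> everywhere.
  With \<open>\<phi> = 1\<close> on \<open>K\<close> one obtains in the same way an equilibrium measure \<open>\<gamma>\<close>, for which the
  Ugaheri principle gives \<open>U\<^sup>\<gamma> \<le> h\<close>; hence \<open>\<omega>\<^sup>K(X) \<le> \<integral> U\<^sup>\<gamma> d\<omega> \<le> h \<omega>(X)\<close>, which bounds the energies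
  \<open>\<parallel>\<omega>\<^sup>K\<parallel>\<^sup>2 = \<integral> U\<^sup>\<omega> d\<omega>\<^sup>K\<close>. For \<open>K \<subseteq> L\<close> one has \<open>\<parallel>\<omega>\<^sup>K - \<omega>\<^sup>L\<parallel>\<^sup>2 = \<parallel>\<omega>\<^sup>L\<parallel>\<^sup>2 - \<parallel>\<omega>\<^sup>K\<parallel>\<^sup>2\<close>, so
  that the net is strongly Cauchy; its limit is the inner balayage, and each characterisation
  follows by comparing potentials and testing against measures carried by compact sets.
\<close>

section \<open>Compactly supported and lower semicontinuous functions\<close>

text \<open>The measure \<open>\<omega>\<close> may have infinite energy, and only positive measures
  of finite energy are assumed to form a complete space, so \<open>\<omega>\<close> cannot simply be
  projected onto a closed subspace. Representing measures are instead limits of minimising sequences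
  in cones. They satisfy a variational inequality, which restriction to measurable subsets and the
  domination principle turn into an equality of potentials. Perfectness makes
  \<open>a \<mapsto> a(\<phi>)\<close> strongly continuous, and strict positivity bounds the mass on
  a compact set by the energy norm. The set \<open>A\<close> is arbitrary and \<open>X\<close> need
  not be sigma-compact. Hence a relation n.e. on \<open>A\<close> is tested a.e. against all
  measures of finite energy carried by compact subsets of \<open>A\<close>, and monotone convergence
  is used for directed families of lower semicontinuous functions rather than for sequences. The
  strong metric lives on signed measures. Its triangle inequality rests on the fact that a signed
  measure of finite energy is a difference of two positive ones of finite energy.\<close>

lemma not_in_supp: "x \<notin> supp \<phi> \<Longrightarrow> \<phi> x = 0"
  unfolding supp_def using closure_subset[of "{x. \<phi> x \<noteq> 0}"] by auto

lemma supp_subset_closed: "closed K \<Longrightarrow> (\<And>x. x \<notin> K \<Longrightarrow> \<phi> x = 0) \<Longrightarrow> supp \<phi> \<subseteq> K"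
  unfolding supp_def by (rule closure_minimal) auto

lemma CcI:
  fixes \<phi> :: "'a::t2_space \<Rightarrow> real"
  assumes "continuous_on UNIV \<phi>" "compact K" "\<And>x. x \<notin> K \<Longrightarrow> \<phi> x = 0"
  shows "\<phi> \<in> Cc"
proof -
  have "supp \<phi> \<subseteq> K" using supp_subset_closed[OF compact_imp_closed[OF assms(2)]] assms(3) by simp
  moreover have "closed (supp \<phi>)" by (simp add: supp_def)
  ultimately have "compact (supp \<phi>)"
    using assms(2) by (metis compact_Int_closed inf.absorb_iff2)
  then show ?thesis using assms(1) by (simp add: Cc_def)
qed

lemma Cc_continuous: "\<phi> \<in> Cc \<Longrightarrow> continuous_on UNIV \<phi>"
  by (simp add: Cc_def)

lemma Cc_compact_supp: "\<phi> \<in> Cc \<Longrightarrow> compact (supp \<phi>)"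
  by (simp add: Cc_def)

lemma Cc_zero: "(\<lambda>x. 0) \<in> Cc"
  by (simp add: Cc_def supp_def)

lemma Cc_add:
  fixes \<phi> \<psi> :: "'a::t2_space \<Rightarrow> real"
  assumes "\<phi> \<in> Cc" "\<psi> \<in> Cc" shows "(\<lambda>x. \<phi> x + \<psi> x) \<in> Cc"
  by (rule CcI[of _ "supp \<phi> \<union> supp \<psi>"])
     (use assms in \<open>auto intro!: continuous_intros dest: Cc_continuous Cc_compact_supp simp: not_in_supp\<close>)

lemma Cc_mult_continuous:
  fixes \<phi> \<psi> :: "'a::t2_space \<Rightarrow> real"
  assumes "\<phi> \<in> Cc" "continuous_on UNIV \<psi>" shows "(\<lambda>x. \<psi> x * \<phi> x) \<in> Cc"
  by (rule CcI[of _ "supp \<phi>"])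
     (use assms in \<open>auto intro!: continuous_intros dest: Cc_continuous Cc_compact_supp simp: not_in_supp\<close>)

lemma Cc_mult:
  fixes \<phi> \<psi> :: "'a::t2_space \<Rightarrow> real"
  assumes "\<phi> \<in> Cc" "\<psi> \<in> Cc" shows "(\<lambda>x. \<phi> x * \<psi> x) \<in> Cc"
  using Cc_mult_continuous[OF assms(2) Cc_continuous[OF assms(1)]] .

lemma Cc_scale:
  fixes \<phi> :: "'a::t2_space \<Rightarrow> real"
  assumes "\<phi> \<in> Cc" shows "(\<lambda>x. c * \<phi> x) \<in> Cc"
  using Cc_mult_continuous[OF assms, of "\<lambda>_. c"] by simp

lemma Cc_diff:
  fixes \<phi> \<psi> :: "'a::t2_space \<Rightarrow> real"
  assumes "\<phi> \<in> Cc" "\<psi> \<in> Cc" shows "(\<lambda>x. \<phi> x - \<psi> x) \<in> Cc"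
  using Cc_add[OF assms(1) Cc_scale[OF assms(2), of "-1"]] by simp

lemma Cc_minus:
  fixes \<phi> :: "'a::t2_space \<Rightarrow> real"
  assumes "\<phi> \<in> Cc" shows "(\<lambda>x. - \<phi> x) \<in> Cc"
  using Cc_scale[OF assms, of "-1"] by simp

lemma Cc_max:
  fixes \<phi> \<psi> :: "'a::t2_space \<Rightarrow> real"
  assumes "\<phi> \<in> Cc" "\<psi> \<in> Cc" shows "(\<lambda>x. max (\<phi> x) (\<psi> x)) \<in> Cc"
  by (rule CcI[of _ "supp \<phi> \<union> supp \<psi>"])
     (use assms in \<open>auto intro!: continuous_intros dest: Cc_continuous Cc_compact_supp simp: not_in_supp\<close>)

lemma Cc_min:
  fixes \<phi> \<psi> :: "'a::t2_space \<Rightarrow> real"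
  assumes "\<phi> \<in> Cc" "\<psi> \<in> Cc" shows "(\<lambda>x. min (\<phi> x) (\<psi> x)) \<in> Cc"
  by (rule CcI[of _ "supp \<phi> \<union> supp \<psi>"])
     (use assms in \<open>auto intro!: continuous_intros dest: Cc_continuous Cc_compact_supp simp: not_in_supp\<close>)

lemma Cc_bounded:
  fixes \<phi> :: "'a::t2_space \<Rightarrow> real"
  assumes "\<phi> \<in> Cc" obtains B where "0 < B" "\<forall>x. \<bar>\<phi> x\<bar> \<le> B"
proof -
  have "compact (\<phi> ` supp \<phi>)"
    by (rule compact_continuous_image[OF continuous_on_subset[OF Cc_continuous[OF assms]] Cc_compact_supp[OF assms]]) simp
  then have "bounded (\<phi> ` supp \<phi>)" by (rule compact_imp_bounded)
  then obtain B where B: "\<And>x. x \<in> supp \<phi> \<Longrightarrow> \<bar>\<phi> x\<bar> \<le> B" by (auto simp: bounded_iff)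
  have "\<bar>\<phi> x\<bar> \<le> max B 1" for x
    by (cases "x \<in> supp \<phi>") (use B[of x] not_in_supp[of x \<phi>] in auto)
  then show ?thesis using that[of "max B 1"] by auto
qed

section \<open>Lower semicontinuous functions with values in \<open>[0,\<infinity>]\<close>\<close>

lemma lower_semicontD: "lower_semicont g \<Longrightarrow> open {x. a < g x}"
  by (simp add: lower_semicont_def)

lemma lower_semicont_continuous:
  fixes \<phi> :: "'a::topological_space \<Rightarrow> real"
  assumes "continuous_on UNIV \<phi>" shows "lower_semicont (\<lambda>x. ennreal (\<phi> x))"
  unfolding lower_semicont_def
  by (intro allI open_Collect_less continuous_intros continuous_on_ennreal assms)

lemma lower_semicont_const: "lower_semicont (\<lambda>_. c)"
  by (simp add: lower_semicont_def)

lemma lower_semicont_indicator: "open G \<Longrightarrow> lower_semicont (indicator G)"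
  unfolding lower_semicont_def
proof
  fix a :: ennreal assume "open G"
  moreover have "{x. a < indicator G x} = (if a < 1 then G else {})"
    by (auto simp: indicator_def split: if_splits)
  ultimately show "open {x. a < indicator G x}" by simp
qed

lemma open_less_lower_semicont:
  fixes \<phi> :: "'a::topological_space \<Rightarrow> real"
  assumes "continuous_on UNIV \<phi>" "lower_semicont g"
  shows "open {x. ennreal (\<phi> x) < g x}"
proof -
  have "{x. ennreal (\<phi> x) < g x} = (\<Union>c. {x. ennreal (\<phi> x) < c} \<inter> {x. c < g x})"
    by (auto dest: dense intro: less_trans)
  moreover have "open {x. ennreal (\<phi> x) < c}" for c
    by (intro open_Collect_less continuous_intros continuous_on_ennreal assms)
  ultimately show ?thesis using assms(2) by (auto simp: lower_semicont_def intro!: open_UN open_Int)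
qed

lemma lower_semicont_SUP:
  assumes "\<And>i. i \<in> I \<Longrightarrow> lower_semicont (g i)"
  shows "lower_semicont (\<lambda>x. SUP i\<in>I. g i x)"
  using assms by (auto simp: lower_semicont_def less_SUP_iff Collect_bex_eq)

text \<open>Addition commutes with suprema over nonempty families; for nonzero \<open>b\<close> and
  \<open>c\<close> the sets \<open>{..<b}\<close> and \<open>{..<c}\<close> are nonempty and have
  suprema \<open>b\<close> and \<open>c\<close>.\<close>

lemma ennreal_less_addE:
  fixes a b c :: ennreal
  assumes "a < b + c" "b \<noteq> 0" "c \<noteq> 0" obtains b' c' where "b' < b" "c' < c" "a \<le> b' + c'"
proof -
  have nb: "{..<b} \<noteq> {}" and nc: "{..<c} \<noteq> {}" using assms(2,3)
    by (metis empty_iff lessThan_iff zero_less_iff_neq_zero)+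
  have "b + c = (SUP x\<in>{..<b}. x + c)" using ennreal_SUP_add_left[OF nb, of "\<lambda>x. x" c] by simp
  then obtain b' where b': "b' < b" "a < b' + c" using assms(1) by (auto simp: less_SUP_iff)
  have "b' + c = (SUP x\<in>{..<c}. b' + x)" using ennreal_SUP_add_right[OF nc, of b' "\<lambda>x. x"] by simp
  then obtain c' where "c' < c" "a < b' + c'" using b' by (auto simp: less_SUP_iff)
  then show ?thesis using b' that by force
qed

lemma lower_semicont_add:
  assumes "lower_semicont f" "lower_semicont g"
  shows "lower_semicont (\<lambda>x. f x + g x)"
  unfolding lower_semicont_def
proof
  fix a
  \<comment> \<open>The double union alone misses the points where one summand is \<open>0\<close>,
    since nothing lies strictly below \<open>0\<close>; the first two sets supply them.\<close>
  have *: "{x. a < f x + g x} = {x. a < f x} \<union> {x. a < g x} \<union>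
      (\<Union>(b,c)\<in>{(b,c). a < b + c}. {x. b < f x} \<inter> {x. c < g x})" (is "?L = ?R")
  proof (intro set_eqI iffI)
    fix x assume "x \<in> ?L"
    then have x: "a < f x + g x" by simp
    show "x \<in> ?R"
    proof (cases "f x = 0 \<or> g x = 0")
      case True then show ?thesis using x by auto
    next
      case False
      obtain a' where a': "a < a'" "a' < f x + g x" using dense x by blast
      obtain b c where "b < f x" "c < g x" "a' \<le> b + c"
        using ennreal_less_addE[OF a'(2)] False by blast
      then show ?thesis using a' by force
    qed
  next
    fix x assume "x \<in> ?R"
    then consider "a < f x" | "a < g x" | b c where "a < b + c" "b < f x" "c < g x" by auto
    then show "x \<in> ?L"
      by cases (auto intro: less_le_trans add_mono less_imp_le order_less_le_trans add_increasing add_increasing2)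
  qed
  show "open {x. a < f x + g x}" unfolding *
    using assms by (auto simp: lower_semicont_def intro!: open_Un open_UN open_Int)
qed

lemma borel_measurable_lower_semicont:
  "lower_semicont g \<Longrightarrow> g \<in> borel_measurable borel"
  by (rule borel_measurableI_greater) (auto simp: lower_semicont_def)

section \<open>Positive functionals and their integrals\<close>

lemma radon_pos_radon: "\<mu> \<in> radon_pos \<Longrightarrow> \<mu> \<in> radon"
  by (simp add: radon_pos_def)

lemma radon_add: "\<mu> \<in> radon \<Longrightarrow> \<phi> \<in> Cc \<Longrightarrow> \<psi> \<in> Cc \<Longrightarrow> \<mu> (\<lambda>x. \<phi> x + \<psi> x) = \<mu> \<phi> + \<mu> \<psi>"
  by (simp add: radon_def)

lemma radon_scale: "\<mu> \<in> radon \<Longrightarrow> \<phi> \<in> Cc \<Longrightarrow> \<mu> (\<lambda>x. c * \<phi> x) = c * \<mu> \<phi>"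
  by (simp add: radon_def)

lemma radon_minus: "\<mu> \<in> radon \<Longrightarrow> \<phi> \<in> Cc \<Longrightarrow> \<mu> (\<lambda>x. - \<phi> x) = - \<mu> \<phi>"
  using radon_scale[of \<mu> \<phi> "-1"] by simp

lemma radon_diff_arg:
  fixes \<phi> \<psi> :: "'a::t2_space \<Rightarrow> real"
  shows "\<mu> \<in> radon \<Longrightarrow> \<phi> \<in> Cc \<Longrightarrow> \<psi> \<in> Cc \<Longrightarrow> \<mu> (\<lambda>x. \<phi> x - \<psi> x) = \<mu> \<phi> - \<mu> \<psi>"
  using radon_add[of \<mu> \<phi> "\<lambda>x. - \<psi> x"] radon_minus[of \<mu> \<psi>] Cc_minus by fastforce

lemma radon_zero_arg: "\<mu> \<in> radon \<Longrightarrow> \<mu> (\<lambda>x. 0) = 0"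
  using radon_scale[of \<mu> "\<lambda>x. 0" 0] Cc_zero by fastforce

lemma radon_pos_nonneg: "\<mu> \<in> radon_pos \<Longrightarrow> \<phi> \<in> Cc \<Longrightarrow> (\<And>x. 0 \<le> \<phi> x) \<Longrightarrow> 0 \<le> \<mu> \<phi>"
  by (simp add: radon_pos_def)

lemma radon_pos_mono:
  fixes \<phi> \<psi> :: "'a::t2_space \<Rightarrow> real"
  assumes "\<mu> \<in> radon_pos" "\<phi> \<in> Cc" "\<psi> \<in> Cc" "\<And>x. \<phi> x \<le> \<psi> x" shows "\<mu> \<phi> \<le> \<mu> \<psi>"
  using radon_pos_nonneg[OF assms(1) Cc_diff[OF assms(3,2)]] assms
    radon_diff_arg[OF radon_pos_radon[OF assms(1)] assms(3,2)] by simp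

lemma radon_abs_le:
  fixes \<phi> \<psi> :: "'a::t2_space \<Rightarrow> real"
  assumes "\<mu> \<in> radon_pos" "\<phi> \<in> Cc" "\<psi> \<in> Cc" "\<And>x. \<bar>\<phi> x\<bar> \<le> \<psi> x" shows "\<bar>\<mu> \<phi>\<bar> \<le> \<mu> \<psi>"
proof -
  have "\<phi> x \<le> \<psi> x" "- \<phi> x \<le> \<psi> x" for x using assms(4)[of x] by auto
  then have "\<mu> \<phi> \<le> \<mu> \<psi>" "\<mu> (\<lambda>x. - \<phi> x) \<le> \<mu> \<psi>"
    using radon_pos_mono[OF assms(1,2,3)] radon_pos_mono[OF assms(1) Cc_minus[OF assms(2)] assms(3)] by auto
  then show ?thesis using radon_minus[OF radon_pos_radon[OF assms(1)] assms(2)] by simp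
qed

definition Cc_below :: "('a::topological_space \<Rightarrow> ennreal) \<Rightarrow> ('a \<Rightarrow> real) set" where
  "Cc_below g = {\<phi>\<in>Cc. \<forall>x. 0 \<le> \<phi> x \<and> ennreal (\<phi> x) \<le> g x}"

lemma pos_integral_eq: "pos_integral \<mu> g = (SUP \<phi>\<in>Cc_below g. ennreal (\<mu> \<phi>))"
  by (simp add: pos_integral_def Cc_below_def)

lemma Cc_below_zero: "(\<lambda>x. 0) \<in> Cc_below g"
  by (simp add: Cc_below_def Cc_zero)

lemma pos_integral_upper: "\<phi> \<in> Cc_below g \<Longrightarrow> ennreal (\<mu> \<phi>) \<le> pos_integral \<mu> g"
  unfolding pos_integral_eq by (rule SUP_upper)

lemma pos_integral_mono: "(\<And>x. f x \<le> g x) \<Longrightarrow> pos_integral \<mu> f \<le> pos_integral \<mu> g"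
  unfolding pos_integral_eq by (rule SUP_subset_mono) (auto simp: Cc_below_def intro: order_trans)

lemma upper_integral_lower_semicont: "lower_semicont g \<Longrightarrow> upper_integral \<mu> g = pos_integral \<mu> g"
  unfolding upper_integral_def
  by (intro antisym INF_lower INF_greatest) (auto intro: pos_integral_mono)

lemma upper_integral_mono: "(\<And>x. f x \<le> g x) \<Longrightarrow> upper_integral \<mu> f \<le> upper_integral \<mu> g"
  unfolding upper_integral_def by (rule INF_superset_mono) (auto intro: order_trans)

lemma pos_integral_Cc:
  fixes \<phi> :: "'a::t2_space \<Rightarrow> real"
  assumes "\<mu> \<in> radon_pos" "\<phi> \<in> Cc" "\<And>x. 0 \<le> \<phi> x"
  shows "pos_integral \<mu> (\<lambda>x. ennreal (\<phi> x)) = ennreal (\<mu> \<phi>)"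
proof (rule antisym)
  show "pos_integral \<mu> (\<lambda>x. ennreal (\<phi> x)) \<le> ennreal (\<mu> \<phi>)"
    unfolding pos_integral_eq
  proof (rule SUP_least, rule ennreal_leI)
    fix \<psi> assume "\<psi> \<in> Cc_below (\<lambda>x. ennreal (\<phi> x))"
    then show "\<mu> \<psi> \<le> \<mu> \<phi>"
      by (intro radon_pos_mono[OF assms(1) _ assms(2)]) (auto simp: Cc_below_def ennreal_le_iff assms(3))
  qed
  show "ennreal (\<mu> \<phi>) \<le> pos_integral \<mu> (\<lambda>x. ennreal (\<phi> x))"
    by (rule pos_integral_upper) (use assms in \<open>auto simp: Cc_below_def\<close>)
qed

lemma Cc_below_max:
  fixes \<phi> \<psi> :: "'a::t2_space \<Rightarrow> real"
  assumes "\<phi> \<in> Cc_below g" "\<psi> \<in> Cc_below g" shows "(\<lambda>x. max (\<phi> x) (\<psi> x)) \<in> Cc_below g"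
  using assms Cc_max[of \<phi> \<psi>] by (auto simp: Cc_below_def) (auto simp: max_def)

lemma finite_directed_bound:
  assumes "finite F" "F \<subseteq> \<G>" "\<G> \<noteq> {}"
    and dir: "\<And>f g. f \<in> \<G> \<Longrightarrow> g \<in> \<G> \<Longrightarrow> \<exists>k\<in>\<G>. \<forall>x. f x \<le> k x \<and> g x \<le> k x"
  shows "\<exists>k\<in>\<G>. \<forall>f\<in>F. \<forall>x. f x \<le> (k x :: 'b::order)"
  using assms(1,2)
proof (induction F)
  case empty then show ?case using assms(3) by auto
next
  case (insert f F)
  then obtain k where k: "k \<in> \<G>" "\<forall>f\<in>F. \<forall>x. f x \<le> k x" by auto
  obtain l where "l \<in> \<G>" "\<forall>x. f x \<le> l x \<and> k x \<le> l x" using dir[of f k] k insert by auto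
  then show ?case using k by (intro bexI[of _ l]) (auto intro: order_trans)
qed

section \<open>Cutoff functions and directed suprema on locally compact Hausdorff spaces\<close>

locale lch_space =
  fixes T :: "'a::t2_space itself"
  assumes loc_compact: "locally_compact_space (euclidean :: 'a topology)"
begin

text \<open>Normality may fail, but complete regularity is enough to separate compact from closed
  sets and to extend continuous functions from compact sets.\<close>

lemma completely_regular: "completely_regular_space (euclidean :: 'a topology)"
proof -
  have "Hausdorff_space (euclidean :: 'a topology)"
    using hausdorff by (auto simp: Hausdorff_space_def disjnt_def)
  then show ?thesis
    using loc_compact locally_compact_regular_imp_completely_regular_space by metis
qed

lemma compact_neighbourhood:
  fixes K :: "'a set" assumes "compact K"
  obtains V C where "open V" "compact C" "K \<subseteq> V" "V \<subseteq> C"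
proof -
  have "\<forall>x. \<exists>U C. open U \<and> compact C \<and> x \<in> U \<and> U \<subseteq> (C::'a set)"
    using loc_compact by (simp add: locally_compact_space_def)
  then obtain U C where UC: "\<And>x. open (U x) \<and> compact (C x) \<and> x \<in> U x \<and> U x \<subseteq> (C x :: 'a set)"
    by metis
  obtain F where "F \<subseteq> K" "finite F" "K \<subseteq> (\<Union>x\<in>F. U x)"
    by (rule compactE_image[OF assms, of K U]) (use UC in auto)
  then show ?thesis
    using UC by (intro that[of "\<Union>x\<in>F. U x" "\<Union>x\<in>F. C x"] open_UN ballI compact_UN UN_mono) auto
qed

lemma urysohn:
  fixes K U :: "'a set"
  assumes "compact K" "open U" "K \<subseteq> U"
  obtains \<phi> where "\<phi> \<in> Cc" "\<forall>x. 0 \<le> \<phi> x" "\<forall>x. \<phi> x \<le> 1" "\<forall>x\<in>K. \<phi> x = 1" "supp \<phi> \<subseteq> U"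
proof -
  obtain V C where V: "open V" "compact C" "K \<subseteq> V" "V \<subseteq> C"
    using compact_neighbourhood assms(1) by blast
  have "compactin euclidean K" "closedin euclidean (- (U \<inter> V))" "disjnt (- (U \<inter> V)) K"
    using assms V by (auto simp: disjnt_def)
  then obtain f where f: "continuous_map euclidean (subtopology euclidean {- 1..0}) f"
      "f ` K \<subseteq> {- 1}" "f ` (- (U \<inter> V)) \<subseteq> {0::real}"
    using Urysohn_completely_regular_closed_compact[of "- 1" 0 euclidean "- (U \<inter> V)" K] completely_regular
    by auto
  have cont: "continuous_on UNIV f" and f01: "\<And>x. - 1 \<le> f x \<and> f x \<le> 0"
    using f(1) by (auto simp: continuous_map_in_subtopology image_subset_iff)
  \<comment> \<open>The function \<open>f\<close> vanishes off \<open>U \<inter> V\<close>, but its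
    support may still leave \<open>U\<close>. Cutting \<open>-f\<close> at height \<open>1/2\<close>
    and rescaling keeps the value \<open>1\<close> on \<open>K\<close> and puts the support into the
    closed set \<open>{x. f x \<le> - 1/2}\<close>, which lies in
    \<open>U \<inter> V\<close>.\<close>
  define \<phi> where "\<phi> = (\<lambda>x. max 0 (- 2 * f x - 1))"
  have c\<phi>: "continuous_on UNIV \<phi>" unfolding \<phi>_def by (intro continuous_intros cont)
  have sub: "supp \<phi> \<subseteq> {x. f x \<le> - 1/2}"
    by (rule supp_subset_closed) (auto intro!: closed_Collect_le continuous_intros cont simp: \<phi>_def)
  have sub2: "{x. f x \<le> - 1/2} \<subseteq> U \<inter> V" using f(3) by force
  have "\<phi> \<in> Cc"
    by (rule CcI[OF c\<phi> V(2)]) (use sub2 V(4) in \<open>force simp: \<phi>_def max_def\<close>)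
  moreover have "0 \<le> \<phi> x" "\<phi> x \<le> 1" for x using f01[of x] by (auto simp: \<phi>_def)
  moreover have "\<phi> x = 1" if "x \<in> K" for x
  proof -
    have "f x = - 1" using f(2) that by auto
    then show ?thesis by (simp add: \<phi>_def)
  qed
  ultimately show ?thesis using that[of \<phi>] sub sub2 by blast
qed

lemma cutoff:
  fixes K :: "'a set"
  assumes "compact K"
  obtains \<phi> where "\<phi> \<in> Cc" "\<forall>x. 0 \<le> \<phi> x" "\<forall>x. \<phi> x \<le> 1" "\<forall>x\<in>K. \<phi> x = 1"
  using urysohn[OF assms open_UNIV subset_UNIV] that by metis

text \<open>A bump at \<open>x\<close> supported in the open set \<open>{y. c < g y}\<close> and
  scaled to height \<open>c\<close> stays below \<open>g\<close>.\<close>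

lemma Cc_below_approx:
  fixes g :: "'a \<Rightarrow> ennreal"
  assumes "lower_semicont g" "a < g x"
  obtains \<phi> where "\<phi> \<in> Cc_below g" "a < ennreal (\<phi> x)"
proof -
  obtain c where c: "a < c" "c < g x" using dense assms(2) by blast
  then obtain r where r: "c = ennreal r" "0 \<le> r" by (cases c) auto
  obtain \<psi> where \<psi>: "\<psi> \<in> Cc" "\<And>x. 0 \<le> \<psi> x" "\<And>x. \<psi> x \<le> 1" "\<psi> x = 1" "supp \<psi> \<subseteq> {y. c < g y}"
    using urysohn[of "{x}" "{y. c < g y}"] lower_semicontD[OF assms(1)] c(2) by auto
  have "ennreal (r * \<psi> y) \<le> g y" for y
  proof (cases "y \<in> supp \<psi>")
    case True
    have "ennreal (r * \<psi> y) \<le> c" using \<psi>(2,3)[of y] r by (simp add: ennreal_leI mult_left_le)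
    then show ?thesis using \<psi>(5) True by force
  qed (simp add: not_in_supp)
  then have "(\<lambda>y. r * \<psi> y) \<in> Cc_below g" using \<psi> r by (auto simp: Cc_below_def Cc_scale)
  then show ?thesis using that[of "\<lambda>y. r * \<psi> y"] c r \<psi> by auto
qed

lemma lower_semicont_eq_SUP:
  fixes g :: "'a \<Rightarrow> ennreal"
  assumes "lower_semicont g"
  shows "g x = (SUP \<phi>\<in>Cc_below g. ennreal (\<phi> x))"
proof (rule antisym)
  show "g x \<le> (SUP \<phi>\<in>Cc_below g. ennreal (\<phi> x))"
  proof (rule dense_le)
    fix a assume "a < g x"
    then obtain \<phi> where "\<phi> \<in> Cc_below g" "a < ennreal (\<phi> x)" using Cc_below_approx[OF assms] by blast
    then show "a \<le> (SUP \<phi>\<in>Cc_below g. ennreal (\<phi> x))" by (meson SUP_upper2 less_imp_le)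
  qed
qed (auto simp: Cc_below_def intro: SUP_least)

text \<open>Monotone convergence for nets. Dini's argument replaces countability: on the compact
  support of a minorant \<open>\<phi>\<close> of the supremum, finitely many members of the family,
  hence by directedness a single one, come within \<open>d\<close> of \<open>\<phi>\<close>.\<close>

lemma pos_integral_directed_SUP:
  fixes \<G> :: "('a \<Rightarrow> ennreal) set"
  assumes \<mu>: "\<mu> \<in> radon_pos" and ne: "\<G> \<noteq> {}"
    and lsc: "\<And>g. g \<in> \<G> \<Longrightarrow> lower_semicont g"
    and dir: "\<And>f g. f \<in> \<G> \<Longrightarrow> g \<in> \<G> \<Longrightarrow> \<exists>k\<in>\<G>. \<forall>x. f x \<le> k x \<and> g x \<le> k x"
  shows "pos_integral \<mu> (\<lambda>x. SUP g\<in>\<G>. g x) = (SUP g\<in>\<G>. pos_integral \<mu> g)"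
proof (rule antisym)
  show "(SUP g\<in>\<G>. pos_integral \<mu> g) \<le> pos_integral \<mu> (\<lambda>x. SUP g\<in>\<G>. g x)"
  proof (rule SUP_least)
    fix g assume "g \<in> \<G>"
    then show "pos_integral \<mu> g \<le> pos_integral \<mu> (\<lambda>x. SUP g\<in>\<G>. g x)"
      by (intro pos_integral_mono) (rule SUP_upper)
  qed
  show "pos_integral \<mu> (\<lambda>x. SUP g\<in>\<G>. g x) \<le> (SUP g\<in>\<G>. pos_integral \<mu> g)"
    unfolding pos_integral_eq[of \<mu> "\<lambda>x. SUP g\<in>\<G>. g x"]
  proof (rule SUP_least)
    fix \<phi> assume "\<phi> \<in> Cc_below (\<lambda>x. SUP g\<in>\<G>. g x)"
    then have \<phi>: "\<phi> \<in> Cc" "\<And>x. 0 \<le> \<phi> x" "\<And>x. ennreal (\<phi> x) \<le> (SUP g\<in>\<G>. g x)"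
      unfolding Cc_below_def by auto
    obtain \<eta> where \<eta>: "\<eta> \<in> Cc" "\<forall>x. 0 \<le> \<eta> x" "\<forall>x. \<eta> x \<le> 1" "\<forall>x\<in>supp \<phi>. \<eta> x = 1"
      by (rule cutoff[OF Cc_compact_supp[OF \<phi>(1)]])
    have \<mu>\<eta>: "0 \<le> \<mu> \<eta>" using radon_pos_nonneg[OF \<mu> \<eta>(1)] \<eta>(2) by simp
    show "ennreal (\<mu> \<phi>) \<le> (SUP g\<in>\<G>. pos_integral \<mu> g)"
    proof (rule ennreal_le_epsilon)
      fix e :: real assume e: "0 < e"
      \<comment> \<open>The summand \<open>1\<close> keeps the denominator positive when
        \<open>\<mu> \<eta> = 0\<close>; the total loss is
        \<open>d * \<mu> \<eta> \<le> e\<close>.\<close>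
      define d where "d = e / (\<mu> \<eta> + 1)"
      have d1: "0 < d" using e \<mu>\<eta> by (simp add: d_def)
      have "d * (\<mu> \<eta> + 1) = e" using \<mu>\<eta> by (simp add: d_def)
      then have d: "0 < d" "d * \<mu> \<eta> \<le> e" using d1 by (simp_all add: distrib_left)
      have cover: "\<exists>g\<in>\<G>. ennreal (\<phi> x) < g x + ennreal d" for x
      proof (cases "\<phi> x < d")
        case True
        then have "ennreal (\<phi> x) < ennreal d" using d(1) by (simp add: ennreal_lessI)
        moreover obtain g where "g \<in> \<G>" using ne by blast
        moreover have "ennreal d \<le> g x + ennreal d" by simp
        ultimately show ?thesis by (meson less_le_trans)
      next
        case False
        then have "ennreal (\<phi> x - d) < ennreal (\<phi> x)" using d by (intro ennreal_lessI) auto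
        then have "ennreal (\<phi> x - d) < (SUP g\<in>\<G>. g x)" by (rule less_le_trans[OF _ \<phi>(3)])
        then obtain g where g: "g \<in> \<G>" "ennreal (\<phi> x - d) < g x" by (auto simp: less_SUP_iff)
        have "ennreal (\<phi> x) = ennreal (\<phi> x - d) + ennreal d"
          using False d by (subst ennreal_plus[symmetric]) auto
        also have "\<dots> < g x + ennreal d" using g by (simp add: add.commute ennreal_add_left_cancel_less)
        finally show ?thesis using g by blast
      qed
      obtain F where F: "F \<subseteq> \<G>" "finite F" "supp \<phi> \<subseteq> (\<Union>g\<in>F. {x. ennreal (\<phi> x) < g x + ennreal d})"
      proof (rule compactE_image[OF Cc_compact_supp[OF \<phi>(1)], of \<G> "\<lambda>g. {x. ennreal (\<phi> x) < g x + ennreal d}"])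
        show "open {x. ennreal (\<phi> x) < g x + ennreal d}" if "g \<in> \<G>" for g
          by (rule open_less_lower_semicont[OF Cc_continuous[OF \<phi>(1)] lower_semicont_add[OF lsc[OF that] lower_semicont_const]])
        show "supp \<phi> \<subseteq> (\<Union>g\<in>\<G>. {x. ennreal (\<phi> x) < g x + ennreal d})" using cover by blast
      qed
      obtain k where k: "k \<in> \<G>" "\<And>g x. g \<in> F \<Longrightarrow> g x \<le> k x"
        using finite_directed_bound[OF F(2,1) ne dir] by blast
      \<comment> \<open>Subtracting \<open>d * \<eta>\<close> instead of the constant
        \<open>d\<close> stays within functions of compact support, and \<open>\<eta>\<close> is
        \<open>1\<close> wherever \<open>\<phi>\<close> is nonzero.\<close>
      define \<psi> where "\<psi> = (\<lambda>x. max 0 (\<phi> x - d * \<eta> x))"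
      have \<psi>Cc: "\<psi> \<in> Cc" unfolding \<psi>_def by (rule Cc_max[OF Cc_zero Cc_diff[OF \<phi>(1) Cc_scale[OF \<eta>(1)]]])
      have "ennreal (\<psi> x) \<le> k x" for x
      proof (cases "x \<in> supp \<phi>")
        case True
        then obtain g where "g \<in> F" "ennreal (\<phi> x) < g x + ennreal d" using F(3) by auto
        then have "ennreal (\<phi> x) \<le> k x + ennreal d"
          using add_right_mono[OF k(2), of g x "ennreal d"] by (meson less_imp_le order_trans)
        moreover have "\<psi> x = max 0 (\<phi> x - d)" using True \<eta> by (simp add: \<psi>_def)
        ultimately show ?thesis
          using d \<phi>(2)[of x]
          by (cases "k x") (auto simp: max_def ennreal_plus[symmetric] ennreal_le_iff2 simp del: ennreal_plus intro: ennreal_leI)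
      next
        case False
        then have "\<psi> x = 0" using not_in_supp[OF False] mult_nonneg_nonneg[OF less_imp_le[OF d(1)] \<eta>(2)[rule_format, of x]]
          by (simp add: \<psi>_def)
        then show ?thesis by simp
      qed
      then have "\<psi> \<in> Cc_below k" using \<psi>Cc by (auto simp: Cc_below_def \<psi>_def)
      then have 1: "ennreal (\<mu> \<psi>) \<le> pos_integral \<mu> k" by (rule pos_integral_upper)
      have sCc: "(\<lambda>x. \<psi> x + d * \<eta> x) \<in> Cc" by (rule Cc_add[OF \<psi>Cc Cc_scale[OF \<eta>(1)]])
      have "\<mu> \<phi> \<le> \<mu> (\<lambda>x. \<psi> x + d * \<eta> x)"
        by (rule radon_pos_mono[OF \<mu> \<phi>(1) sCc]) (simp add: \<psi>_def)
      moreover have "\<mu> (\<lambda>x. \<psi> x + d * \<eta> x) = \<mu> \<psi> + d * \<mu> \<eta>"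
        using radon_add[OF radon_pos_radon[OF \<mu>] \<psi>Cc Cc_scale[OF \<eta>(1)], of d]
          radon_scale[OF radon_pos_radon[OF \<mu>] \<eta>(1), of d] by linarith
      moreover have "0 \<le> \<mu> \<psi>" by (rule radon_pos_nonneg[OF \<mu> \<psi>Cc]) (simp add: \<psi>_def)
      ultimately have "ennreal (\<mu> \<phi>) \<le> ennreal (\<mu> \<psi>) + ennreal e"
        using d(2) e by (simp add: ennreal_leI flip: ennreal_plus)
      then show "ennreal (\<mu> \<phi>) \<le> (SUP g\<in>\<G>. pos_integral \<mu> g) + ennreal e"
        by (rule order_trans) (rule add_right_mono[OF order_trans[OF 1 SUP_upper[OF k(1), of "pos_integral \<mu>"]]])
    qed
  qed
qed

end

section \<open>Linearity of the integral of lower semicontinuous functions\<close>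

lemma ennreal_SUP_add_SUP:
  fixes f :: "'i \<Rightarrow> ennreal" and g :: "'j \<Rightarrow> ennreal"
  assumes "I \<noteq> {}" "J \<noteq> {}"
  shows "(SUP i\<in>I. f i) + (SUP j\<in>J. g j) = (SUP p\<in>I \<times> J. f (fst p) + g (snd p))"
proof (rule antisym)
  have "(SUP i\<in>I. f i) + (SUP j\<in>J. g j) = (SUP i\<in>I. f i + (SUP j\<in>J. g j))"
    by (rule ennreal_SUP_add_left[OF assms(1), symmetric])
  moreover have "f i + (SUP j\<in>J. g j) = (SUP j\<in>J. f i + g j)" for i
    using ennreal_SUP_add_right[OF assms(2), of "f i" g] by simp
  moreover have "f i + g j \<le> (SUP p\<in>I \<times> J. f (fst p) + g (snd p))" if "i \<in> I" "j \<in> J" for i j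
    using SUP_upper[of "(i, j)" "I \<times> J" "\<lambda>p. f (fst p) + g (snd p)"] that by simp
  ultimately show "(SUP i\<in>I. f i) + (SUP j\<in>J. g j) \<le> (SUP p\<in>I \<times> J. f (fst p) + g (snd p))"
    by (simp add: SUP_least)
  have "f i \<le> (SUP i\<in>I. f i)" if "i \<in> I" for i using that by (rule SUP_upper)
  moreover have "g j \<le> (SUP j\<in>J. g j)" if "j \<in> J" for j using that by (rule SUP_upper)
  ultimately show "(SUP p\<in>I \<times> J. f (fst p) + g (snd p)) \<le> (SUP i\<in>I. f i) + (SUP j\<in>J. g j)"
    by (intro SUP_least add_mono) auto
qed

text \<open>The number of levels \<open>k / n\<close> strictly below \<open>r\<close> is the integer
  part of \<open>r * n\<close> up to one unit; this unit is the error of one step in the layer-cake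
  sums.\<close>

lemma card_levels_bounds:
  fixes r :: real and n m :: nat
  assumes "0 \<le> r" "0 < n"
  defines "S \<equiv> {k\<in>{1..m}. real k / real n < r}"
  shows "real (card S) \<le> r * n" "r * n \<le> m \<Longrightarrow> r * n \<le> real (card S) + 1"
proof -
  have S: "S = {k\<in>{1..m}. real k < r * n}" using assms(2) by (auto simp: S_def field_simps)
  have rn: "0 \<le> r * n" using assms(1) by simp
  have "S \<subseteq> {1..nat \<lfloor>r * n\<rfloor>}" by (auto simp: S le_nat_floor)
  then have "card S \<le> nat \<lfloor>r * n\<rfloor>" using card_mono[of "{1..nat \<lfloor>r * n\<rfloor>}" S] by simp
  then show "real (card S) \<le> r * n" using rn of_nat_floor[of "r * n"] by linarith
  assume m: "r * n \<le> m"
  have "{1..<nat \<lceil>r * n\<rceil>} \<subseteq> S"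
  proof
    fix k assume k: "k \<in> {1..<nat \<lceil>r * n\<rceil>}"
    then have "int k < \<lceil>r * n\<rceil>" by auto
    then have "real k < r * n" by (simp add: less_ceiling_iff)
    then show "k \<in> S" using k m by (auto simp: S)
  qed
  moreover have "finite S" by (simp add: S)
  ultimately have "nat \<lceil>r * n\<rceil> - 1 \<le> card S" using card_mono[of S "{1..<nat \<lceil>r * n\<rceil>}"] by simp
  then show "r * n \<le> real (card S) + 1" using real_nat_ceiling_ge[of "r * n"] by linarith
qed

lemma lower_semicont_mult_indicator:
  assumes "lower_semicont g" "open G" shows "lower_semicont (\<lambda>x. g x * indicator G x)"
  unfolding lower_semicont_def
proof
  fix a :: ennreal
  have "{x. a < g x * indicator G x} = G \<inter> {x. a < g x}"
    by (auto simp: indicator_def split: if_splits)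
  then show "open {x. a < g x * indicator G x}" using assms lower_semicontD by (metis open_Int)
qed

lemma lower_semicont_diff:
  fixes \<phi> :: "'a::topological_space \<Rightarrow> real"
  assumes "lower_semicont g" "continuous_on UNIV \<phi>" "\<forall>x. 0 \<le> \<phi> x"
  shows "lower_semicont (\<lambda>x. g x - ennreal (\<phi> x))"
  unfolding lower_semicont_def
proof
  fix a :: ennreal
  show "open {x. a < g x - ennreal (\<phi> x)}"
  proof (cases a)
    case (real r)
    have "(a < g x - ennreal (\<phi> x)) = (ennreal (r + \<phi> x) < g x)" for x
      using real assms(3) by (cases "g x") (auto simp: ennreal_minus ennreal_less_iff simp flip: ennreal_plus)
    then have "{x. a < g x - ennreal (\<phi> x)} = {x. ennreal (r + \<phi> x) < g x}" by simp
    moreover have "continuous_on UNIV (\<lambda>x. r + \<phi> x)" using assms(2) by (intro continuous_intros)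
    ultimately show ?thesis using open_less_lower_semicont[OF _ assms(1)] by metis
  qed simp
qed

lemma lower_semicont_sum:
  assumes "\<And>i. i \<in> I \<Longrightarrow> lower_semicont (g i)"
  shows "lower_semicont (\<lambda>x. \<Sum>i\<in>I. g i x)"
proof (cases "finite I")
  case True
  then show ?thesis using assms
    by (induction I) (auto intro: lower_semicont_add lower_semicont_const)
qed (simp add: lower_semicont_const)

lemma lower_semicont_scale:
  assumes "lower_semicont g" "0 < c" shows "lower_semicont (\<lambda>x. ennreal c * g x)"
  unfolding lower_semicont_def
proof
  fix a :: ennreal
  show "open {x. a < ennreal c * g x}"
  proof (cases a)
    case (real r)
    have "(a < ennreal c * g x) = (ennreal (r / c) < g x)" for x
      using real assms(2)
      by (cases "g x") (auto simp: ennreal_mult_top ennreal_mult[symmetric] ennreal_less_iff field_simps)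
    then show ?thesis using lower_semicontD[OF assms(1)] by simp
  qed simp
qed

context lch_space
begin

text \<open>A minorant of \<open>f + g\<close> need not split into minorants of \<open>f\<close> and
  \<open>g\<close>. The sums of such minorants nevertheless form a directed family with supremum
  \<open>f + g\<close>, so the theorem on directed suprema applies to them.\<close>

lemma pos_integral_add:
  fixes f g :: "'a \<Rightarrow> ennreal"
  assumes \<mu>: "\<mu> \<in> radon_pos" and lsc: "lower_semicont f" "lower_semicont g"
  shows "pos_integral \<mu> (\<lambda>x. f x + g x) = pos_integral \<mu> f + pos_integral \<mu> g"
proof -
  let ?I = "Cc_below f \<times> Cc_below g"
  define F where "F = (\<lambda>p::('a \<Rightarrow> real) \<times> ('a \<Rightarrow> real). \<lambda>x. ennreal (fst p x) + ennreal (snd p x))"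
  have ne: "Cc_below f \<noteq> {}" "Cc_below g \<noteq> {}" using Cc_below_zero by blast+
  have F: "F p = (\<lambda>x. ennreal (fst p x + snd p x))" "pos_integral \<mu> (F p) = ennreal (\<mu> (fst p)) + ennreal (\<mu> (snd p))"
    "lower_semicont (F p)" if "p \<in> ?I" for p
  proof -
    have p: "fst p \<in> Cc" "snd p \<in> Cc" "\<forall>x. 0 \<le> fst p x" "\<forall>x. 0 \<le> snd p x"
      using that by (auto simp: Cc_below_def)
    show 1: "F p = (\<lambda>x. ennreal (fst p x + snd p x))" using p by (simp add: F_def)
    have s: "(\<lambda>x. fst p x + snd p x) \<in> Cc" by (rule Cc_add[OF p(1,2)])
    have "pos_integral \<mu> (F p) = ennreal (\<mu> (\<lambda>x. fst p x + snd p x))"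
      unfolding 1 by (rule pos_integral_Cc[OF \<mu> s]) (simp add: p)
    then show "pos_integral \<mu> (F p) = ennreal (\<mu> (fst p)) + ennreal (\<mu> (snd p))"
      using radon_add[OF radon_pos_radon[OF \<mu>] p(1,2)] radon_pos_nonneg[OF \<mu> p(1)]
        radon_pos_nonneg[OF \<mu> p(2)] p by simp
    show "lower_semicont (F p)" unfolding 1 by (rule lower_semicont_continuous[OF Cc_continuous[OF s]])
  qed
  have "(\<lambda>x. f x + g x) = (\<lambda>x. SUP k\<in>F ` ?I. k x)"
  proof
    fix x
    show "f x + g x = (SUP k\<in>F ` ?I. k x)"
      unfolding lower_semicont_eq_SUP[OF lsc(1), of x] lower_semicont_eq_SUP[OF lsc(2), of x]
        ennreal_SUP_add_SUP[OF ne] by (simp add: image_image F_def)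
  qed
  moreover have "pos_integral \<mu> (\<lambda>x. SUP k\<in>F ` ?I. k x) = (SUP k\<in>F ` ?I. pos_integral \<mu> k)"
  proof (rule pos_integral_directed_SUP[OF \<mu>])
    show "F ` ?I \<noteq> {}" using ne by blast
    show "lower_semicont k" if "k \<in> F ` ?I" for k using that F(3) by blast
    fix h k assume "h \<in> F ` ?I" "k \<in> F ` ?I"
    then obtain p q where pq: "p \<in> ?I" "q \<in> ?I" "h = F p" "k = F q" by blast
    let ?r = "(\<lambda>x. max (fst p x) (fst q x), \<lambda>x. max (snd p x) (snd q x))"
    have "?r \<in> ?I" using pq Cc_below_max[of "fst p" f "fst q"] Cc_below_max[of "snd p" g "snd q"] by auto
    moreover have "F p x \<le> F ?r x \<and> F q x \<le> F ?r x" for x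
      unfolding F_def by (auto intro!: add_mono ennreal_leI)
    ultimately show "\<exists>l\<in>F ` ?I. \<forall>x. h x \<le> l x \<and> k x \<le> l x" using pq by blast
  qed
  moreover have "(SUP k\<in>F ` ?I. pos_integral \<mu> k) = (SUP p\<in>?I. ennreal (\<mu> (fst p)) + ennreal (\<mu> (snd p)))"
    using F(2) by (simp add: image_image)
  moreover have "\<dots> = pos_integral \<mu> f + pos_integral \<mu> g"
    unfolding pos_integral_eq by (rule ennreal_SUP_add_SUP[OF ne, symmetric])
  ultimately show ?thesis by simp
qed

lemma pos_integral_zero: "\<mu> \<in> radon_pos \<Longrightarrow> pos_integral \<mu> (\<lambda>x::'a. 0) = 0"
  using pos_integral_Cc[of \<mu> "\<lambda>x. 0"] Cc_zero radon_zero_arg[OF radon_pos_radon] by fastforce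

lemma pos_integral_sum:
  fixes g :: "'i \<Rightarrow> 'a \<Rightarrow> ennreal"
  assumes \<mu>: "\<mu> \<in> radon_pos" and lsc: "\<And>i. i \<in> I \<Longrightarrow> lower_semicont (g i)"
  shows "pos_integral \<mu> (\<lambda>x. \<Sum>i\<in>I. g i x) = (\<Sum>i\<in>I. pos_integral \<mu> (g i))"
proof (cases "finite I")
  case True
  then show ?thesis using lsc
  proof (induction I)
    case empty then show ?case by (simp add: pos_integral_zero[OF \<mu>])
  next
    case (insert i I)
    then show ?case
      using pos_integral_add[OF \<mu>, of "g i" "\<lambda>x. \<Sum>i\<in>I. g i x"] lower_semicont_sum[of I g] by simp
  qed
qed (simp add: pos_integral_zero[OF \<mu>])

lemma pos_integral_suminf:
  fixes g :: "nat \<Rightarrow> 'a \<Rightarrow> ennreal"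
  assumes \<mu>: "\<mu> \<in> radon_pos" and lsc: "\<And>i. lower_semicont (g i)"
  shows "lower_semicont (\<lambda>x. \<Sum>i. g i x)" "pos_integral \<mu> (\<lambda>x. \<Sum>i. g i x) = (\<Sum>i. pos_integral \<mu> (g i))"
proof -
  define s where "s = (\<lambda>n x. \<Sum>i<n. g i x)"
  have s: "lower_semicont (s n)" for n unfolding s_def by (rule lower_semicont_sum) (rule lsc)
  have mono: "s m x \<le> s n x" if "m \<le> n" for m n x
    unfolding s_def using that by (intro sum_mono2) auto
  have eq: "(\<lambda>x. \<Sum>i. g i x) = (\<lambda>x. SUP k\<in>range s. k x)"
    by (simp add: s_def suminf_eq_SUP image_image)
  have "(\<lambda>x. SUP k\<in>range s. k x) = (\<lambda>x. SUP n\<in>UNIV. s n x)" by (simp add: image_image)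
  then show "lower_semicont (\<lambda>x. \<Sum>i. g i x)" unfolding eq using lower_semicont_SUP[of UNIV s] s by simp
  have "pos_integral \<mu> (\<lambda>x. SUP k\<in>range s. k x) = (SUP k\<in>range s. pos_integral \<mu> k)"
  proof (rule pos_integral_directed_SUP[OF \<mu>])
    show "range s \<noteq> {}" by simp
    show "lower_semicont k" if "k \<in> range s" for k using that s by blast
    fix h k assume "h \<in> range s" "k \<in> range s"
    then obtain m n where "h = s m" "k = s n" by blast
    then show "\<exists>l\<in>range s. \<forall>x. h x \<le> l x \<and> k x \<le> l x"
      using mono[of m "max m n"] mono[of n "max m n"] by (intro bexI[of _ "s (max m n)"]) auto
  qed
  also have "\<dots> = (SUP n. \<Sum>i<n. pos_integral \<mu> (g i))"
    unfolding image_image s_def pos_integral_sum[OF \<mu> lsc] ..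
  also have "\<dots> = (\<Sum>i. pos_integral \<mu> (g i))" by (simp add: suminf_eq_SUP)
  finally show "pos_integral \<mu> (\<lambda>x. \<Sum>i. g i x) = (\<Sum>i. pos_integral \<mu> (g i))" by (simp only: eq)
qed

lemma pos_integral_scale:
  fixes g :: "'a \<Rightarrow> ennreal"
  assumes \<mu>: "\<mu> \<in> radon_pos" and c: "0 < c"
  shows "pos_integral \<mu> (\<lambda>x. ennreal c * g x) = ennreal c * pos_integral \<mu> g"
proof -
  have le: "ennreal c * pos_integral \<mu> g \<le> pos_integral \<mu> (\<lambda>x. ennreal c * g x)" if c: "0 < c" for c g
  proof -
    have "ennreal c * ennreal (\<mu> \<phi>) \<le> pos_integral \<mu> (\<lambda>x. ennreal c * g x)" if "\<phi> \<in> Cc_below g" for \<phi>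
    proof -
      have \<phi>: "\<phi> \<in> Cc" "\<forall>x. 0 \<le> \<phi> x" "\<forall>x. ennreal (\<phi> x) \<le> g x" using that by (auto simp: Cc_below_def)
      have "(\<lambda>x. c * \<phi> x) \<in> Cc_below (\<lambda>x. ennreal c * g x)"
        using c \<phi> Cc_scale[OF \<phi>(1), of c] by (auto simp: Cc_below_def ennreal_mult intro!: mult_left_mono)
      then have "ennreal (\<mu> (\<lambda>x. c * \<phi> x)) \<le> pos_integral \<mu> (\<lambda>x. ennreal c * g x)" by (rule pos_integral_upper)
      then show ?thesis using radon_scale[OF radon_pos_radon[OF \<mu>] \<phi>(1), of c] c by (simp add: ennreal_mult')
    qed
    then show ?thesis unfolding pos_integral_eq[of \<mu> g] SUP_mult_left_ennreal by (rule SUP_least)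
  qed
  have "ennreal (1/c) * pos_integral \<mu> (\<lambda>x. ennreal c * g x) \<le> pos_integral \<mu> (\<lambda>x. ennreal (1/c) * (ennreal c * g x))"
    using le[of "1/c"] c by simp
  also have "(\<lambda>x. ennreal (1/c) * (ennreal c * g x)) = g"
    using c by (simp add: ennreal_mult[symmetric] mult.assoc[symmetric])
  finally have "ennreal c * (ennreal (1/c) * pos_integral \<mu> (\<lambda>x. ennreal c * g x)) \<le> ennreal c * pos_integral \<mu> g"
    by (rule mult_left_mono) simp
  then have "pos_integral \<mu> (\<lambda>x. ennreal c * g x) \<le> ennreal c * pos_integral \<mu> g"
    using c by (simp add: ennreal_mult[symmetric] mult.assoc[symmetric])
  then show ?thesis using le[OF c] by (rule antisym)
qed

end

section \<open>The measure of a positive functional\<close>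

definition radon_outer :: "'a::topological_space functional \<Rightarrow> 'a set \<Rightarrow> ennreal" where
  "radon_outer \<mu> S = upper_integral \<mu> (indicator S)"

text \<open>The measure lives on the whole Caratheodory sigma-algebra, not only on the Borel sets.
  It is therefore complete, and its null sets are exactly the sets of upper integral zero, Borel or
  not.\<close>

definition radon_measure :: "'a::topological_space functional \<Rightarrow> 'a measure" where
  "radon_measure \<mu> = measure_of UNIV (lambda_system UNIV (Pow UNIV) (radon_outer \<mu>)) (radon_outer \<mu>)"

lemma radon_outer_mono: "S \<subseteq> T \<Longrightarrow> radon_outer \<mu> S \<le> radon_outer \<mu> T"
  unfolding radon_outer_def by (rule upper_integral_mono) (auto simp: indicator_def)

context lch_space
begin

text \<open>Each \<open>f i\<close> is majorised by a lower semicontinuous function with an excess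
  of \<open>e / 2 ^ Suc i\<close>; these majorants can be summed term by term.\<close>

lemma upper_integral_suminf_le:
  fixes f :: "nat \<Rightarrow> 'a \<Rightarrow> ennreal"
  assumes \<mu>: "\<mu> \<in> radon_pos"
  shows "upper_integral \<mu> (\<lambda>x. \<Sum>i. f i x) \<le> (\<Sum>i. upper_integral \<mu> (f i))"
proof (rule ennreal_le_epsilon)
  fix e :: real assume fin: "(\<Sum>i. upper_integral \<mu> (f i)) < top" and e: "0 < e"
  have fini: "upper_integral \<mu> (f i) < top" for i
    using fin ennreal_suminf_lessD by blast
  have "\<exists>g. lower_semicont g \<and> (\<forall>x. f i x \<le> g x) \<and>
      pos_integral \<mu> g < upper_integral \<mu> (f i) + ennreal (e * (1/2) ^ Suc i)" for i
  proof -
    have "upper_integral \<mu> (f i) < upper_integral \<mu> (f i) + ennreal (e * (1/2) ^ Suc i)"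
      using fini[of i] e by (cases "upper_integral \<mu> (f i)") (auto simp: ennreal_less_iff simp flip: ennreal_plus)
    then show ?thesis unfolding upper_integral_def[of \<mu> "f i"] INF_less_iff by blast
  qed
  then obtain g where g: "\<And>i. lower_semicont (g i)" "\<And>i x. f i x \<le> g i x"
      "\<And>i. pos_integral \<mu> (g i) < upper_integral \<mu> (f i) + ennreal (e * (1/2) ^ Suc i)" by metis
  have "upper_integral \<mu> (\<lambda>x. \<Sum>i. f i x) \<le> upper_integral \<mu> (\<lambda>x. \<Sum>i. g i x)"
    by (rule upper_integral_mono) (intro suminf_le g summableI)
  also have "\<dots> = (\<Sum>i. pos_integral \<mu> (g i))"
    using upper_integral_lower_semicont[OF pos_integral_suminf(1)[where g = g, OF \<mu> g(1)], of \<mu>]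
      pos_integral_suminf(2)[where g = g, OF \<mu> g(1)] by (rule trans)
  also have "\<dots> \<le> (\<Sum>i. upper_integral \<mu> (f i) + ennreal (e * (1/2) ^ Suc i))"
    by (intro suminf_le summableI less_imp_le g(3))
  also have "\<dots> = (\<Sum>i. upper_integral \<mu> (f i)) + (\<Sum>i. ennreal (e * (1/2) ^ Suc i))"
    by (intro suminf_add[symmetric] summableI)
  also have "(\<Sum>i. ennreal (e * (1/2) ^ Suc i)) = ennreal (e * 1)"
    by (rule suminf_ennreal_eq[OF _ sums_mult[OF power_half_series]]) (use e in auto)
  finally show "upper_integral \<mu> (\<lambda>x. \<Sum>i. f i x) \<le> (\<Sum>i. upper_integral \<mu> (f i)) + ennreal e" by simp
qed

text \<open>The Caratheodory inequality for open sets. Removing from \<open>g\<close> a continuous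
  minorant \<open>\<phi>\<close> of its part on \<open>G\<close> leaves a lower semicontinuous
  function, which still dominates the part of \<open>g\<close> off \<open>G\<close>.\<close>

lemma pos_integral_split_open:
  fixes g :: "'a \<Rightarrow> ennreal"
  assumes \<mu>: "\<mu> \<in> radon_pos" and g: "lower_semicont g" and G: "open G"
  shows "pos_integral \<mu> (\<lambda>x. g x * indicator G x) + upper_integral \<mu> (\<lambda>x. g x * indicator (-G) x) \<le> pos_integral \<mu> g"
proof -
  have "ennreal (\<mu> \<phi>) + upper_integral \<mu> (\<lambda>x. g x * indicator (-G) x) \<le> pos_integral \<mu> g"
    if "\<phi> \<in> Cc_below (\<lambda>x. g x * indicator G x)" for \<phi>
  proof -
    have \<phi>: "\<phi> \<in> Cc" "\<forall>x. 0 \<le> \<phi> x" "\<forall>x. ennreal (\<phi> x) \<le> g x * indicator G x"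
      using that by (auto simp: Cc_below_def)
    define k where "k = (\<lambda>x. g x - ennreal (\<phi> x))"
    have k: "lower_semicont k" unfolding k_def by (rule lower_semicont_diff[OF g Cc_continuous[OF \<phi>(1)] \<phi>(2)])
    have "ennreal (\<phi> x) \<le> g x" for x
      using \<phi>(3)[rule_format, of x] by (cases "x \<in> G") auto
    then have "g = (\<lambda>x. ennreal (\<phi> x) + k x)" by (auto simp: k_def fun_eq_iff add_diff_inverse_ennreal)
    then have "pos_integral \<mu> g = pos_integral \<mu> (\<lambda>x. ennreal (\<phi> x)) + pos_integral \<mu> k"
      using pos_integral_add[OF \<mu> lower_semicont_continuous[OF Cc_continuous[OF \<phi>(1)]] k] by simp
    also have "pos_integral \<mu> (\<lambda>x. ennreal (\<phi> x)) = ennreal (\<mu> \<phi>)"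
      by (rule pos_integral_Cc[OF \<mu> \<phi>(1)]) (use \<phi>(2) in simp)
    finally have 1: "pos_integral \<mu> g = ennreal (\<mu> \<phi>) + pos_integral \<mu> k" .
    have "g x * indicator (-G) x \<le> k x" for x
      using \<phi>(3)[rule_format, of x] by (cases "x \<in> G") (auto simp: k_def)
    then have "upper_integral \<mu> (\<lambda>x. g x * indicator (-G) x) \<le> pos_integral \<mu> k"
      using upper_integral_mono[of "\<lambda>x. g x * indicator (-G) x" k \<mu>] upper_integral_lower_semicont[OF k] by simp
    then show ?thesis unfolding 1 by (rule add_left_mono)
  qed
  moreover have "Cc_below (\<lambda>x. g x * indicator G x) \<noteq> {}" using Cc_below_zero by blast
  ultimately show ?thesis
    unfolding pos_integral_eq[of \<mu> "\<lambda>x. g x * indicator G x"]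
    by (subst ennreal_SUP_add_left[symmetric]) (auto intro: SUP_least)
qed

lemma outer_measure_space_radon_outer:
  assumes \<mu>: "(\<mu>::'a functional) \<in> radon_pos"
  shows "outer_measure_space (Pow UNIV) (radon_outer \<mu>)"
proof -
  have empty: "radon_outer \<mu> {} = 0"
    using upper_integral_lower_semicont[OF lower_semicont_const, of \<mu> 0] pos_integral_zero[OF \<mu>]
    by (simp add: radon_outer_def indicator_def[abs_def])
  have "radon_outer \<mu> (\<Union>i. S i) \<le> (\<Sum>i. radon_outer \<mu> (S i))" for S :: "nat \<Rightarrow> 'a set"
  proof -
    have "indicator (\<Union>i. S i) x \<le> (\<Sum>i. indicator (S i) x :: ennreal)" for x
    proof (cases "\<exists>i. x \<in> S i")
      case True
      then obtain i where "x \<in> S i" by blast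
      then have "(1::ennreal) \<le> (\<Sum>j\<in>{i}. indicator (S j) x)" by simp
      also have "\<dots> \<le> (\<Sum>i. indicator (S i) x)" by (rule sum_le_suminf[OF summableI]) auto
      finally show ?thesis by (simp add: indicator_def split: if_splits)
    qed simp
    then have "radon_outer \<mu> (\<Union>i. S i) \<le> upper_integral \<mu> (\<lambda>x. \<Sum>i. indicator (S i) x)"
      unfolding radon_outer_def by (rule upper_integral_mono)
    also have "\<dots> \<le> (\<Sum>i. radon_outer \<mu> (S i))"
      unfolding radon_outer_def by (rule upper_integral_suminf_le[OF \<mu>])
    finally show ?thesis .
  qed
  then show ?thesis
    by (auto simp: outer_measure_space_def positive_def increasing_def countably_subadditive_def empty radon_outer_mono)
qed

lemma measure_space_radon_outer:
  assumes "(\<mu>::'a functional) \<in> radon_pos"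
  shows "measure_space UNIV (lambda_system UNIV (Pow UNIV) (radon_outer \<mu>)) (radon_outer \<mu>)"
  by (rule sigma_algebra.caratheodory_lemma[OF sigma_algebra_Pow outer_measure_space_radon_outer[OF assms]])

lemma sets_radon_measure:
  assumes "(\<mu>::'a functional) \<in> radon_pos"
  shows "sets (radon_measure \<mu>) = lambda_system UNIV (Pow UNIV) (radon_outer \<mu>)"
  using measure_space_radon_outer[OF assms]
  by (auto simp: radon_measure_def measure_space_def sigma_algebra.sigma_sets_eq)

lemma space_radon_measure [simp]: "space (radon_measure \<mu>) = UNIV"
  by (simp add: radon_measure_def space_measure_of_conv)

lemma emeasure_radon_measure:
  assumes "(\<mu>::'a functional) \<in> radon_pos" "S \<in> sets (radon_measure \<mu>)"
  shows "emeasure (radon_measure \<mu>) S = radon_outer \<mu> S"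
  using measure_space_radon_outer[OF assms(1)] assms(2)
  unfolding radon_measure_def measure_space_def
  by (intro emeasure_measure_of_sigma) (auto simp: sigma_algebra.sigma_sets_eq)

lemma sets_radon_measureI:
  assumes \<mu>: "(\<mu>::'a functional) \<in> radon_pos"
    and le: "\<And>T. radon_outer \<mu> (T \<inter> S) + radon_outer \<mu> (T - S) \<le> radon_outer \<mu> T"
  shows "S \<in> sets (radon_measure \<mu>)"
proof -
  interpret sigma_algebra UNIV "Pow UNIV :: 'a set set" by (rule sigma_algebra_Pow)
  have "radon_outer \<mu> T \<le> radon_outer \<mu> (T \<inter> S) + radon_outer \<mu> (T - S)" for T
  proof -
    have "subadditive (Pow UNIV) (radon_outer \<mu>)"
      using outer_measure_space_radon_outer[OF \<mu>] countably_subadditive_subadditive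
      by (auto simp: outer_measure_space_def)
    then have "radon_outer \<mu> ((T \<inter> S) \<union> (T - S)) \<le> radon_outer \<mu> (T \<inter> S) + radon_outer \<mu> (T - S)"
      by (rule subadditiveD) auto
    then show ?thesis by (simp add: Int_Diff_Un)
  qed
  then show ?thesis
    unfolding sets_radon_measure[OF \<mu>] lambda_system_eq using le by (auto intro: antisym)
qed

lemma open_in_sets_radon_measure:
  assumes \<mu>: "(\<mu>::'a functional) \<in> radon_pos" and G: "open G"
  shows "G \<in> sets (radon_measure \<mu>)"
proof (rule sets_radon_measureI[OF \<mu>])
  fix T
  show "radon_outer \<mu> (T \<inter> G) + radon_outer \<mu> (T - G) \<le> radon_outer \<mu> T"
    unfolding radon_outer_def[of \<mu> T] upper_integral_def
  proof (rule INF_greatest, clarify)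
    fix g :: "'a \<Rightarrow> ennreal" assume g: "lower_semicont g" "\<forall>x. indicator T x \<le> g x"
    have 1: "1 \<le> g x" if "x \<in> T" for x using g(2)[rule_format, of x] that by simp
    have "radon_outer \<mu> (T \<inter> G) \<le> upper_integral \<mu> (\<lambda>x. g x * indicator G x)"
      unfolding radon_outer_def by (rule upper_integral_mono) (auto simp: indicator_def 1)
    also have "\<dots> = pos_integral \<mu> (\<lambda>x. g x * indicator G x)"
      by (rule upper_integral_lower_semicont[OF lower_semicont_mult_indicator[OF g(1) G]])
    finally have 2: "radon_outer \<mu> (T \<inter> G) \<le> pos_integral \<mu> (\<lambda>x. g x * indicator G x)" .
    have "radon_outer \<mu> (T - G) \<le> upper_integral \<mu> (\<lambda>x. g x * indicator (-G) x)"
      unfolding radon_outer_def by (rule upper_integral_mono) (auto simp: indicator_def 1)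
    from add_mono[OF 2 this] show "radon_outer \<mu> (T \<inter> G) + radon_outer \<mu> (T - G) \<le> pos_integral \<mu> g"
      by (rule order_trans[OF _ pos_integral_split_open[OF \<mu> g(1) G]])
  qed
qed

lemma borel_in_sets_radon_measure:
  assumes \<mu>: "(\<mu>::'a functional) \<in> radon_pos"
  shows "sets borel \<subseteq> sets (radon_measure \<mu>)"
proof -
  have "sigma_sets (space (radon_measure \<mu>)) {S. open S} \<subseteq> sets (radon_measure \<mu>)"
    by (rule sets.sigma_sets_subset) (auto intro: open_in_sets_radon_measure[OF \<mu>])
  then show ?thesis by (simp add: borel_def)
qed

lemma borel_measurable_radon_measure:
  assumes \<mu>: "(\<mu>::'a functional) \<in> radon_pos" and f: "f \<in> measurable borel N"
  shows "f \<in> measurable (radon_measure \<mu>) N"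
  using f borel_in_sets_radon_measure[OF \<mu>] by (auto simp: measurable_def)

lemma lower_semicont_measurable:
  assumes "(\<mu>::'a functional) \<in> radon_pos" "lower_semicont g"
  shows "g \<in> borel_measurable (radon_measure \<mu>)"
  by (rule borel_measurable_radon_measure[OF assms(1) borel_measurable_lower_semicont[OF assms(2)]])

lemma null_sets_radon_measure:
  assumes \<mu>: "(\<mu>::'a functional) \<in> radon_pos"
  shows "N \<in> null_sets (radon_measure \<mu>) \<longleftrightarrow> negligible_for \<mu> N"
proof
  assume N: "N \<in> null_sets (radon_measure \<mu>)"
  then show "negligible_for \<mu> N"
    using emeasure_radon_measure[OF \<mu> null_setsD2[OF N]] null_setsD1[OF N]
    by (simp add: negligible_for_def radon_outer_def)
next
  assume "negligible_for \<mu> N"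
  then have 0: "radon_outer \<mu> N = 0" by (simp add: negligible_for_def radon_outer_def)
  have "N \<in> sets (radon_measure \<mu>)"
  proof (rule sets_radon_measureI[OF \<mu>])
    fix T
    have "radon_outer \<mu> (T \<inter> N) = 0" using radon_outer_mono[of "T \<inter> N" N \<mu>] 0 by simp
    then show "radon_outer \<mu> (T \<inter> N) + radon_outer \<mu> (T - N) \<le> radon_outer \<mu> T"
      using radon_outer_mono[of "T - N" T \<mu>] by simp
  qed
  then show "N \<in> null_sets (radon_measure \<mu>)" using emeasure_radon_measure[OF \<mu>, of N] 0 by auto
qed

lemma emeasure_open_radon_measure:
  assumes "(\<mu>::'a functional) \<in> radon_pos" "open G"
  shows "emeasure (radon_measure \<mu>) G = pos_integral \<mu> (indicator G)"
  using emeasure_radon_measure[OF assms(1) open_in_sets_radon_measure[OF assms]]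
    upper_integral_lower_semicont[OF lower_semicont_indicator[OF assms(2)]] by (simp add: radon_outer_def)

text \<open>The layer-cake formula with step \<open>1 / n\<close>, truncated at height \<open>n\<close>.\<close>

definition level_sum :: "nat \<Rightarrow> ('a \<Rightarrow> ennreal) \<Rightarrow> 'a \<Rightarrow> ennreal" where
  "level_sum n g x = (\<Sum>k\<in>{1..n*n}. ennreal (1 / real n) * indicator {x. ennreal (real k / real n) < g x} x)"

lemma level_sum_eq_card:
  assumes "0 < n"
  shows "level_sum n g x = ennreal (real (card {k\<in>{1..n*n}. ennreal (real k / real n) < g x}) / real n)"
proof -
  let ?S = "{k\<in>{1..n*n}. ennreal (real k / real n) < g x}"
  have "level_sum n g x = (\<Sum>k\<in>{1..n*n}. if ennreal (real k / real n) < g x then ennreal (1 / real n) else 0)"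
    unfolding level_sum_def by (intro sum.cong) (auto simp: indicator_def)
  also have "\<dots> = (\<Sum>k\<in>?S. ennreal (1 / real n))"
    by (rule sum.inter_filter[symmetric]) simp
  also have "\<dots> = ennreal (real (card ?S) * (1 / real n))"
    by (simp add: divide_inverse ennreal_mult ennreal_of_nat_eq_real_of_nat)
  finally show ?thesis by simp
qed

lemma level_sum_le:
  assumes "0 < n" shows "level_sum n g x \<le> g x"
proof (cases "g x")
  case (real r)
  have "{k\<in>{1..n*n}. ennreal (real k / real n) < g x} = {k\<in>{1..n*n}. real k / real n < r}"
    using real by (auto simp: ennreal_less_iff)
  then show ?thesis
    using card_levels_bounds(1)[OF real(1) assms, of "n*n"] assms real
    unfolding level_sum_eq_card[OF assms] by (auto intro!: ennreal_leI simp: field_simps)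
qed simp

text \<open>The bound \<open>r \<le> n\<close> keeps \<open>r\<close> below the height at which the
  sum is truncated; rounding then loses at most one step.\<close>

lemma level_sum_ge:
  assumes "0 < n" "ennreal r \<le> g x" "r \<le> n" shows "ennreal (r - 1 / n) \<le> level_sum n g x"
proof (cases "0 \<le> r")
  case True
  let ?S = "{k\<in>{1..n*n}. ennreal (real k / real n) < g x}"
  have "{k\<in>{1..n*n}. real k / real n < r} \<subseteq> ?S"
    using assms(2) True by (auto intro!: less_le_trans[OF _ assms(2)] simp: ennreal_less_iff)
  then have "real (card {k\<in>{1..n*n}. real k / real n < r}) \<le> real (card ?S)"
    by (intro of_nat_mono card_mono) auto
  moreover have "r * n \<le> real (n * n)" using assms by (simp add: mult_right_mono)
  ultimately have "r * n - 1 \<le> real (card ?S)"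
    using card_levels_bounds(2)[OF True assms(1), of "n*n"] by linarith
  then have "(r * n - 1) / n \<le> real (card ?S) / n" by (rule divide_right_mono) simp
  then show ?thesis using assms(1)
    unfolding level_sum_eq_card[OF assms(1)] by (intro ennreal_leI) (simp add: diff_divide_distrib)
next
  case False
  moreover have "0 \<le> 1 / real n" by simp
  ultimately have "r - 1 / n \<le> 0" by linarith
  then show ?thesis by (simp add: ennreal_neg)
qed

lemma level_sum_integrals:
  assumes \<mu>: "(\<mu>::'a functional) \<in> radon_pos" and g: "lower_semicont g" and n: "0 < n"
  shows "(\<integral>\<^sup>+x. level_sum n g x \<partial>radon_measure \<mu>) = pos_integral \<mu> (level_sum n g)"
    "lower_semicont (level_sum n g)"
proof -
  let ?G = "\<lambda>k. {x. ennreal (real k / real n) < g x}"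
  have c: "0 < 1 / real n" using n by simp
  have G: "open (?G k)" for k by (rule lower_semicontD[OF g])
  have lsc: "lower_semicont (\<lambda>x. ennreal (1 / real n) * indicator (?G k) x)" for k
    by (rule lower_semicont_scale[OF lower_semicont_indicator[OF G] c])
  show "lower_semicont (level_sum n g)" unfolding level_sum_def[abs_def] by (rule lower_semicont_sum[OF lsc])
  have "pos_integral \<mu> (level_sum n g) = (\<Sum>k\<in>{1..n*n}. ennreal (1 / real n) * pos_integral \<mu> (indicator (?G k)))"
    unfolding level_sum_def[abs_def] pos_integral_sum[OF \<mu> lsc] pos_integral_scale[OF \<mu> c] ..
  moreover have "(\<integral>\<^sup>+x. level_sum n g x \<partial>radon_measure \<mu>) =
      (\<Sum>k\<in>{1..n*n}. ennreal (1 / real n) * emeasure (radon_measure \<mu>) (?G k))"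
  proof -
    have "(\<integral>\<^sup>+x. level_sum n g x \<partial>radon_measure \<mu>) =
        (\<Sum>k\<in>{1..n*n}. \<integral>\<^sup>+x. ennreal (1 / real n) * indicator (?G k) x \<partial>radon_measure \<mu>)"
      unfolding level_sum_def
      by (rule nn_integral_sum) (rule lower_semicont_measurable[OF \<mu> lsc])
    then show ?thesis
      unfolding nn_integral_cmult_indicator[OF open_in_sets_radon_measure[OF \<mu> G]] .
  qed
  ultimately show "(\<integral>\<^sup>+x. level_sum n g x \<partial>radon_measure \<mu>) = pos_integral \<mu> (level_sum n g)"
    unfolding emeasure_open_radon_measure[OF \<mu> G] by simp
qed

text \<open>Both integrals agree on level sums, which are finite combinations of indicators of open
  sets. The inequality \<open>\<le>\<close> uses Fatou's lemma, because the level sums are not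
  monotone in \<open>n\<close>; for \<open>\<ge>\<close> the level sums of a continuous minorant
  approximate it uniformly.\<close>

lemma nn_integral_radon_measure:
  assumes \<mu>: "(\<mu>::'a functional) \<in> radon_pos" and g: "lower_semicont g"
  shows "(\<integral>\<^sup>+x. g x \<partial>radon_measure \<mu>) = pos_integral \<mu> g"
proof (rule antisym)
  have "g x \<le> liminf (\<lambda>n. level_sum n g x)" for x
    unfolding le_Liminf_iff
  proof (intro allI impI)
    fix y assume "y < g x"
    then obtain z where z: "y < z" "z < g x" using dense by blast
    then obtain r where r: "z = ennreal r" "0 \<le> r" by (cases z) auto
    obtain s where s: "y = ennreal s" "0 \<le> s" "s < r" using z(1) r by (cases y) (auto simp: ennreal_less_iff)
    obtain N where N: "1 / (r - s) < real N" "r < real N"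
      using reals_Archimedean2[of "max (1 / (r - s)) r"] by auto
    show "\<forall>\<^sub>F n in sequentially. y < level_sum n g x"
      unfolding eventually_sequentially
    proof (intro exI[of _ "Suc N"] allI impI)
      fix n assume n: "Suc N \<le> n"
      then have "1 / (r - s) < real n" using N by simp
      then have "1 / real n < r - s" using s n by (simp add: field_simps)
      then have "y < ennreal (r - 1 / n)" using s by (simp add: ennreal_less_iff)
      also have "\<dots> \<le> level_sum n g x"
        by (rule level_sum_ge) (use n N z r in auto)
      finally show "y < level_sum n g x" .
    qed
  qed
  \<comment> \<open>The index is shifted because the level sums are compared only for a positive
    number of steps.\<close>
  then have "(\<integral>\<^sup>+x. g x \<partial>radon_measure \<mu>) \<le> (\<integral>\<^sup>+x. liminf (\<lambda>n. level_sum (Suc n) g x) \<partial>radon_measure \<mu>)"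
    using liminf_shift[of "\<lambda>n. level_sum n g _"] by (intro nn_integral_mono) (simp add: liminf_shift)
  also have "\<dots> \<le> liminf (\<lambda>n. \<integral>\<^sup>+x. level_sum (Suc n) g x \<partial>radon_measure \<mu>)"
    by (rule nn_integral_liminf) (rule lower_semicont_measurable[OF \<mu> level_sum_integrals(2)[OF \<mu> g]], simp)
  also have "\<dots> \<le> liminf (\<lambda>n. pos_integral \<mu> g)"
    by (rule Liminf_mono)
       (auto simp: level_sum_integrals(1)[OF \<mu> g] intro!: always_eventually pos_integral_mono level_sum_le)
  finally show "(\<integral>\<^sup>+x. g x \<partial>radon_measure \<mu>) \<le> pos_integral \<mu> g" by (simp add: Liminf_const)
next
  show "pos_integral \<mu> g \<le> (\<integral>\<^sup>+x. g x \<partial>radon_measure \<mu>)"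
    unfolding pos_integral_eq
  proof (rule SUP_least)
    fix \<phi> assume "\<phi> \<in> Cc_below g"
    then have \<phi>: "\<phi> \<in> Cc" "\<forall>x. 0 \<le> \<phi> x" "\<forall>x. ennreal (\<phi> x) \<le> g x" by (auto simp: Cc_below_def)
    have lsc: "lower_semicont (\<lambda>x. ennreal (\<phi> x))"
      by (rule lower_semicont_continuous[OF Cc_continuous[OF \<phi>(1)]])
    obtain B where B: "0 < B" "\<forall>x. \<bar>\<phi> x\<bar> \<le> B" by (rule Cc_bounded[OF \<phi>(1)])
    obtain \<eta> where \<eta>: "\<eta> \<in> Cc" "\<forall>x. 0 \<le> \<eta> x" "\<forall>x. \<eta> x \<le> 1" "\<forall>x\<in>supp \<phi>. \<eta> x = 1"
      by (rule cutoff[OF Cc_compact_supp[OF \<phi>(1)]])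
    have \<mu>\<eta>: "0 \<le> \<mu> \<eta>" using radon_pos_nonneg[OF \<mu> \<eta>(1)] \<eta>(2) by simp
    \<comment> \<open>The condition \<open>B \<le> real n\<close> rules out truncation, so that the
      level sum misses \<open>\<phi>\<close> by at most \<open>1 / n\<close>. The cutoff
      \<open>\<eta>\<close> confines this error to a compact set, where its integral tends to
      \<open>0\<close>.\<close>
    have le: "ennreal (\<mu> \<phi>) \<le> (\<integral>\<^sup>+x. g x \<partial>radon_measure \<mu>) + ennreal (1 / real n * \<mu> \<eta>)"
      if n: "0 < n" "B \<le> real n" for n
    proof -
      have "ennreal (\<phi> x) \<le> level_sum n (\<lambda>x. ennreal (\<phi> x)) x + ennreal (1 / real n) * ennreal (\<eta> x)" for x
      proof (cases "x \<in> supp \<phi>")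
        case True
        have "\<phi> x \<le> real n" using B(2)[rule_format, of x] n by linarith
        then have 1: "ennreal (\<phi> x - 1 / real n) \<le> level_sum n (\<lambda>x. ennreal (\<phi> x)) x"
          using level_sum_ge[OF n(1), of "\<phi> x" "\<lambda>x. ennreal (\<phi> x)" x] by simp
        have "ennreal (\<phi> x) \<le> ennreal (\<phi> x - 1 / real n) + ennreal (1 / real n)"
        proof (cases "\<phi> x \<ge> 1 / real n")
          case True then show ?thesis by (subst ennreal_plus[symmetric]) auto
        next
          case False then show ?thesis by (intro add_increasing) (auto intro: ennreal_leI)
        qed
        also have "\<dots> \<le> level_sum n (\<lambda>x. ennreal (\<phi> x)) x + ennreal (1 / real n)"
          by (rule add_right_mono[OF 1])
        finally show ?thesis using True \<eta>(4) by simp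
      next
        case False then show ?thesis by (simp add: not_in_supp[OF False])
      qed
      then have "pos_integral \<mu> (\<lambda>x. ennreal (\<phi> x)) \<le>
          pos_integral \<mu> (\<lambda>x. level_sum n (\<lambda>x. ennreal (\<phi> x)) x + ennreal (1 / real n) * ennreal (\<eta> x))"
        by (rule pos_integral_mono)
      also have "\<dots> = pos_integral \<mu> (level_sum n (\<lambda>x. ennreal (\<phi> x))) + pos_integral \<mu> (\<lambda>x. ennreal (1 / real n) * ennreal (\<eta> x))"
        by (rule pos_integral_add[OF \<mu> level_sum_integrals(2)[OF \<mu> lsc n(1)]
              lower_semicont_scale[OF lower_semicont_continuous[OF Cc_continuous[OF \<eta>(1)]]]]) (use n in simp)
      also have "pos_integral \<mu> (\<lambda>x. ennreal (1 / real n) * ennreal (\<eta> x)) = ennreal (1 / real n) * ennreal (\<mu> \<eta>)"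
        using n pos_integral_scale[OF \<mu>, of "1 / real n" "\<lambda>x. ennreal (\<eta> x)"] pos_integral_Cc[OF \<mu> \<eta>(1)] \<eta>(2) by simp
      also have "pos_integral \<mu> (level_sum n (\<lambda>x. ennreal (\<phi> x))) \<le> (\<integral>\<^sup>+x. g x \<partial>radon_measure \<mu>)"
        unfolding level_sum_integrals(1)[OF \<mu> lsc n(1), symmetric]
        by (intro nn_integral_mono order_trans[OF level_sum_le[OF n(1)]]) (use \<phi>(3) in simp)
      also have "pos_integral \<mu> (\<lambda>x. ennreal (\<phi> x)) = ennreal (\<mu> \<phi>)"
        using pos_integral_Cc[OF \<mu> \<phi>(1)] \<phi>(2) by simp
      finally show ?thesis using ennreal_mult[of "1 / real n" "\<mu> \<eta>"] \<mu>\<eta> by (simp add: add_mono del: times_divide_eq_left)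
    qed
    show "ennreal (\<mu> \<phi>) \<le> (\<integral>\<^sup>+x. g x \<partial>radon_measure \<mu>)"
    proof (rule ennreal_le_epsilon)
      fix e :: real assume e: "0 < e"
      obtain n where n: "max B (max 1 (\<mu> \<eta> / e)) < real n" using reals_Archimedean2 by blast
      then have n': "0 < n" "B \<le> real n" by auto
      have "\<mu> \<eta> / e \<le> real n" using n by simp
      then have "1 / real n * \<mu> \<eta> \<le> e" using e n'(1) by (simp add: field_simps)
      then have "ennreal (1 / real n * \<mu> \<eta>) \<le> ennreal e" by (rule ennreal_leI)
      then show "ennreal (\<mu> \<phi>) \<le> (\<integral>\<^sup>+x. g x \<partial>radon_measure \<mu>) + ennreal e"
        using le[OF n'] add_left_mono order_trans by blast
    qed
  qed
qed

end

section \<open>Sums, multiples and restrictions\<close>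

definition radon_plus :: "'a::topological_space functional \<Rightarrow> 'a functional \<Rightarrow> 'a functional" where
  "radon_plus \<mu> \<nu> = (\<lambda>\<phi>\<in>Cc. \<mu> \<phi> + \<nu> \<phi>)"

definition radon_cmult :: "real \<Rightarrow> 'a::topological_space functional \<Rightarrow> 'a functional" where
  "radon_cmult c \<mu> = (\<lambda>\<phi>\<in>Cc. c * \<mu> \<phi>)"

text \<open>The measure \<open>1_B \<mu>\<close> as a functional. Integration over the complete
  measure admits every measurable \<open>B\<close>, in particular sets such as
  \<open>{x. v x < u x}\<close> on which potentials are compared.\<close>

definition radon_restrict :: "'a::topological_space functional \<Rightarrow> 'a set \<Rightarrow> 'a functional" where
  "radon_restrict \<mu> B = (\<lambda>\<phi>\<in>Cc. LINT x|radon_measure \<mu>. indicator B x * \<phi> x)"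

lemma radon_eqI: "\<mu> \<in> radon \<Longrightarrow> \<nu> \<in> radon \<Longrightarrow> (\<And>\<phi>. \<phi> \<in> Cc \<Longrightarrow> \<mu> \<phi> = \<nu> \<phi>) \<Longrightarrow> \<mu> = \<nu>"
  by (rule extensionalityI[of _ Cc]) (auto simp: radon_def)

context lch_space
begin

text \<open>Local boundedness is automatic for positive functionals: a function supported in
  \<open>K\<close> lies between \<open>- s * \<eta>\<close> and \<open>s * \<eta>\<close>, where
  \<open>s\<close> is its supremum norm and \<open>\<eta>\<close> a cutoff for
  \<open>K\<close>.\<close>

lemma radon_posI:
  fixes \<mu> :: "'a functional"
  assumes ext: "\<mu> \<in> extensional Cc"
    and add: "\<And>\<phi> \<psi>. \<phi> \<in> Cc \<Longrightarrow> \<psi> \<in> Cc \<Longrightarrow> \<mu> (\<lambda>x. \<phi> x + \<psi> x) = \<mu> \<phi> + \<mu> \<psi>"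
    and scale: "\<And>c \<phi>. \<phi> \<in> Cc \<Longrightarrow> \<mu> (\<lambda>x. c * \<phi> x) = c * \<mu> \<phi>"
    and nonneg: "\<And>\<phi>. \<phi> \<in> Cc \<Longrightarrow> \<forall>x. 0 \<le> \<phi> x \<Longrightarrow> 0 \<le> \<mu> \<phi>"
  shows "\<mu> \<in> radon_pos"
proof -
  have "\<exists>M. \<forall>\<phi>\<in>Cc. supp \<phi> \<subseteq> K \<longrightarrow> \<bar>\<mu> \<phi>\<bar> \<le> M * (SUP x. \<bar>\<phi> x\<bar>)" if K: "compact K" for K
  proof -
    obtain \<eta> where \<eta>: "\<eta> \<in> Cc" "\<forall>x. 0 \<le> \<eta> x" "\<forall>x. \<eta> x \<le> 1" "\<forall>x\<in>K. \<eta> x = 1" by (rule cutoff[OF K])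
    have "\<bar>\<mu> \<phi>\<bar> \<le> \<mu> \<eta> * (SUP x. \<bar>\<phi> x\<bar>)" if \<phi>: "\<phi> \<in> Cc" "supp \<phi> \<subseteq> K" for \<phi>
    proof -
      let ?s = "SUP x. \<bar>\<phi> x\<bar>"
      obtain B where B: "0 < B" "\<forall>x. \<bar>\<phi> x\<bar> \<le> B" by (rule Cc_bounded[OF \<phi>(1)])
      have s: "\<bar>\<phi> x\<bar> \<le> ?s" for x by (rule cSUP_upper) (use B in \<open>auto intro!: bdd_aboveI2\<close>)
      have le: "\<bar>\<phi> x\<bar> \<le> ?s * \<eta> x" for x
        using s[of x] \<eta>(4) \<phi>(2) not_in_supp[of x \<phi>] \<eta>(2) order_trans[OF abs_ge_zero s[of x]]
        by (cases "x \<in> supp \<phi>") auto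
      have sCc: "(\<lambda>x. ?s * \<eta> x) \<in> Cc" by (rule Cc_scale[OF \<eta>(1)])
      have "0 \<le> \<mu> (\<lambda>x. ?s * \<eta> x + \<phi> x)"
        by (rule nonneg[OF Cc_add[OF sCc \<phi>(1)]]) (use le abs_le_iff in \<open>smt (verit)\<close>)
      moreover have "0 \<le> \<mu> (\<lambda>x. ?s * \<eta> x + (-1) * \<phi> x)"
        by (rule nonneg[OF Cc_add[OF sCc Cc_scale[OF \<phi>(1)]]]) (use le abs_le_iff in \<open>smt (verit)\<close>)
      ultimately show ?thesis
        using add[OF sCc \<phi>(1)] add[OF sCc Cc_scale[OF \<phi>(1), of "-1"]] scale[OF \<eta>(1), of ?s] scale[OF \<phi>(1), of "-1"]
        by (simp add: mult.commute abs_le_iff)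
    qed
    then show ?thesis by blast
  qed
  then show ?thesis using assms by (simp add: radon_pos_def radon_def)
qed

lemma radon_plus_pos:
  assumes "(\<mu>::'a functional) \<in> radon_pos" "\<nu> \<in> radon_pos" shows "radon_plus \<mu> \<nu> \<in> radon_pos"
proof (rule radon_posI)
  note m = radon_pos_radon[OF assms(1)] and n = radon_pos_radon[OF assms(2)]
  show "radon_plus \<mu> \<nu> \<in> extensional Cc" by (simp add: radon_plus_def)
  show "radon_plus \<mu> \<nu> (\<lambda>x. \<phi> x + \<psi> x) = radon_plus \<mu> \<nu> \<phi> + radon_plus \<mu> \<nu> \<psi>" if "\<phi> \<in> Cc" "\<psi> \<in> Cc" for \<phi> \<psi>
    using that by (simp add: radon_plus_def Cc_add radon_add[OF m that] radon_add[OF n that])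
  show "radon_plus \<mu> \<nu> (\<lambda>x. c * \<phi> x) = c * radon_plus \<mu> \<nu> \<phi>" if "\<phi> \<in> Cc" for c \<phi>
    using that by (simp add: radon_plus_def Cc_scale radon_scale[OF m that] radon_scale[OF n that] distrib_left)
  show "0 \<le> radon_plus \<mu> \<nu> \<phi>" if "\<phi> \<in> Cc" "\<forall>x. 0 \<le> \<phi> x" for \<phi>
    using that radon_pos_nonneg[OF assms(1), of \<phi>] radon_pos_nonneg[OF assms(2), of \<phi>] by (simp add: radon_plus_def)
qed

lemma radon_cmult_pos:
  assumes "(\<mu>::'a functional) \<in> radon_pos" "0 \<le> c" shows "radon_cmult c \<mu> \<in> radon_pos"
proof (rule radon_posI)
  note m = radon_pos_radon[OF assms(1)]
  show "radon_cmult c \<mu> \<in> extensional Cc" by (simp add: radon_cmult_def)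
  show "radon_cmult c \<mu> (\<lambda>x. \<phi> x + \<psi> x) = radon_cmult c \<mu> \<phi> + radon_cmult c \<mu> \<psi>" if "\<phi> \<in> Cc" "\<psi> \<in> Cc" for \<phi> \<psi>
    using that by (simp add: radon_cmult_def Cc_add radon_add[OF m that] distrib_left)
  show "radon_cmult c \<mu> (\<lambda>x. d * \<phi> x) = d * radon_cmult c \<mu> \<phi>" if "\<phi> \<in> Cc" for d \<phi>
    using that by (simp add: radon_cmult_def Cc_scale radon_scale[OF m that])
  show "0 \<le> radon_cmult c \<mu> \<phi>" if "\<phi> \<in> Cc" "\<forall>x. 0 \<le> \<phi> x" for \<phi>
    using that radon_pos_nonneg[OF assms(1), of \<phi>] assms(2) by (simp add: radon_cmult_def)
qed

lemma radon_zero_pos: "(radon_zero :: 'a functional) \<in> radon_pos"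
  by (rule radon_posI) (auto simp: radon_zero_def Cc_add Cc_scale)

lemma pos_integral_mono_functional:
  assumes "\<And>\<phi>. \<phi> \<in> Cc \<Longrightarrow> \<forall>x. 0 \<le> \<phi> x \<Longrightarrow> \<mu> \<phi> \<le> \<nu> \<phi>"
  shows "pos_integral \<mu> g \<le> pos_integral \<nu> g"
  unfolding pos_integral_eq
proof (rule SUP_least)
  fix \<phi> assume p: "\<phi> \<in> Cc_below g"
  then have "\<mu> \<phi> \<le> \<nu> \<phi>" using assms[of \<phi>] by (auto simp: Cc_below_def)
  then show "ennreal (\<mu> \<phi>) \<le> (SUP \<phi>\<in>Cc_below g. ennreal (\<nu> \<phi>))"
    by (intro SUP_upper2[OF p] ennreal_leI)
qed

text \<open>The minorants of \<open>g\<close> are closed under maxima, so one minorant can serve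
  both measures at once.\<close>

lemma pos_integral_radon_plus:
  assumes \<mu>: "(\<mu>::'a functional) \<in> radon_pos" and \<nu>: "\<nu> \<in> radon_pos"
  shows "pos_integral (radon_plus \<mu> \<nu>) g = pos_integral \<mu> g + pos_integral \<nu> g"
proof -
  have ne: "Cc_below g \<noteq> {}" using Cc_below_zero by blast
  have Cc: "\<phi> \<in> Cc" "\<And>x. 0 \<le> \<phi> x" if "\<phi> \<in> Cc_below g" for \<phi> using that by (auto simp: Cc_below_def)
  have eq: "ennreal (radon_plus \<mu> \<nu> \<phi>) = ennreal (\<mu> \<phi>) + ennreal (\<nu> \<phi>)" if "\<phi> \<in> Cc_below g" for \<phi>
    using Cc[OF that] radon_pos_nonneg[OF \<mu> Cc[OF that]] radon_pos_nonneg[OF \<nu> Cc[OF that]]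
    by (simp add: radon_plus_def)
  show ?thesis
  proof (rule antisym)
    show "pos_integral (radon_plus \<mu> \<nu>) g \<le> pos_integral \<mu> g + pos_integral \<nu> g"
      unfolding pos_integral_eq[of "radon_plus \<mu> \<nu>"]
      by (rule SUP_least) (simp add: eq add_mono pos_integral_upper)
    show "pos_integral \<mu> g + pos_integral \<nu> g \<le> pos_integral (radon_plus \<mu> \<nu>) g"
      unfolding pos_integral_eq[of \<mu>] pos_integral_eq[of \<nu>] ennreal_SUP_add_SUP[OF ne ne]
    proof (rule SUP_least)
      fix p assume "p \<in> Cc_below g \<times> Cc_below g"
      then have p: "fst p \<in> Cc_below g" "snd p \<in> Cc_below g" by auto
      let ?m = "\<lambda>x. max (fst p x) (snd p x)"
      have m: "?m \<in> Cc_below g" by (rule Cc_below_max[OF p])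
      have "\<mu> (fst p) \<le> \<mu> ?m" by (rule radon_pos_mono[OF \<mu> Cc(1)[OF p(1)] Cc(1)[OF m]]) simp
      moreover have "\<nu> (snd p) \<le> \<nu> ?m" by (rule radon_pos_mono[OF \<nu> Cc(1)[OF p(2)] Cc(1)[OF m]]) simp
      ultimately have "ennreal (\<mu> (fst p)) + ennreal (\<nu> (snd p)) \<le> ennreal (radon_plus \<mu> \<nu> ?m)"
        unfolding eq[OF m] by (intro add_mono ennreal_leI)
      then show "ennreal (\<mu> (fst p)) + ennreal (\<nu> (snd p)) \<le> pos_integral (radon_plus \<mu> \<nu>) g"
        by (rule order_trans) (rule pos_integral_upper[OF m])
    qed
  qed
qed

lemma pos_integral_radon_cmult:
  assumes \<mu>: "(\<mu>::'a functional) \<in> radon_pos" and c: "0 \<le> c"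
  shows "pos_integral (radon_cmult c \<mu>) g = ennreal c * pos_integral \<mu> g"
proof -
  have "ennreal (radon_cmult c \<mu> \<phi>) = ennreal c * ennreal (\<mu> \<phi>)" if "\<phi> \<in> Cc_below g" for \<phi>
    using that c by (simp add: Cc_below_def radon_cmult_def ennreal_mult')
  then have "(SUP \<phi>\<in>Cc_below g. ennreal (radon_cmult c \<mu> \<phi>)) = (SUP \<phi>\<in>Cc_below g. ennreal c * ennreal (\<mu> \<phi>))"
    by (rule SUP_cong[OF refl])
  then show ?thesis unfolding pos_integral_eq SUP_mult_left_ennreal .
qed

section \<open>Integration of continuous functions and restriction to measurable sets\<close>

lemma compact_in_sets_radon_measure:
  assumes "(\<mu>::'a functional) \<in> radon_pos" "compact K" shows "K \<in> sets (radon_measure \<mu>)"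
  using borel_in_sets_radon_measure[OF assms(1)] borel_closed[OF compact_imp_closed[OF assms(2)]] by blast

lemma emeasure_compact_le:
  assumes \<mu>: "(\<mu>::'a functional) \<in> radon_pos" and K: "compact K"
    and \<eta>: "\<eta> \<in> Cc" "\<forall>x. 0 \<le> \<eta> x" "\<forall>x\<in>K. 1 \<le> \<eta> x"
  shows "emeasure (radon_measure \<mu>) K \<le> ennreal (\<mu> \<eta>)"
proof -
  have lsc: "lower_semicont (\<lambda>x. ennreal (\<eta> x))"
    by (rule lower_semicont_continuous[OF Cc_continuous[OF \<eta>(1)]])
  have "emeasure (radon_measure \<mu>) K = (\<integral>\<^sup>+x. indicator K x \<partial>radon_measure \<mu>)"
    using compact_in_sets_radon_measure[OF \<mu> K] by simp
  also have "\<dots> \<le> (\<integral>\<^sup>+x. ennreal (\<eta> x) \<partial>radon_measure \<mu>)"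
  proof (rule nn_integral_mono)
    fix x show "indicator K x \<le> ennreal (\<eta> x)"
      using \<eta>(3) by (cases "x \<in> K") (auto intro: order_trans[OF _ ennreal_leI[of 1]])
  qed
  also have "\<dots> = ennreal (\<mu> \<eta>)"
    using nn_integral_radon_measure[OF \<mu> lsc] pos_integral_Cc[OF \<mu> \<eta>(1)] \<eta>(2) by simp
  finally show ?thesis .
qed

lemma emeasure_compact_finite:
  assumes \<mu>: "(\<mu>::'a functional) \<in> radon_pos" and K: "compact K"
  shows "emeasure (radon_measure \<mu>) K < \<infinity>"
proof -
  obtain \<eta> where \<eta>: "\<eta> \<in> Cc" "\<forall>x. 0 \<le> \<eta> x" "\<forall>x. \<eta> x \<le> 1" "\<forall>x\<in>K. \<eta> x = 1" by (rule cutoff[OF K])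
  have "emeasure (radon_measure \<mu>) K \<le> ennreal (\<mu> \<eta>)" by (rule emeasure_compact_le[OF \<mu> K \<eta>(1,2)]) (use \<eta>(4) in simp)
  then show ?thesis by (rule order_le_less_trans) simp
qed

lemma has_integral_Cc:
  assumes \<mu>: "(\<mu>::'a functional) \<in> radon_pos" and \<phi>: "\<phi> \<in> Cc"
  shows "has_bochner_integral (radon_measure \<mu>) \<phi> (\<mu> \<phi>)"
proof -
  have pos: "has_bochner_integral (radon_measure \<mu>) \<psi> (\<mu> \<psi>)" if \<psi>: "\<psi> \<in> Cc" "\<forall>x. 0 \<le> \<psi> x" for \<psi>
  proof (rule has_bochner_integral_nn_integral)
    have c: "continuous_on UNIV \<psi>" by (rule Cc_continuous[OF \<psi>(1)])
    show "\<psi> \<in> borel_measurable (radon_measure \<mu>)"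
      by (rule borel_measurable_radon_measure[OF \<mu> borel_measurable_continuous_onI[OF c]])
    show "AE x in radon_measure \<mu>. 0 \<le> \<psi> x" using \<psi>(2) by simp
    show "0 \<le> \<mu> \<psi>" using radon_pos_nonneg[OF \<mu> \<psi>(1)] \<psi>(2) by simp
    show "(\<integral>\<^sup>+x. ennreal (\<psi> x) \<partial>radon_measure \<mu>) = ennreal (\<mu> \<psi>)"
      using nn_integral_radon_measure[OF \<mu> lower_semicont_continuous[OF c]] pos_integral_Cc[OF \<mu> \<psi>(1)] \<psi>(2) by simp
  qed
  let ?p = "\<lambda>x. max 0 (\<phi> x)" and ?n = "\<lambda>x. max 0 (- \<phi> x)"
  have p: "?p \<in> Cc" "?n \<in> Cc" by (rule Cc_max[OF Cc_zero \<phi>], rule Cc_max[OF Cc_zero Cc_minus[OF \<phi>]])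
  have eq: "\<phi> = (\<lambda>x. ?p x - ?n x)" by (auto simp: fun_eq_iff max_def)
  have "has_bochner_integral (radon_measure \<mu>) (\<lambda>x. ?p x - ?n x) (\<mu> ?p - \<mu> ?n)"
    by (rule has_bochner_integral_diff[OF pos[OF p(1)] pos[OF p(2)]]) auto
  then show ?thesis using radon_diff_arg[OF radon_pos_radon[OF \<mu>] p] eq by simp
qed

lemma integral_Cc: "(\<mu>::'a functional) \<in> radon_pos \<Longrightarrow> \<phi> \<in> Cc \<Longrightarrow> (LINT x|radon_measure \<mu>. \<phi> x) = \<mu> \<phi>"
  using has_integral_Cc has_bochner_integral_integral_eq by blast

lemma integrable_restrict:
  assumes "(\<mu>::'a functional) \<in> radon_pos" "\<phi> \<in> Cc" "B \<in> sets (radon_measure \<mu>)"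
  shows "integrable (radon_measure \<mu>) (\<lambda>x. indicator B x * \<phi> x :: real)"
  using integrable_mult_indicator[OF assms(3) integrable.intros[OF has_integral_Cc[OF assms(1,2)]]] by simp

lemma radon_restrict_pos:
  assumes \<mu>: "(\<mu>::'a functional) \<in> radon_pos" and B: "B \<in> sets (radon_measure \<mu>)"
  shows "radon_restrict \<mu> B \<in> radon_pos"
proof (rule radon_posI)
  show "radon_restrict \<mu> B \<in> extensional Cc" by (simp add: radon_restrict_def)
  show "radon_restrict \<mu> B (\<lambda>x. \<phi> x + \<psi> x) = radon_restrict \<mu> B \<phi> + radon_restrict \<mu> B \<psi>"
    if "\<phi> \<in> Cc" "\<psi> \<in> Cc" for \<phi> \<psi>
    using that integrable_restrict[OF \<mu> that(1) B] integrable_restrict[OF \<mu> that(2) B]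
    by (simp add: radon_restrict_def Cc_add distrib_left)
  show "radon_restrict \<mu> B (\<lambda>x. c * \<phi> x) = c * radon_restrict \<mu> B \<phi>" if "\<phi> \<in> Cc" for c \<phi>
    using that by (simp add: radon_restrict_def Cc_scale mult.left_commute[of _ c])
  show "0 \<le> radon_restrict \<mu> B \<phi>" if "\<phi> \<in> Cc" "\<forall>x. 0 \<le> \<phi> x" for \<phi>
    using that by (auto simp: radon_restrict_def intro!: integral_nonneg_AE)
qed

lemma radon_restrict_plus_compl:
  assumes \<mu>: "(\<mu>::'a functional) \<in> radon_pos" and B: "B \<in> sets (radon_measure \<mu>)"
  shows "radon_plus (radon_restrict \<mu> B) (radon_restrict \<mu> (-B)) = \<mu>"
proof (rule radon_eqI)
  have B': "-B \<in> sets (radon_measure \<mu>)" using sets.compl_sets[OF B] by (simp add: Compl_eq_Diff_UNIV)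
  show "radon_plus (radon_restrict \<mu> B) (radon_restrict \<mu> (-B)) \<in> radon"
    by (intro radon_pos_radon radon_plus_pos radon_restrict_pos \<mu> B B')
  show "\<mu> \<in> radon" by (rule radon_pos_radon[OF \<mu>])
  fix \<phi> :: "'a \<Rightarrow> real" assume \<phi>: "\<phi> \<in> Cc"
  have "(LINT x|radon_measure \<mu>. indicator B x * \<phi> x) + (LINT x|radon_measure \<mu>. indicator (-B) x * \<phi> x) =
      (LINT x|radon_measure \<mu>. indicator B x * \<phi> x + indicator (-B) x * \<phi> x)"
    by (rule Bochner_Integration.integral_add[symmetric, OF integrable_restrict[OF \<mu> \<phi> B] integrable_restrict[OF \<mu> \<phi> B']])
  also have "\<dots> = (LINT x|radon_measure \<mu>. \<phi> x)"
    by (rule Bochner_Integration.integral_cong) (auto simp: indicator_def)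
  finally show "radon_plus (radon_restrict \<mu> B) (radon_restrict \<mu> (-B)) \<phi> = \<mu> \<phi>"
    using \<phi> integral_Cc[OF \<mu> \<phi>] by (simp add: radon_plus_def radon_restrict_def)
qed

lemma radon_restrict_le:
  assumes \<mu>: "(\<mu>::'a functional) \<in> radon_pos" and B: "B \<in> sets (radon_measure \<mu>)"
    and \<phi>: "\<phi> \<in> Cc" "\<forall>x. 0 \<le> \<phi> x"
  shows "radon_restrict \<mu> B \<phi> \<le> \<mu> \<phi>"
proof -
  have B': "-B \<in> sets (radon_measure \<mu>)" using sets.compl_sets[OF B] by (simp add: Compl_eq_Diff_UNIV)
  have "radon_plus (radon_restrict \<mu> B) (radon_restrict \<mu> (-B)) \<phi> = \<mu> \<phi>"
    using radon_restrict_plus_compl[OF \<mu> B] by simp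
  then show ?thesis
    using \<phi> radon_pos_nonneg[OF radon_restrict_pos[OF \<mu> B'] \<phi>(1)] by (simp add: radon_plus_def)
qed

lemma pos_integral_restrict_le:
  assumes \<mu>: "(\<mu>::'a functional) \<in> radon_pos" and B: "B \<in> sets (radon_measure \<mu>)"
  shows "pos_integral (radon_restrict \<mu> B) g \<le> (\<integral>\<^sup>+x. g x * indicator B x \<partial>radon_measure \<mu>)"
  unfolding pos_integral_eq
proof (rule SUP_least)
  fix \<phi> assume "\<phi> \<in> Cc_below g"
  then have \<phi>: "\<phi> \<in> Cc" "\<forall>x. 0 \<le> \<phi> x" "\<forall>x. ennreal (\<phi> x) \<le> g x" by (auto simp: Cc_below_def)
  have "ennreal (radon_restrict \<mu> B \<phi>) = (\<integral>\<^sup>+x. ennreal (indicator B x * \<phi> x) \<partial>radon_measure \<mu>)"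
    using \<phi>(1,2) nn_integral_eq_integral[OF integrable_restrict[OF \<mu> \<phi>(1) B]] by (simp add: radon_restrict_def)
  also have "\<dots> \<le> (\<integral>\<^sup>+x. g x * indicator B x \<partial>radon_measure \<mu>)"
    using \<phi>(3) by (intro nn_integral_mono) (auto simp: indicator_def)
  finally show "ennreal (radon_restrict \<mu> B \<phi>) \<le> (\<integral>\<^sup>+x. g x * indicator B x \<partial>radon_measure \<mu>)" .
qed

text \<open>The inequality \<open>\<le>\<close> holds for \<open>B\<close> and for its complement.
  The two sides have the same finite sum over these two sets, so both inequalities are
  equalities.\<close>

lemma pos_integral_restrict:
  assumes \<mu>: "(\<mu>::'a functional) \<in> radon_pos" and B: "B \<in> sets (radon_measure \<mu>)"
    and g: "lower_semicont g" and fin: "pos_integral \<mu> g < \<infinity>"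
  shows "pos_integral (radon_restrict \<mu> B) g = (\<integral>\<^sup>+x. g x * indicator B x \<partial>radon_measure \<mu>)"
proof -
  have B': "-B \<in> sets (radon_measure \<mu>)" using sets.compl_sets[OF B] by (simp add: Compl_eq_Diff_UNIV)
  let ?a = "pos_integral (radon_restrict \<mu> B) g" and ?b = "pos_integral (radon_restrict \<mu> (-B)) g"
  let ?A = "\<integral>\<^sup>+x. g x * indicator B x \<partial>radon_measure \<mu>" and ?B = "\<integral>\<^sup>+x. g x * indicator (-B) x \<partial>radon_measure \<mu>"
  have gm: "g \<in> borel_measurable (radon_measure \<mu>)" by (rule lower_semicont_measurable[OF \<mu> g])
  have "pos_integral \<mu> g = ?a + ?b"
    using pos_integral_radon_plus[OF radon_restrict_pos[OF \<mu> B] radon_restrict_pos[OF \<mu> B'], of g]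
      radon_restrict_plus_compl[OF \<mu> B] by simp
  moreover have "pos_integral \<mu> g = ?A + ?B"
  proof -
    have "pos_integral \<mu> g = (\<integral>\<^sup>+x. g x * indicator B x + g x * indicator (-B) x \<partial>radon_measure \<mu>)"
      unfolding nn_integral_radon_measure[OF \<mu> g, symmetric]
      by (rule nn_integral_cong) (auto simp: indicator_def)
    then show ?thesis using gm B B' by (simp add: nn_integral_add)
  qed
  moreover have "?a \<le> ?A" "?b \<le> ?B" by (rule pos_integral_restrict_le[OF \<mu> B], rule pos_integral_restrict_le[OF \<mu> B'])
  moreover have "?A \<noteq> \<infinity>" "?B \<noteq> \<infinity>" using fin calculation(2) by auto
  ultimately show ?thesis
    by (cases ?a; cases ?b; cases ?A; cases ?B) (auto simp flip: ennreal_plus)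
qed

section \<open>Regularity and carriers\<close>

text \<open>The open set need not be sigma-compact, but a continuous minorant of its indicator lives
  on the countable union of the compact sets \<open>{x. 1 / real (Suc n) \<le> \<phi> x}\<close>,
  each contained in \<open>G\<close>.\<close>

lemma open_null_if_compacts_null:
  assumes \<mu>: "(\<mu>::'a functional) \<in> radon_pos" and G: "open G"
    and null: "\<And>C. compact C \<Longrightarrow> C \<subseteq> G \<Longrightarrow> emeasure (radon_measure \<mu>) C = 0"
  shows "emeasure (radon_measure \<mu>) G = 0"
proof -
  have "ennreal (\<mu> \<phi>) = 0" if "\<phi> \<in> Cc_below (indicator G)" for \<phi>
  proof -
    have \<phi>: "\<phi> \<in> Cc" "\<forall>x. 0 \<le> \<phi> x" "\<forall>x. ennreal (\<phi> x) \<le> indicator G x" using that by (auto simp: Cc_below_def)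
    have c: "continuous_on UNIV \<phi>" by (rule Cc_continuous[OF \<phi>(1)])
    have C: "compact {x. 1 / real (Suc n) \<le> \<phi> x}" "{x. 1 / real (Suc n) \<le> \<phi> x} \<subseteq> G" for n
    proof -
      have "closed {x. 1 / real (Suc n) \<le> \<phi> x}" by (intro closed_Collect_le continuous_intros c)
      moreover have pos: "0 < \<phi> x" if "1 / real (Suc n) \<le> \<phi> x" for x
        using that by (meson less_le_trans of_nat_0_less_iff zero_less_Suc zero_less_divide_1_iff)
      then have "{x. 1 / real (Suc n) \<le> \<phi> x} \<subseteq> supp \<phi>" using not_in_supp[of _ \<phi>] by force
      ultimately show "compact {x. 1 / real (Suc n) \<le> \<phi> x}"
        using compact_Int_closed[OF Cc_compact_supp[OF \<phi>(1)]] by (metis inf.absorb2)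
      show "{x. 1 / real (Suc n) \<le> \<phi> x} \<subseteq> G"
      proof
        fix x assume "x \<in> {x. 1 / real (Suc n) \<le> \<phi> x}"
        then have "0 < \<phi> x" using pos by blast
        then show "x \<in> G" using \<phi>(3)[rule_format, of x] by (cases "x \<in> G") auto
      qed
    qed
    have "{x. 1 / real (Suc n) \<le> \<phi> x} \<in> null_sets (radon_measure \<mu>)" for n
      using null[OF C] compact_in_sets_radon_measure[OF \<mu> C(1)] by auto
    then have "(\<Union>n. {x. 1 / real (Suc n) \<le> \<phi> x}) \<in> null_sets (radon_measure \<mu>)" by (rule null_sets_UN)
    then have "AE x in radon_measure \<mu>. \<phi> x = 0"
    proof (rule AE_I')
      show "{x \<in> space (radon_measure \<mu>). \<phi> x \<noteq> 0} \<subseteq> (\<Union>n. {x. 1 / real (Suc n) \<le> \<phi> x})"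
      proof
        fix x assume "x \<in> {x \<in> space (radon_measure \<mu>). \<phi> x \<noteq> 0}"
        then have "0 < \<phi> x" using \<phi>(2)[rule_format, of x] by simp
        then obtain n where "inverse (real (Suc n)) < \<phi> x" using reals_Archimedean by blast
        then show "x \<in> (\<Union>n. {x. 1 / real (Suc n) \<le> \<phi> x})" by (auto simp: inverse_eq_divide intro: less_imp_le)
      qed
    qed
    then have "(LINT x|radon_measure \<mu>. \<phi> x) = 0" by (rule integral_eq_zero_AE)
    then show ?thesis using integral_Cc[OF \<mu> \<phi>(1)] by simp
  qed
  then show ?thesis
    unfolding emeasure_open_radon_measure[OF \<mu> G] pos_integral_eq
    using SUP_least[of "Cc_below (indicator G)" "\<lambda>\<phi>. ennreal (\<mu> \<phi>)" 0] by (simp add: le_zero_eq)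
qed

text \<open>A lower semicontinuous majorant \<open>g\<close> of the indicator of \<open>S\<close> is
  at least \<open>1\<close> on \<open>S\<close>, so the open set where \<open>g\<close> exceeds
  \<open>1 / t\<close> contains \<open>S\<close> and has measure at most \<open>t\<close> times the
  integral of \<open>g\<close>.\<close>

lemma outer_regular:
  assumes \<mu>: "(\<mu>::'a functional) \<in> radon_pos" and S: "S \<in> sets (radon_measure \<mu>)"
    and a: "emeasure (radon_measure \<mu>) S < a"
  obtains V where "open V" "S \<subseteq> V" "emeasure (radon_measure \<mu>) V \<le> a"
proof -
  have "upper_integral \<mu> (indicator S) < a" using a emeasure_radon_measure[OF \<mu> S] by (simp add: radon_outer_def)
  then obtain g where g: "lower_semicont g" "\<forall>x. indicator S x \<le> g x" "pos_integral \<mu> g < a"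
    unfolding upper_integral_def INF_less_iff by blast
  obtain t where t: "1 < t" "ennreal t * pos_integral \<mu> g \<le> a"
  proof (cases a)
    case (real r)
    obtain p where p: "pos_integral \<mu> g = ennreal p" "0 \<le> p" "p < r"
      using g(3) real by (cases "pos_integral \<mu> g") (auto simp: ennreal_less_iff)
    \<comment> \<open>Chosen above \<open>1\<close> with \<open>?t * p \<le> r\<close>: the increase
      is \<open>(r - p) * (p / (p + 1))\<close>, at most the room \<open>r - p\<close>. The
      denominator \<open>p + 1\<close> covers \<open>p = 0\<close>.\<close>
    let ?t = "1 + (r - p) / (p + 1)"
    have "?t * p = p + (r - p) * (p / (p + 1))" using p by (simp add: field_simps)
    also have "\<dots> \<le> p + (r - p) * 1" by (intro add_left_mono mult_left_mono) (use p in auto)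
    finally have "?t * p \<le> r" by simp
    moreover have "0 \<le> ?t" using p by simp
    ultimately have "ennreal ?t * ennreal p \<le> ennreal r"
      unfolding ennreal_mult[OF \<open>0 \<le> ?t\<close> p(2), symmetric] by (intro ennreal_leI)
    moreover have "1 < ?t" using p by simp
    ultimately show ?thesis using that[of ?t] p(1) real by simp
  next
    case top then show ?thesis using that[of 2] by simp
  qed
  define V where "V = {x. ennreal (1 / t) < g x}"
  have V: "open V" unfolding V_def by (rule lower_semicontD[OF g(1)])
  have t0: "0 < t" using t by simp
  have "indicator V x \<le> ennreal t * g x" for x
  proof (cases "x \<in> V")
    case True
    then have "ennreal (1 / t) \<le> g x" by (simp add: V_def)
    then have "ennreal t * ennreal (1 / t) \<le> ennreal t * g x" by (rule mult_left_mono) simp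
    moreover have "ennreal t * ennreal (1 / t) = 1" using t0 by (simp add: ennreal_mult[symmetric])
    ultimately show ?thesis using True by simp
  qed simp
  then have "pos_integral \<mu> (indicator V) \<le> pos_integral \<mu> (\<lambda>x. ennreal t * g x)" by (rule pos_integral_mono)
  then have "emeasure (radon_measure \<mu>) V \<le> a"
    unfolding emeasure_open_radon_measure[OF \<mu> V] pos_integral_scale[OF \<mu> t0] using t(2) by (rule order_trans)
  moreover have "S \<subseteq> V"
  proof
    fix x assume "x \<in> S"
    then have "1 \<le> g x" using g(2)[rule_format, of x] by simp
    moreover have "ennreal (1 / t) < ennreal 1" by (rule ennreal_lessI) (use t in auto)
    ultimately have "ennreal (1 / t) < g x" by (metis ennreal_1 less_le_trans)
    then show "x \<in> V" by (simp add: V_def)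
  qed
  ultimately show ?thesis using that V by blast
qed

text \<open>Inside a compact \<open>C\<close> the measure is finite, so inner regularity follows
  from outer regularity of \<open>C - B\<close>: the compact set is what an open neighbourhood of
  \<open>C - B\<close> leaves of \<open>C\<close>.\<close>

lemma inner_regular:
  assumes \<mu>: "(\<mu>::'a functional) \<in> radon_pos" and B: "B \<in> sets (radon_measure \<mu>)"
    and C: "compact C" "B \<subseteq> C" and e: "0 < e"
  obtains K where "compact K" "K \<subseteq> B" "emeasure (radon_measure \<mu>) (B - K) \<le> ennreal e"
proof -
  let ?M = "radon_measure \<mu>"
  have Cs: "C \<in> sets ?M" by (rule compact_in_sets_radon_measure[OF \<mu> C(1)])
  have D: "C - B \<in> sets ?M" using Cs B by blast
  have "emeasure ?M (C - B) \<le> emeasure ?M C" by (rule emeasure_mono[OF _ Cs]) blast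
  then have fin: "emeasure ?M (C - B) < \<infinity>" by (rule order_le_less_trans[OF _ emeasure_compact_finite[OF \<mu> C(1)]])
  then have "emeasure ?M (C - B) < emeasure ?M (C - B) + ennreal e"
    using e by (cases "emeasure ?M (C - B)") (auto simp: ennreal_less_iff simp flip: ennreal_plus)
  then obtain V where V: "open V" "C - B \<subseteq> V" "emeasure ?M V \<le> emeasure ?M (C - B) + ennreal e"
    by (rule outer_regular[OF \<mu> D])
  have Vs: "V \<in> sets ?M" by (rule open_in_sets_radon_measure[OF \<mu> V(1)])
  have "emeasure ?M (B \<inter> V) + emeasure ?M (C - B) = emeasure ?M ((B \<inter> V) \<union> (C - B))"
    by (rule plus_emeasure) (use B Vs D in auto)
  also have "\<dots> \<le> emeasure ?M V" by (rule emeasure_mono[OF _ Vs]) (use V(2) in blast)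
  also have "\<dots> \<le> ennreal e + emeasure ?M (C - B)" using V(3) by (simp add: add.commute)
  finally have "emeasure ?M (B \<inter> V) \<le> ennreal e"
    using fin by (auto simp: add.commute[of _ "emeasure ?M (C - B)"] ennreal_add_left_cancel_le)
  moreover have "B - (C - V) = B \<inter> V" using C(2) by blast
  moreover have "compact (C - V)" using C(1) V(1) by (rule compact_diff)
  ultimately show ?thesis using that[of "C - V"] V(2) by auto
qed

text \<open>A locally negligible set need not have measure zero in general. For open sets it does,
  because their measure is determined by compact subsets.\<close>

lemma null_compl_of_radon_pos_on:
  assumes \<mu>: "\<mu> \<in> radon_pos_on K" and K: "closed (K::'a set)"
  shows "emeasure (radon_measure \<mu>) (-K) = 0"
proof -
  have m: "\<mu> \<in> radon_pos" "locally_negligible_for \<mu> (-K)" using \<mu> by (auto simp: radon_pos_on_def)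
  show ?thesis
  proof (rule open_null_if_compacts_null[OF m(1)])
    show "open (-K)" using K by (rule open_Compl)
    fix C assume "compact C" "C \<subseteq> -K"
    then have "negligible_for \<mu> C" using m(2) by (metis inf.absorb2 locally_negligible_for_def)
    then show "emeasure (radon_measure \<mu>) C = 0" using null_sets_radon_measure[OF m(1), of C] null_setsD1 by blast
  qed
qed

lemma radon_pos_onI:
  assumes \<mu>: "(\<mu>::'a functional) \<in> radon_pos" and N: "emeasure (radon_measure \<mu>) (-K) = 0" and K: "closed K" "K \<subseteq> A"
  shows "\<mu> \<in> radon_pos_on A"
proof -
  have "-K \<in> null_sets (radon_measure \<mu>)"
    using N open_in_sets_radon_measure[OF \<mu> open_Compl[OF K(1)]] by auto
  then have "radon_outer \<mu> (-K) = 0" using null_sets_radon_measure[OF \<mu>] by (simp add: negligible_for_def radon_outer_def)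
  then have "radon_outer \<mu> (-A \<inter> C) = 0" for C
    using radon_outer_mono[of "-A \<inter> C" "-K" \<mu>] K(2) by auto
  then show ?thesis using \<mu> by (simp add: radon_pos_on_def locally_negligible_for_def negligible_for_def radon_outer_def)
qed

text \<open>The complement of the support is a possibly uncountable union of open null sets. A
  compact subset meets only finitely many of them essentially, and compact subsets decide whether an
  open set is null.\<close>

lemma null_compl_of_Supp:
  assumes \<mu>: "(\<mu>::'a functional) \<in> radon_pos" and K: "closed K" "Supp \<mu> \<subseteq> K"
  shows "emeasure (radon_measure \<mu>) (-K) = 0"
proof (rule open_null_if_compacts_null[OF \<mu>])
  show "open (-K)" using K(1) by (rule open_Compl)
  fix C assume C: "compact C" "C \<subseteq> -K"
  let ?\<G> = "{G. open G \<and> (\<forall>\<phi>\<in>Cc. supp \<phi> \<subseteq> G \<longrightarrow> \<mu> \<phi> = 0)}"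
  have G0: "emeasure (radon_measure \<mu>) G = 0" if "G \<in> ?\<G>" for G
  proof (rule open_null_if_compacts_null[OF \<mu>])
    show "open G" using that by simp
    fix D assume D: "compact D" "D \<subseteq> G"
    obtain \<eta> where \<eta>: "\<eta> \<in> Cc" "\<forall>x. 0 \<le> \<eta> x" "\<forall>x. \<eta> x \<le> 1" "\<forall>x\<in>D. \<eta> x = 1" "supp \<eta> \<subseteq> G"
      by (rule urysohn[OF D(1) \<open>open G\<close> D(2)])
    have "emeasure (radon_measure \<mu>) D \<le> ennreal (\<mu> \<eta>)"
      by (rule emeasure_compact_le[OF \<mu> D(1) \<eta>(1,2)]) (use \<eta>(4) in simp)
    moreover have "\<mu> \<eta> = 0" using that \<eta>(1,5) by blast
    ultimately show "emeasure (radon_measure \<mu>) D = 0" by simp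
  qed
  have "C \<subseteq> \<Union>?\<G>" using C(2) K(2) by (auto simp: Supp_def)
  then obtain F where F: "F \<subseteq> ?\<G>" "finite F" "C \<subseteq> \<Union>F"
    by (rule compactE[OF C(1)]) auto
  have "(\<Union>G\<in>F. G) \<in> null_sets (radon_measure \<mu>)"
  proof (rule null_sets_UN')
    show "countable F" using F(2) by (rule countable_finite)
    fix G assume "G \<in> F"
    then have "G \<in> ?\<G>" using F(1) by blast
    then show "G \<in> null_sets (radon_measure \<mu>)" using G0[of G] open_in_sets_radon_measure[OF \<mu>, of G] by auto
  qed
  then have "emeasure (radon_measure \<mu>) C \<le> 0"
    using emeasure_mono[OF _ null_setsD2, of C "\<Union>F" "radon_measure \<mu>"] F(3) by (simp add: null_setsD1)
  then show "emeasure (radon_measure \<mu>) C = 0" by simp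
qed

lemma radon_eq_on_carrier:
  assumes \<mu>: "(\<mu>::'a functional) \<in> radon_pos" and K: "closed K" "emeasure (radon_measure \<mu>) (-K) = 0"
    and \<phi>: "\<phi> \<in> Cc" "\<psi> \<in> Cc" "\<forall>x\<in>K. \<phi> x = \<psi> x"
  shows "\<mu> \<phi> = \<mu> \<psi>"
proof -
  have "-K \<in> null_sets (radon_measure \<mu>)"
    using K(2) open_in_sets_radon_measure[OF \<mu> open_Compl[OF K(1)]] by auto
  then have "AE x in radon_measure \<mu>. \<phi> x = \<psi> x" by (rule AE_I') (use \<phi>(3) in auto)
  then have "(LINT x|radon_measure \<mu>. \<phi> x) = (LINT x|radon_measure \<mu>. \<psi> x)"
    by (intro Bochner_Integration.integral_cong_AE)
      (auto intro!: borel_measurable_radon_measure[OF \<mu>] borel_measurable_continuous_onI Cc_continuous \<phi>)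
  then show ?thesis using integral_Cc[OF \<mu>] \<phi> by simp
qed

lemma Supp_subset:
  assumes \<mu>: "(\<mu>::'a functional) \<in> radon_pos" and K: "closed K" "emeasure (radon_measure \<mu>) (-K) = 0"
  shows "Supp \<mu> \<subseteq> K"
proof -
  have "\<mu> \<phi> = 0" if "\<phi> \<in> Cc" "supp \<phi> \<subseteq> -K" for \<phi>
  proof -
    have "\<phi> x = 0" if "x \<in> K" for x by (rule not_in_supp) (use \<open>supp \<phi> \<subseteq> -K\<close> that in auto)
    then show ?thesis
      using radon_eq_on_carrier[OF \<mu> K \<open>\<phi> \<in> Cc\<close> Cc_zero] radon_zero_arg[OF radon_pos_radon[OF \<mu>]] by simp
  qed
  then have "-K \<in> {G. open G \<and> (\<forall>\<phi>\<in>Cc. supp \<phi> \<subseteq> G \<longrightarrow> \<mu> \<phi> = 0)}" using K(1) by auto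
  then have "-K \<subseteq> - Supp \<mu>" unfolding Supp_def by blast
  then show ?thesis by blast
qed

lemma mass_eq_emeasure:
  assumes "(\<mu>::'a functional) \<in> radon_pos" shows "mass \<mu> = emeasure (radon_measure \<mu>) UNIV"
  using emeasure_open_radon_measure[OF assms open_UNIV] by (simp add: mass_def indicator_def[abs_def])

lemma mass_eq_cutoff:
  assumes \<mu>: "(\<mu>::'a functional) \<in> radon_pos" and K: "closed K" "emeasure (radon_measure \<mu>) (-K) = 0"
    and \<eta>: "\<eta> \<in> Cc" "\<forall>x. 0 \<le> \<eta> x" "\<forall>x\<in>K. \<eta> x = 1"
  shows "mass \<mu> = ennreal (\<mu> \<eta>)"
proof -
  have "-K \<in> null_sets (radon_measure \<mu>)"
    using K(2) open_in_sets_radon_measure[OF \<mu> open_Compl[OF K(1)]] by auto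
  then have ae: "AE x in radon_measure \<mu>. 1 = ennreal (\<eta> x)" by (rule AE_I') (use \<eta>(3) in auto)
  have lsc: "lower_semicont (\<lambda>x. ennreal (\<eta> x))" by (rule lower_semicont_continuous[OF Cc_continuous[OF \<eta>(1)]])
  have "mass \<mu> = (\<integral>\<^sup>+x. 1 \<partial>radon_measure \<mu>)"
    unfolding mass_def by (rule nn_integral_radon_measure[OF \<mu> lower_semicont_const, symmetric])
  also have "\<dots> = (\<integral>\<^sup>+x. ennreal (\<eta> x) \<partial>radon_measure \<mu>)" by (rule nn_integral_cong_AE[OF ae])
  also have "\<dots> = ennreal (\<mu> \<eta>)"
    using nn_integral_radon_measure[OF \<mu> lsc] pos_integral_Cc[OF \<mu> \<eta>(1)] \<eta>(2) by simp
  finally show ?thesis .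
qed

lemma radon_restrict_null_compl:
  assumes \<mu>: "(\<mu>::'a functional) \<in> radon_pos" and B: "B \<in> sets (radon_measure \<mu>)" and K: "closed K" "B \<subseteq> K"
  shows "emeasure (radon_measure (radon_restrict \<mu> B)) (-K) = 0"
proof -
  have "emeasure (radon_measure (radon_restrict \<mu> B)) (-K) = pos_integral (radon_restrict \<mu> B) (indicator (-K))"
    by (rule emeasure_open_radon_measure[OF radon_restrict_pos[OF \<mu> B] open_Compl[OF K(1)]])
  also have "\<dots> \<le> (\<integral>\<^sup>+x. indicator (-K) x * indicator B x \<partial>radon_measure \<mu>)"
    by (rule pos_integral_restrict_le[OF \<mu> B])
  also have "(\<lambda>x. indicator (-K) x * indicator B x :: ennreal) = (\<lambda>x. 0)"
  proof
    fix x show "indicator (-K) x * indicator B x = (0::ennreal)" using K(2) by (cases "x \<in> B") auto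
  qed
  finally show ?thesis by simp
qed

end

section \<open>The Jordan decomposition\<close>

definition Cc_order_interval :: "('a::topological_space \<Rightarrow> real) \<Rightarrow> ('a \<Rightarrow> real) set" where
  "Cc_order_interval \<phi> = {\<psi>\<in>Cc. \<forall>x. 0 \<le> \<psi> x \<and> \<psi> x \<le> \<phi> x}"

definition jordan_sup :: "'a::topological_space functional \<Rightarrow> ('a \<Rightarrow> real) \<Rightarrow> real" where
  "jordan_sup \<mu> \<phi> = (SUP \<psi>\<in>Cc_order_interval \<phi>. \<mu> \<psi>)"

lemma pos_part_eq: "pos_part \<mu> = (\<lambda>\<phi>\<in>Cc. jordan_sup \<mu> (\<lambda>x. max 0 (\<phi> x)) - jordan_sup \<mu> (\<lambda>x. max 0 (- \<phi> x)))"
  by (simp add: pos_part_def jordan_sup_def Cc_order_interval_def)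

lemma radon_diff_apply [simp]: "\<phi> \<in> Cc \<Longrightarrow> radon_diff \<mu> \<nu> \<phi> = \<mu> \<phi> - \<nu> \<phi>"
  by (simp add: radon_diff_def)

lemma radon_plus_apply [simp]: "\<phi> \<in> Cc \<Longrightarrow> radon_plus \<mu> \<nu> \<phi> = \<mu> \<phi> + \<nu> \<phi>"
  by (simp add: radon_plus_def)

lemma radon_cmult_apply [simp]: "\<phi> \<in> Cc \<Longrightarrow> radon_cmult c \<mu> \<phi> = c * \<mu> \<phi>"
  by (simp add: radon_cmult_def)

lemma radon_zero_apply [simp]: "\<phi> \<in> Cc \<Longrightarrow> radon_zero \<phi> = 0"
  by (simp add: radon_zero_def)

lemma radon_diff_radon:
  fixes \<mu> \<nu> :: "'a::t2_space functional"
  assumes m: "\<mu> \<in> radon" and n: "\<nu> \<in> radon" shows "radon_diff \<mu> \<nu> \<in> radon"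
proof -
  have "\<exists>M. \<forall>\<phi>\<in>Cc. supp \<phi> \<subseteq> K \<longrightarrow> \<bar>radon_diff \<mu> \<nu> \<phi>\<bar> \<le> M * (SUP x. \<bar>\<phi> x\<bar>)" if K: "compact K" for K
  proof -
    obtain M where M: "\<forall>\<phi>\<in>Cc. supp \<phi> \<subseteq> K \<longrightarrow> \<bar>\<mu> \<phi>\<bar> \<le> M * (SUP x. \<bar>\<phi> x\<bar>)" using m K unfolding radon_def by blast
    obtain N where N: "\<forall>\<phi>\<in>Cc. supp \<phi> \<subseteq> K \<longrightarrow> \<bar>\<nu> \<phi>\<bar> \<le> N * (SUP x. \<bar>\<phi> x\<bar>)" using n K unfolding radon_def by blast
    have "\<bar>radon_diff \<mu> \<nu> \<phi>\<bar> \<le> (M + N) * (SUP x. \<bar>\<phi> x\<bar>)" if p: "\<phi> \<in> Cc" "supp \<phi> \<subseteq> K" for \<phi>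
      using M[rule_format, OF p] N[rule_format, OF p] p(1) by (simp add: distrib_right)
    then show ?thesis by blast
  qed
  moreover have "radon_diff \<mu> \<nu> \<in> extensional Cc" by (simp add: radon_diff_def)
  moreover have "radon_diff \<mu> \<nu> (\<lambda>x. \<phi> x + \<psi> x) = radon_diff \<mu> \<nu> \<phi> + radon_diff \<mu> \<nu> \<psi>" if "\<phi> \<in> Cc" "\<psi> \<in> Cc" for \<phi> \<psi>
    using that by (simp add: Cc_add radon_add[OF m that] radon_add[OF n that])
  moreover have "radon_diff \<mu> \<nu> (\<lambda>x. c * \<phi> x) = c * radon_diff \<mu> \<nu> \<phi>" if "\<phi> \<in> Cc" for c \<phi>
    using that by (simp add: Cc_scale radon_scale[OF m that] radon_scale[OF n that] right_diff_distrib)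
  ultimately show ?thesis by (simp add: radon_def)
qed

lemma jordan_sup_bounded:
  fixes \<mu> :: "'a::t2_space functional"
  assumes \<mu>: "\<mu> \<in> radon" and \<phi>: "\<phi> \<in> Cc" "\<forall>x. 0 \<le> \<phi> x"
  shows "bdd_above (\<mu> ` Cc_order_interval \<phi>)"
proof -
  obtain M where M: "\<forall>\<psi>\<in>Cc. supp \<psi> \<subseteq> supp \<phi> \<longrightarrow> \<bar>\<mu> \<psi>\<bar> \<le> M * (SUP x. \<bar>\<psi> x\<bar>)"
    using \<mu> Cc_compact_supp[OF \<phi>(1)] unfolding radon_def by blast
  obtain B where B: "0 < B" "\<forall>x. \<bar>\<phi> x\<bar> \<le> B" by (rule Cc_bounded[OF \<phi>(1)])
  show ?thesis
  proof (rule bdd_aboveI2)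
    fix \<psi> assume "\<psi> \<in> Cc_order_interval \<phi>"
    then have \<psi>: "\<psi> \<in> Cc" "\<forall>x. 0 \<le> \<psi> x" "\<forall>x. \<psi> x \<le> \<phi> x" by (auto simp: Cc_order_interval_def)
    have "supp \<psi> \<subseteq> supp \<phi>"
    proof (rule supp_subset_closed)
      show "closed (supp \<phi>)" by (simp add: supp_def)
      show "\<psi> x = 0" if "x \<notin> supp \<phi>" for x
        using \<psi>(2)[rule_format, of x] \<psi>(3)[rule_format, of x] not_in_supp[OF that] by simp
    qed
    then have 1: "\<bar>\<mu> \<psi>\<bar> \<le> M * (SUP x. \<bar>\<psi> x\<bar>)" using M \<psi>(1) by blast
    have le: "\<bar>\<psi> x\<bar> \<le> B" for x
      using \<psi>(2)[rule_format, of x] \<psi>(3)[rule_format, of x] B(2)[rule_format, of x] by linarith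
    have "(SUP x. \<bar>\<psi> x\<bar>) \<le> B" by (rule cSUP_least) (use le in auto)
    moreover have "0 \<le> (SUP x. \<bar>\<psi> x\<bar>)"
      by (rule order_trans[OF abs_ge_zero cSUP_upper[of undefined UNIV "\<lambda>x. \<bar>\<psi> x\<bar>"]]) (use le in \<open>auto intro!: bdd_aboveI2\<close>)
    ultimately have "\<bar>M\<bar> * (SUP x. \<bar>\<psi> x\<bar>) \<le> \<bar>M\<bar> * B" by (intro mult_left_mono) auto
    moreover have "M * (SUP x. \<bar>\<psi> x\<bar>) \<le> \<bar>M\<bar> * (SUP x. \<bar>\<psi> x\<bar>)"
      using \<open>0 \<le> (SUP x. \<bar>\<psi> x\<bar>)\<close> by (intro mult_right_mono) auto
    ultimately show "\<mu> \<psi> \<le> \<bar>M\<bar> * B" using 1 by linarith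
  qed
qed

lemma jordan_sup_upper:
  fixes \<mu> :: "'a::t2_space functional"
  assumes "\<mu> \<in> radon" "\<phi> \<in> Cc" "\<forall>x. 0 \<le> \<phi> x" "\<psi> \<in> Cc_order_interval \<phi>"
  shows "\<mu> \<psi> \<le> jordan_sup \<mu> \<phi>"
  unfolding jordan_sup_def by (rule cSUP_upper[OF assms(4) jordan_sup_bounded[OF assms(1-3)]])

lemma zero_in_Cc_order_interval: "\<forall>x. 0 \<le> \<phi> x \<Longrightarrow> (\<lambda>x. 0) \<in> Cc_order_interval \<phi>"
  by (simp add: Cc_order_interval_def Cc_zero)

lemma jordan_sup_least:
  assumes "\<forall>x. 0 \<le> \<phi> x" "\<And>\<psi>. \<psi> \<in> Cc_order_interval \<phi> \<Longrightarrow> \<mu> \<psi> \<le> c"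
  shows "jordan_sup \<mu> \<phi> \<le> c"
  unfolding jordan_sup_def by (rule cSUP_least) (use assms zero_in_Cc_order_interval in blast)+

lemma jordan_sup_nonneg:
  fixes \<mu> :: "'a::t2_space functional"
  assumes "\<mu> \<in> radon" "\<phi> \<in> Cc" "\<forall>x. 0 \<le> \<phi> x" shows "0 \<le> jordan_sup \<mu> \<phi>"
  using jordan_sup_upper[OF assms zero_in_Cc_order_interval[OF assms(3)]] radon_zero_arg[OF assms(1)] by simp

text \<open>The Riesz decomposition property: \<open>0 \<le> \<psi> \<le> f + g\<close> splits into
  \<open>min \<psi> f\<close> and a remainder below \<open>g\<close>.\<close>

lemma jordan_sup_add:
  fixes \<mu> :: "'a::t2_space functional"
  assumes \<mu>: "\<mu> \<in> radon" and f: "f \<in> Cc" "\<forall>x. 0 \<le> f x" and g: "g \<in> Cc" "\<forall>x. 0 \<le> g x"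
  shows "jordan_sup \<mu> (\<lambda>x. f x + g x) = jordan_sup \<mu> f + jordan_sup \<mu> g"
proof (rule antisym)
  have fg: "(\<lambda>x. f x + g x) \<in> Cc" "\<forall>x. 0 \<le> f x + g x" using Cc_add[OF f(1) g(1)] f(2) g(2) by auto
  show "jordan_sup \<mu> (\<lambda>x. f x + g x) \<le> jordan_sup \<mu> f + jordan_sup \<mu> g"
  proof (rule jordan_sup_least[OF fg(2)])
    fix \<psi> assume "\<psi> \<in> Cc_order_interval (\<lambda>x. f x + g x)"
    then have \<psi>: "\<psi> \<in> Cc" "\<forall>x. 0 \<le> \<psi> x" "\<forall>x. \<psi> x \<le> f x + g x" by (auto simp: Cc_order_interval_def)
    let ?a = "\<lambda>x. min (\<psi> x) (f x)" and ?b = "\<lambda>x. \<psi> x - min (\<psi> x) (f x)"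
    have a: "?a \<in> Cc" by (rule Cc_min[OF \<psi>(1) f(1)])
    have b: "?b \<in> Cc" by (rule Cc_diff[OF \<psi>(1) a])
    have "?a \<in> Cc_order_interval f" using a \<psi>(2) f(2) by (auto simp: Cc_order_interval_def)
    moreover have "?b \<in> Cc_order_interval g"
    proof -
      have "0 \<le> ?b x \<and> ?b x \<le> g x" for x using \<psi>(3)[rule_format, of x] g(2)[rule_format, of x] by auto
      then show ?thesis using b by (simp add: Cc_order_interval_def)
    qed
    ultimately have "\<mu> ?a \<le> jordan_sup \<mu> f" "\<mu> ?b \<le> jordan_sup \<mu> g"
      using jordan_sup_upper[OF \<mu> f] jordan_sup_upper[OF \<mu> g] by blast+
    moreover have "\<mu> \<psi> = \<mu> ?a + \<mu> ?b" using radon_diff_arg[OF \<mu> \<psi>(1) a] by simp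
    ultimately show "\<mu> \<psi> \<le> jordan_sup \<mu> f + jordan_sup \<mu> g" by simp
  qed
  have 1: "\<mu> a + \<mu> b \<le> jordan_sup \<mu> (\<lambda>x. f x + g x)"
    if "a \<in> Cc_order_interval f" "b \<in> Cc_order_interval g" for a b
  proof -
    have ab: "a \<in> Cc" "b \<in> Cc" "\<And>x. 0 \<le> a x \<and> a x \<le> f x" "\<And>x. 0 \<le> b x \<and> b x \<le> g x"
      using that by (auto simp: Cc_order_interval_def)
    have "(\<lambda>x. a x + b x) \<in> Cc_order_interval (\<lambda>x. f x + g x)"
      using Cc_add[OF ab(1,2)] ab(3,4) by (simp add: Cc_order_interval_def add_mono)
    from jordan_sup_upper[OF \<mu> fg this] show ?thesis using radon_add[OF \<mu> ab(1,2)] by simp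
  qed
  have "jordan_sup \<mu> f \<le> jordan_sup \<mu> (\<lambda>x. f x + g x) - \<mu> b" if "b \<in> Cc_order_interval g" for b
    by (rule jordan_sup_least[OF f(2)]) (use 1[OF _ that] in \<open>simp add: le_diff_eq\<close>)
  then have "jordan_sup \<mu> g \<le> jordan_sup \<mu> (\<lambda>x. f x + g x) - jordan_sup \<mu> f"
    by (intro jordan_sup_least[OF g(2)]) (simp add: le_diff_eq add.commute)
  then show "jordan_sup \<mu> f + jordan_sup \<mu> g \<le> jordan_sup \<mu> (\<lambda>x. f x + g x)" by simp
qed

lemma jordan_sup_scale:
  fixes \<mu> :: "'a::t2_space functional"
  assumes \<mu>: "\<mu> \<in> radon" and f: "f \<in> Cc" "\<forall>x. 0 \<le> f x" and c: "0 \<le> c"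
  shows "jordan_sup \<mu> (\<lambda>x. c * f x) = c * jordan_sup \<mu> f"
proof -
  have le: "jordan_sup \<mu> (\<lambda>x. c * f x) \<le> c * jordan_sup \<mu> f"
    if c: "0 < c" and f: "f \<in> Cc" "\<forall>x. 0 \<le> f x" for c f
  proof (rule jordan_sup_least)
    show "\<forall>x. 0 \<le> c * f x" using c f by simp
    fix \<psi> assume "\<psi> \<in> Cc_order_interval (\<lambda>x. c * f x)"
    then have \<psi>: "\<psi> \<in> Cc" "\<forall>x. 0 \<le> \<psi> x" "\<forall>x. \<psi> x \<le> c * f x" by (auto simp: Cc_order_interval_def)
    have "(\<lambda>x. (1/c) * \<psi> x) \<in> Cc_order_interval f"
      using Cc_scale[OF \<psi>(1), of "1/c"] \<psi> c by (simp add: Cc_order_interval_def field_simps)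
    from jordan_sup_upper[OF \<mu> f this] have "(1/c) * \<mu> \<psi> \<le> jordan_sup \<mu> f"
      using radon_scale[OF \<mu> \<psi>(1), of "1/c"] by simp
    then show "\<mu> \<psi> \<le> c * jordan_sup \<mu> f" using c by (simp add: field_simps)
  qed
  show ?thesis
  proof (cases "c = 0")
    case True
    have "jordan_sup \<mu> (\<lambda>x. 0 + 0) = jordan_sup \<mu> (\<lambda>x. 0) + jordan_sup \<mu> (\<lambda>x. 0)"
      by (rule jordan_sup_add[OF \<mu> Cc_zero _ Cc_zero]) auto
    then show ?thesis using True by simp
  next
    case False
    then have c: "0 < c" using \<open>0 \<le> c\<close> by simp
    have cf: "(\<lambda>x. c * f x) \<in> Cc" "\<forall>x. 0 \<le> c * f x" using Cc_scale[OF f(1)] f(2) c by auto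
    have "jordan_sup \<mu> (\<lambda>x. (1/c) * (c * f x)) \<le> (1/c) * jordan_sup \<mu> (\<lambda>x. c * f x)"
      by (rule le[OF _ cf]) (use c in simp)
    then have "c * jordan_sup \<mu> f \<le> jordan_sup \<mu> (\<lambda>x. c * f x)" using c by (simp add: field_simps)
    then show ?thesis using le[OF c f] by simp
  qed
qed

context lch_space
begin

text \<open>On nonnegative functions the supremum is additive. It extends linearly because its value
  on a difference \<open>a - b\<close> does not depend on the representation, which is the content
  of the auxiliary fact \<open>diff\<close>.\<close>

lemma pos_part_radon_pos:
  assumes \<mu>: "(\<mu>::'a functional) \<in> radon"
  shows "pos_part \<mu> \<in> radon_pos" "\<And>\<phi>. \<phi> \<in> Cc \<Longrightarrow> \<forall>x. 0 \<le> \<phi> x \<Longrightarrow> pos_part \<mu> \<phi> = jordan_sup \<mu> \<phi>"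
proof -
  let ?P = "pos_part \<mu>" and ?j = "jordan_sup \<mu>"
  have diff: "?P (\<lambda>x. a x - b x) = ?j a - ?j b"
    if a: "a \<in> Cc" "\<forall>x. 0 \<le> a x" and b: "b \<in> Cc" "\<forall>x. 0 \<le> b x" for a b
  proof -
    let ?f = "\<lambda>x. a x - b x"
    have f: "?f \<in> Cc" by (rule Cc_diff[OF a(1) b(1)])
    have p: "(\<lambda>x. max 0 (?f x)) \<in> Cc" "(\<lambda>x. max 0 (- ?f x)) \<in> Cc"
      by (rule Cc_max[OF Cc_zero f], rule Cc_max[OF Cc_zero Cc_minus[OF f]])
    have 1: "?j (\<lambda>x. max 0 (?f x) + b x) = ?j (\<lambda>x. max 0 (?f x)) + ?j b"
      by (rule jordan_sup_add[OF \<mu> p(1) _ b]) simp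
    have 2: "?j (\<lambda>x. max 0 (- ?f x) + a x) = ?j (\<lambda>x. max 0 (- ?f x)) + ?j a"
      by (rule jordan_sup_add[OF \<mu> p(2) _ a]) simp
    have 3: "(\<lambda>x. max 0 (?f x) + b x) = (\<lambda>x. max 0 (- ?f x) + a x)" by (auto simp: fun_eq_iff max_def)
    have "?P ?f = ?j (\<lambda>x. max 0 (?f x)) - ?j (\<lambda>x. max 0 (- ?f x))" using f by (simp add: pos_part_eq)
    then show ?thesis using 1 2 unfolding 3 by linarith
  qed
  have j0: "?j (\<lambda>x. 0) = 0" using jordan_sup_scale[OF \<mu> Cc_zero, of 0] by simp
  show nonneg: "?P \<phi> = ?j \<phi>" if "\<phi> \<in> Cc" "\<forall>x. 0 \<le> \<phi> x" for \<phi>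
    using diff[OF that Cc_zero] j0 by simp
  have split: "\<phi> = (\<lambda>x. max 0 (\<phi> x) - max 0 (- \<phi> x))" for \<phi> :: "'a \<Rightarrow> real" by (auto simp: fun_eq_iff max_def)
  show "?P \<in> radon_pos"
  proof (rule radon_posI)
    show "?P \<in> extensional Cc" by (simp add: pos_part_eq)
    show "0 \<le> ?P \<phi>" if "\<phi> \<in> Cc" "\<forall>x. 0 \<le> \<phi> x" for \<phi>
      using nonneg[OF that] jordan_sup_nonneg[OF \<mu> that] by simp
    fix \<phi> :: "'a \<Rightarrow> real" assume f: "\<phi> \<in> Cc"
    let ?p = "\<lambda>x. max 0 (\<phi> x)" and ?n = "\<lambda>x. max 0 (- \<phi> x)"
    have pn: "?p \<in> Cc" "?n \<in> Cc" by (rule Cc_max[OF Cc_zero f], rule Cc_max[OF Cc_zero Cc_minus[OF f]])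
    have Pf: "?P \<phi> = ?j ?p - ?j ?n" using f by (simp add: pos_part_eq)
    show "?P (\<lambda>x. c * \<phi> x) = c * ?P \<phi>" for c
    proof (cases "0 \<le> c")
      case True
      have e: "(\<lambda>x. c * \<phi> x) = (\<lambda>x. c * ?p x - c * ?n x)" by (auto simp: fun_eq_iff max_def)
      have "?P (\<lambda>x. c * \<phi> x) = ?j (\<lambda>x. c * ?p x) - ?j (\<lambda>x. c * ?n x)"
        unfolding e by (rule diff[OF Cc_scale[OF pn(1)] _ Cc_scale[OF pn(2)]]) (use True in auto)
      then show ?thesis
        using jordan_sup_scale[OF \<mu> pn(1) _ True] jordan_sup_scale[OF \<mu> pn(2) _ True] Pf by (simp add: right_diff_distrib)
    next
      case False
      then have c: "0 \<le> - c" by simp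
      have e: "(\<lambda>x. c * \<phi> x) = (\<lambda>x. (- c) * ?n x - (- c) * ?p x)" by (auto simp: fun_eq_iff max_def)
      have "\<forall>x. 0 \<le> (- c) * ?n x" "\<forall>x. 0 \<le> (- c) * ?p x"
        by (intro allI mult_nonneg_nonneg[OF c] max.cobounded1)+
      then have "?P (\<lambda>x. c * \<phi> x) = ?j (\<lambda>x. (- c) * ?n x) - ?j (\<lambda>x. (- c) * ?p x)"
        unfolding e using diff[OF Cc_scale[OF pn(2)] _ Cc_scale[OF pn(1)], of "- c" "- c"] by blast
      moreover have "?j (\<lambda>x. (- c) * ?n x) = (- c) * ?j ?n" by (rule jordan_sup_scale[OF \<mu> pn(2) _ c]) simp
      moreover have "?j (\<lambda>x. (- c) * ?p x) = (- c) * ?j ?p" by (rule jordan_sup_scale[OF \<mu> pn(1) _ c]) simp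
      ultimately show ?thesis using Pf by (simp add: right_diff_distrib)
    qed
    fix \<psi> :: "'a \<Rightarrow> real" assume g: "\<psi> \<in> Cc"
    let ?q = "\<lambda>x. max 0 (\<psi> x)" and ?m = "\<lambda>x. max 0 (- \<psi> x)"
    have qm: "?q \<in> Cc" "?m \<in> Cc" by (rule Cc_max[OF Cc_zero g], rule Cc_max[OF Cc_zero Cc_minus[OF g]])
    have Pg: "?P \<psi> = ?j ?q - ?j ?m" using g by (simp add: pos_part_eq)
    have e: "(\<lambda>x. \<phi> x + \<psi> x) = (\<lambda>x. (?p x + ?q x) - (?n x + ?m x))" by (auto simp: fun_eq_iff max_def)
    have "?P (\<lambda>x. \<phi> x + \<psi> x) = ?j (\<lambda>x. ?p x + ?q x) - ?j (\<lambda>x. ?n x + ?m x)"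
      unfolding e by (rule diff[OF Cc_add[OF pn(1) qm(1)] _ Cc_add[OF pn(2) qm(2)]]) auto
    then show "?P (\<lambda>x. \<phi> x + \<psi> x) = ?P \<phi> + ?P \<psi>"
      using jordan_sup_add[OF \<mu> pn(1) _ qm(1)] jordan_sup_add[OF \<mu> pn(2) _ qm(2)] Pf Pg by simp
  qed
qed

lemma radon_zero_radon: "(radon_zero :: 'a functional) \<in> radon"
  by (rule radon_pos_radon[OF radon_zero_pos])

lemma neg_part_radon_pos: "(\<mu>::'a functional) \<in> radon \<Longrightarrow> neg_part \<mu> \<in> radon_pos"
  unfolding neg_part_def by (rule pos_part_radon_pos(1)[OF radon_diff_radon[OF radon_zero_radon]])

lemma radon_eq_nonnegI:
  assumes m: "(\<mu>::'a functional) \<in> radon" and n: "\<nu> \<in> radon"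
    and eq: "\<And>\<phi>. \<phi> \<in> Cc \<Longrightarrow> \<forall>x. 0 \<le> \<phi> x \<Longrightarrow> \<mu> \<phi> = \<nu> \<phi>"
  shows "\<mu> = \<nu>"
proof (rule radon_eqI[OF m n])
  fix \<phi> :: "'a \<Rightarrow> real" assume f: "\<phi> \<in> Cc"
  let ?p = "\<lambda>x. max 0 (\<phi> x)" and ?n = "\<lambda>x. max 0 (- \<phi> x)"
  have pn: "?p \<in> Cc" "?n \<in> Cc" by (rule Cc_max[OF Cc_zero f], rule Cc_max[OF Cc_zero Cc_minus[OF f]])
  have "\<phi> = (\<lambda>x. ?p x - ?n x)" by (auto simp: fun_eq_iff max_def)
  then have "\<mu> \<phi> = \<mu> ?p - \<mu> ?n" "\<nu> \<phi> = \<nu> ?p - \<nu> ?n"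
    using radon_diff_arg[OF m pn] radon_diff_arg[OF n pn] by simp_all
  then show "\<mu> \<phi> = \<nu> \<phi>" using eq[OF pn(1)] eq[OF pn(2)] by simp
qed

text \<open>The reflection \<open>\<psi> \<mapsto> \<phi> - \<psi>\<close> maps the order interval
  of \<open>\<phi>\<close> onto itself and exchanges the suprema of \<open>\<mu>\<close> and
  \<open>-\<mu>\<close> up to the constant \<open>\<mu> \<phi>\<close>.\<close>

lemma jordan_decomposition:
  assumes \<mu>: "(\<mu>::'a functional) \<in> radon"
  shows "radon_diff (pos_part \<mu>) (neg_part \<mu>) = \<mu>"
proof (rule radon_eq_nonnegI[OF _ \<mu>])
  show "radon_diff (pos_part \<mu>) (neg_part \<mu>) \<in> radon"
    by (intro radon_diff_radon radon_pos_radon pos_part_radon_pos(1) neg_part_radon_pos \<mu>)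
  fix \<phi> :: "'a \<Rightarrow> real" assume f: "\<phi> \<in> Cc" "\<forall>x. 0 \<le> \<phi> x"
  let ?\<nu> = "radon_diff radon_zero \<mu>"
  have n: "?\<nu> \<in> radon" by (rule radon_diff_radon[OF radon_zero_radon \<mu>])
  have swap: "(\<lambda>x. \<phi> x - \<psi> x) \<in> Cc_order_interval \<phi>" "\<psi> \<in> Cc" "\<mu> (\<lambda>x. \<phi> x - \<psi> x) = \<mu> \<phi> - \<mu> \<psi>"
    if "\<psi> \<in> Cc_order_interval \<phi>" for \<psi>
    using that Cc_diff[OF f(1), of \<psi>] radon_diff_arg[OF \<mu> f(1), of \<psi>] by (auto simp: Cc_order_interval_def)
  have "jordan_sup \<mu> \<phi> \<le> \<mu> \<phi> + jordan_sup ?\<nu> \<phi>"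
  proof (rule jordan_sup_least[OF f(2)])
    fix \<psi> assume p: "\<psi> \<in> Cc_order_interval \<phi>"
    have "?\<nu> (\<lambda>x. \<phi> x - \<psi> x) \<le> jordan_sup ?\<nu> \<phi>" by (rule jordan_sup_upper[OF n f swap(1)[OF p]])
    then show "\<mu> \<psi> \<le> \<mu> \<phi> + jordan_sup ?\<nu> \<phi>" using swap[OF p] Cc_diff[OF f(1) swap(2)[OF p]] by simp
  qed
  moreover have "jordan_sup ?\<nu> \<phi> \<le> jordan_sup \<mu> \<phi> - \<mu> \<phi>"
  proof (rule jordan_sup_least[OF f(2)])
    fix \<psi> assume p: "\<psi> \<in> Cc_order_interval \<phi>"
    have "\<mu> (\<lambda>x. \<phi> x - \<psi> x) \<le> jordan_sup \<mu> \<phi>" by (rule jordan_sup_upper[OF \<mu> f swap(1)[OF p]])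
    then show "?\<nu> \<psi> \<le> jordan_sup \<mu> \<phi> - \<mu> \<phi>" using swap[OF p] by simp
  qed
  ultimately show "radon_diff (pos_part \<mu>) (neg_part \<mu>) \<phi> = \<mu> \<phi>"
    using f pos_part_radon_pos(2)[OF \<mu> f] pos_part_radon_pos(2)[OF n f] by (simp add: neg_part_def)
qed

text \<open>The Jordan decomposition is the least one: every representation as a difference of
  positive measures exceeds it by one common summand. Signed integrals can thus be computed from any
  representation.\<close>

lemma jordan_minimal:
  assumes a: "(a::'a functional) \<in> radon_pos" and b: "b \<in> radon_pos"
  obtains \<rho> where "\<rho> \<in> radon_pos" "a = radon_plus (pos_part (radon_diff a b)) \<rho>" "b = radon_plus (neg_part (radon_diff a b)) \<rho>"
proof -
  let ?\<mu> = "radon_diff a b"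
  have \<mu>: "?\<mu> \<in> radon" by (intro radon_diff_radon radon_pos_radon a b)
  note p = pos_part_radon_pos(1)[OF \<mu>] and n = neg_part_radon_pos[OF \<mu>]
  let ?\<rho> = "radon_diff a (pos_part ?\<mu>)"
  have r: "?\<rho> \<in> radon" by (intro radon_diff_radon radon_pos_radon a p)
  have "0 \<le> ?\<rho> \<phi>" if f: "\<phi> \<in> Cc" "\<forall>x. 0 \<le> \<phi> x" for \<phi>
  proof -
    have "jordan_sup ?\<mu> \<phi> \<le> a \<phi>"
    proof (rule jordan_sup_least[OF f(2)])
      fix \<psi> assume "\<psi> \<in> Cc_order_interval \<phi>"
      then have \<psi>: "\<psi> \<in> Cc" "\<And>x. 0 \<le> \<psi> x" "\<And>x. \<psi> x \<le> \<phi> x" by (auto simp: Cc_order_interval_def)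
      show "?\<mu> \<psi> \<le> a \<phi>"
        using radon_pos_mono[OF a \<psi>(1) f(1) \<psi>(3)] radon_pos_nonneg[OF b \<psi>(1,2)] \<psi>(1) by simp
    qed
    then show ?thesis using f pos_part_radon_pos(2)[OF \<mu> f] by simp
  qed
  then have rp: "?\<rho> \<in> radon_pos" using r by (simp add: radon_pos_def)
  moreover have "a = radon_plus (pos_part ?\<mu>) ?\<rho>"
    by (rule radon_eqI[OF radon_pos_radon[OF a] radon_pos_radon[OF radon_plus_pos[OF p rp]]]) simp
  moreover have "b = radon_plus (neg_part ?\<mu>) ?\<rho>"
  proof (rule radon_eqI[OF radon_pos_radon[OF b] radon_pos_radon[OF radon_plus_pos[OF n rp]]])
    fix \<phi> :: "'a \<Rightarrow> real" assume f: "\<phi> \<in> Cc"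
    have "radon_diff (pos_part ?\<mu>) (neg_part ?\<mu>) \<phi> = ?\<mu> \<phi>" using jordan_decomposition[OF \<mu>] by simp
    then show "b \<phi> = radon_plus (neg_part ?\<mu>) ?\<rho> \<phi>" using f by simp
  qed
  ultimately show ?thesis by (rule that)
qed

lemma pos_part_pos:
  assumes a: "(a::'a functional) \<in> radon_pos" shows "pos_part a = a" "neg_part a = radon_zero"
proof -
  have "pos_part a \<phi> = a \<phi>" if f: "\<phi> \<in> Cc" "\<forall>x. 0 \<le> \<phi> x" for \<phi>
  proof -
    have "jordan_sup a \<phi> \<le> a \<phi>"
    proof (rule jordan_sup_least[OF f(2)])
      fix \<psi> assume "\<psi> \<in> Cc_order_interval \<phi>"
      then have \<psi>: "\<psi> \<in> Cc" "\<And>x. \<psi> x \<le> \<phi> x" by (auto simp: Cc_order_interval_def)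
      show "a \<psi> \<le> a \<phi>" by (rule radon_pos_mono[OF a \<psi>(1) f(1) \<psi>(2)])
    qed
    moreover have "a \<phi> \<le> jordan_sup a \<phi>"
      by (rule jordan_sup_upper[OF radon_pos_radon[OF a] f]) (use f in \<open>simp add: Cc_order_interval_def\<close>)
    ultimately show ?thesis using pos_part_radon_pos(2)[OF radon_pos_radon[OF a] f] by simp
  qed
  note p = this
  show 1: "pos_part a = a"
    by (rule radon_eq_nonnegI[OF radon_pos_radon[OF pos_part_radon_pos(1)] _ p]) (use a radon_pos_radon in auto)
  show "neg_part a = radon_zero"
  proof (rule radon_eqI[OF radon_pos_radon[OF neg_part_radon_pos[OF radon_pos_radon[OF a]]] radon_zero_radon])
    fix \<phi> :: "'a \<Rightarrow> real" assume f: "\<phi> \<in> Cc"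
    have "radon_diff (pos_part a) (neg_part a) \<phi> = a \<phi>" using jordan_decomposition[OF radon_pos_radon[OF a]] by simp
    then show "neg_part a \<phi> = radon_zero \<phi>" using f 1 by simp
  qed
qed

lemma pos_integral_radon_zero: "pos_integral (radon_zero :: 'a functional) g = 0"
  unfolding pos_integral_eq using Cc_below_zero by (auto simp: Cc_below_def intro!: SUP_eq_const)

lemma signed_integral_pos:
  assumes "(a::'a functional) \<in> radon_pos"
  shows "signed_integral a g = enn2ereal (pos_integral a g)" "integral_defined a g"
  using pos_part_pos[OF assms] pos_integral_radon_zero
  by (simp_all add: signed_integral_def integral_defined_def zero_ennreal.rep_eq)

text \<open>The common summand \<open>\<rho>\<close> has a finite integral, since
  \<open>\<rho>\<close> is part of \<open>a\<close>, and cancels. The integral of \<open>b\<close>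
  may be infinite; the resulting value \<open>-\<infinity>\<close> is what later excludes infinite
  mutual energies.\<close>

lemma signed_integral_diff:
  assumes a: "(a::'a functional) \<in> radon_pos" and b: "b \<in> radon_pos" and fin: "pos_integral a g < \<infinity>"
  shows "integral_defined (radon_diff a b) g"
    "signed_integral (radon_diff a b) g = enn2ereal (pos_integral a g) - enn2ereal (pos_integral b g)"
proof -
  let ?\<mu> = "radon_diff a b"
  have \<mu>: "?\<mu> \<in> radon" by (intro radon_diff_radon radon_pos_radon a b)
  obtain \<rho> where \<rho>: "\<rho> \<in> radon_pos" "a = radon_plus (pos_part ?\<mu>) \<rho>" "b = radon_plus (neg_part ?\<mu>) \<rho>"
    by (rule jordan_minimal[OF a b])
  have A: "pos_integral a g = pos_integral (pos_part ?\<mu>) g + pos_integral \<rho> g"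
    using pos_integral_radon_plus[OF pos_part_radon_pos(1)[OF \<mu>] \<rho>(1), of g] \<rho>(2) by simp
  have B: "pos_integral b g = pos_integral (neg_part ?\<mu>) g + pos_integral \<rho> g"
    using pos_integral_radon_plus[OF neg_part_radon_pos[OF \<mu>] \<rho>(1), of g] \<rho>(3) by simp
  show "integral_defined ?\<mu> g" using fin A by (auto simp: integral_defined_def)
  show "signed_integral ?\<mu> g = enn2ereal (pos_integral a g) - enn2ereal (pos_integral b g)"
    unfolding A B signed_integral_def using fin A
    by (cases "pos_integral (pos_part ?\<mu>) g"; cases "pos_integral (neg_part ?\<mu>) g"; cases "pos_integral \<rho> g")
      (auto simp: enn2ereal_ennreal simp flip: ennreal_plus)
qed

lemma prod_lch: "lch_space TYPE('a \<times> 'a)"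
proof
  have "locally_compact_space (prod_topology (euclidean :: 'a topology) (euclidean :: 'a topology))"
    using loc_compact locally_compact_space_prod_topology by blast
  then show "locally_compact_space (euclidean :: ('a \<times> 'a) topology)" by simp
qed

end

section \<open>Product measures\<close>

text \<open>The algebra to which the Stone-Weierstrass theorem is applied. Its factors are merely
  continuous, so that constants belong to it; compact support is restored by multiplying with a
  cutoff.\<close>

inductive tensor_sum :: "('a::topological_space \<times> 'a \<Rightarrow> real) \<Rightarrow> bool" where
  tensor: "continuous_on UNIV f \<Longrightarrow> continuous_on UNIV g \<Longrightarrow> tensor_sum (\<lambda>z. f (fst z) * g (snd z))"
| add: "tensor_sum F \<Longrightarrow> tensor_sum G \<Longrightarrow> tensor_sum (\<lambda>z. F z + G z)"

lemma tensor_sum_continuous: "tensor_sum F \<Longrightarrow> continuous_on UNIV F"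
proof (induction rule: tensor_sum.induct)
  case (tensor f g)
  have "continuous_on UNIV (\<lambda>z. f (fst z))" by (rule continuous_on_compose2[OF tensor(1)]) (auto intro!: continuous_intros)
  moreover have "continuous_on UNIV (\<lambda>z. g (snd z))" by (rule continuous_on_compose2[OF tensor(2)]) (auto intro!: continuous_intros)
  ultimately show ?case by (rule continuous_on_mult)
next
  case (add F G) then show ?case by (intro continuous_on_add)
qed

lemma tensor_sum_mult:
  assumes "tensor_sum F" "tensor_sum G" shows "tensor_sum (\<lambda>z. F z * G z)"
  using assms(1)
proof (induction rule: tensor_sum.induct)
  case (tensor f g)
  show ?case using assms(2)
  proof (induction rule: tensor_sum.induct)
    case (tensor f' g')
    have "tensor_sum (\<lambda>z. (\<lambda>x. f x * f' x) (fst z) * (\<lambda>y. g y * g' y) (snd z))"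
      by (rule tensor_sum.tensor; rule continuous_on_mult) (use tensor \<open>continuous_on UNIV f\<close> \<open>continuous_on UNIV g\<close> in auto)
    moreover have "(\<lambda>z. (\<lambda>x. f x * f' x) (fst z) * (\<lambda>y. g y * g' y) (snd z)) =
        (\<lambda>z. f (fst z) * g (snd z) * (f' (fst z) * g' (snd z)))" by (simp add: fun_eq_iff)
    ultimately show ?case by metis
  next
    case (add F' G')
    have "tensor_sum (\<lambda>z. f (fst z) * g (snd z) * F' z + f (fst z) * g (snd z) * G' z)"
      by (rule tensor_sum.add[OF add.IH])
    then show ?case by (simp add: distrib_left)
  qed
next
  case (add F G')
  have "tensor_sum (\<lambda>z. F z * G z + G' z * G z)" by (rule tensor_sum.add[OF add.IH])
  then show ?case by (simp add: distrib_right)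
qed

lemma Cc_prod_supp:
  fixes \<phi> :: "'a::t2_space \<times> 'a \<Rightarrow> real"
  assumes "\<phi> \<in> Cc"
  obtains K where "compact K" "\<forall>x y. \<phi> (x, y) \<noteq> 0 \<longrightarrow> x \<in> K \<and> y \<in> K"
proof
  let ?K = "fst ` supp \<phi> \<union> snd ` supp \<phi>"
  show "compact ?K"
    by (intro compact_Un compact_continuous_image Cc_compact_supp[OF assms] continuous_intros)
  show "\<forall>x y. \<phi> (x, y) \<noteq> 0 \<longrightarrow> x \<in> ?K \<and> y \<in> ?K"
  proof (intro allI impI)
    fix x y assume "\<phi> (x, y) \<noteq> 0"
    then have "(x, y) \<in> supp \<phi>" using not_in_supp[of "(x, y)" \<phi>] by blast
    then show "x \<in> ?K \<and> y \<in> ?K" by force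
  qed
qed

lemma Cc_slice:
  fixes \<phi> :: "'a::t2_space \<times> 'a \<Rightarrow> real"
  assumes "\<phi> \<in> Cc" shows "(\<lambda>y. \<phi> (x, y)) \<in> Cc"
proof -
  obtain K where K: "compact K" "\<forall>x y. \<phi> (x, y) \<noteq> 0 \<longrightarrow> x \<in> K \<and> y \<in> K" by (rule Cc_prod_supp[OF assms])
  have "continuous_on UNIV (\<lambda>y. \<phi> (x, y))"
    by (rule continuous_on_compose2[OF Cc_continuous[OF assms]]) (auto intro!: continuous_intros)
  then show ?thesis by (rule CcI[OF _ K(1)]) (use K(2) in blast)
qed

lemma Cc_swap:
  fixes \<phi> :: "'a::t2_space \<times> 'a \<Rightarrow> real"
  assumes "\<phi> \<in> Cc" shows "(\<lambda>z. \<phi> (snd z, fst z)) \<in> Cc"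
proof -
  obtain K where K: "compact K" "\<forall>x y. \<phi> (x, y) \<noteq> 0 \<longrightarrow> x \<in> K \<and> y \<in> K" by (rule Cc_prod_supp[OF assms])
  have "continuous_on UNIV (\<lambda>z. \<phi> (snd z, fst z))"
    by (rule continuous_on_compose2[OF Cc_continuous[OF assms]]) (auto intro!: continuous_intros)
  then show ?thesis by (rule CcI[OF _ compact_Times[OF K(1) K(1)]]) (use K(2) in force)
qed

lemma Cc_tensor_mult:
  fixes \<eta> \<theta> :: "'a::t2_space \<Rightarrow> real"
  assumes "\<eta> \<in> Cc" "\<theta> \<in> Cc" "continuous_on UNIV F" shows "(\<lambda>z. \<eta> (fst z) * \<theta> (snd z) * F z) \<in> Cc"
proof (rule CcI[OF _ compact_Times[OF Cc_compact_supp[OF assms(1)] Cc_compact_supp[OF assms(2)]]])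
  have "continuous_on UNIV (\<lambda>z::'a\<times>'a. \<eta> (fst z))"
    by (rule continuous_on_compose2[OF Cc_continuous[OF assms(1)]]) (auto intro!: continuous_intros)
  moreover have "continuous_on UNIV (\<lambda>z::'a\<times>'a. \<theta> (snd z))"
    by (rule continuous_on_compose2[OF Cc_continuous[OF assms(2)]]) (auto intro!: continuous_intros)
  ultimately show "continuous_on UNIV (\<lambda>z. \<eta> (fst z) * \<theta> (snd z) * F z)"
    using assms(3) by (intro continuous_on_mult)
  show "\<eta> (fst z) * \<theta> (snd z) * F z = 0" if "z \<notin> supp \<eta> \<times> supp \<theta>" for z
    using that not_in_supp[of "fst z" \<eta>] not_in_supp[of "snd z" \<theta>] by (cases z) auto
qed

section \<open>Fubini and Tonelli theorems for positive functionals\<close>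

context lch_space
begin

text \<open>By the tube lemma \<open>\<phi> (x, \<cdot>)\<close> tends to
  \<open>\<phi> (x0, \<cdot>)\<close> uniformly on the compact set \<open>K\<close> outside which
  all slices vanish.\<close>

lemma Cc_partial_integral:
  fixes \<phi> :: "'a \<times> 'a \<Rightarrow> real"
  assumes \<nu>: "\<nu> \<in> radon_pos" and \<phi>: "\<phi> \<in> Cc"
  shows "(\<lambda>x. \<nu> (\<lambda>y. \<phi> (x, y))) \<in> Cc"
proof -
  obtain K where K: "compact K" "\<forall>x y. \<phi> (x, y) \<noteq> 0 \<longrightarrow> x \<in> K \<and> y \<in> K" by (rule Cc_prod_supp[OF \<phi>])
  obtain \<eta> where \<eta>: "\<eta> \<in> Cc" "\<forall>x. 0 \<le> \<eta> x" "\<forall>x. \<eta> x \<le> 1" "\<forall>x\<in>K. \<eta> x = 1" by (rule cutoff[OF K(1)])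
  have \<nu>\<eta>: "0 \<le> \<nu> \<eta>" using radon_pos_nonneg[OF \<nu> \<eta>(1)] \<eta>(2) by simp
  have "continuous_on UNIV (\<lambda>x. \<nu> (\<lambda>y. \<phi> (x, y)))"
    unfolding continuous_on_def
  proof (intro ballI tendstoI)
    fix x0 :: 'a and e :: real assume e: "0 < e"
    define d where "d = e / (\<nu> \<eta> + 1)"
    have d: "0 < d" using e \<nu>\<eta> by (simp add: d_def)
    have "d * (\<nu> \<eta> + 1) = e" using \<nu>\<eta> by (simp add: d_def)
    then have de: "d * \<nu> \<eta> < e" using d by (simp add: distrib_left)
    define W where "W = {z. \<bar>\<phi> z - \<phi> (x0, snd z)\<bar> < d}"
    have "continuous_on UNIV (\<lambda>z. \<phi> (x0, snd z))"
      by (rule continuous_on_compose2[OF Cc_continuous[OF \<phi>]]) (auto intro!: continuous_intros)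
    then have W: "open W" unfolding W_def
      by (intro open_Collect_less continuous_intros Cc_continuous[OF \<phi>])
    have "{x0} \<times> K \<subseteq> W" using d by (auto simp: W_def)
    then obtain X0 where X0: "x0 \<in> X0" "open X0" "X0 \<times> K \<subseteq> W"
      using Elementary_Topology.tube_lemma[OF K(1) W] by blast
    have "dist (\<nu> (\<lambda>y. \<phi> (x, y))) (\<nu> (\<lambda>y. \<phi> (x0, y))) < e" if x: "x \<in> X0" for x
    proof -
      have s: "(\<lambda>y. \<phi> (x, y)) \<in> Cc" "(\<lambda>y. \<phi> (x0, y)) \<in> Cc" by (rule Cc_slice[OF \<phi>])+
      have "\<bar>\<phi> (x, y) - \<phi> (x0, y)\<bar> \<le> d * \<eta> y" for y
      proof (cases "y \<in> K")
        case True
        then have "(x, y) \<in> W" using X0(3) x by blast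
        then show ?thesis using \<eta>(4) True by (simp add: W_def)
      next
        case False
        then have "\<phi> (x, y) = 0" "\<phi> (x0, y) = 0" using K(2) by blast+
        then show ?thesis using \<eta>(2) d by simp
      qed
      then have "\<bar>\<nu> (\<lambda>y. \<phi> (x, y) - \<phi> (x0, y))\<bar> \<le> \<nu> (\<lambda>y. d * \<eta> y)"
        by (rule radon_abs_le[OF \<nu> Cc_diff[OF s] Cc_scale[OF \<eta>(1)]])
      then have "\<bar>\<nu> (\<lambda>y. \<phi> (x, y)) - \<nu> (\<lambda>y. \<phi> (x0, y))\<bar> \<le> d * \<nu> \<eta>"
        using radon_diff_arg[OF radon_pos_radon[OF \<nu>] s] radon_scale[OF radon_pos_radon[OF \<nu>] \<eta>(1), of d] by simp
      then show ?thesis using de by (simp add: dist_real_def)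
    qed
    then show "\<forall>\<^sub>F x in at x0 within UNIV. dist (\<nu> (\<lambda>y. \<phi> (x, y))) (\<nu> (\<lambda>y. \<phi> (x0, y))) < e"
      unfolding eventually_at_topological using X0(1,2) by blast
  qed
  then show ?thesis
  proof (rule CcI[OF _ K(1)])
    fix x assume "x \<notin> K"
    then have "(\<lambda>y. \<phi> (x, y)) = (\<lambda>y. 0)" using K(2) by blast
    then show "\<nu> (\<lambda>y. \<phi> (x, y)) = 0" using radon_zero_arg[OF radon_pos_radon[OF \<nu>]] by simp
  qed
qed

lemma radon_product_apply [simp]: "\<phi> \<in> Cc \<Longrightarrow> radon_product \<mu> \<nu> \<phi> = \<mu> (\<lambda>x. \<nu> (\<lambda>y. \<phi> (x, y)))"
  by (simp add: radon_product_def)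

lemma radon_product_pos:
  assumes \<mu>: "(\<mu>::'a functional) \<in> radon_pos" and \<nu>: "\<nu> \<in> radon_pos"
  shows "radon_product \<mu> \<nu> \<in> radon_pos"
proof -
  interpret P: lch_space "TYPE('a \<times> 'a)" by (rule prod_lch)
  note m = radon_pos_radon[OF \<mu>] and n = radon_pos_radon[OF \<nu>]
  show ?thesis
  proof (rule P.radon_posI)
    show "radon_product \<mu> \<nu> \<in> extensional Cc" by (simp add: radon_product_def)
    show "radon_product \<mu> \<nu> (\<lambda>x. \<phi> x + \<psi> x) = radon_product \<mu> \<nu> \<phi> + radon_product \<mu> \<nu> \<psi>"
      if p: "\<phi> \<in> Cc" "\<psi> \<in> Cc" for \<phi> \<psi>
      using p radon_add[OF n Cc_slice[OF p(1)] Cc_slice[OF p(2)]]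
        radon_add[OF m Cc_partial_integral[OF \<nu> p(1)] Cc_partial_integral[OF \<nu> p(2)]] by (simp add: Cc_add)
    show "radon_product \<mu> \<nu> (\<lambda>x. c * \<phi> x) = c * radon_product \<mu> \<nu> \<phi>" if p: "\<phi> \<in> Cc" for c \<phi>
      using p radon_scale[OF n Cc_slice[OF p]] radon_scale[OF m Cc_partial_integral[OF \<nu> p]] by (simp add: Cc_scale)
    show "0 \<le> radon_product \<mu> \<nu> \<phi>" if p: "\<phi> \<in> Cc" "\<forall>x. 0 \<le> \<phi> x" for \<phi>
      using p(1) radon_pos_nonneg[OF \<mu> Cc_partial_integral[OF \<nu> p(1)]] radon_pos_nonneg[OF \<nu> Cc_slice[OF p(1)]] p(2) by simp
  qed
qed

lemma radon_product_tensor: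
  assumes \<mu>: "(\<mu>::'a functional) \<in> radon_pos" and \<nu>: "\<nu> \<in> radon_pos" and \<eta>: "\<eta> \<in> Cc" "\<theta> \<in> Cc"
  shows "\<mu> (\<lambda>x. \<nu> (\<lambda>y. \<eta> x * \<theta> y)) = \<mu> \<eta> * \<nu> \<theta>"
  using radon_scale[OF radon_pos_radon[OF \<nu>] \<eta>(2)] radon_scale[OF radon_pos_radon[OF \<mu>] \<eta>(1), of "\<nu> \<theta>"]
  by (simp add: mult.commute)

text \<open>Fubini's theorem on \<open>Cc\<close>: both orders of integration agree on products,
  hence on tensor sums cut off by \<open>\<eta>\<close>, and both are continuous for uniform
  convergence on a fixed compact set.\<close>

lemma radon_product_swap:
  assumes \<mu>: "(\<mu>::'a functional) \<in> radon_pos" and \<nu>: "\<nu> \<in> radon_pos" and \<phi>: "\<phi> \<in> Cc"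
  shows "radon_product \<nu> \<mu> (\<lambda>z. \<phi> (snd z, fst z)) = radon_product \<mu> \<nu> \<phi>"
proof -
  define A where "A = (\<lambda>\<phi>. radon_product \<mu> \<nu> \<phi>)"
  define B where "B = (\<lambda>\<phi>. radon_product \<nu> \<mu> (\<lambda>z. \<phi> (snd z, fst z)))"
  note A = radon_product_pos[OF \<mu> \<nu>] and B' = radon_product_pos[OF \<nu> \<mu>]
  have A_abs: "\<bar>A f\<bar> \<le> A g" and B_abs: "\<bar>B f\<bar> \<le> B g"
    if fg: "f \<in> Cc" "g \<in> Cc" "\<forall>z. \<bar>f z\<bar> \<le> g z" for f g
    using radon_abs_le[OF A fg(1,2)] radon_abs_le[OF B' Cc_swap[OF fg(1)] Cc_swap[OF fg(2)]] fg(3)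
    by (simp_all add: A_def B_def)
  have A_add: "A (\<lambda>z. f z + g z) = A f + A g" and B_add: "B (\<lambda>z. f z + g z) = B f + B g"
    if fg: "f \<in> Cc" "g \<in> Cc" for f g
    using radon_add[OF radon_pos_radon[OF A] fg] radon_add[OF radon_pos_radon[OF B'] Cc_swap[OF fg(1)] Cc_swap[OF fg(2)]]
    by (simp_all add: A_def B_def)
  have A_scale: "A (\<lambda>z. c * f z) = c * A f" and B_scale: "B (\<lambda>z. c * f z) = c * B f" if f: "f \<in> Cc" for f c
    using radon_scale[OF radon_pos_radon[OF A] f] radon_scale[OF radon_pos_radon[OF B'] Cc_swap[OF f]]
    by (simp_all add: A_def B_def)
  have AB: "A (\<lambda>z. \<eta> (fst z) * \<eta> (snd z) * F z) = B (\<lambda>z. \<eta> (fst z) * \<eta> (snd z) * F z)"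
    if \<eta>: "\<eta> \<in> Cc" and F: "tensor_sum F" for \<eta> F
    using F
  proof (induction rule: tensor_sum.induct)
    case (tensor f g)
    have fg: "(\<lambda>x. f x * \<eta> x) \<in> Cc" "(\<lambda>x. g x * \<eta> x) \<in> Cc"
      by (rule Cc_mult_continuous[OF \<eta> tensor(1)], rule Cc_mult_continuous[OF \<eta> tensor(2)])
    define F where "F = (\<lambda>z. f (fst z) * g (snd z))"
    have "tensor_sum F" unfolding F_def by (rule tensor_sum.tensor[OF tensor])
    then have c: "(\<lambda>z. \<eta> (fst z) * \<eta> (snd z) * F z) \<in> Cc" by (rule Cc_tensor_mult[OF \<eta> \<eta> tensor_sum_continuous])
    have "A (\<lambda>z. \<eta> (fst z) * \<eta> (snd z) * F z) = \<mu> (\<lambda>x. \<nu> (\<lambda>y. (f x * \<eta> x) * (g y * \<eta> y)))"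
      using c by (simp add: A_def F_def ac_simps)
    moreover have "B (\<lambda>z. \<eta> (fst z) * \<eta> (snd z) * F z) = \<nu> (\<lambda>x. \<mu> (\<lambda>y. (g x * \<eta> x) * (f y * \<eta> y)))"
      using Cc_swap[OF c] by (simp add: B_def F_def ac_simps)
    ultimately show ?case
      using radon_product_tensor[OF \<mu> \<nu> fg] radon_product_tensor[OF \<nu> \<mu> fg(2,1)] by (simp add: F_def)
  next
    case (add F G)
    have "(\<lambda>z. \<eta> (fst z) * \<eta> (snd z) * F z) \<in> Cc" "(\<lambda>z. \<eta> (fst z) * \<eta> (snd z) * G z) \<in> Cc"
      using add.hyps by (auto intro!: Cc_tensor_mult[OF \<eta> \<eta>] tensor_sum_continuous)
    from A_add[OF this] B_add[OF this] show ?case using add.IH by (simp add: distrib_left)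
  qed
  obtain K where K: "compact K" "\<forall>x y. \<phi> (x, y) \<noteq> 0 \<longrightarrow> x \<in> K \<and> y \<in> K" by (rule Cc_prod_supp[OF \<phi>])
  obtain \<eta> where \<eta>: "\<eta> \<in> Cc" "\<forall>x. 0 \<le> \<eta> x" "\<forall>x. \<eta> x \<le> 1" "\<forall>x\<in>K. \<eta> x = 1" by (rule cutoff[OF K(1)])
  let ?S = "supp \<eta> \<times> supp \<eta>"
  \<comment> \<open>Multiplication by \<open>?H\<close> leaves \<open>\<phi>\<close> unchanged,
    because \<open>\<eta>\<close> is \<open>1\<close> on the compact set carrying both coordinates,
    and it turns the approximating tensor sum into a function of compact support.\<close>
  let ?H = "\<lambda>z. \<eta> (fst z) * \<eta> (snd z)"
  have H: "?H \<in> Cc" using Cc_tensor_mult[OF \<eta>(1) \<eta>(1), of "\<lambda>_. 1"] by simp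
  have \<phi>H: "?H z * \<phi> z = \<phi> z" for z
    using K(2)[rule_format, of "fst z" "snd z"] \<eta>(4) by (cases "\<phi> z = 0") auto
  have "\<bar>A \<phi> - B \<phi>\<bar> \<le> e * (A ?H + B ?H)" if e: "0 < e" for e
  proof -
    have "\<exists>g. tensor_sum g \<and> (\<forall>z\<in>?S. \<bar>\<phi> z - g z\<bar> < e)"
    proof (rule Stone_Weierstrass_HOL[where P = tensor_sum])
      show "compact ?S" by (intro compact_Times Cc_compact_supp \<eta>(1))
      show "tensor_sum (\<lambda>z. c)" for c using tensor_sum.tensor[of "\<lambda>_. c" "\<lambda>_. 1"] by simp
      show "continuous_on ?S f" if "tensor_sum f" for f
        by (rule continuous_on_subset[OF tensor_sum_continuous[OF that]]) simp
      show "tensor_sum (\<lambda>z. f z + g z)" if "tensor_sum f \<and> tensor_sum g" for f g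
        using that tensor_sum.add by blast
      show "tensor_sum (\<lambda>z. f z * g z)" if "tensor_sum f \<and> tensor_sum g" for f g
        using that tensor_sum_mult by blast
      show "continuous_on ?S \<phi>" by (rule continuous_on_subset[OF Cc_continuous[OF \<phi>]]) simp
      show "0 < e" by (rule e)
      fix z w :: "'a \<times> 'a" assume "z \<in> ?S \<and> w \<in> ?S \<and> z \<noteq> w"
      have sep: "\<exists>f. continuous_on UNIV f \<and> f x \<noteq> (f y :: real)" if xy: "x \<noteq> y" for x y :: 'a
      proof -
        obtain f where f: "f \<in> Cc" "\<forall>x. 0 \<le> f x" "\<forall>x. f x \<le> 1" "\<forall>z\<in>{x}. f z = 1" "supp f \<subseteq> - {y}"
          by (rule urysohn[of "{x}" "- {y}"]) (use xy in auto)
        then have "f x = 1" "f y = 0" using not_in_supp[of y f] by auto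
        then show ?thesis using Cc_continuous[OF f(1)] by (intro exI[of _ f]) simp
      qed
      show "\<exists>f. tensor_sum f \<and> f z \<noteq> f w"
      proof (cases "fst z = fst w")
        case False
        then obtain f where f: "continuous_on UNIV f" "f (fst z) \<noteq> (f (fst w) :: real)" using sep by blast
        have "tensor_sum (\<lambda>z. f (fst z) * (\<lambda>_. 1) (snd z))" by (rule tensor_sum.tensor[OF f(1)]) simp
        then show ?thesis using f(2) by (intro exI[of _ "\<lambda>z. f (fst z) * (\<lambda>_. 1) (snd z)"]) simp
      next
        case True
        then have "snd z \<noteq> snd w" using \<open>z \<in> ?S \<and> w \<in> ?S \<and> z \<noteq> w\<close> by (auto simp: prod_eq_iff)
        then obtain f where f: "continuous_on UNIV f" "f (snd z) \<noteq> (f (snd w) :: real)" using sep by blast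
        have "tensor_sum (\<lambda>z. (\<lambda>_. 1) (fst z) * f (snd z))" by (rule tensor_sum.tensor[OF _ f(1)]) simp
        then show ?thesis using f(2) by (intro exI[of _ "\<lambda>z. (\<lambda>_. 1) (fst z) * f (snd z)"]) simp
      qed
    qed
    then obtain g where g: "tensor_sum g" "\<forall>z\<in>?S. \<bar>\<phi> z - g z\<bar> < e" by blast
    let ?G = "\<lambda>z. ?H z * g z"
    have G: "?G \<in> Cc" by (rule Cc_tensor_mult[OF \<eta>(1) \<eta>(1) tensor_sum_continuous[OF g(1)]])
    let ?D = "\<lambda>z. \<phi> z - ?G z"
    have D: "?D \<in> Cc" by (rule Cc_diff[OF \<phi> G])
    have bound: "\<bar>?D z\<bar> \<le> e * ?H z" for z
    proof -
      have H0: "0 \<le> ?H z" using \<eta>(2) by simp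
      have "?D z = ?H z * (\<phi> z - g z)" using \<phi>H[of z] by (simp add: right_diff_distrib)
      then have 1: "\<bar>?D z\<bar> = ?H z * \<bar>\<phi> z - g z\<bar>" using H0 by (metis abs_mult abs_of_nonneg)
      show ?thesis
      proof (cases "z \<in> ?S")
        case True
        then have "\<bar>\<phi> z - g z\<bar> \<le> e" using g(2) by (meson less_imp_le)
        then have "?H z * \<bar>\<phi> z - g z\<bar> \<le> ?H z * e" using H0 by (rule mult_left_mono)
        then show ?thesis using 1 by (simp add: mult.commute)
      next
        case False
        then have 0: "?H z = 0" using not_in_supp[of "fst z" \<eta>] not_in_supp[of "snd z" \<eta>] by (cases z) auto
        show ?thesis using 1 unfolding 0 by simp
      qed
    qed
    have eH: "(\<lambda>z. e * ?H z) \<in> Cc" by (rule Cc_scale[OF H])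
    have "\<bar>A ?D\<bar> \<le> e * A ?H" "\<bar>B ?D\<bar> \<le> e * B ?H"
      using A_abs[OF D eH] B_abs[OF D eH] bound A_scale[OF H, of e] B_scale[OF H, of e] by simp_all
    moreover have "A \<phi> = A ?D + A ?G" "B \<phi> = B ?D + B ?G"
      using A_add[OF D G] B_add[OF D G] by simp_all
    ultimately show ?thesis using AB[OF \<eta>(1) g(1)] by (simp add: distrib_left abs_le_iff)
  qed
  note est = this
  have "\<bar>A \<phi> - B \<phi>\<bar> \<le> 0"
  proof (rule field_le_epsilon)
    fix e :: real assume e: "0 < e"
    have AB0: "0 \<le> A ?H + B ?H" using order_trans[OF abs_ge_zero A_abs[OF H H]] order_trans[OF abs_ge_zero B_abs[OF H H]] \<eta>(2) by simp
    define d where "d = e / (A ?H + B ?H + 1)"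
    have d: "0 < d" using e AB0 by (simp add: d_def)
    have "d * (A ?H + B ?H + 1) = e" using AB0 by (simp add: d_def)
    then have "d * (A ?H + B ?H) \<le> e" using d by (simp add: distrib_left)
    then show "\<bar>A \<phi> - B \<phi>\<bar> \<le> 0 + e" using est[OF d] by simp
  qed
  then show ?thesis by (simp add: A_def B_def)
qed

text \<open>Tonelli's theorem for lower semicontinuous functions. The kernel is the directed
  supremum of its continuous minorants, and directed suprema pass first through the inner integral
  and then through the outer one.\<close>

lemma pos_integral_product:
  fixes k :: "'a \<times> 'a \<Rightarrow> ennreal"
  assumes \<mu>: "\<mu> \<in> radon_pos" and \<nu>: "\<nu> \<in> radon_pos" and k: "lower_semicont k"
  shows "lower_semicont (\<lambda>x. pos_integral \<nu> (\<lambda>y. k (x, y)))"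
    "pos_integral (radon_product \<mu> \<nu>) k = pos_integral \<mu> (\<lambda>x. pos_integral \<nu> (\<lambda>y. k (x, y)))"
proof -
  interpret P: lch_space "TYPE('a \<times> 'a)" by (rule prod_lch)
  have Cc: "\<phi> \<in> Cc" "\<And>z. 0 \<le> \<phi> z" if "\<phi> \<in> Cc_below k" for \<phi> using that by (auto simp: Cc_below_def)
  have ne: "Cc_below k \<noteq> {}" using Cc_below_zero by blast
  have inner: "pos_integral \<nu> (\<lambda>y. k (x, y)) = (SUP \<phi>\<in>Cc_below k. ennreal (\<nu> (\<lambda>y. \<phi> (x, y))))" for x
  proof -
    define F where "F = (\<lambda>\<phi> y. ennreal ((\<phi>::'a\<times>'a\<Rightarrow>real) (x, y)))"
    have eq: "(\<lambda>y. k (x, y)) = (\<lambda>y. SUP g\<in>F ` Cc_below k. g y)"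
      unfolding image_image F_def using P.lower_semicont_eq_SUP[OF k] by (rule ext)
    have "pos_integral \<nu> (\<lambda>y. SUP g\<in>F ` Cc_below k. g y) = (SUP g\<in>F ` Cc_below k. pos_integral \<nu> g)"
    proof (rule pos_integral_directed_SUP[OF \<nu>])
      show "F ` Cc_below k \<noteq> {}" using ne by blast
      show "lower_semicont g" if g: "g \<in> F ` Cc_below k" for g
      proof -
        obtain \<phi> where "\<phi> \<in> Cc_below k" "g = F \<phi>" using g by blast
        then show ?thesis
          using lower_semicont_continuous[OF Cc_continuous[OF Cc_slice[OF Cc(1), of \<phi> x]]] by (simp add: F_def)
      qed
      fix f g assume "f \<in> F ` Cc_below k" "g \<in> F ` Cc_below k"
      then obtain \<phi> \<psi> where pq: "\<phi> \<in> Cc_below k" "\<psi> \<in> Cc_below k" "f = F \<phi>" "g = F \<psi>" by blast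
      have "F \<phi> y \<le> F (\<lambda>z. max (\<phi> z) (\<psi> z)) y \<and> F \<psi> y \<le> F (\<lambda>z. max (\<phi> z) (\<psi> z)) y" for y
        by (simp add: F_def ennreal_leI)
      then show "\<exists>h\<in>F ` Cc_below k. \<forall>x. f x \<le> h x \<and> g x \<le> h x"
        using Cc_below_max[OF pq(1,2)] pq(3,4) by blast
    qed
    moreover have "pos_integral \<nu> (F \<phi>) = ennreal (\<nu> (\<lambda>y. \<phi> (x, y)))" if "\<phi> \<in> Cc_below k" for \<phi>
      unfolding F_def by (rule pos_integral_Cc[OF \<nu> Cc_slice[OF Cc(1)[OF that]] Cc(2)[OF that]])
    ultimately show ?thesis unfolding eq by (simp add: image_image)
  qed
  define G where "G = (\<lambda>\<phi> x. ennreal (\<nu> (\<lambda>y. (\<phi>::'a\<times>'a\<Rightarrow>real) (x, y))))"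
  have Gl: "lower_semicont (G \<phi>)" if "\<phi> \<in> Cc_below k" for \<phi>
    unfolding G_def by (rule lower_semicont_continuous[OF Cc_continuous[OF Cc_partial_integral[OF \<nu> Cc(1)[OF that]]]])
  have eq: "(\<lambda>x. pos_integral \<nu> (\<lambda>y. k (x, y))) = (\<lambda>x. SUP \<phi>\<in>Cc_below k. G \<phi> x)"
    by (simp add: inner G_def)
  show "lower_semicont (\<lambda>x. pos_integral \<nu> (\<lambda>y. k (x, y)))" unfolding eq by (rule lower_semicont_SUP[OF Gl])
  have "pos_integral \<mu> (\<lambda>x. SUP g\<in>G ` Cc_below k. g x) = (SUP g\<in>G ` Cc_below k. pos_integral \<mu> g)"
  proof (rule pos_integral_directed_SUP[OF \<mu>])
    show "G ` Cc_below k \<noteq> {}" using ne by blast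
    show "lower_semicont g" if "g \<in> G ` Cc_below k" for g using that Gl by blast
    fix f g assume "f \<in> G ` Cc_below k" "g \<in> G ` Cc_below k"
    then obtain \<phi> \<psi> where pq: "\<phi> \<in> Cc_below k" "\<psi> \<in> Cc_below k" "f = G \<phi>" "g = G \<psi>" by blast
    let ?m = "\<lambda>z. max (\<phi> z) (\<psi> z)"
    have m: "?m \<in> Cc_below k" by (rule Cc_below_max[OF pq(1,2)])
    have "G \<phi> x \<le> G ?m x \<and> G \<psi> x \<le> G ?m x" for x
      using radon_pos_mono[OF \<nu> Cc_slice[OF Cc(1)[OF pq(1)]] Cc_slice[OF Cc(1)[OF m]], of x x]
        radon_pos_mono[OF \<nu> Cc_slice[OF Cc(1)[OF pq(2)]] Cc_slice[OF Cc(1)[OF m]], of x x]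
      by (simp add: G_def ennreal_leI)
    then show "\<exists>h\<in>G ` Cc_below k. \<forall>x. f x \<le> h x \<and> g x \<le> h x" using m pq(3,4) by blast
  qed
  moreover have "pos_integral \<mu> (G \<phi>) = ennreal (radon_product \<mu> \<nu> \<phi>)" if p: "\<phi> \<in> Cc_below k" for \<phi>
    using pos_integral_Cc[OF \<mu> Cc_partial_integral[OF \<nu> Cc(1)[OF p]]] radon_pos_nonneg[OF \<nu> Cc_slice[OF Cc(1)[OF p]]]
      Cc[OF p] by (simp add: G_def)
  ultimately show "pos_integral (radon_product \<mu> \<nu>) k = pos_integral \<mu> (\<lambda>x. pos_integral \<nu> (\<lambda>y. k (x, y)))"
    unfolding eq pos_integral_eq[of "radon_product \<mu> \<nu>"] by (simp add: image_image)
qed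

lemma pos_integral_product_commute:
  fixes k :: "'a \<times> 'a \<Rightarrow> ennreal"
  assumes \<mu>: "\<mu> \<in> radon_pos" and \<nu>: "\<nu> \<in> radon_pos" and sym: "\<And>x y. k (x, y) = k (y, x)"
  shows "pos_integral (radon_product \<mu> \<nu>) k = pos_integral (radon_product \<nu> \<mu>) k"
proof -
  have le: "pos_integral (radon_product a b) k \<le> pos_integral (radon_product b a) k"
    if a: "a \<in> radon_pos" and b: "b \<in> radon_pos" for a b
    unfolding pos_integral_eq[of "radon_product a b"]
  proof (rule SUP_least)
    fix \<phi> assume "\<phi> \<in> Cc_below k"
    then have c: "\<phi> \<in> Cc" "\<forall>z. 0 \<le> \<phi> z" "\<forall>z. ennreal (\<phi> z) \<le> k z" by (auto simp: Cc_below_def)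
    have "ennreal (\<phi> (snd z, fst z)) \<le> k z" for z using c(3)[rule_format, of "(snd z, fst z)"] sym[of "snd z" "fst z"] by simp
    then have "(\<lambda>z. \<phi> (snd z, fst z)) \<in> Cc_below k" using Cc_swap[OF c(1)] c(2) by (simp add: Cc_below_def del: split_paired_All)
    then have "ennreal (radon_product b a (\<lambda>z. \<phi> (snd z, fst z))) \<le> pos_integral (radon_product b a) k"
      by (rule pos_integral_upper)
    then show "ennreal (radon_product a b \<phi>) \<le> pos_integral (radon_product b a) k"
      using radon_product_swap[OF a b c(1)] by (simp del: radon_product_apply)
  qed
  show ?thesis by (rule antisym[OF le[OF \<mu> \<nu>] le[OF \<nu> \<mu>]])
qed

lemma radon_product_diff:
  assumes pos: "(a::'a functional) \<in> radon_pos" "b \<in> radon_pos" "c \<in> radon_pos" "d \<in> radon_pos"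
  shows "radon_product (radon_diff a b) (radon_diff c d) =
    radon_diff (radon_plus (radon_product a c) (radon_product b d)) (radon_plus (radon_product a d) (radon_product b c))"
proof (rule extensionalityI[of _ Cc])
  show "radon_product (radon_diff a b) (radon_diff c d) \<in> extensional Cc" by (simp add: radon_product_def)
  show "radon_diff (radon_plus (radon_product a c) (radon_product b d)) (radon_plus (radon_product a d) (radon_product b c)) \<in> extensional Cc"
    by (simp add: radon_diff_def)
  fix \<phi> :: "'a \<times> 'a \<Rightarrow> real" assume \<phi>: "\<phi> \<in> Cc"
  let ?c = "\<lambda>x. c (\<lambda>y. \<phi> (x, y))" and ?d = "\<lambda>x. d (\<lambda>y. \<phi> (x, y))"
  have cd: "?c \<in> Cc" "?d \<in> Cc" by (rule Cc_partial_integral[OF pos(3) \<phi>], rule Cc_partial_integral[OF pos(4) \<phi>])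
  have "radon_product (radon_diff a b) (radon_diff c d) \<phi> = radon_diff a b (\<lambda>x. ?c x - ?d x)"
    using \<phi> by (simp add: Cc_slice[OF \<phi>])
  also have "\<dots> = (a ?c - a ?d) - (b ?c - b ?d)"
    using Cc_diff[OF cd] radon_diff_arg[OF radon_pos_radon[OF pos(1)] cd] radon_diff_arg[OF radon_pos_radon[OF pos(2)] cd] by simp
  finally show "radon_product (radon_diff a b) (radon_diff c d) \<phi> =
      radon_diff (radon_plus (radon_product a c) (radon_product b d)) (radon_plus (radon_product a d) (radon_product b c)) \<phi>"
    using \<phi> by simp
qed

text \<open>A function \<open>0 \<le> \<psi> \<le> \<eta>\<close> with \<open>\<mu> \<psi>\<close> close to \<open>\<mu>\<^sup>+ \<eta>\<close> makes \<open>\<psi>\<mu>\<close> close to \<open>\<eta>\<mu>\<^sup>+\<close> in total variation.\<close>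

lemma pos_part_product_le:
  assumes \<mu>: "(\<mu>::'a functional) \<in> radon"
  shows "pos_integral (radon_product (pos_part \<mu>) (pos_part \<mu>)) k \<le> pos_integral (pos_part (radon_product \<mu> \<mu>)) k"
proof -
  interpret P: lch_space "TYPE('a \<times> 'a)" by (rule prod_lch)
  define p where "p = pos_part \<mu>"
  define n where "n = neg_part \<mu>"
  have p: "p \<in> radon_pos" and n: "n \<in> radon_pos"
    using pos_part_radon_pos(1)[OF \<mu>] neg_part_radon_pos[OF \<mu>] by (auto simp: p_def n_def)
  have \<mu>eq: "\<mu> = radon_diff p n" using jordan_decomposition[OF \<mu>] by (simp add: p_def n_def)
  have \<mu>\<mu>: "radon_product \<mu> \<mu> \<in> radon"
    unfolding \<mu>eq radon_product_diff[OF p n p n]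
    by (intro radon_diff_radon radon_pos_radon P.radon_plus_pos radon_product_pos p n)
  show ?thesis
  proof (rule P.pos_integral_mono_functional)
    fix \<phi> :: "'a \<times> 'a \<Rightarrow> real" assume \<phi>: "\<phi> \<in> Cc" "\<forall>z. 0 \<le> \<phi> z"
    obtain K where K: "compact K" "\<forall>x y. \<phi> (x, y) \<noteq> 0 \<longrightarrow> x \<in> K \<and> y \<in> K" by (rule Cc_prod_supp[OF \<phi>(1)])
    obtain \<eta> where \<eta>: "\<eta> \<in> Cc" "\<forall>x. 0 \<le> \<eta> x" "\<forall>x. \<eta> x \<le> 1" "\<forall>x\<in>K. \<eta> x = 1" by (rule cutoff[OF K(1)])
    obtain B where B: "0 < B" "\<forall>z. \<bar>\<phi> z\<bar> \<le> B" by (rule Cc_bounded[OF \<phi>(1)])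
    have p\<eta>: "0 \<le> p \<eta>" using radon_pos_nonneg[OF p \<eta>(1)] \<eta>(2) by simp
    \<comment> \<open>Replacing one factor \<open>p\<close> after the other by
      \<open>\<psi>\<mu>\<close> costs \<open>B * p \<eta> * e\<close> and
      \<open>B * e * (p \<eta> + e)\<close>. What remains is the integral of
      \<open>\<psi> x * \<psi> y * \<phi> (x, y)\<close> with respect to
      \<open>\<mu> \<otimes> \<mu>\<close>, a competitor in the supremum that defines the positive
      part.\<close>
    have main: "radon_product p p \<phi> \<le> pos_part (radon_product \<mu> \<mu>) \<phi> + e * (B * (2 * p \<eta> + e))" if e: "0 < e" for e
    proof -
      have "jordan_sup \<mu> \<eta> - e < jordan_sup \<mu> \<eta>" using e by simp
      then obtain \<psi> where "\<psi> \<in> Cc_order_interval \<eta>" and \<psi>e: "jordan_sup \<mu> \<eta> - e < \<mu> \<psi>"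
        unfolding jordan_sup_def
        using less_cSUP_iff[OF _ jordan_sup_bounded[OF \<mu> \<eta>(1,2)]] zero_in_Cc_order_interval[OF \<eta>(2)] by blast
      then have \<psi>: "\<psi> \<in> Cc" "\<forall>x. 0 \<le> \<psi> x" "\<forall>x. \<psi> x \<le> \<eta> x" by (auto simp: Cc_order_interval_def)
      have d: "(\<lambda>x. \<eta> x - \<psi> x) \<in> Cc" by (rule Cc_diff[OF \<eta>(1) \<psi>(1)])
      \<comment> \<open>The left side is the total mass of
        \<open>(\<eta> - \<psi>) p + \<psi> n\<close>, which equals
        \<open>\<eta> p - \<psi> \<mu>\<close>. It is small since \<open>p \<eta>\<close> is the
        supremum that \<open>\<psi>\<close> nearly attains.\<close>
      have var: "p (\<lambda>x. \<eta> x - \<psi> x) + n \<psi> < e"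
      proof -
        have "p \<eta> - e < p \<psi> - n \<psi>"
          using \<psi>e pos_part_radon_pos(2)[OF \<mu> \<eta>(1,2)] \<psi>(1) \<mu>eq by (metis p_def radon_diff_apply)
        then show ?thesis using radon_diff_arg[OF radon_pos_radon[OF p] \<eta>(1) \<psi>(1)] by simp
      qed
      have pd0: "0 \<le> p (\<lambda>x. \<eta> x - \<psi> x)" using radon_pos_nonneg[OF p d] \<psi>(3) by simp
      have p\<psi>: "p \<psi> \<le> p \<eta>" using radon_pos_mono[OF p \<psi>(1) \<eta>(1)] \<psi>(3) by simp
      have close: "\<bar>p (\<lambda>x. g x * \<eta> x) - \<mu> (\<lambda>x. g x * \<psi> x)\<bar> \<le> C * e"
        if g: "continuous_on UNIV g" "\<forall>x. \<bar>g x\<bar> \<le> C" for g C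
      proof -
        have c: "(\<lambda>x. g x * \<eta> x) \<in> Cc" "(\<lambda>x. g x * \<psi> x) \<in> Cc" "(\<lambda>x. g x * (\<eta> x - \<psi> x)) \<in> Cc"
          using Cc_mult_continuous[OF \<eta>(1) g(1)] Cc_mult_continuous[OF \<psi>(1) g(1)] Cc_mult_continuous[OF d g(1)] by auto
        have C: "0 \<le> C" using g(2) abs_ge_zero order_trans by blast
        have "p (\<lambda>x. g x * \<eta> x) - p (\<lambda>x. g x * \<psi> x) = p (\<lambda>x. g x * (\<eta> x - \<psi> x))"
          using radon_diff_arg[OF radon_pos_radon[OF p] c(1,2)] by (simp add: right_diff_distrib)
        moreover have "\<bar>p (\<lambda>x. g x * (\<eta> x - \<psi> x))\<bar> \<le> p (\<lambda>x. C * (\<eta> x - \<psi> x))"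
          by (rule radon_abs_le[OF p c(3) Cc_scale[OF d]])
            (use g(2) \<psi>(3) in \<open>auto simp: abs_mult intro!: mult_mono\<close>)
        moreover have "\<bar>n (\<lambda>x. g x * \<psi> x)\<bar> \<le> n (\<lambda>x. C * \<psi> x)"
          by (rule radon_abs_le[OF n c(2) Cc_scale[OF \<psi>(1)]])
            (use g(2) \<psi>(2) in \<open>auto simp: abs_mult intro!: mult_mono\<close>)
        moreover have "p (\<lambda>x. C * (\<eta> x - \<psi> x)) + n (\<lambda>x. C * \<psi> x) \<le> C * e"
          using radon_scale[OF radon_pos_radon[OF p] d, of C] radon_scale[OF radon_pos_radon[OF n] \<psi>(1), of C]
            mult_left_mono[OF less_imp_le[OF var] C] by (simp add: distrib_left)
        moreover have "\<mu> (\<lambda>x. g x * \<psi> x) = p (\<lambda>x. g x * \<psi> x) - n (\<lambda>x. g x * \<psi> x)"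
          using c(2) \<mu>eq by (metis radon_diff_apply)
        ultimately show ?thesis by linarith
      qed
      have sl: "continuous_on UNIV (\<lambda>y. \<phi> (x, y))" "\<forall>y. \<bar>\<phi> (x, y)\<bar> \<le> B" for x
        using Cc_continuous[OF Cc_slice[OF \<phi>(1)]] B(2) by auto
      define \<Phi> where "\<Phi> = (\<lambda>z. \<psi> (fst z) * \<psi> (snd z) * \<phi> z)"
      define \<Psi> where "\<Psi> = (\<lambda>z. \<psi> (snd z) * \<phi> z)"
      have c2: "continuous_on UNIV (\<lambda>z::'a\<times>'a. \<psi> (snd z))"
        by (rule continuous_on_compose2[OF Cc_continuous[OF \<psi>(1)]]) (auto intro!: continuous_intros)
      have \<Phi>Cc: "\<Phi> \<in> Cc" unfolding \<Phi>_def by (rule Cc_tensor_mult[OF \<psi>(1) \<psi>(1) Cc_continuous[OF \<phi>(1)]])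
      have \<Psi>Cc: "\<Psi> \<in> Cc" unfolding \<Psi>_def by (rule Cc_mult_continuous[OF \<phi>(1) c2])
      define G where "G = (\<lambda>x. p (\<lambda>y. \<phi> (x, y)))"
      define F where "F = (\<lambda>x. \<mu> (\<lambda>y. \<phi> (x, y) * \<psi> y))"
      have GCc: "G \<in> Cc" unfolding G_def by (rule Cc_partial_integral[OF p \<phi>(1)])
      have Feq: "F x = p (\<lambda>y. \<Psi> (x, y)) - n (\<lambda>y. \<Psi> (x, y))" for x
        using Cc_slice[OF \<Psi>Cc, of x] \<mu>eq by (simp add: F_def \<Psi>_def mult.commute)
      have FCc: "F \<in> Cc" unfolding Feq[abs_def]
        by (rule Cc_diff[OF Cc_partial_integral[OF p \<Psi>Cc] Cc_partial_integral[OF n \<Psi>Cc]])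
      have \<phi>\<eta>: "\<phi> (x, y) * \<eta> y = \<phi> (x, y)" "\<phi> (x, y) * \<eta> x = \<phi> (x, y)" for x y
        using K(2)[rule_format, of x y] \<eta>(4) by (cases "\<phi> (x, y) = 0"; auto)+
      have GF: "\<bar>G x - F x\<bar> \<le> B * e" for x using close[OF sl, of x] by (simp add: G_def F_def \<phi>\<eta>)
      have G\<eta>: "G x * \<eta> x = G x" for x
      proof -
        have "(\<lambda>y. \<eta> x * \<phi> (x, y)) = (\<lambda>y. \<phi> (x, y))" using \<phi>\<eta>(2)[of x] by (simp only: mult.commute)
        then show ?thesis
          using radon_scale[OF radon_pos_radon[OF p] Cc_slice[OF \<phi>(1)], of "\<eta> x" x] by (simp add: G_def mult.commute)
      qed
      have GB: "\<bar>G x\<bar> \<le> B * p \<eta>" for x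
      proof -
        have "\<bar>p (\<lambda>y. \<phi> (x, y))\<bar> \<le> p (\<lambda>y. B * \<eta> y)"
        proof (rule radon_abs_le[OF p Cc_slice[OF \<phi>(1)] Cc_scale[OF \<eta>(1)]])
          fix y show "\<bar>\<phi> (x, y)\<bar> \<le> B * \<eta> y"
            using B(2)[rule_format, of "(x, y)"] K(2)[rule_format, of x y] \<eta>(2,4) B(1) by (cases "\<phi> (x, y) = 0") auto
        qed
        then show ?thesis using radon_scale[OF radon_pos_radon[OF p] \<eta>(1), of B] by (simp add: G_def)
      qed
      have 1: "\<bar>p G - \<mu> (\<lambda>x. G x * \<psi> x)\<bar> \<le> B * p \<eta> * e"
        using close[OF Cc_continuous[OF GCc], of "B * p \<eta>"] GB by (simp add: G\<eta>)
      have cGF: "(\<lambda>x. G x * \<psi> x) \<in> Cc" "(\<lambda>x. F x * \<psi> x) \<in> Cc" by (rule Cc_mult[OF GCc \<psi>(1)], rule Cc_mult[OF FCc \<psi>(1)])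
      have cd: "(\<lambda>x. G x * \<psi> x - F x * \<psi> x) \<in> Cc" by (rule Cc_diff[OF cGF])
      have bd: "\<bar>G x * \<psi> x - F x * \<psi> x\<bar> \<le> (B * e) * \<psi> x" for x
        using GF[of x] \<psi>(2) by (simp add: left_diff_distrib[symmetric] abs_mult mult_right_mono)
      have "\<bar>p (\<lambda>x. G x * \<psi> x - F x * \<psi> x)\<bar> \<le> (B * e) * p \<psi>" "\<bar>n (\<lambda>x. G x * \<psi> x - F x * \<psi> x)\<bar> \<le> (B * e) * n \<psi>"
        using radon_abs_le[OF p cd Cc_scale[OF \<psi>(1)] bd] radon_abs_le[OF n cd Cc_scale[OF \<psi>(1)] bd]
          radon_scale[OF radon_pos_radon[OF p] \<psi>(1), of "B * e"] radon_scale[OF radon_pos_radon[OF n] \<psi>(1), of "B * e"] by simp_all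
      moreover have "\<mu> (\<lambda>x. G x * \<psi> x) - \<mu> (\<lambda>x. F x * \<psi> x) = p (\<lambda>x. G x * \<psi> x - F x * \<psi> x) - n (\<lambda>x. G x * \<psi> x - F x * \<psi> x)"
        using radon_diff_arg[OF \<mu> cGF] cd \<mu>eq by (metis radon_diff_apply)
      moreover have "(B * e) * p \<psi> + (B * e) * n \<psi> \<le> (B * e) * (p \<eta> + e)"
        unfolding distrib_left[symmetric] using p\<psi> var pd0 B(1) e by (intro mult_left_mono) auto
      ultimately have 2: "\<bar>\<mu> (\<lambda>x. G x * \<psi> x) - \<mu> (\<lambda>x. F x * \<psi> x)\<bar> \<le> (B * e) * (p \<eta> + e)" by linarith
      have "radon_product \<mu> \<mu> \<Phi> = \<mu> (\<lambda>x. F x * \<psi> x)"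
      proof -
        have "\<mu> (\<lambda>y. \<Phi> (x, y)) = F x * \<psi> x" for x
          using radon_scale[OF \<mu>, of "\<lambda>y. \<phi> (x, y) * \<psi> y" "\<psi> x"] Cc_mult[OF Cc_slice[OF \<phi>(1)] \<psi>(1), of x]
          by (simp add: F_def \<Phi>_def ac_simps)
        then show ?thesis using \<Phi>Cc by simp
      qed
      moreover have "radon_product \<mu> \<mu> \<Phi> \<le> jordan_sup (radon_product \<mu> \<mu>) \<phi>"
      proof (rule jordan_sup_upper[OF \<mu>\<mu> \<phi>])
        have "0 \<le> \<Phi> z \<and> \<Phi> z \<le> \<phi> z" for z
        proof -
          have "\<psi> x \<le> 1" for x using \<psi>(3) \<eta>(3) order_trans by blast
          then have "\<psi> (fst z) * \<psi> (snd z) \<le> 1" using \<psi>(2) by (simp add: mult_le_one)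
          moreover have "0 \<le> \<psi> (fst z) * \<psi> (snd z)" using \<psi>(2) by simp
          moreover have "0 \<le> \<phi> z" using \<phi>(2) by blast
          ultimately show ?thesis unfolding \<Phi>_def by (metis mult_left_le_one_le mult_nonneg_nonneg)
        qed
        then show "\<Phi> \<in> Cc_order_interval \<phi>" using \<Phi>Cc by (simp add: Cc_order_interval_def)
      qed
      moreover have "radon_product p p \<phi> = p G" using \<phi>(1) by (simp add: G_def)
      ultimately show ?thesis
        using 1 2 P.pos_part_radon_pos(2)[OF \<mu>\<mu> \<phi>] by (simp add: algebra_simps)
    qed
    have "radon_product p p \<phi> \<le> pos_part (radon_product \<mu> \<mu>) \<phi>"
    proof (rule field_le_epsilon)
      fix \<epsilon> :: real assume e: "0 < \<epsilon>"
      \<comment> \<open>An upper bound of \<open>B * (2 * p \<eta> + d)\<close> for all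
        \<open>d \<le> 1\<close>; the summand \<open>1\<close> makes division by it safe.\<close>
      define M where "M = B * (2 * p \<eta> + 1) + 1"
      have M: "1 \<le> M" using B(1) p\<eta> by (simp add: M_def)
      define d where "d = min 1 (\<epsilon> / M)"
      have d: "0 < d" "d \<le> 1" using e M by (auto simp: d_def)
      have "B * (2 * p \<eta> + d) \<le> B * (2 * p \<eta> + 1)" using d B(1) by (intro mult_left_mono) auto
      then have "B * (2 * p \<eta> + d) \<le> M" by (simp add: M_def)
      then have "d * (B * (2 * p \<eta> + d)) \<le> d * M" using d by (intro mult_left_mono) auto
      also have "d * M \<le> \<epsilon> / M * M" using M by (intro mult_right_mono) (auto simp: d_def)
      also have "\<dots> = \<epsilon>" using M by simp
      finally show "radon_product p p \<phi> \<le> pos_part (radon_product \<mu> \<mu>) \<phi> + \<epsilon>" using main[OF d(1)] by linarith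
    qed
    then show "radon_product (pos_part \<mu>) (pos_part \<mu>) \<phi> \<le> pos_part (radon_product \<mu> \<mu>) \<phi>" by (simp only: p_def)
  qed
qed

end

section \<open>Energy and the strong topology\<close>

lemma quadratic_nonneg_imp_discriminant:
  fixes a b c :: real
  assumes "\<And>t. 0 \<le> a + 2 * t * b + t\<^sup>2 * c" "0 \<le> c"
  shows "b\<^sup>2 \<le> a * c"
proof (cases "c = 0")
  case True
  have "b = 0"
  proof (rule ccontr)
    assume b: "b \<noteq> 0"
    \<comment> \<open>This value of \<open>t\<close> makes the right side equal to
      \<open>-1\<close>.\<close>
    have "0 \<le> a + 2 * (- (a + 1) / (2 * b)) * b" using assms(1)[of "- (a + 1) / (2 * b)"] True by simp
    then show False using b by (simp add: field_simps)
  qed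
  then show ?thesis using True by simp
next
  case False
  then have c: "0 < c" using assms(2) by simp
  have "0 \<le> a + 2 * (- b / c) * b + (- b / c)\<^sup>2 * c" by (rule assms(1))
  also have "\<dots> = a - b\<^sup>2 / c" using c by (simp add: power2_eq_square field_simps)
  finally show ?thesis using c by (simp add: field_simps)
qed

definition pos_potential :: "('a::topological_space \<times> 'a \<Rightarrow> ennreal) \<Rightarrow> 'a functional \<Rightarrow> 'a \<Rightarrow> ennreal" where
  "pos_potential \<kappa> \<mu> x = pos_integral \<mu> (\<lambda>y. \<kappa> (x, y))"

definition pos_energy :: "('a::topological_space \<times> 'a \<Rightarrow> ennreal) \<Rightarrow> 'a functional \<Rightarrow> 'a functional \<Rightarrow> ennreal" where
  "pos_energy \<kappa> \<mu> \<nu> = pos_integral (radon_product \<mu> \<nu>) \<kappa>"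

text \<open>\<open>enn2real\<close> sends \<open>\<infinity>\<close> to \<open>0\<close>; the value
  is the true mutual energy on positive measures of finite energy, where infinite values are
  excluded.\<close>

definition energy_inner :: "('a::topological_space \<times> 'a \<Rightarrow> ennreal) \<Rightarrow> 'a functional \<Rightarrow> 'a functional \<Rightarrow> real" where
  "energy_inner \<kappa> \<mu> \<nu> = enn2real (pos_energy \<kappa> \<mu> \<nu>)"

text \<open>\<open>energy_gap \<kappa> a b\<close> is \<open>\<parallel>a - b\<parallel>\<^sup>2\<close>, expressed through positive measures only.\<close>

definition energy_gap :: "('a::topological_space \<times> 'a \<Rightarrow> ennreal) \<Rightarrow> 'a functional \<Rightarrow> 'a functional \<Rightarrow> real" where
  "energy_gap \<kappa> a b = energy_inner \<kappa> a a + energy_inner \<kappa> b b - 2 * energy_inner \<kappa> a b"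

section \<open>The energy form on positive measures of finite energy\<close>

locale perfect_kernel = lch_space T for T :: "'a::t2_space itself" +
  fixes \<kappa> :: "'a \<times> 'a \<Rightarrow> ennreal"
  assumes perfect: "perfect \<kappa>"
begin

abbreviation "U \<equiv> pos_potential \<kappa>"
abbreviation "E \<equiv> pos_energy \<kappa>"
abbreviation "B \<equiv> energy_inner \<kappa>"
abbreviation "Q \<equiv> energy_gap \<kappa>"
abbreviation "Epos \<equiv> finite_energy_pos \<kappa>"
abbreviation "sd \<equiv> strong_dist \<kappa>"

lemma kernel_sym: "\<kappa> (x, y) = \<kappa> (y, x)" and kernel_lsc: "lower_semicont \<kappa>"
  using perfect by (auto simp: perfect_def kernel_def)

lemma potential_lsc: "\<mu> \<in> radon_pos \<Longrightarrow> lower_semicont (U \<mu>)"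
  unfolding pos_potential_def[abs_def] by (rule pos_integral_product(1)[OF radon_zero_pos _ kernel_lsc])

lemma potential_pos: "\<mu> \<in> radon_pos \<Longrightarrow> potential \<kappa> \<mu> x = enn2ereal (U \<mu> x)"
  unfolding potential_def pos_potential_def by (rule signed_integral_pos(1))

lemma mutual_energy_pos:
  assumes "\<mu> \<in> radon_pos" "\<nu> \<in> radon_pos" shows "mutual_energy \<kappa> \<mu> \<nu> = enn2ereal (E \<mu> \<nu>)"
proof -
  interpret P: lch_space "TYPE('a \<times> 'a)" by (rule prod_lch)
  show ?thesis unfolding mutual_energy_def pos_energy_def
    by (rule P.signed_integral_pos(1)[OF radon_product_pos[OF assms]])
qed

lemma pos_energy_eq: "\<mu> \<in> radon_pos \<Longrightarrow> \<nu> \<in> radon_pos \<Longrightarrow> E \<mu> \<nu> = pos_integral \<mu> (U \<nu>)"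
  unfolding pos_energy_def pos_potential_def[abs_def] by (rule pos_integral_product(2)[OF _ _ kernel_lsc])

lemma pos_energy_commute: "\<mu> \<in> radon_pos \<Longrightarrow> \<nu> \<in> radon_pos \<Longrightarrow> E \<mu> \<nu> = E \<nu> \<mu>"
  unfolding pos_energy_def by (rule pos_integral_product_commute, assumption, assumption, rule kernel_sym)

lemma pos_energy_plus_left:
  assumes "\<mu> \<in> radon_pos" "\<nu> \<in> radon_pos" "\<rho> \<in> radon_pos"
  shows "E (radon_plus \<mu> \<nu>) \<rho> = E \<mu> \<rho> + E \<nu> \<rho>"
  using assms by (simp add: pos_energy_eq radon_plus_pos pos_integral_radon_plus)

lemma pos_energy_cmult_left:
  assumes "\<mu> \<in> radon_pos" "\<rho> \<in> radon_pos" "0 \<le> c"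
  shows "E (radon_cmult c \<mu>) \<rho> = ennreal c * E \<mu> \<rho>"
  using assms by (simp add: pos_energy_eq radon_cmult_pos pos_integral_radon_cmult)

lemma pos_energy_mono:
  assumes pos: "\<mu> \<in> radon_pos" "\<nu> \<in> radon_pos" "\<rho> \<in> radon_pos"
    and le: "\<And>\<phi>. \<phi> \<in> Cc \<Longrightarrow> \<forall>x. 0 \<le> \<phi> x \<Longrightarrow> \<mu> \<phi> \<le> \<nu> \<phi>"
  shows "E \<mu> \<rho> \<le> E \<nu> \<rho>"
  unfolding pos_energy_eq[OF pos(1,3)] pos_energy_eq[OF pos(2,3)]
  by (rule pos_integral_mono_functional) (rule le)

lemma finite_energy_pos_iff: "\<mu> \<in> Epos \<longleftrightarrow> \<mu> \<in> radon_pos \<and> E \<mu> \<mu> < \<infinity>"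
proof -
  interpret P: lch_space "TYPE('a \<times> 'a)" by (rule prod_lch)
  have "energy_defined \<kappa> \<mu>" "(\<bar>energy \<kappa> \<mu>\<bar> \<noteq> \<infinity>) = (E \<mu> \<mu> < \<infinity>)" if "\<mu> \<in> radon_pos"
  proof -
    show "energy_defined \<kappa> \<mu>" unfolding energy_defined_def
      by (rule P.signed_integral_pos(2)[OF radon_product_pos[OF that that]])
    show "(\<bar>energy \<kappa> \<mu>\<bar> \<noteq> \<infinity>) = (E \<mu> \<mu> < \<infinity>)"
      unfolding mutual_energy_pos[OF that that] by (cases "E \<mu> \<mu>") (auto simp: enn2ereal_ennreal)
  qed
  then show ?thesis by (auto simp: finite_energy_pos_def finite_energy_def radon_pos_radon)
qed

lemma Epos_pos: "\<mu> \<in> Epos \<Longrightarrow> \<mu> \<in> radon_pos"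
  by (simp add: finite_energy_pos_def)

lemma mutual_energy_diff:
  assumes a: "a \<in> Epos" and b: "b \<in> Epos"
  shows "energy_defined \<kappa> (radon_diff a b)"
    "energy \<kappa> (radon_diff a b) = enn2ereal (E a a + E b b) - enn2ereal (E a b + E b a)"
proof -
  interpret P: lch_space "TYPE('a \<times> 'a)" by (rule prod_lch)
  have ab: "a \<in> radon_pos" "b \<in> radon_pos" "E a a < \<infinity>" "E b b < \<infinity>" using a b by (auto simp: finite_energy_pos_iff)
  note pr = radon_product_pos[OF ab(1,1)] radon_product_pos[OF ab(2,2)] radon_product_pos[OF ab(1,2)] radon_product_pos[OF ab(2,1)]
  have fin: "pos_integral (radon_plus (radon_product a a) (radon_product b b)) \<kappa> < \<infinity>"
    using ab(3,4) unfolding P.pos_integral_radon_plus[OF pr(1,2)] pos_energy_def by simp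
  show "energy_defined \<kappa> (radon_diff a b)"
    unfolding energy_defined_def radon_product_diff[OF ab(1,2,1,2)]
    by (rule P.signed_integral_diff(1)[OF P.radon_plus_pos[OF pr(1,2)] P.radon_plus_pos[OF pr(3,4)] fin])
  show "energy \<kappa> (radon_diff a b) = enn2ereal (E a a + E b b) - enn2ereal (E a b + E b a)"
    unfolding mutual_energy_def radon_product_diff[OF ab(1,2,1,2)]
      P.signed_integral_diff(2)[OF P.radon_plus_pos[OF pr(1,2)] P.radon_plus_pos[OF pr(3,4)] fin]
      P.pos_integral_radon_plus[OF pr(1,2)] P.pos_integral_radon_plus[OF pr(3,4)] pos_energy_def ..
qed

lemma energy_principleD:
  assumes "\<mu> \<in> radon" "energy_defined \<kappa> \<mu>"
  shows "0 \<le> energy \<kappa> \<mu>" "energy \<kappa> \<mu> = 0 \<Longrightarrow> \<mu> = radon_zero"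
  using perfect assms unfolding perfect_def energy_principle_def by blast+

lemma radon_diff_Epos_radon: "a \<in> Epos \<Longrightarrow> b \<in> Epos \<Longrightarrow> radon_diff a b \<in> radon"
  by (intro radon_diff_radon radon_pos_radon Epos_pos)

text \<open>If the mutual energy were infinite, the energy of \<open>a - b\<close> would be defined
  with value \<open>-\<infinity>\<close>, against the energy principle.\<close>

lemma pos_energy_finite:
  assumes a: "a \<in> Epos" and b: "b \<in> Epos" shows "E a b < \<infinity>"
proof (rule ccontr)
  assume "\<not> E a b < \<infinity>"
  then have "E a b = \<infinity>" by (metis infinity_ennreal_def top.not_eq_extremum)
  moreover have "E a a < \<infinity>" "E b b < \<infinity>" using a b by (auto simp: finite_energy_pos_iff)
  ultimately have "energy \<kappa> (radon_diff a b) = - \<infinity>"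
    unfolding mutual_energy_diff(2)[OF a b] by (cases "E a a"; cases "E b b") (auto simp: enn2ereal_ennreal simp flip: ennreal_plus)
  then show False using energy_principleD(1)[OF radon_diff_Epos_radon[OF a b] mutual_energy_diff(1)[OF a b]] by simp
qed

lemma pos_energy_real: "a \<in> Epos \<Longrightarrow> b \<in> Epos \<Longrightarrow> E a b = ennreal (B a b)"
  using pos_energy_finite[of a b] by (simp add: energy_inner_def)

lemma energy_inner_nonneg: "0 \<le> B a b"
  by (simp add: energy_inner_def)

lemma energy_inner_commute: "a \<in> Epos \<Longrightarrow> b \<in> Epos \<Longrightarrow> B a b = B b a"
  using pos_energy_commute[OF Epos_pos Epos_pos] by (simp add: energy_inner_def)

lemma energy_radon_diff:
  assumes a: "a \<in> Epos" and b: "b \<in> Epos"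
  shows "energy \<kappa> (radon_diff a b) = ereal (Q a b)" "radon_diff a b \<in> finite_energy \<kappa>"
proof -
  show 1: "energy \<kappa> (radon_diff a b) = ereal (Q a b)"
    unfolding mutual_energy_diff(2)[OF a b]
    using pos_energy_real[OF a a] pos_energy_real[OF b b] pos_energy_real[OF a b] pos_energy_real[OF b a]
      energy_inner_commute[OF a b] energy_inner_nonneg
    by (simp add: enn2ereal_ennreal energy_gap_def flip: ennreal_plus)
  show "radon_diff a b \<in> finite_energy \<kappa>"
    using radon_diff_Epos_radon[OF a b] mutual_energy_diff(1)[OF a b] 1 by (simp add: finite_energy_def)
qed

lemma energy_gap_nonneg: "a \<in> Epos \<Longrightarrow> b \<in> Epos \<Longrightarrow> 0 \<le> Q a b"
  using energy_principleD(1)[OF radon_diff_Epos_radon mutual_energy_diff(1)] energy_radon_diff(1) by force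

lemma radon_diff_eq_zero:
  assumes "\<mu> \<in> radon" "\<nu> \<in> radon" "radon_diff \<mu> \<nu> = (radon_zero :: 'a functional)" shows "\<mu> = \<nu>"
proof (rule radon_eqI[OF assms(1,2)])
  fix \<phi> :: "'a \<Rightarrow> real" assume p: "\<phi> \<in> Cc"
  have "radon_diff \<mu> \<nu> \<phi> = radon_zero \<phi>" using assms(3) by simp
  then show "\<mu> \<phi> = \<nu> \<phi>" using p by simp
qed

lemma energy_gap_eq_zero:
  assumes a: "a \<in> Epos" and b: "b \<in> Epos" and "Q a b = 0" shows "a = b"
proof (rule radon_diff_eq_zero)
  show "a \<in> radon" "b \<in> radon" using a b by (auto intro: radon_pos_radon Epos_pos)
  show "radon_diff a b = radon_zero"
    using energy_principleD(2)[OF radon_diff_Epos_radon[OF a b] mutual_energy_diff(1)[OF a b]]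
      energy_radon_diff(1)[OF a b] assms(3) by simp
qed

lemma Epos_plus:
  assumes a: "a \<in> Epos" and b: "b \<in> Epos" shows "radon_plus a b \<in> Epos"
proof -
  note p = Epos_pos[OF a] Epos_pos[OF b]
  have "E (radon_plus a b) (radon_plus a b) = E a a + E b a + (E a b + E b b)"
    using p pos_energy_commute[OF _ radon_plus_pos[OF p]] by (simp add: pos_energy_plus_left radon_plus_pos)
  then show ?thesis
    using pos_energy_finite[OF a a] pos_energy_finite[OF b a] pos_energy_finite[OF a b] pos_energy_finite[OF b b]
    by (simp add: finite_energy_pos_iff radon_plus_pos p)
qed

lemma Epos_cmult:
  assumes a: "a \<in> Epos" and c: "0 \<le> c" shows "radon_cmult c a \<in> Epos"
proof -
  note p = Epos_pos[OF a]
  have "E (radon_cmult c a) (radon_cmult c a) = ennreal c * (ennreal c * E a a)"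
    using p c pos_energy_commute[OF _ radon_cmult_pos[OF p c]] by (simp add: pos_energy_cmult_left radon_cmult_pos)
  then show ?thesis using pos_energy_finite[OF a a] by (simp add: finite_energy_pos_iff radon_cmult_pos p c ennreal_mult_less_top)
qed

text \<open>The energy is monotone in each argument separately; symmetry allows the comparison to be
  made twice.\<close>

lemma Epos_mono:
  assumes a: "a \<in> Epos" and b: "b \<in> radon_pos" and le: "\<And>\<phi>. \<phi> \<in> Cc \<Longrightarrow> \<forall>x. 0 \<le> \<phi> x \<Longrightarrow> b \<phi> \<le> a \<phi>"
  shows "b \<in> Epos"
proof -
  note p = Epos_pos[OF a]
  have "E b b \<le> E a b" by (rule pos_energy_mono[OF b p b le])
  also have "E a b = E b a" by (rule pos_energy_commute[OF p b])
  also have "E b a \<le> E a a" by (rule pos_energy_mono[OF b p p le])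
  finally show ?thesis using pos_energy_finite[OF a a] b by (auto simp: finite_energy_pos_iff intro: order_le_less_trans)
qed

lemma Epos_restrict:
  assumes "a \<in> Epos" "S \<in> sets (radon_measure a)" shows "radon_restrict a S \<in> Epos"
  by (rule Epos_mono[OF assms(1) radon_restrict_pos[OF Epos_pos[OF assms(1)] assms(2)] radon_restrict_le[OF Epos_pos[OF assms(1)] assms(2)]])

lemma Epos_zero: "radon_zero \<in> Epos"
  using pos_energy_eq[OF radon_zero_pos radon_zero_pos] pos_integral_radon_zero by (simp add: finite_energy_pos_iff radon_zero_pos)

lemma energy_inner_zero_left: "b \<in> Epos \<Longrightarrow> B radon_zero b = 0"
  using pos_energy_eq[OF radon_zero_pos Epos_pos] pos_integral_radon_zero by (simp add: energy_inner_def)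

lemma energy_inner_zero_right: "b \<in> Epos \<Longrightarrow> B b radon_zero = 0"
  using energy_inner_zero_left energy_inner_commute[OF _ Epos_zero] by simp

lemma energy_inner_plus_left:
  assumes "a \<in> Epos" "b \<in> Epos" "c \<in> Epos" shows "B (radon_plus a b) c = B a c + B b c"
proof -
  have "E (radon_plus a b) c = ennreal (B a c) + ennreal (B b c)"
    unfolding pos_energy_plus_left[OF assms[THEN Epos_pos]] pos_energy_real[OF assms(1,3)] pos_energy_real[OF assms(2,3)] ..
  also have "\<dots> = ennreal (B a c + B b c)" by (rule ennreal_plus[symmetric]) (rule energy_inner_nonneg)+
  finally have "enn2real (E (radon_plus a b) c) = enn2real (ennreal (B a c + B b c))" by simp
  then show ?thesis
    unfolding energy_inner_def[of _ "radon_plus a b" c]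
      enn2real_ennreal[OF add_nonneg_nonneg[OF energy_inner_nonneg energy_inner_nonneg]] .
qed

lemma energy_inner_plus_right:
  assumes "a \<in> Epos" "b \<in> Epos" "c \<in> Epos" shows "B c (radon_plus a b) = B c a + B c b"
  using energy_inner_plus_left[OF assms] energy_inner_commute assms Epos_plus by metis

lemma energy_inner_cmult_left:
  assumes "a \<in> Epos" "c \<in> Epos" "0 \<le> t" shows "B (radon_cmult t a) c = t * B a c"
  using pos_energy_cmult_left[OF Epos_pos[OF assms(1)] Epos_pos[OF assms(2)] assms(3)] assms(3)
  by (simp add: energy_inner_def enn2real_mult)

lemma energy_inner_cmult_right:
  assumes "a \<in> Epos" "c \<in> Epos" "0 \<le> t" shows "B c (radon_cmult t a) = t * B c a"
  using energy_inner_cmult_left[OF assms] energy_inner_commute assms Epos_cmult by metis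

lemmas energy_inner_linear = energy_inner_plus_left energy_inner_plus_right energy_inner_cmult_left
  energy_inner_cmult_right Epos_plus Epos_cmult

lemma energy_gap_commute: "a \<in> Epos \<Longrightarrow> b \<in> Epos \<Longrightarrow> Q a b = Q b a"
  using energy_inner_commute[of a b] by (simp add: energy_gap_def)

lemma energy_gap_plus:
  assumes "a \<in> Epos" "b \<in> Epos" "c \<in> Epos" "d \<in> Epos"
  shows "Q (radon_plus a c) (radon_plus b d) = Q a b + 2 * (B a c - B a d - B b c + B b d) + Q c d"
  using assms energy_inner_commute[OF assms(1,3)] energy_inner_commute[OF assms(2,3)] energy_inner_commute[OF assms(2,4)]
    energy_inner_commute[OF assms(1,4)]
  by (simp add: energy_gap_def energy_inner_linear algebra_simps)

lemma energy_gap_cmult: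
  assumes "a \<in> Epos" "b \<in> Epos" "0 \<le> t" shows "Q (radon_cmult t a) (radon_cmult t b) = t\<^sup>2 * Q a b"
  using assms by (simp add: energy_gap_def energy_inner_linear power2_eq_square algebra_simps)

text \<open>The Cauchy-Schwarz inequality for the signed measures \<open>a - b\<close> and
  \<open>c - d\<close>, expanded so that only mutual energies of positive measures occur.\<close>

lemma energy_cauchy_schwarz:
  assumes ab: "a \<in> Epos" "b \<in> Epos" and cd: "c \<in> Epos" "d \<in> Epos"
  shows "\<bar>B a c - B a d - B b c + B b d\<bar> \<le> sqrt (Q a b) * sqrt (Q c d)"
proof -
  let ?i = "B a c - B a d - B b c + B b d"
  have "?i\<^sup>2 \<le> Q a b * Q c d"
  proof (rule quadratic_nonneg_imp_discriminant)
    show "0 \<le> Q c d" by (rule energy_gap_nonneg[OF cd])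
    fix t :: real
    show "0 \<le> Q a b + 2 * t * ?i + t\<^sup>2 * Q c d"
    proof (cases "0 \<le> t")
      case True
      have "0 \<le> Q (radon_plus a (radon_cmult t c)) (radon_plus b (radon_cmult t d))"
        by (intro energy_gap_nonneg Epos_plus Epos_cmult ab cd True)
      also have "\<dots> = Q a b + 2 * t * ?i + t\<^sup>2 * Q c d"
        using ab cd True by (simp add: energy_gap_plus energy_gap_cmult energy_inner_linear algebra_simps)
      finally show ?thesis .
    next
      case False
      then have t: "0 \<le> - t" by simp
      \<comment> \<open>For negative \<open>t\<close> the measures \<open>c\<close> and
        \<open>d\<close> change sides, so that only nonnegative multiples of positive measures are
        formed.\<close>
      have "0 \<le> Q (radon_plus a (radon_cmult (- t) d)) (radon_plus b (radon_cmult (- t) c))"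
        by (intro energy_gap_nonneg Epos_plus Epos_cmult ab cd t)
      also have "\<dots> = Q a b + 2 * t * ?i + t\<^sup>2 * Q c d"
        using ab cd t energy_gap_commute[OF cd]
        by (simp add: energy_gap_plus[OF ab Epos_cmult[OF cd(2) t] Epos_cmult[OF cd(1) t]]
            energy_gap_cmult[OF cd(2,1) t] energy_inner_cmult_right[OF _ _ t] algebra_simps)
      finally show ?thesis .
    qed
  qed
  then have "sqrt (?i\<^sup>2) \<le> sqrt (Q a b * Q c d)" by (rule real_sqrt_le_mono)
  then show ?thesis by (simp add: real_sqrt_mult)
qed

lemma energy_gap_triangle:
  assumes ab: "a \<in> Epos" "b \<in> Epos" and cd: "c \<in> Epos" "d \<in> Epos"
  shows "sqrt (Q (radon_plus a c) (radon_plus b d)) \<le> sqrt (Q a b) + sqrt (Q c d)"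
proof (rule real_le_lsqrt)
  show "0 \<le> sqrt (Q a b) + sqrt (Q c d)" using energy_gap_nonneg ab cd by simp
  show "Q (radon_plus a c) (radon_plus b d) \<le> (sqrt (Q a b) + sqrt (Q c d))\<^sup>2"
    unfolding energy_gap_plus[OF ab cd]
    using energy_cauchy_schwarz[OF ab cd] energy_gap_nonneg[OF ab] energy_gap_nonneg[OF cd]
    by (simp add: power2_sum)
qed

section \<open>The metric space of signed measures of finite energy\<close>

text \<open>Finiteness of the energy controls the positive part of
  \<open>\<sigma> \<otimes> \<sigma>\<close>, which dominates the product of the positive part of
  \<open>\<sigma>\<close> with itself. The negative part follows by applying this to
  \<open>-\<sigma>\<close>, whose product with itself is the same.\<close>

lemma finite_energy_decomp:
  assumes \<sigma>: "\<sigma> \<in> finite_energy \<kappa>"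
  obtains a b where "a \<in> Epos" "b \<in> Epos" "\<sigma> = radon_diff a b"
proof -
  interpret P: lch_space "TYPE('a \<times> 'a)" by (rule prod_lch)
  have s: "\<sigma> \<in> radon" "integral_defined (radon_product \<sigma> \<sigma>) \<kappa>" "\<bar>signed_integral (radon_product \<sigma> \<sigma>) \<kappa>\<bar> \<noteq> \<infinity>"
    using \<sigma> by (auto simp: finite_energy_def energy_defined_def mutual_energy_def)
  let ?p = "pos_part \<sigma>" and ?n = "neg_part \<sigma>"
  let ?P = "radon_product \<sigma> \<sigma>"
  have pn: "?p \<in> radon_pos" "?n \<in> radon_pos" by (rule pos_part_radon_pos(1)[OF s(1)], rule neg_part_radon_pos[OF s(1)])
  \<comment> \<open>In \<open>ereal\<close> a difference whose first term is
    \<open>\<infinity>\<close> is again \<open>\<infinity>\<close>, so a finite value forces a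
    finite first term.\<close>
  have fin: "pos_integral (pos_part ?P) \<kappa> < \<infinity>"
    using s(2,3) unfolding integral_defined_def signed_integral_def
    by (cases "pos_integral (pos_part ?P) \<kappa>"; cases "pos_integral (neg_part ?P) \<kappa>") (auto simp: enn2ereal_ennreal)
  have "?p \<in> Epos"
    using order_le_less_trans[OF pos_part_product_le[OF s(1)] fin] pn by (simp add: finite_energy_pos_iff pos_energy_def)
  moreover have "?n \<in> Epos"
  proof -
    let ?m = "radon_diff radon_zero \<sigma>"
    have m: "?m \<in> radon" by (rule radon_diff_radon[OF radon_zero_radon s(1)])
    have se: "\<sigma> = radon_diff ?p ?n" by (rule jordan_decomposition[OF s(1), symmetric])
    have "?m = radon_diff ?n ?p"
    proof (rule radon_eqI[OF m radon_diff_radon[OF radon_pos_radon[OF pn(2)] radon_pos_radon[OF pn(1)]]])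
      fix \<phi> :: "'a \<Rightarrow> real" assume "\<phi> \<in> Cc"
      moreover have "\<sigma> \<phi> = radon_diff ?p ?n \<phi>" using se by simp
      ultimately show "?m \<phi> = radon_diff ?n ?p \<phi>" by simp
    qed
    moreover have "radon_product (radon_diff ?n ?p) (radon_diff ?n ?p) = radon_product (radon_diff ?p ?n) (radon_diff ?p ?n)"
      unfolding radon_product_diff[OF pn(2,1,2,1)] radon_product_diff[OF pn(1,2,1,2)]
      by (simp add: radon_plus_def add.commute)
    ultimately have "radon_product ?m ?m = ?P" using se by simp
    then show ?thesis
      using order_le_less_trans[OF pos_part_product_le[OF m]] fin pn by (simp add: finite_energy_pos_iff pos_energy_def neg_part_def)
  qed
  ultimately show ?thesis using that jordan_decomposition[OF s(1)] by metis
qed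

lemma radon_diff_diff:
  assumes "a \<in> Epos" "b \<in> Epos" "c \<in> Epos" "d \<in> Epos"
  shows "radon_diff (radon_diff a b) (radon_diff c d) = radon_diff (radon_plus a d) (radon_plus b c)"
  by (auto simp: radon_diff_def radon_plus_def fun_eq_iff)

lemma strong_dist_decomp:
  assumes "a \<in> Epos" "b \<in> Epos" "c \<in> Epos" "d \<in> Epos"
  shows "sd (radon_diff a b) (radon_diff c d) = sqrt (Q (radon_plus a d) (radon_plus b c))"
  using assms energy_radon_diff(2) energy_radon_diff(1)[of "radon_plus a d" "radon_plus b c"]
  by (simp add: strong_dist_def energy_norm_def radon_diff_diff Epos_plus)

lemma Metric_space_strong_dist: "Metric_space (finite_energy \<kappa>) (strong_dist \<kappa>)"
proof unfold_locales
  have rep: "\<exists>a b. a \<in> Epos \<and> b \<in> Epos \<and> x = radon_diff a b" if "x \<in> finite_energy \<kappa>" for x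
    using finite_energy_decomp[OF that] by metis
  \<comment> \<open>Nonnegativity and symmetry are required for all pairs, also outside the energy
    space, where the distance is \<open>0\<close> by default.\<close>
  have outside: "sd x y = 0" if "x \<notin> finite_energy \<kappa> \<or> y \<notin> finite_energy \<kappa>" for x y
    using that by (auto simp: strong_dist_def)
  fix x y :: "'a functional"
  show "0 \<le> sd x y"
  proof (cases "x \<in> finite_energy \<kappa> \<and> y \<in> finite_energy \<kappa>")
    case True
    then obtain a b c d where r: "a \<in> Epos" "b \<in> Epos" "x = radon_diff a b" "c \<in> Epos" "d \<in> Epos" "y = radon_diff c d"
      using rep by metis
    then show ?thesis using energy_gap_nonneg by (simp add: strong_dist_decomp Epos_plus)
  qed (use outside in auto)
  show "sd x y = sd y x"
  proof (cases "x \<in> finite_energy \<kappa> \<and> y \<in> finite_energy \<kappa>")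
    case True
    then obtain a b c d where r: "a \<in> Epos" "b \<in> Epos" "x = radon_diff a b" "c \<in> Epos" "d \<in> Epos" "y = radon_diff c d"
      using rep by metis
    have "radon_plus a d = radon_plus d a" "radon_plus b c = radon_plus c b" by (simp_all add: radon_plus_def add.commute)
    then show ?thesis using r energy_gap_commute[of "radon_plus a d" "radon_plus b c"] by (simp add: strong_dist_decomp Epos_plus)
  qed (use outside in auto)
  assume x: "x \<in> finite_energy \<kappa>" and y: "y \<in> finite_energy \<kappa>"
  obtain a b where ab: "a \<in> Epos" "b \<in> Epos" "x = radon_diff a b" using rep[OF x] by metis
  obtain c d where cd: "c \<in> Epos" "d \<in> Epos" "y = radon_diff c d" using rep[OF y] by metis
  have xy: "sd x y = sqrt (Q (radon_plus a d) (radon_plus b c))" using ab cd by (simp add: strong_dist_decomp)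
  show "(sd x y = 0) = (x = y)"
  proof
    assume "sd x y = 0"
    then have "Q (radon_plus a d) (radon_plus b c) = 0" using xy by simp
    then have eq: "radon_plus a d = radon_plus b c"
      by (rule energy_gap_eq_zero[OF Epos_plus[OF ab(1) cd(2)] Epos_plus[OF ab(2) cd(1)]])
    show "x = y"
    proof (rule radon_eqI)
      show "x \<in> radon" "y \<in> radon" using x y by (auto simp: finite_energy_def)
      fix \<phi> :: "'a \<Rightarrow> real" assume p: "\<phi> \<in> Cc"
      have "radon_plus a d \<phi> = radon_plus b c \<phi>" using eq by simp
      then show "x \<phi> = y \<phi>" using p ab cd by simp
    qed
  next
    assume "x = y"
    then have "sd x y = sqrt (Q (radon_plus a b) (radon_plus b a))" using ab strong_dist_decomp by metis
    moreover have "radon_plus a b = radon_plus b a" by (simp add: radon_plus_def add.commute)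
    moreover have "Q e e = 0" for e by (simp add: energy_gap_def)
    ultimately show "sd x y = 0" by simp
  qed
next
  fix x y z assume xyz: "x \<in> finite_energy \<kappa>" "y \<in> finite_energy \<kappa>" "z \<in> finite_energy \<kappa>"
  obtain a b where ab: "a \<in> Epos" "b \<in> Epos" "x = radon_diff a b" by (rule finite_energy_decomp[OF xyz(1)])
  obtain c d where cd: "c \<in> Epos" "d \<in> Epos" "y = radon_diff c d" by (rule finite_energy_decomp[OF xyz(2)])
  obtain e f where ef: "e \<in> Epos" "f \<in> Epos" "z = radon_diff e f" by (rule finite_energy_decomp[OF xyz(3)])
  note r = ab cd ef
  \<comment> \<open>Both measures contain the summand \<open>c + d\<close>; the gap depends only on
    the difference of its arguments, so this summand drops out.\<close>
  have "Q (radon_plus (radon_plus a d) (radon_plus c f)) (radon_plus (radon_plus b c) (radon_plus d e)) =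
      Q (radon_plus a f) (radon_plus b e)"
  proof -
    let ?s = "radon_plus c d"
    have s: "?s \<in> Epos" using r by (simp add: Epos_plus)
    have "radon_plus (radon_plus a d) (radon_plus c f) = radon_plus (radon_plus a f) ?s"
      "radon_plus (radon_plus b c) (radon_plus d e) = radon_plus (radon_plus b e) ?s"
      by (auto simp: radon_plus_def fun_eq_iff)
    then show ?thesis
      using energy_gap_plus[OF Epos_plus[OF r(1,8)] Epos_plus[OF r(2,7)] s s] by (simp add: energy_gap_def[of \<kappa> ?s ?s])
  qed
  then show "sd x z \<le> sd x y + sd y z"
    using r energy_gap_triangle[of "radon_plus a d" "radon_plus b c" "radon_plus c f" "radon_plus d e"]
    by (simp add: strong_dist_decomp Epos_plus)
qed

sublocale SM: Metric_space "finite_energy \<kappa>" "strong_dist \<kappa>"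
  by (rule Metric_space_strong_dist)

sublocale SP: Submetric "finite_energy \<kappa>" "strong_dist \<kappa>" "finite_energy_pos \<kappa>"
  by unfold_locales (simp add: finite_energy_pos_def)

lemma strong_topology_pos_eq: "strong_topology_pos \<kappa> = Metric_space.mtopology Epos sd"
  unfolding strong_topology_pos_def strong_topology_def SP.mtopology_submetric ..

lemma strong_dist_Epos:
  assumes a: "a \<in> Epos" and b: "b \<in> Epos" shows "sd a b = sqrt (Q a b)"
proof -
  have "a \<in> finite_energy \<kappa>" "b \<in> finite_energy \<kappa>" using a b by (auto simp: finite_energy_pos_def)
  then show ?thesis using energy_radon_diff(1)[OF a b] by (simp add: strong_dist_def energy_norm_def)
qed

lemma energy_norm_Epos: "a \<in> Epos \<Longrightarrow> energy_norm \<kappa> a = sqrt (B a a)"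
  using pos_energy_real[of a a] energy_inner_nonneg
  by (simp add: energy_norm_def mutual_energy_pos Epos_pos enn2ereal_ennreal)

lemma energy_inner_diff_le:
  assumes "a \<in> Epos" "b \<in> Epos" "c \<in> Epos" shows "\<bar>B a c - B b c\<bar> \<le> sd a b * sqrt (B c c)"
proof -
  have "Q c radon_zero = B c c"
    by (simp add: energy_gap_def energy_inner_zero_right Epos_zero assms)
  then show ?thesis
    using energy_cauchy_schwarz[OF assms Epos_zero] assms
    by (simp add: strong_dist_Epos energy_inner_zero_right)
qed

lemma energy_inner_le: "a \<in> Epos \<Longrightarrow> c \<in> Epos \<Longrightarrow> B a c \<le> sqrt (B a a) * sqrt (B c c)"
  using energy_inner_diff_le[of a radon_zero c] Epos_zero
  by (simp add: strong_dist_Epos energy_gap_def energy_inner_zero_left energy_inner_zero_right)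

lemma strong_complete:
  assumes s: "\<And>n. s n \<in> Epos" and cauchy: "\<And>e. 0 < e \<Longrightarrow> \<exists>N. \<forall>n\<ge>N. \<forall>m\<ge>N. Q (s n) (s m) < e"
  obtains l where "l \<in> Epos" "(\<lambda>n. sd (s n) l) \<longlonglongrightarrow> 0"
proof -
  have "SP.sub.MCauchy s"
    unfolding SP.sub.MCauchy_def
  proof (intro conjI allI impI)
    show "range s \<subseteq> Epos" using s by blast
    fix e :: real assume e: "0 < e"
    obtain N where N: "\<forall>n\<ge>N. \<forall>m\<ge>N. Q (s n) (s m) < e\<^sup>2" using cauchy[of "e\<^sup>2"] e by auto
    have "sd (s n) (s m) < e" if "N \<le> n" "N \<le> m" for n m
    proof -
      have "sqrt (Q (s n) (s m)) < sqrt (e\<^sup>2)" using N that by (intro real_sqrt_less_mono) blast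
      then show ?thesis using e s by (simp add: strong_dist_Epos)
    qed
    then show "\<exists>N. \<forall>n n'. N \<le> n \<longrightarrow> N \<le> n' \<longrightarrow> sd (s n) (s n') < e" by blast
  qed
  moreover have "SP.sub.mcomplete" using perfect by (simp add: perfect_def)
  ultimately obtain l where "limitin SP.sub.mtopology s l sequentially" unfolding SP.sub.mcomplete_def by blast
  then show ?thesis using that[of l] by (simp add: SP.sub.limitin_metric_dist_null)
qed

section \<open>Strong and vague limits\<close>

lemma closure_of_strong_iff:
  "S \<subseteq> Epos \<Longrightarrow> \<nu> \<in> strong_topology_pos \<kappa> closure_of S \<longleftrightarrow> \<nu> \<in> Epos \<and> (\<forall>e>0. \<exists>\<mu>\<in>S. sd \<nu> \<mu> < e)"
  unfolding strong_topology_pos_eq SP.sub.metric_closure_of SP.sub.in_mball by blast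

lemma limitin_strong_iff:
  "limitin (strong_topology_pos \<kappa>) f l F \<longleftrightarrow> l \<in> Epos \<and> (\<forall>\<^sub>F x in F. f x \<in> Epos) \<and> ((\<lambda>x. sd (f x) l) \<longlongrightarrow> 0) F"
  unfolding strong_topology_pos_eq by (rule SP.sub.limitin_metric_dist_null)

lemma topspace_vague: "topspace vague_topology = (radon :: 'a functional set)"
  unfolding vague_topology_def by (auto simp: radon_def PiE_UNIV_domain PiE_def)

lemma limitin_vague_apply:
  assumes "limitin (vague_topology :: 'a functional topology) f l F" "\<phi> \<in> Cc"
  shows "((\<lambda>x. f x \<phi>) \<longlongrightarrow> l \<phi>) F"
proof -
  have "continuous_map (vague_topology :: 'a functional topology) euclideanreal (\<lambda>\<mu>. \<mu> \<phi>)"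
    unfolding vague_topology_def
    by (rule continuous_map_from_subtopology[OF continuous_map_product_projection[OF assms(2)]])
  from continuous_map_limit[OF this assms(1)] show ?thesis by (simp add: o_def)
qed

text \<open>Perfectness compares the two topologies only on measures of finite energy; the limit is
  therefore taken in that subspace first and then in the larger space of all positive
  measures.\<close>

lemma strong_imp_vague:
  assumes "limitin (strong_topology_pos \<kappa>) f l F" shows "limitin (subtopology vague_topology radon_pos) f l F"
proof -
  have "limitin (subtopology vague_topology Epos) f l F"
    unfolding limitin_def
  proof (intro conjI allI impI)
    show "l \<in> topspace (subtopology vague_topology Epos)"
      using assms by (auto simp: limitin_strong_iff topspace_vague intro: radon_pos_radon Epos_pos)
    fix S assume "openin (subtopology vague_topology Epos) S \<and> l \<in> S"
    then have "openin (strong_topology_pos \<kappa>) S" "l \<in> S" using perfect by (auto simp: perfect_def)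
    then show "\<forall>\<^sub>F x in F. f x \<in> S" using assms by (auto simp: limitin_def)
  qed
  then have "l \<in> Epos" "\<forall>\<^sub>F x in F. f x \<in> Epos" "limitin vague_topology f l F" by (auto simp: limitin_subtopology)
  then show ?thesis unfolding limitin_subtopology by (auto intro: Epos_pos elim: eventually_mono)
qed

lemma strong_imp_pointwise:
  "limitin (strong_topology_pos \<kappa>) f l F \<Longrightarrow> \<phi> \<in> Cc \<Longrightarrow> ((\<lambda>x. f x \<phi>) \<longlongrightarrow> l \<phi>) F"
  using strong_imp_vague limitin_vague_apply unfolding limitin_subtopology by blast

lemma vague_limit_unique:
  assumes "limitin (vague_topology :: 'a functional topology) f l F" "limitin vague_topology f m F" "F \<noteq> bot"
  shows "l = m"
proof (rule radon_eqI)
  show "l \<in> radon" "m \<in> radon" using assms(1,2) by (auto simp: limitin_def topspace_vague)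
  show "l \<phi> = m \<phi>" if "\<phi> \<in> Cc" for \<phi>
    by (rule tendsto_unique[OF assms(3) limitin_vague_apply[OF assms(1) that] limitin_vague_apply[OF assms(2) that]])
qed

text \<open>The integral is a supremum of the vaguely continuous functionals
  \<open>\<mu> \<mapsto> \<mu> \<phi>\<close>, hence vaguely lower semicontinuous. Applied to slices
  of the kernel this is the principle of descent for potentials.\<close>

lemma pos_integral_vague_lsc:
  assumes lim: "\<And>\<phi>. \<phi> \<in> Cc \<Longrightarrow> ((\<lambda>x. f x \<phi>) \<longlongrightarrow> l \<phi>) F" and a: "a < pos_integral (l :: 'a functional) g"
  shows "\<forall>\<^sub>F x in F. a < pos_integral (f x) g"
proof -
  obtain \<phi> where \<phi>: "\<phi> \<in> Cc_below g" "a < ennreal (l \<phi>)"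
    using a unfolding pos_integral_eq less_SUP_iff by blast
  have "((\<lambda>x. ennreal (f x \<phi>)) \<longlongrightarrow> ennreal (l \<phi>)) F"
    by (rule tendsto_ennrealI[OF lim]) (use \<phi>(1) in \<open>simp add: Cc_below_def\<close>)
  then have "\<forall>\<^sub>F x in F. a < ennreal (f x \<phi>)" using \<phi>(2) by (rule order_tendstoD(1))
  then show ?thesis by (rule eventually_mono) (rule less_le_trans[OF _ pos_integral_upper[OF \<phi>(1)]])
qed

end

section \<open>Capacity and cones of measures on compact sets\<close>

lemma nonneg_if_linear_perturbation:
  fixes x y :: real
  assumes "\<And>t. 0 < t \<Longrightarrow> t \<le> 1 \<Longrightarrow> 0 \<le> x + t * y" shows "0 \<le> x"
proof (rule ccontr)
  assume x: "\<not> 0 \<le> x"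
  \<comment> \<open>Small enough that \<open>t * \<bar>y\<bar>\<close> cannot exceed
    \<open>- x / 2\<close>, and at most \<open>1\<close> as the assumption demands.\<close>
  define t where "t = min 1 (- x / (2 * (\<bar>y\<bar> + 1)))"
  have "0 < - x / (2 * (\<bar>y\<bar> + 1))" by (rule divide_pos_pos) (use x in auto)
  then have t: "0 < t" "t \<le> 1" by (auto simp: t_def)
  have "t * y \<le> t * (\<bar>y\<bar> + 1)" using t by (intro mult_left_mono) auto
  also have "t * (\<bar>y\<bar> + 1) \<le> (- x / (2 * (\<bar>y\<bar> + 1))) * (\<bar>y\<bar> + 1)" by (intro mult_right_mono) (auto simp: t_def)
  also have "\<dots> = - x / 2" by (simp add: field_simps)
  finally show False using assms[OF t] x by simp
qed

context perfect_kernel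
begin

lemma finite_energy_on_iff:
  assumes K: "compact K"
  shows "\<mu> \<in> finite_energy_on \<kappa> K \<longleftrightarrow> \<mu> \<in> Epos \<and> emeasure (radon_measure \<mu>) (-K) = 0"
proof
  assume "\<mu> \<in> finite_energy_on \<kappa> K"
  then show "\<mu> \<in> Epos \<and> emeasure (radon_measure \<mu>) (-K) = 0"
    using null_compl_of_radon_pos_on[OF _ compact_imp_closed[OF K]]
    by (auto simp: finite_energy_on_def finite_energy_pos_def radon_pos_on_def)
next
  assume "\<mu> \<in> Epos \<and> emeasure (radon_measure \<mu>) (-K) = 0"
  then show "\<mu> \<in> finite_energy_on \<kappa> K"
    using radon_pos_onI[OF _ _ compact_imp_closed[OF K] order.refl]
    by (auto simp: finite_energy_on_def finite_energy_pos_def)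
qed

lemma finite_energy_on_Epos: "finite_energy_on \<kappa> A \<subseteq> Epos"
  by (auto simp: finite_energy_on_def finite_energy_pos_def radon_pos_on_def)

lemma finite_energy_on_subset:
  assumes K: "compact K" "K \<subseteq> A" shows "finite_energy_on \<kappa> K \<subseteq> finite_energy_on \<kappa> A"
proof
  fix \<mu> assume "\<mu> \<in> finite_energy_on \<kappa> K"
  then have "\<mu> \<in> Epos" "emeasure (radon_measure \<mu>) (-K) = 0" using finite_energy_on_iff[OF K(1)] by auto
  then show "\<mu> \<in> finite_energy_on \<kappa> A"
    using radon_pos_onI[OF _ _ compact_imp_closed[OF K(1)] K(2)] by (auto simp: finite_energy_on_def finite_energy_pos_def)
qed

lemma carrier_AE:
  assumes "\<mu> \<in> radon_pos" "compact (K::'a set)" "emeasure (radon_measure \<mu>) (-K) = 0"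
  shows "AE x in radon_measure \<mu>. x \<in> K"
proof (rule AE_I')
  show "-K \<in> null_sets (radon_measure \<mu>)"
    using assms(3) open_in_sets_radon_measure[OF assms(1) open_Compl[OF compact_imp_closed[OF assms(2)]]] by auto
qed auto

lemma finite_energy_on_zero: "compact K \<Longrightarrow> radon_zero \<in> finite_energy_on \<kappa> K"
  using emeasure_open_radon_measure[OF radon_zero_pos open_Compl[OF compact_imp_closed]] pos_integral_radon_zero
  by (simp add: finite_energy_on_iff Epos_zero)

lemma finite_energy_on_plus:
  assumes K: "compact K" and "a \<in> finite_energy_on \<kappa> K" "b \<in> finite_energy_on \<kappa> K"
  shows "radon_plus a b \<in> finite_energy_on \<kappa> K"
proof -
  have ab: "a \<in> Epos" "b \<in> Epos" "emeasure (radon_measure a) (-K) = 0" "emeasure (radon_measure b) (-K) = 0"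
    using assms by (auto simp: finite_energy_on_iff)
  note p = Epos_pos[OF ab(1)] Epos_pos[OF ab(2)]
  have o: "open (-K)" by (rule open_Compl[OF compact_imp_closed[OF K]])
  show ?thesis
    using ab(3,4) emeasure_open_radon_measure[OF p(1) o] emeasure_open_radon_measure[OF p(2) o]
      emeasure_open_radon_measure[OF radon_plus_pos[OF p] o] pos_integral_radon_plus[OF p]
    by (simp add: finite_energy_on_iff[OF K] Epos_plus[OF ab(1,2)])
qed

lemma finite_energy_on_cmult:
  assumes K: "compact K" and "a \<in> finite_energy_on \<kappa> K" "0 \<le> c"
  shows "radon_cmult c a \<in> finite_energy_on \<kappa> K"
proof -
  have a: "a \<in> Epos" "emeasure (radon_measure a) (-K) = 0" using assms by (auto simp: finite_energy_on_iff)
  have o: "open (-K)" by (rule open_Compl[OF compact_imp_closed[OF K]])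
  show ?thesis
    using a(2) emeasure_open_radon_measure[OF Epos_pos[OF a(1)] o]
      emeasure_open_radon_measure[OF radon_cmult_pos[OF Epos_pos[OF a(1)] assms(3)] o]
      pos_integral_radon_cmult[OF Epos_pos[OF a(1)] assms(3)]
    by (simp add: finite_energy_on_iff[OF K] Epos_cmult[OF a(1) assms(3)])
qed

lemma finite_energy_on_restrict:
  assumes K: "compact K" and \<mu>: "\<mu> \<in> Epos" and S: "S \<in> sets (radon_measure \<mu>)" "S \<subseteq> K"
  shows "radon_restrict \<mu> S \<in> finite_energy_on \<kappa> K"
  using Epos_restrict[OF \<mu> S(1)] radon_restrict_null_compl[OF Epos_pos[OF \<mu>] S(1) compact_imp_closed[OF K] S(2)]
  by (simp add: finite_energy_on_iff[OF K])

lemma finite_energy_on_restrict_sets: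
  assumes K: "compact K" and \<mu>: "\<mu> \<in> finite_energy_on \<kappa> K" and S: "S \<in> sets (radon_measure \<mu>)"
  shows "radon_restrict \<mu> S \<in> finite_energy_on \<kappa> K"
proof -
  have m: "\<mu> \<in> Epos" "emeasure (radon_measure \<mu>) (-K) = 0" using \<mu> by (auto simp: finite_energy_on_iff[OF K])
  note p = Epos_pos[OF m(1)]
  have o: "open (-K)" by (rule open_Compl[OF compact_imp_closed[OF K]])
  have "pos_integral (radon_restrict \<mu> S) (indicator (-K)) \<le> pos_integral \<mu> (indicator (-K))"
    by (rule pos_integral_mono_functional) (rule radon_restrict_le[OF p S])
  then have "emeasure (radon_measure (radon_restrict \<mu> S)) (-K) = 0"
    using m(2) emeasure_open_radon_measure[OF p o] emeasure_open_radon_measure[OF radon_restrict_pos[OF p S] o] by simp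
  then show ?thesis using Epos_restrict[OF m(1) S] by (simp add: finite_energy_on_iff[OF K])
qed

section \<open>Sets of inner capacity zero and relations holding nearly everywhere\<close>

text \<open>If \<open>\<mu>\<close> charged \<open>K\<close>, its restriction to \<open>K\<close>,
  normalised to mass one, would be a competitor of finite energy and give \<open>K\<close> positive
  capacity.\<close>

lemma null_if_inner_cap_zero:
  assumes cap: "inner_cap \<kappa> N = 0" and K: "compact K" "K \<subseteq> N" and \<mu>: "\<mu> \<in> Epos"
  shows "emeasure (radon_measure \<mu>) K = 0"
proof (rule ccontr)
  assume n0: "emeasure (radon_measure \<mu>) K \<noteq> 0"
  note p = Epos_pos[OF \<mu>]
  have Ks: "K \<in> sets (radon_measure \<mu>)" by (rule compact_in_sets_radon_measure[OF p K(1)])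
  define m where "m = measure (radon_measure \<mu>) K"
  have "emeasure (radon_measure \<mu>) K < \<infinity>" by (rule emeasure_compact_finite[OF p K(1)])
  then have m: "emeasure (radon_measure \<mu>) K = ennreal m" by (simp add: m_def emeasure_eq_ennreal_measure)
  then have m0: "0 < m" using n0 by (metis ennreal_0 ennreal_neg m_def measure_nonneg not_less order_le_less)
  define r where "r = radon_restrict \<mu> K"
  have r: "r \<in> finite_energy_on \<kappa> K" unfolding r_def by (rule finite_energy_on_restrict[OF K(1) \<mu> Ks order.refl])
  then have r': "r \<in> Epos" "emeasure (radon_measure r) (-K) = 0" by (auto simp: finite_energy_on_iff[OF K(1)])
  obtain \<eta> where \<eta>: "\<eta> \<in> Cc" "\<forall>x. 0 \<le> \<eta> x" "\<forall>x. \<eta> x \<le> 1" "\<forall>x\<in>K. \<eta> x = 1" by (rule cutoff[OF K(1)])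
  have "r \<eta> = (LINT x|radon_measure \<mu>. indicator K x * \<eta> x)" using \<eta>(1) by (simp add: r_def radon_restrict_def)
  also have "\<dots> = (LINT x|radon_measure \<mu>. indicator K x)"
    by (rule Bochner_Integration.integral_cong[OF refl]) (use \<eta>(4) in \<open>auto simp: indicator_def\<close>)
  also have "\<dots> = m" using Ks by (simp add: m_def)
  finally have "mass r = ennreal m"
    using mass_eq_cutoff[OF Epos_pos[OF r'(1)] compact_imp_closed[OF K(1)] r'(2) \<eta>(1,2,4)] by simp
  define s where "s = radon_cmult (1 / m) r"
  have c: "0 \<le> 1 / m" using m0 by simp
  have s: "s \<in> finite_energy_on \<kappa> K" unfolding s_def by (rule finite_energy_on_cmult[OF K(1) r c])
  then have s': "s \<in> Epos" "emeasure (radon_measure s) (-K) = 0" by (auto simp: finite_energy_on_iff[OF K(1)])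
  have "mass s = ennreal (1 / m) * ennreal m"
    using pos_integral_radon_cmult[OF Epos_pos[OF r'(1)] c] \<open>mass r = ennreal m\<close> by (simp add: mass_def s_def)
  then have "mass s = 1" using m0 by (simp add: ennreal_mult[symmetric])
  moreover have "Supp s \<subseteq> K" by (rule Supp_subset[OF Epos_pos[OF s'(1)] compact_imp_closed[OF K(1)] s'(2)])
  ultimately have sm: "s \<in> {\<mu> \<in> radon_pos. Supp \<mu> \<subseteq> K \<and> mass \<mu> = 1}" using Epos_pos[OF s'(1)] by simp
  let ?I = "INF \<mu>\<in>{\<mu> \<in> radon_pos. Supp \<mu> \<subseteq> K \<and> mass \<mu> = 1}. energy \<kappa> \<mu>"
  have "?I \<le> energy \<kappa> s" by (rule INF_lower[OF sm])
  also have "\<dots> = ereal (B s s)"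
    using pos_energy_real[OF s'(1) s'(1)] energy_inner_nonneg by (simp add: mutual_energy_pos Epos_pos[OF s'(1)] enn2ereal_ennreal)
  finally have "?I < \<infinity>" by (rule order_le_less_trans) simp
  moreover have "0 \<le> ?I" by (rule INF_greatest) (auto simp: mutual_energy_pos)
  ultimately have "0 < cap \<kappa> K" unfolding cap_def by (cases ?I) (auto simp: divide_ereal_def)
  moreover have "cap \<kappa> K \<le> inner_cap \<kappa> N" unfolding inner_cap_def by (rule SUP_upper) (use K in simp)
  ultimately show False using cap by simp
qed

text \<open>A unit measure supported in \<open>K\<close> cannot be null on \<open>K\<close>. Hence
  every competitor has infinite energy, the infimum is \<open>\<infinity>\<close>, and its
  reciprocal is \<open>0\<close>.\<close>

lemma inner_cap_zeroI:
  assumes null: "\<And>K \<mu>. compact K \<Longrightarrow> K \<subseteq> N \<Longrightarrow> \<mu> \<in> finite_energy_on \<kappa> K \<Longrightarrow> emeasure (radon_measure \<mu>) K = 0"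
  shows "inner_cap \<kappa> N = 0"
proof -
  have "cap \<kappa> K = 0" if K: "compact K" "K \<subseteq> N" for K
  proof -
    have "energy \<kappa> \<mu> = \<infinity>" if m: "\<mu> \<in> radon_pos" "Supp \<mu> \<subseteq> K" "mass \<mu> = 1" for \<mu>
    proof (rule ccontr)
      assume "energy \<kappa> \<mu> \<noteq> \<infinity>"
      then have "E \<mu> \<mu> < \<infinity>" using m(1) by (cases "E \<mu> \<mu>") (auto simp: mutual_energy_pos)
      then have "\<mu> \<in> finite_energy_on \<kappa> K"
        using null_compl_of_Supp[OF m(1) compact_imp_closed[OF K(1)] m(2)] m(1)
        by (simp add: finite_energy_on_iff[OF K(1)] finite_energy_pos_iff)
      then have 0: "emeasure (radon_measure \<mu>) K = 0" "emeasure (radon_measure \<mu>) (-K) = 0"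
        using null[OF K] by (auto simp: finite_energy_on_iff[OF K(1)])
      have Ks: "K \<in> sets (radon_measure \<mu>)" by (rule compact_in_sets_radon_measure[OF m(1) K(1)])
      have "emeasure (radon_measure \<mu>) K + emeasure (radon_measure \<mu>) (-K) = emeasure (radon_measure \<mu>) (K \<union> -K)"
        by (rule plus_emeasure) (use Ks sets.compl_sets[OF Ks] in \<open>auto simp: Compl_eq_Diff_UNIV\<close>)
      then show False using 0 m(3) mass_eq_emeasure[OF m(1)] by simp
    qed
    then have "(INF \<mu>\<in>{\<mu> \<in> radon_pos. Supp \<mu> \<subseteq> K \<and> mass \<mu> = 1}. energy \<kappa> \<mu>) = \<infinity>"
      by (intro antisym INF_greatest) auto
    then show ?thesis by (simp add: cap_def)
  qed
  then have "(SUP K\<in>{K. compact K \<and> K \<subseteq> N}. cap \<kappa> K) = (SUP K\<in>{K. compact K \<and> K \<subseteq> N}. 0)"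
    by (intro SUP_cong) auto
  moreover have "{K. compact K \<and> K \<subseteq> N} \<noteq> {}" using compact_empty by blast
  ultimately show ?thesis by (simp add: inner_cap_def)
qed

text \<open>Turns capacity statements into almost everywhere statements, which combine freely. Since
  the property is Borel, an exceptional set inside \<open>K\<close> is measurable and can be
  exhausted by compact subsets, each null because its capacity vanishes.\<close>

lemma nearly_everywhere_iff:
  assumes P: "{x. P x} \<in> sets borel"
  shows "nearly_everywhere \<kappa> A P \<longleftrightarrow>
    (\<forall>K \<rho>. compact K \<and> K \<subseteq> A \<and> \<rho> \<in> finite_energy_on \<kappa> K \<longrightarrow> (AE x in radon_measure \<rho>. P x))"
proof (intro iffI allI impI)
  fix K \<rho> assume ne: "nearly_everywhere \<kappa> A P" and "compact K \<and> K \<subseteq> A \<and> \<rho> \<in> finite_energy_on \<kappa> K"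
  then have K: "compact K" "K \<subseteq> A" and r: "\<rho> \<in> Epos" "emeasure (radon_measure \<rho>) (-K) = 0"
    by (auto simp: finite_energy_on_iff)
  note p = Epos_pos[OF r(1)]
  define S where "S = K - {x. P x}"
  have S: "S \<in> sets (radon_measure \<rho>)"
    unfolding S_def using borel_in_sets_radon_measure[OF p] P compact_in_sets_radon_measure[OF p K(1)] by blast
  have "emeasure (radon_measure \<rho>) S \<le> ennreal e" if e: "0 < e" for e
  proof -
    obtain C where C: "compact C" "C \<subseteq> S" "emeasure (radon_measure \<rho>) (S - C) \<le> ennreal e"
      by (rule inner_regular[OF p S K(1) _ e]) (auto simp: S_def)
    have sub: "C \<subseteq> {x \<in> A. \<not> P x}" using C(2) K(2) by (auto simp: S_def)
    have C0: "emeasure (radon_measure \<rho>) C = 0"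
      by (rule null_if_inner_cap_zero[OF ne[unfolded nearly_everywhere_def] C(1) sub r(1)])
    have Cs: "C \<in> sets (radon_measure \<rho>)" by (rule compact_in_sets_radon_measure[OF p C(1)])
    have "S = C \<union> (S - C)" using C(2) by blast
    then have "emeasure (radon_measure \<rho>) S \<le> emeasure (radon_measure \<rho>) C + emeasure (radon_measure \<rho>) (S - C)"
      using emeasure_subadditive[OF Cs sets.Diff[OF S Cs]] by simp
    then show ?thesis using C(3) unfolding C0 add_0 by (rule order_trans)
  qed
  note small = this
  have "emeasure (radon_measure \<rho>) S \<le> 0"
  proof (rule ennreal_le_epsilon)
    fix e :: real assume "0 < e"
    then show "emeasure (radon_measure \<rho>) S \<le> 0 + ennreal e" using small[of e] by simp
  qed
  then have "S \<in> null_sets (radon_measure \<rho>)" using S by auto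
  then have "AE x in radon_measure \<rho>. x \<notin> S" by (rule AE_not_in)
  then show "AE x in radon_measure \<rho>. P x"
    using carrier_AE[OF p K(1) r(2)] by eventually_elim (auto simp: S_def)
next
  assume ae: "\<forall>K \<rho>. compact K \<and> K \<subseteq> A \<and> \<rho> \<in> finite_energy_on \<kappa> K \<longrightarrow> (AE x in radon_measure \<rho>. P x)"
  show "nearly_everywhere \<kappa> A P"
    unfolding nearly_everywhere_def
  proof (rule inner_cap_zeroI)
    fix K \<mu> assume K: "compact K" "K \<subseteq> {x \<in> A. \<not> P x}" and m: "\<mu> \<in> finite_energy_on \<kappa> K"
    have p: "\<mu> \<in> radon_pos" using m finite_energy_on_Epos Epos_pos by blast
    have "AE x in radon_measure \<mu>. P x" using ae K m by blast
    then have "AE x in radon_measure \<mu>. x \<notin> K" by eventually_elim (use K(2) in auto)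
    then show "emeasure (radon_measure \<mu>) K = 0"
      using AE_iff_measurable[OF compact_in_sets_radon_measure[OF p K(1)], of "\<lambda>x. x \<notin> K"] by simp
  qed
qed

lemma borel_potential: "\<mu> \<in> radon_pos \<Longrightarrow> U \<mu> \<in> borel_measurable borel"
  by (rule borel_measurable_lower_semicont[OF potential_lsc])

lemma nearly_everywhere_potential_le_iff:
  assumes "\<mu> \<in> radon_pos" "\<nu> \<in> radon_pos"
  shows "nearly_everywhere \<kappa> A (\<lambda>x. potential \<kappa> \<mu> x \<le> potential \<kappa> \<nu> x) \<longleftrightarrow>
    (\<forall>K \<rho>. compact K \<and> K \<subseteq> A \<and> \<rho> \<in> finite_energy_on \<kappa> K \<longrightarrow> (AE x in radon_measure \<rho>. U \<mu> x \<le> U \<nu> x))"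
proof -
  have "{x. U \<mu> x \<le> U \<nu> x} \<in> sets borel"
    using borel_measurable_le[OF borel_potential borel_potential, of \<mu> \<nu>] assms by simp
  from nearly_everywhere_iff[OF this, of A] show ?thesis
    by (simp add: potential_pos assms less_eq_ennreal.rep_eq[symmetric])
qed

lemma nearly_everywhere_potential_eq_iff:
  assumes "\<mu> \<in> radon_pos" "\<nu> \<in> radon_pos"
  shows "nearly_everywhere \<kappa> A (\<lambda>x. potential \<kappa> \<mu> x = potential \<kappa> \<nu> x) \<longleftrightarrow>
    (\<forall>K \<rho>. compact K \<and> K \<subseteq> A \<and> \<rho> \<in> finite_energy_on \<kappa> K \<longrightarrow> (AE x in radon_measure \<rho>. U \<mu> x = U \<nu> x))"
proof -
  have "{x. U \<mu> x = U \<nu> x} \<in> sets borel"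
    using borel_measurable_eq[OF borel_potential borel_potential, of \<mu> \<nu>] assms by simp
  from nearly_everywhere_iff[OF this, of A] show ?thesis
    by (simp add: potential_pos assms enn2ereal_inject)
qed

text \<open>Only the restriction to \<open>{x. v x < u x}\<close> matters: there
  \<open>u - v\<close> is positive although its integral is at most \<open>0\<close>. Finite
  integrals permit the subtraction.\<close>

lemma AE_le_if_restrictions_le:
  fixes u v :: "'a \<Rightarrow> ennreal"
  assumes \<rho>: "\<rho> \<in> radon_pos" and u: "lower_semicont u" "pos_integral \<rho> u < \<infinity>" and v: "lower_semicont v" "pos_integral \<rho> v < \<infinity>"
    and le: "\<And>S. S \<in> sets (radon_measure \<rho>) \<Longrightarrow> pos_integral (radon_restrict \<rho> S) u \<le> pos_integral (radon_restrict \<rho> S) v"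
  shows "AE x in radon_measure \<rho>. u x \<le> v x"
proof -
  let ?M = "radon_measure \<rho>"
  have m: "u \<in> borel_measurable ?M" "v \<in> borel_measurable ?M"
    by (rule lower_semicont_measurable[OF \<rho> u(1)], rule lower_semicont_measurable[OF \<rho> v(1)])
  define S where "S = {x. v x < u x}"
  have S: "S \<in> sets ?M" using borel_measurable_less[OF m(2,1)] by (simp add: S_def)
  let ?u = "\<lambda>x. u x * indicator S x" and ?v = "\<lambda>x. v x * indicator S x"
  have m': "?u \<in> borel_measurable ?M" "?v \<in> borel_measurable ?M" using m S by auto
  have int: "(\<integral>\<^sup>+x. ?u x \<partial>?M) \<le> (\<integral>\<^sup>+x. ?v x \<partial>?M)"
    using le[OF S] pos_integral_restrict[OF \<rho> S u] pos_integral_restrict[OF \<rho> S v] by simp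
  have "(\<integral>\<^sup>+x. ?v x \<partial>?M) \<le> (\<integral>\<^sup>+x. v x \<partial>?M)" by (rule nn_integral_mono) (auto simp: indicator_def)
  then have fin: "(\<integral>\<^sup>+x. ?v x \<partial>?M) \<noteq> \<infinity>" using v nn_integral_radon_measure[OF \<rho> v(1)] by auto
  have "(\<integral>\<^sup>+x. ?u x - ?v x \<partial>?M) = (\<integral>\<^sup>+x. ?u x \<partial>?M) - (\<integral>\<^sup>+x. ?v x \<partial>?M)"
    by (rule nn_integral_diff[OF m' fin]) (auto simp: S_def indicator_def less_imp_le)
  also have "\<dots> = 0" using int fin
    by (auto simp: diff_eq_0_iff_ennreal top.not_eq_extremum intro: order_le_less_trans)
  finally have "AE x in ?M. ?u x - ?v x = 0" using m' by (subst (asm) nn_integral_0_iff_AE) auto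
  then show ?thesis
  proof eventually_elim
    fix x assume 0: "?u x - ?v x = 0"
    show "u x \<le> v x"
    proof (rule ccontr)
      assume "\<not> u x \<le> v x"
      then have "v x < u x" "x \<in> S" by (auto simp: S_def)
      then show False using 0 by (auto simp: diff_eq_0_iff_ennreal)
    qed
  qed
qed

text \<open>Comparing integrals is enough, because measures of finite energy carried by
  \<open>K\<close> remain such under restriction to any measurable set.\<close>

lemma nearly_everywhere_leI:
  assumes \<omega>: "\<omega> \<in> radon_pos" and \<mu>: "\<mu> \<in> Epos"
    and le: "\<And>K \<rho>. compact K \<Longrightarrow> K \<subseteq> A \<Longrightarrow> \<rho> \<in> finite_energy_on \<kappa> K \<Longrightarrow> pos_integral \<rho> (U \<omega>) \<le> E \<rho> \<mu>"
  shows "nearly_everywhere \<kappa> A (\<lambda>x. potential \<kappa> \<omega> x \<le> potential \<kappa> \<mu> x)"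
  unfolding nearly_everywhere_potential_le_iff[OF \<omega> Epos_pos[OF \<mu>]]
proof (intro allI impI)
  fix K \<rho> assume "compact K \<and> K \<subseteq> A \<and> \<rho> \<in> finite_energy_on \<kappa> K"
  then have K: "compact K" "K \<subseteq> A" "\<rho> \<in> finite_energy_on \<kappa> K" by auto
  then have r: "\<rho> \<in> Epos" using finite_energy_on_Epos by blast
  note p = Epos_pos[OF r] and m = Epos_pos[OF \<mu>]
  show "AE x in radon_measure \<rho>. U \<omega> x \<le> U \<mu> x"
  proof (rule AE_le_if_restrictions_le[OF p potential_lsc[OF \<omega>] _ potential_lsc[OF m]])
    show "pos_integral \<rho> (U \<mu>) < \<infinity>" using pos_energy_finite[OF r \<mu>] pos_energy_eq[OF p m] by simp
    then show "pos_integral \<rho> (U \<omega>) < \<infinity>" using le[OF K] pos_energy_eq[OF p m] by (auto intro: order_le_less_trans)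
    fix S assume S: "S \<in> sets (radon_measure \<rho>)"
    show "pos_integral (radon_restrict \<rho> S) (U \<omega>) \<le> pos_integral (radon_restrict \<rho> S) (U \<mu>)"
      using le[OF K(1,2) finite_energy_on_restrict_sets[OF K(1,3) S]] pos_energy_eq[OF radon_restrict_pos[OF p S] m] by simp
  qed
qed

lemma nearly_everywhere_eqI:
  assumes \<omega>: "\<omega> \<in> radon_pos" and \<mu>: "\<mu> \<in> radon_pos"
    and le: "nearly_everywhere \<kappa> A (\<lambda>x. potential \<kappa> \<omega> x \<le> potential \<kappa> \<mu> x)"
    and ge: "\<And>x. U \<mu> x \<le> U \<omega> x"
  shows "nearly_everywhere \<kappa> A (\<lambda>x. potential \<kappa> \<mu> x = potential \<kappa> \<omega> x)"
  unfolding nearly_everywhere_potential_eq_iff[OF \<mu> \<omega>]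
proof (intro allI impI)
  fix K \<rho> assume "compact K \<and> K \<subseteq> A \<and> \<rho> \<in> finite_energy_on \<kappa> K"
  then have "AE x in radon_measure \<rho>. U \<omega> x \<le> U \<mu> x"
    using le[unfolded nearly_everywhere_potential_le_iff[OF \<omega> \<mu>]] by blast
  then show "AE x in radon_measure \<rho>. U \<mu> x = U \<omega> x" by eventually_elim (rule antisym[OF ge])
qed

lemma pos_integral_AE_le:
  assumes \<rho>: "(\<rho>::'a functional) \<in> radon_pos" and "lower_semicont u" "lower_semicont v" "AE x in radon_measure \<rho>. u x \<le> v x"
  shows "pos_integral \<rho> u \<le> pos_integral \<rho> v"
  using nn_integral_mono_AE[OF assms(4)] nn_integral_radon_measure[OF \<rho>] assms(2,3) by simp

lemma pos_integral_AE_eq: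
  assumes \<rho>: "(\<rho>::'a functional) \<in> radon_pos" and "lower_semicont u" "lower_semicont v" "AE x in radon_measure \<rho>. u x = v x"
  shows "pos_integral \<rho> u = pos_integral \<rho> v"
  using nn_integral_cong_AE[OF assms(4)] nn_integral_radon_measure[OF \<rho>] assms(2,3) by simp

section \<open>Minimisation over cones of measures\<close>

text \<open>Strong limits are vague limits, and a vague limit of measures carried by a closed set
  vanishes on every test function living in the open complement.\<close>

lemma finite_energy_on_strong_closed:
  assumes K: "compact K" and s: "\<And>n. s n \<in> finite_energy_on \<kappa> K" and l: "l \<in> Epos" "(\<lambda>n. sd (s n) l) \<longlonglongrightarrow> 0"
  shows "l \<in> finite_energy_on \<kappa> K"
proof -
  have sE: "s n \<in> Epos" "emeasure (radon_measure (s n)) (-K) = 0" for n using s[of n] by (auto simp: finite_energy_on_iff[OF K])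
  have lim: "limitin (strong_topology_pos \<kappa>) s l sequentially" using l sE by (simp add: limitin_strong_iff)
  have Kc: "closed K" by (rule compact_imp_closed[OF K])
  have "ennreal (l \<phi>) \<le> 0" if "\<phi> \<in> Cc_below (indicator (-K))" for \<phi>
  proof -
    have f: "\<phi> \<in> Cc" "\<forall>x. 0 \<le> \<phi> x" "\<forall>x. ennreal (\<phi> x) \<le> indicator (-K) x" using that by (auto simp: Cc_below_def)
    have f0: "\<forall>x\<in>K. \<phi> x = 0"
    proof
      fix x assume "x \<in> K"
      then have "ennreal (\<phi> x) \<le> 0" using f(3)[rule_format, of x] by simp
      then show "\<phi> x = 0" using f(2) by (simp add: ennreal_eq_0_iff antisym)
    qed
    have "s n \<phi> = 0" for n
      using radon_eq_on_carrier[OF Epos_pos[OF sE(1)] Kc sE(2) f(1) Cc_zero f0] radon_zero_arg[OF radon_pos_radon[OF Epos_pos[OF sE(1)]]] by simp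
    then have "l \<phi> = 0" using strong_imp_pointwise[OF lim f(1)] by (simp add: LIMSEQ_const_iff)
    then show ?thesis by simp
  qed
  then have "pos_integral l (indicator (-K)) \<le> 0" unfolding pos_integral_eq by (rule SUP_least)
  then have "emeasure (radon_measure l) (-K) = 0"
    using emeasure_open_radon_measure[OF Epos_pos[OF l(1)] open_Compl[OF Kc]] by simp
  then show ?thesis using l(1) by (simp add: finite_energy_on_iff[OF K])
qed

lemma energy_inner_tendsto:
  assumes "\<And>n. s n \<in> Epos" "l \<in> Epos" "(\<lambda>n. sd (s n) l) \<longlonglongrightarrow> 0" "c \<in> Epos"
  shows "(\<lambda>n. B (s n) c) \<longlonglongrightarrow> B l c"
proof (rule LIM_zero_cancel, rule Lim_null_comparison)
  show "\<forall>\<^sub>F n in sequentially. norm (B (s n) c - B l c) \<le> sd (s n) l * sqrt (B c c)"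
    using energy_inner_diff_le[OF assms(1,2,4)] by simp
  show "(\<lambda>n. sd (s n) l * sqrt (B c c)) \<longlonglongrightarrow> 0" using tendsto_mult_left_zero[OF assms(3)] .
qed

lemma energy_tendsto:
  assumes s: "\<And>n. s n \<in> Epos" and l: "l \<in> Epos" "(\<lambda>n. sd (s n) l) \<longlonglongrightarrow> 0"
  shows "(\<lambda>n. B (s n) (s n)) \<longlonglongrightarrow> B l l"
proof -
  have "B (s n) (s n) = (sd (s n) l)\<^sup>2 + 2 * B (s n) l - B l l" for n
    using strong_dist_Epos[OF s l(1)] energy_gap_nonneg[OF s l(1)] by (simp add: energy_gap_def)
  moreover have "(\<lambda>n. (sd (s n) l)\<^sup>2 + 2 * B (s n) l - B l l) \<longlonglongrightarrow> 0\<^sup>2 + 2 * B l l - B l l"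
    by (intro tendsto_intros l energy_inner_tendsto[OF s l l(1)])
  ultimately show ?thesis by simp
qed

text \<open>The hypothesis on \<open>Q\<close> is the parallelogram estimate that makes minimising
  sequences Cauchy. It is kept abstract to serve the energy on measures of unit mass as well as
  \<open>\<parallel>a\<parallel>\<close>-squared minus a linear term on a cone. The limit is only
  claimed to lie in \<open>Epos\<close>; closedness of \<open>C\<close> is a separate
  matter.\<close>

lemma minimizing_sequence:
  assumes C: "C \<subseteq> Epos" "C \<noteq> {}" and bdd: "bdd_below (J ` C)"
    and Q: "\<And>a b. a \<in> C \<Longrightarrow> b \<in> C \<Longrightarrow> Q a b \<le> 2 * (J a + J b) - 4 * (INF c\<in>C. J c)"
  obtains s l where "\<forall>n. s n \<in> C" "l \<in> Epos" "(\<lambda>n. sd (s n) l) \<longlonglongrightarrow> 0" "(\<lambda>n. J (s n)) \<longlonglongrightarrow> (INF c\<in>C. J c)"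
proof -
  let ?i = "INF c\<in>C. J c"
  have "\<exists>c\<in>C. J c < ?i + inverse (real (Suc n))" for n
    using cINF_less_iff[OF C(2) bdd, of "?i + inverse (real (Suc n))"] by simp
  then obtain s where s: "\<And>n. s n \<in> C" "\<And>n. J (s n) < ?i + inverse (real (Suc n))" by metis
  have sE: "s n \<in> Epos" for n using s(1) C(1) by blast
  have i: "?i \<le> J (s n)" for n by (rule cINF_lower[OF bdd s(1)])
  have cauchy: "\<exists>N. \<forall>n\<ge>N. \<forall>m\<ge>N. Q (s n) (s m) < e" if e: "0 < e" for e
  proof -
    \<comment> \<open>If both values lie within \<open>e / 4\<close> of the infimum, the estimate
      gives \<open>Q < e\<close>.\<close>
    obtain N where N: "inverse (real (Suc N)) < e / 4" using reals_Archimedean[of "e / 4"] e by auto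
    have "Q (s n) (s m) < e" if nm: "N \<le> n" "N \<le> m" for n m
    proof -
      have J: "J (s k) < ?i + e / 4" if k: "N \<le> k" for k
      proof -
        have "inverse (real (Suc k)) \<le> inverse (real (Suc N))" using k by (intro le_imp_inverse_le) auto
        then show ?thesis using s(2)[of k] N by linarith
      qed
      have arith: "q < e" if "q \<le> 2 * (x + y) - 4 * i" "x < i + e / 4" "y < i + e / 4" for q x y i :: real
        using that by (simp add: field_simps)
      show ?thesis by (rule arith[OF Q[OF s(1)[of n] s(1)[of m]] J[OF nm(1)] J[OF nm(2)]])
    qed
    then show ?thesis by blast
  qed
  obtain l where l: "l \<in> Epos" "(\<lambda>n. sd (s n) l) \<longlonglongrightarrow> 0" by (rule strong_complete[OF sE cauchy])
  have "(\<lambda>n. J (s n)) \<longlonglongrightarrow> ?i"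
  proof (rule tendsto_sandwich[of "\<lambda>_. ?i" _ _ "\<lambda>n. ?i + inverse (real (Suc n))"])
    show "(\<lambda>n. ?i + inverse (real (Suc n))) \<longlonglongrightarrow> ?i" by (rule LIMSEQ_inverse_real_of_nat_add)
    show "\<forall>\<^sub>F n in sequentially. ?i \<le> J (s n)" using i by simp
    show "\<forall>\<^sub>F n in sequentially. J (s n) \<le> ?i + inverse (real (Suc n))"
      by (intro always_eventually allI less_imp_le s(2))
  qed simp
  then show ?thesis using that s(1) l by blast
qed

text \<open>The parallelogram law, written with the midpoint because a convex set of positive
  measures contains the midpoint but not the difference.\<close>

lemma energy_inner_midpoint:
  assumes "a \<in> Epos" "b \<in> Epos"
  defines "m \<equiv> radon_cmult (1/2) (radon_plus a b)"
  shows "Q a b = 2 * B a a + 2 * B b b - 4 * B m m"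
  using assms energy_inner_commute[OF assms(2,1)] by (simp add: m_def energy_gap_def energy_inner_linear field_simps)

text \<open>The representing element minimises \<open>\<parallel>a\<parallel>\<^sup>2 - 2 L a\<close> over the cone; it need only satisfy the variational inequality.\<close>

lemma cone_riesz:
  assumes C: "C \<subseteq> Epos" "radon_zero \<in> C"
    and plus: "\<And>a b. a \<in> C \<Longrightarrow> b \<in> C \<Longrightarrow> radon_plus a b \<in> C"
    and cmult: "\<And>a t. a \<in> C \<Longrightarrow> 0 \<le> t \<Longrightarrow> radon_cmult t a \<in> C"
    and closed: "\<And>s l. (\<And>n. s n \<in> C) \<Longrightarrow> l \<in> Epos \<Longrightarrow> (\<lambda>n. sd (s n) l) \<longlonglongrightarrow> 0 \<Longrightarrow> l \<in> C"
    and L_plus: "\<And>a b. a \<in> C \<Longrightarrow> b \<in> C \<Longrightarrow> L (radon_plus a b) = L a + L b"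
    and L_cmult: "\<And>a t. a \<in> C \<Longrightarrow> 0 \<le> t \<Longrightarrow> L (radon_cmult t a) = t * L a"
    and L_bound: "\<And>a. a \<in> C \<Longrightarrow> L a \<le> M * sqrt (B a a)"
    and L_cont: "\<And>s l. (\<And>n. s n \<in> C) \<Longrightarrow> l \<in> C \<Longrightarrow> (\<lambda>n. sd (s n) l) \<longlonglongrightarrow> 0 \<Longrightarrow> (\<lambda>n. L (s n)) \<longlonglongrightarrow> L l"
  obtains m where "m \<in> C" "\<And>a. a \<in> C \<Longrightarrow> L a \<le> B m a" "B m m = L m"
proof -
  define J where "J = (\<lambda>a. B a a - 2 * L a)"
  have CE: "a \<in> Epos" if "a \<in> C" for a using that C(1) by blast
  \<comment> \<open>Completing the square: with the norm \<open>s\<close> of \<open>a\<close>, the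
    value is at least \<open>s\<^sup>2 - 2 * M * s\<close>, hence at least
    \<open>- M\<^sup>2\<close>.\<close>
  have bdd: "bdd_below (J ` C)"
  proof (rule bdd_belowI2)
    fix a assume a: "a \<in> C"
    have "0 \<le> (sqrt (B a a) - M)\<^sup>2" by simp
    then have "2 * (M * sqrt (B a a)) - M\<^sup>2 \<le> B a a" using energy_inner_nonneg[of a a] by (simp add: power2_diff algebra_simps)
    then show "- M\<^sup>2 \<le> J a" using L_bound[OF a] by (simp add: J_def)
  qed
  let ?i = "INF c\<in>C. J c"
  have Jle: "?i \<le> J a" if "a \<in> C" for a by (rule cINF_lower[OF bdd that])
  have Qle: "Q a b \<le> 2 * (J a + J b) - 4 * ?i" if ab: "a \<in> C" "b \<in> C" for a b
  proof -
    let ?m = "radon_cmult (1/2) (radon_plus a b)"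
    have "?m \<in> C" by (intro cmult plus ab) simp
    moreover have "L ?m = (L a + L b) / 2" using L_cmult[OF plus[OF ab], of "1/2"] L_plus[OF ab] by simp
    ultimately show ?thesis
      using Jle[of ?m] energy_inner_midpoint[OF CE[OF ab(1)] CE[OF ab(2)]] by (simp add: J_def)
  qed
  have ne: "C \<noteq> {}" using C(2) by blast
  obtain s m where s': "\<forall>n. s n \<in> C" and m: "m \<in> Epos" "(\<lambda>n. sd (s n) m) \<longlonglongrightarrow> 0" and J: "(\<lambda>n. J (s n)) \<longlonglongrightarrow> ?i"
    by (rule minimizing_sequence[OF C(1) ne bdd Qle])
  have s: "s n \<in> C" for n using s' by blast
  have mC: "m \<in> C" by (rule closed[OF s m])
  have "(\<lambda>n. J (s n)) \<longlonglongrightarrow> J m"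
    unfolding J_def by (intro tendsto_intros energy_tendsto[OF CE[OF s] m] L_cont[OF s mC m(2)])
  then have Jm: "J m = ?i" using LIMSEQ_unique[OF J] by simp
  have "L a \<le> B m a" if a: "a \<in> C" for a
  proof -
    \<comment> \<open>Perturbation in the direction of \<open>a\<close>; only positive
      \<open>t\<close> keep the measure in the cone, which is why an inequality results.\<close>
    have "0 \<le> (B m a - L a) + t * (B a a / 2)" if t: "0 < t" "t \<le> 1" for t
    proof -
      let ?n = "radon_plus m (radon_cmult t a)"
      have ta: "radon_cmult t a \<in> C" using cmult[OF a] t by simp
      have "B ?n ?n = B m m + 2 * t * B m a + t * t * B a a"
        using CE[OF a] m(1) t energy_inner_commute[OF CE[OF a] m(1)] by (simp add: energy_inner_linear algebra_simps)
      moreover have "L ?n = L m + t * L a" using L_plus[OF mC ta] L_cmult[OF a, of t] t by simp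
      moreover have "J m \<le> J ?n" using Jm Jle[OF plus[OF mC ta]] by simp
      ultimately have "0 \<le> 2 * t * ((B m a - L a) + t * (B a a / 2))" by (simp add: J_def algebra_simps)
      then show ?thesis using t by (simp add: zero_le_mult_iff)
    qed
    then have "0 \<le> B m a - L a" by (rule nonneg_if_linear_perturbation)
    then show ?thesis by simp
  qed
  moreover have "B m m \<le> L m"
  proof -
    \<comment> \<open>In the direction of \<open>m\<close> itself the measure may also be shrunk,
      since \<open>t \<le> 1\<close> leaves a nonnegative multiple. This supplies the opposite
      inequality at \<open>a = m\<close>.\<close>
    have "0 \<le> (L m - B m m) + t * (B m m / 2)" if t: "0 < t" "t \<le> 1" for t
    proof -
      let ?n = "radon_cmult (1 - t) m"
      have "B ?n ?n = (1 - t) * ((1 - t) * B m m)" using m(1) t by (simp add: energy_inner_linear)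
      moreover have "L ?n = (1 - t) * L m" using L_cmult[OF mC, of "1 - t"] t by simp
      moreover have "J m \<le> J ?n" using Jm Jle[OF cmult[OF mC, of "1 - t"]] t by simp
      ultimately have "0 \<le> 2 * t * ((L m - B m m) + t * (B m m / 2))" by (simp add: J_def algebra_simps)
      then show ?thesis using t by (simp add: zero_le_mult_iff)
    qed
    then have "0 \<le> L m - B m m" by (rule nonneg_if_linear_perturbation)
    then show ?thesis by simp
  qed
  ultimately show ?thesis using that[OF mC] mC by (meson antisym)
qed

text \<open>On measures carried by \<open>K\<close> the value \<open>\<mu> \<eta>\<close> is the
  mass. The least energy at mass one is attained, because the mass survives strong limits, and is
  positive by strict definiteness; its inverse square root is the constant. If no measure of finite
  energy charges \<open>K\<close>, the constant is \<open>0\<close>.\<close>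

lemma mass_bound_compact:
  assumes K: "compact K" and \<eta>: "\<eta> \<in> Cc" "\<forall>x\<in>K. \<eta> x = 1"
  obtains M where "0 \<le> M" "\<forall>\<mu>\<in>finite_energy_on \<kappa> K. \<mu> \<eta> \<le> M * sqrt (B \<mu> \<mu>)"
proof (cases "\<exists>\<mu>\<in>finite_energy_on \<kappa> K. 0 < \<mu> \<eta>")
  case False
  then show ?thesis using that[of 0] by force
next
  case True
  define C where "C = {\<mu> \<in> finite_energy_on \<kappa> K. \<mu> \<eta> = 1}"
  have CE: "C \<subseteq> Epos" using finite_energy_on_Epos by (auto simp: C_def)
  have normalize: "radon_cmult (1 / \<mu> \<eta>) \<mu> \<in> C" if "\<mu> \<in> finite_energy_on \<kappa> K" "0 < \<mu> \<eta>" for \<mu>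
    using finite_energy_on_cmult[OF K that(1), of "1 / \<mu> \<eta>"] that(2) \<eta>(1) by (simp add: C_def)
  then have ne: "C \<noteq> {}" using True by blast
  have bdd: "bdd_below ((\<lambda>a. B a a) ` C)" by (rule bdd_belowI2[of _ 0]) (rule energy_inner_nonneg)
  let ?i = "INF c\<in>C. B c c"
  have Qle: "Q a b \<le> 2 * (B a a + B b b) - 4 * ?i" if ab: "a \<in> C" "b \<in> C" for a b
  proof -
    let ?m = "radon_cmult (1/2) (radon_plus a b)"
    have "?m \<in> C" using ab \<eta>(1) finite_energy_on_cmult[OF K finite_energy_on_plus[OF K], of a b "1/2"] by (simp add: C_def)
    then have "?i \<le> B ?m ?m" by (rule cINF_lower[OF bdd])
    moreover have "Q a b = 2 * B a a + 2 * B b b - 4 * B ?m ?m"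
      by (rule energy_inner_midpoint) (use ab CE in auto)
    ultimately show ?thesis by simp
  qed
  obtain s l where s': "\<forall>n. s n \<in> C" and l: "l \<in> Epos" "(\<lambda>n. sd (s n) l) \<longlonglongrightarrow> 0" and J: "(\<lambda>n. B (s n) (s n)) \<longlonglongrightarrow> ?i"
    by (rule minimizing_sequence[OF CE ne bdd Qle])
  have s: "s n \<in> C" for n using s' by blast
  have sE: "s n \<in> Epos" for n using s CE by blast
  have i: "?i = B l l" using LIMSEQ_unique[OF J energy_tendsto[OF sE l]] .
  have "limitin (strong_topology_pos \<kappa>) s l sequentially" using l sE by (simp add: limitin_strong_iff)
  then have "(\<lambda>n. s n \<eta>) \<longlonglongrightarrow> l \<eta>" by (rule strong_imp_pointwise[OF _ \<eta>(1)])
  moreover have "s n \<eta> = 1" for n using s by (simp add: C_def)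
  ultimately have "l \<eta> = 1" by (simp add: LIMSEQ_const_iff)
  \<comment> \<open>The limit keeps the mass \<open>1\<close>, so it is nonzero and the energy
    principle makes the infimum positive.\<close>
  then have "l \<noteq> radon_zero" using \<eta>(1) by auto
  moreover have "Q l radon_zero = B l l" by (simp add: energy_gap_def energy_inner_zero_right energy_inner_zero_left l Epos_zero)
  ultimately have "B l l \<noteq> 0" using energy_gap_eq_zero[OF l(1) Epos_zero] by auto
  then have i0: "0 < ?i" using i energy_inner_nonneg[of l l] by simp
  have "\<mu> \<eta> \<le> (1 / sqrt ?i) * sqrt (B \<mu> \<mu>)" if m: "\<mu> \<in> finite_energy_on \<kappa> K" for \<mu>
  proof (cases "0 < \<mu> \<eta>")
    case True
    have mE: "\<mu> \<in> Epos" using m finite_energy_on_Epos by blast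
    have "?i \<le> B (radon_cmult (1 / \<mu> \<eta>) \<mu>) (radon_cmult (1 / \<mu> \<eta>) \<mu>)" by (rule cINF_lower[OF bdd normalize[OF m True]])
    also have "\<dots> = B \<mu> \<mu> / (\<mu> \<eta>)\<^sup>2" using True mE by (simp add: energy_inner_linear power2_eq_square)
    finally have "?i * (\<mu> \<eta>)\<^sup>2 \<le> B \<mu> \<mu>" using True by (simp add: field_simps)
    then have "sqrt (?i * (\<mu> \<eta>)\<^sup>2) \<le> sqrt (B \<mu> \<mu>)" by (rule real_sqrt_le_mono)
    then have "sqrt ?i * \<mu> \<eta> \<le> sqrt (B \<mu> \<mu>)" using True by (simp add: real_sqrt_mult)
    then show ?thesis using i0 by (simp add: field_simps)
  next
    case False
    have "0 \<le> (1 / sqrt ?i) * sqrt (B \<mu> \<mu>)" using i0 energy_inner_nonneg[of \<mu> \<mu>] by simp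
    then show ?thesis using False by linarith
  qed
  then show ?thesis using that[of "1 / sqrt ?i"] i0 by auto
qed

section \<open>Approximation by measures carried by compact subsets of \<open>A\<close>\<close>

text \<open>A continuous minorant of \<open>g\<close> with almost the full integral reduces the
  problem to its compact support, where inner regularity yields an increasing sequence of compact
  subsets of \<open>A\<close> filling the support up to a null set.\<close>

lemma compact_exhaustion:
  assumes \<mu>: "\<mu> \<in> radon_pos" "locally_negligible_for \<mu> (-A)" and g: "lower_semicont g" and a: "a < pos_integral \<mu> g"
  obtains K where "compact K" "K \<subseteq> (A::'a set)" "a < (\<integral>\<^sup>+x. g x * indicator K x \<partial>radon_measure \<mu>)"
proof -
  let ?M = "radon_measure \<mu>"
  obtain \<phi> where "\<phi> \<in> Cc_below g" and a': "a < ennreal (\<mu> \<phi>)" using a unfolding pos_integral_eq less_SUP_iff by blast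
  then have \<phi>: "\<phi> \<in> Cc" "\<forall>x. 0 \<le> \<phi> x" "\<forall>x. ennreal (\<phi> x) \<le> g x" by (auto simp: Cc_below_def)
  let ?C = "supp \<phi>"
  have C: "compact ?C" by (rule Cc_compact_supp[OF \<phi>(1)])
  note gm = lower_semicont_measurable[OF \<mu>(1) g]
  have Cs: "?C \<in> sets ?M" by (rule compact_in_sets_radon_measure[OF \<mu>(1) C])
  \<comment> \<open>\<open>A\<close> itself need not be measurable. Within the compact support its
    complement is null, and completeness of the measure makes \<open>?C \<inter> A\<close>
    measurable.\<close>
  have "-A \<inter> ?C \<in> null_sets ?M"
    using \<mu>(2) C null_sets_radon_measure[OF \<mu>(1)] by (simp add: locally_negligible_for_def)
  then have nul: "-A \<inter> ?C \<in> null_sets ?M" .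
  have "?C - (-A \<inter> ?C) \<in> sets ?M" using Cs null_setsD2[OF nul] by blast
  moreover have "?C - (-A \<inter> ?C) = ?C \<inter> A" by blast
  ultimately have CA: "?C \<inter> A \<in> sets ?M" by simp
  have "\<exists>L. compact L \<and> L \<subseteq> ?C \<inter> A \<and> emeasure ?M (?C \<inter> A - L) \<le> ennreal (inverse (real (Suc n)))" for n
    using inner_regular[OF \<mu>(1) CA C Int_lower1, of "inverse (real (Suc n))"] by (metis inverse_positive_iff_positive of_nat_0_less_iff zero_less_Suc)
  then obtain L where L: "\<And>n. compact (L n)" "\<And>n. L n \<subseteq> ?C \<inter> A"
      "\<And>n. emeasure ?M (?C \<inter> A - L n) \<le> ennreal (inverse (real (Suc n)))" by metis
  \<comment> \<open>Finite unions make the sequence increasing, as monotone convergence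
    requires.\<close>
  define K where "K = (\<lambda>n. \<Union>i\<le>n. L i)"
  have K: "compact (K n)" "K n \<subseteq> ?C \<inter> A" for n using L by (auto simp: K_def intro!: compact_UN)
  have Ks: "K n \<in> sets ?M" for n by (rule compact_in_sets_radon_measure[OF \<mu>(1) K(1)])
  have inc: "incseq K" unfolding incseq_def K_def by (intro allI impI UN_mono) auto
  have UK: "(\<Union>n. K n) \<in> sets ?M" using Ks by blast
  have "emeasure ?M (?C \<inter> A - (\<Union>n. K n)) \<le> ennreal (inverse (real (Suc n)))" for n
  proof -
    have "emeasure ?M (?C \<inter> A - (\<Union>n. K n)) \<le> emeasure ?M (?C \<inter> A - L n)"
      by (rule emeasure_mono) (use CA compact_in_sets_radon_measure[OF \<mu>(1) L(1)] in \<open>auto simp: K_def\<close>)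
    then show ?thesis using L(3) by (rule order_trans)
  qed
  note le = this
  have "emeasure ?M (?C \<inter> A - (\<Union>n. K n)) \<le> 0"
  proof (rule ennreal_le_epsilon)
    fix e :: real assume e: "0 < e"
    obtain n where "inverse (real (Suc n)) < e" using reals_Archimedean[OF e] by blast
    then show "emeasure ?M (?C \<inter> A - (\<Union>n. K n)) \<le> 0 + ennreal e"
      using order_trans[OF le[of n] ennreal_leI[of "inverse (real (Suc n))" e]] by simp
  qed
  then have "?C \<inter> A - (\<Union>n. K n) \<in> null_sets ?M" using CA UK by auto
  then have "(-A \<inter> ?C) \<union> (?C \<inter> A - (\<Union>n. K n)) \<in> null_sets ?M" using nul by (intro null_sets.Un)
  then have ae: "AE x in ?M. x \<in> ?C \<longrightarrow> x \<in> (\<Union>n. K n)" by (rule AE_I') auto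
  have "ennreal (\<mu> \<phi>) = (\<integral>\<^sup>+x. ennreal (\<phi> x) \<partial>?M)"
    using pos_integral_Cc[OF \<mu>(1) \<phi>(1)] nn_integral_radon_measure[OF \<mu>(1) lower_semicont_continuous[OF Cc_continuous[OF \<phi>(1)]]] \<phi>(2) by simp
  also have "\<dots> \<le> (\<integral>\<^sup>+x. g x * indicator (\<Union>n. K n) x \<partial>?M)"
  proof (rule nn_integral_mono_AE)
    have imp: "(x \<in> ?C \<longrightarrow> x \<in> (\<Union>n. K n)) \<longrightarrow> ennreal (\<phi> x) \<le> g x * indicator (\<Union>n. K n) x" for x
    proof (cases "x \<in> ?C")
      case True then show ?thesis using \<phi>(3) by simp
    next
      case False then show ?thesis by (simp add: not_in_supp[OF False])
    qed
    show "AE x in ?M. ennreal (\<phi> x) \<le> g x * indicator (\<Union>n. K n) x"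
      by (rule AE_mp[OF ae AE_I2[OF imp]])
  qed
  also have "\<dots> = (\<integral>\<^sup>+x. (SUP n. g x * indicator (K n) x) \<partial>?M)"
  proof (rule nn_integral_cong)
    fix x
    show "g x * indicator (\<Union>n. K n) x = (SUP n. g x * indicator (K n) x)"
    proof (rule antisym)
      show "g x * indicator (\<Union>n. K n) x \<le> (SUP n. g x * indicator (K n) x)"
      proof (cases "x \<in> (\<Union>n. K n)")
        case True
        then obtain n where "x \<in> K n" by blast
        then show ?thesis using SUP_upper[of n UNIV "\<lambda>n. g x * indicator (K n) x"] True by simp
      qed simp
      show "(SUP n. g x * indicator (K n) x) \<le> g x * indicator (\<Union>n. K n) x"
        by (rule SUP_least) (auto simp: indicator_def)
    qed
  qed
  also have "\<dots> = (SUP n. \<integral>\<^sup>+x. g x * indicator (K n) x \<partial>?M)"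
  proof (rule nn_integral_monotone_convergence_SUP)
    show "incseq (\<lambda>n x. g x * indicator (K n) x)"
      using inc by (auto simp: incseq_def le_fun_def indicator_def)
    show "(\<lambda>x. g x * indicator (K n) x) \<in> borel_measurable ?M" for n using gm Ks by simp
  qed
  finally have "ennreal (\<mu> \<phi>) \<le> (SUP n. \<integral>\<^sup>+x. g x * indicator (K n) x \<partial>?M)" .
  with a' have "a < (SUP n. \<integral>\<^sup>+x. g x * indicator (K n) x \<partial>?M)" by (rule less_le_trans)
  then obtain n where "a < (\<integral>\<^sup>+x. g x * indicator (K n) x \<partial>?M)" by (auto simp: less_SUP_iff)
  then show ?thesis using that K by blast
qed

text \<open>The error of restricting \<open>\<mu>\<close> to \<open>K\<close> is the energy of the
  remainder \<open>\<sigma>\<close>, which is at most the integral of \<open>U \<mu>\<close> with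
  respect to \<open>\<mu>\<close> over the complement of \<open>K\<close>.\<close>

lemma finite_energy_on_approx:
  assumes \<mu>: "\<mu> \<in> finite_energy_on \<kappa> A" and e: "0 < e"
  obtains K \<rho> where "compact K" "K \<subseteq> A" "\<rho> \<in> finite_energy_on \<kappa> K" "sd \<mu> \<rho> < e"
proof -
  have m: "\<mu> \<in> Epos" "locally_negligible_for \<mu> (-A)"
    using \<mu> finite_energy_on_Epos by (auto simp: finite_energy_on_def radon_pos_on_def)
  note p = Epos_pos[OF m(1)] and Ul = potential_lsc[OF Epos_pos[OF m(1)]]
  let ?M = "radon_measure \<mu>"
  have I: "pos_integral \<mu> (U \<mu>) = ennreal (B \<mu> \<mu>)" using pos_energy_real[OF m(1) m(1)] pos_energy_eq[OF p p] by simp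
  have B0: "0 \<le> B \<mu> \<mu>" by (rule energy_inner_nonneg)
  \<comment> \<open>When the whole energy is below \<open>e\<^sup>2\<close> the empty set already
    works; separating this case keeps \<open>B \<mu> \<mu> - e\<^sup>2\<close> nonnegative before it
    is passed to \<open>ennreal\<close>.\<close>
  obtain K where K: "compact K" "K \<subseteq> A" and small: "(\<integral>\<^sup>+x. U \<mu> x * indicator (-K) x \<partial>?M) < ennreal (e\<^sup>2)"
  proof (cases "B \<mu> \<mu> < e\<^sup>2")
    case True
    have "(\<integral>\<^sup>+x. U \<mu> x * indicator (-{}) x \<partial>?M) = ennreal (B \<mu> \<mu>)" using nn_integral_radon_measure[OF p Ul] I by simp
    then show ?thesis using that[of "{}"] True B0 e by (simp add: ennreal_less_iff)
  next
    case False
    have "ennreal (B \<mu> \<mu> - e\<^sup>2) < pos_integral \<mu> (U \<mu>)"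
      unfolding I by (rule ennreal_lessI) (use False e in \<open>auto intro: less_le_trans[of 0 "e\<^sup>2"]\<close>)
    then obtain K where K: "compact K" "K \<subseteq> A" "ennreal (B \<mu> \<mu> - e\<^sup>2) < (\<integral>\<^sup>+x. U \<mu> x * indicator K x \<partial>?M)"
      by (rule compact_exhaustion[OF p m(2) Ul])
    have Ks: "K \<in> sets ?M" by (rule compact_in_sets_radon_measure[OF p K(1)])
    have "(\<integral>\<^sup>+x. U \<mu> x * indicator K x \<partial>?M) + (\<integral>\<^sup>+x. U \<mu> x * indicator (-K) x \<partial>?M) = (\<integral>\<^sup>+x. U \<mu> x * indicator K x + U \<mu> x * indicator (-K) x \<partial>?M)"
      using lower_semicont_measurable[OF p Ul] Ks sets.compl_sets[OF Ks] by (simp add: nn_integral_add Compl_eq_Diff_UNIV)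
    also have "\<dots> = (\<integral>\<^sup>+x. U \<mu> x \<partial>?M)" by (rule nn_integral_cong) (auto simp: indicator_def)
    also have "\<dots> = ennreal (B \<mu> \<mu>)" using nn_integral_radon_measure[OF p Ul] I by simp
    finally have sum: "(\<integral>\<^sup>+x. U \<mu> x * indicator K x \<partial>?M) + (\<integral>\<^sup>+x. U \<mu> x * indicator (-K) x \<partial>?M) = ennreal (B \<mu> \<mu>)" .
    have "(\<integral>\<^sup>+x. U \<mu> x * indicator (-K) x \<partial>?M) < ennreal (e\<^sup>2)"
      using sum K(3) B0 False
      by (cases "\<integral>\<^sup>+x. U \<mu> x * indicator K x \<partial>?M"; cases "\<integral>\<^sup>+x. U \<mu> x * indicator (-K) x \<partial>?M")
        (auto simp: ennreal_less_iff simp flip: ennreal_plus)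
    then show ?thesis using that K(1,2) by blast
  qed
  have Ks: "K \<in> sets ?M" "-K \<in> sets ?M"
    using compact_in_sets_radon_measure[OF p K(1)] open_in_sets_radon_measure[OF p open_Compl[OF compact_imp_closed[OF K(1)]]] by auto
  define \<rho> where "\<rho> = radon_restrict \<mu> K"
  define \<sigma> where "\<sigma> = radon_restrict \<mu> (-K)"
  have \<rho>: "\<rho> \<in> finite_energy_on \<kappa> K" unfolding \<rho>_def by (rule finite_energy_on_restrict[OF K(1) m(1) Ks(1) order.refl])
  then have \<rho>E: "\<rho> \<in> Epos" using finite_energy_on_Epos by blast
  have \<sigma>E: "\<sigma> \<in> Epos" unfolding \<sigma>_def by (rule Epos_restrict[OF m(1) Ks(2)])
  have \<mu>eq: "\<mu> = radon_plus \<rho> \<sigma>" unfolding \<rho>_def \<sigma>_def by (rule radon_restrict_plus_compl[OF p Ks(1), symmetric])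
  have "Q \<mu> \<rho> = B \<sigma> \<sigma>"
    unfolding \<mu>eq using \<rho>E \<sigma>E energy_inner_commute[OF \<sigma>E \<rho>E] by (simp add: energy_gap_def energy_inner_linear)
  moreover have "B \<sigma> \<sigma> < e\<^sup>2"
  proof -
    have "E \<sigma> \<sigma> \<le> E \<mu> \<sigma>"
      by (rule pos_energy_mono[OF Epos_pos[OF \<sigma>E] p Epos_pos[OF \<sigma>E]]) (simp add: \<sigma>_def radon_restrict_le[OF p Ks(2)])
    also have "E \<mu> \<sigma> = pos_integral \<sigma> (U \<mu>)"
      using pos_energy_commute[OF p Epos_pos[OF \<sigma>E]] pos_energy_eq[OF Epos_pos[OF \<sigma>E] p] by simp
    also have "\<dots> \<le> (\<integral>\<^sup>+x. U \<mu> x * indicator (-K) x \<partial>?M)" unfolding \<sigma>_def by (rule pos_integral_restrict_le[OF p Ks(2)])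
    finally have "ennreal (B \<sigma> \<sigma>) < ennreal (e\<^sup>2)" using small pos_energy_real[OF \<sigma>E \<sigma>E] by simp
    then show ?thesis using energy_inner_nonneg[of \<sigma> \<sigma>] by (simp add: ennreal_less_iff)
  qed
  ultimately have "Q \<mu> \<rho> < e\<^sup>2" by simp
  then have "sqrt (Q \<mu> \<rho>) < sqrt (e\<^sup>2)" by (rule real_sqrt_less_mono)
  then have "sd \<mu> \<rho> < e" unfolding strong_dist_Epos[OF m(1) \<rho>E] using e by simp
  then show ?thesis using that K \<rho> by blast
qed

text \<open>The strong closure is already generated by measures carried by compact subsets, which
  are the only measures against which relations n.e. are tested.\<close>

lemma closure_on_iff:
  "\<nu> \<in> closure_on \<kappa> A \<longleftrightarrow> \<nu> \<in> Epos \<and> (\<forall>e>0. \<exists>K. compact K \<and> K \<subseteq> A \<and> (\<exists>\<rho>\<in>finite_energy_on \<kappa> K. sd \<nu> \<rho> < e))"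
proof -
  have "(\<exists>\<mu>\<in>finite_energy_on \<kappa> A. sd \<nu> \<mu> < e) \<longrightarrow> (\<exists>K. compact K \<and> K \<subseteq> A \<and> (\<exists>\<rho>\<in>finite_energy_on \<kappa> K. sd \<nu> \<rho> < e))"
    if \<nu>: "\<nu> \<in> Epos" for e
  proof
    assume "\<exists>\<mu>\<in>finite_energy_on \<kappa> A. sd \<nu> \<mu> < e"
    then obtain \<mu> where m: "\<mu> \<in> finite_energy_on \<kappa> A" "sd \<nu> \<mu> < e" by blast
    have mE: "\<mu> \<in> Epos" using m(1) finite_energy_on_Epos by blast
    obtain K \<rho> where K: "compact K" "K \<subseteq> A" "\<rho> \<in> finite_energy_on \<kappa> K" "sd \<mu> \<rho> < e - sd \<nu> \<mu>"
      using finite_energy_on_approx[OF m(1), of "e - sd \<nu> \<mu>"] m(2) by auto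
    have "\<rho> \<in> Epos" using K(3) finite_energy_on_Epos by blast
    then have "sd \<nu> \<rho> \<le> sd \<nu> \<mu> + sd \<mu> \<rho>" by (rule SP.sub.triangle[OF \<nu> mE])
    then show "\<exists>K. compact K \<and> K \<subseteq> A \<and> (\<exists>\<rho>\<in>finite_energy_on \<kappa> K. sd \<nu> \<rho> < e)" using K by force
  qed
  then show ?thesis
    unfolding closure_on_def closure_of_strong_iff[OF finite_energy_on_Epos]
    using finite_energy_on_subset by (meson subsetD)
qed

end

section \<open>Balayage onto compact sets and its limit\<close>

lemma eventually_compacts_at_top:
  fixes A :: "'a::topological_space set"
  shows "eventually P (compacts_at_top A) \<longleftrightarrow>
    (\<exists>K. compact K \<and> K \<subseteq> A \<and> (\<forall>K'. compact K' \<and> K \<subseteq> K' \<and> K' \<subseteq> A \<longrightarrow> P K'))"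
proof -
  let ?\<K> = "{K. compact K \<and> K \<subseteq> A}"
  have "eventually P (compacts_at_top A) \<longleftrightarrow>
      (\<exists>K\<in>?\<K>. eventually P (principal {K'. compact K' \<and> K \<subseteq> K' \<and> K' \<subseteq> A}))"
    unfolding compacts_at_top_def
  proof (rule eventually_INF_base)
    show "?\<K> \<noteq> {}" using compact_empty by blast
    fix K L assume "K \<in> ?\<K>" "L \<in> ?\<K>"
    then have "K \<union> L \<in> ?\<K>" by (simp add: compact_Un)
    moreover have "principal {K'. compact K' \<and> K \<union> L \<subseteq> K' \<and> K' \<subseteq> A} \<le>
        inf (principal {K'. compact K' \<and> K \<subseteq> K' \<and> K' \<subseteq> A}) (principal {K'. compact K' \<and> L \<subseteq> K' \<and> K' \<subseteq> A})"
      by auto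
    ultimately show "\<exists>M\<in>?\<K>. principal {K'. compact K' \<and> M \<subseteq> K' \<and> K' \<subseteq> A} \<le>
        inf (principal {K'. compact K' \<and> K \<subseteq> K' \<and> K' \<subseteq> A}) (principal {K'. compact K' \<and> L \<subseteq> K' \<and> K' \<subseteq> A})"
      by blast
  qed
  then show ?thesis by (auto simp: eventually_principal)
qed

lemma compacts_at_top_neq_bot: "compacts_at_top A \<noteq> bot"
  unfolding trivial_limit_def eventually_compacts_at_top by blast

lemma real_le_if_le_mult:
  fixes a b c :: real assumes "\<And>e. 0 < e \<Longrightarrow> a \<le> b + e * c" "0 \<le> c" shows "a \<le> b"
proof (rule field_le_epsilon)
  fix e :: real assume e: "0 < e"
  have "0 < e / (c + 1)" using assms(2) e by simp
  then have "a \<le> b + (e / (c + 1)) * c" by (rule assms(1))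
  moreover have "(e / (c + 1)) * c \<le> e" using e assms(2) by (simp add: field_simps)
  ultimately show "a \<le> b + e" by linarith
qed

context perfect_kernel
begin

section \<open>Potentials representing linear functionals on a compact set\<close>

text \<open>Boundedness of \<open>a \<mapsto> a \<phi>\<close> comes from the mass bound with factor
  \<open>D\<close>, the supremum of \<open>\<phi>\<close>; continuity comes from strong convergence
  being vague convergence.\<close>

lemma compact_riesz:
  assumes K: "compact K" and \<phi>: "\<phi> \<in> Cc" "\<forall>x. 0 \<le> \<phi> x"
  obtains m where "m \<in> finite_energy_on \<kappa> K" "\<forall>a\<in>finite_energy_on \<kappa> K. a \<phi> \<le> B m a" "B m m = m \<phi>"
proof -
  obtain \<eta> where \<eta>: "\<eta> \<in> Cc" "\<forall>x. 0 \<le> \<eta> x" "\<forall>x. \<eta> x \<le> 1" "\<forall>x\<in>K \<union> supp \<phi>. \<eta> x = 1"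
    by (rule cutoff[OF compact_Un[OF K Cc_compact_supp[OF \<phi>(1)]]])
  obtain D where D: "0 < D" "\<forall>x. \<bar>\<phi> x\<bar> \<le> D" by (rule Cc_bounded[OF \<phi>(1)])
  have \<eta>K: "\<forall>x\<in>K. \<eta> x = 1" using \<eta>(4) by blast
  obtain M where M: "0 \<le> M" "\<forall>\<mu>\<in>finite_energy_on \<kappa> K. \<mu> \<eta> \<le> M * sqrt (B \<mu> \<mu>)"
    by (rule mass_bound_compact[OF K \<eta>(1) \<eta>K])
  have bound: "a \<phi> \<le> (D * M) * sqrt (B a a)" if a: "a \<in> finite_energy_on \<kappa> K" for a
  proof -
    have p: "a \<in> radon_pos" using a finite_energy_on_Epos Epos_pos by blast
    have "\<phi> x \<le> D * \<eta> x" for x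
      using D(2)[rule_format, of x] \<eta>(2,4) D(1) not_in_supp[of x \<phi>] by (cases "x \<in> supp \<phi>") auto
    then have "a \<phi> \<le> a (\<lambda>x. D * \<eta> x)" by (rule radon_pos_mono[OF p \<phi>(1) Cc_scale[OF \<eta>(1)]])
    moreover have "a (\<lambda>x. D * \<eta> x) = D * a \<eta>" by (rule radon_scale[OF radon_pos_radon[OF p] \<eta>(1)])
    moreover have "D * a \<eta> \<le> D * (M * sqrt (B a a))" using M(2) a D(1) by (intro mult_left_mono) auto
    ultimately show ?thesis by (simp add: mult.assoc)
  qed
  show ?thesis
  proof (rule cone_riesz[of "finite_energy_on \<kappa> K" "\<lambda>a. a \<phi>" "D * M"])
    show "(\<lambda>n. s n \<phi>) \<longlonglongrightarrow> l \<phi>"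
      if s: "\<And>n. s n \<in> finite_energy_on \<kappa> K" "l \<in> finite_energy_on \<kappa> K" "(\<lambda>n. sd (s n) l) \<longlonglongrightarrow> 0" for s l
    proof -
      have "limitin (strong_topology_pos \<kappa>) s l sequentially"
        using subsetD[OF finite_energy_on_Epos s(1)] subsetD[OF finite_energy_on_Epos s(2)] s(3)
        by (simp add: limitin_strong_iff)
      then show ?thesis by (rule strong_imp_pointwise[OF _ \<phi>(1)])
    qed
    fix m assume "m \<in> finite_energy_on \<kappa> K" "\<And>a. a \<in> finite_energy_on \<kappa> K \<Longrightarrow> a \<phi> \<le> B m a" "B m m = m \<phi>"
    then show thesis using that by blast
  next
    show "finite_energy_on \<kappa> K \<subseteq> Epos" by (rule finite_energy_on_Epos)
    show "radon_zero \<in> finite_energy_on \<kappa> K" by (rule finite_energy_on_zero[OF K])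
    show "radon_plus a b \<in> finite_energy_on \<kappa> K" if "a \<in> finite_energy_on \<kappa> K" "b \<in> finite_energy_on \<kappa> K" for a b
      by (rule finite_energy_on_plus[OF K that])
    show "radon_cmult t a \<in> finite_energy_on \<kappa> K" if "a \<in> finite_energy_on \<kappa> K" "0 \<le> t" for a t
      by (rule finite_energy_on_cmult[OF K that])
    show "n \<in> finite_energy_on \<kappa> K" if "\<And>i. s i \<in> finite_energy_on \<kappa> K" "n \<in> Epos" "(\<lambda>i. sd (s i) n) \<longlonglongrightarrow> 0" for s n
      by (rule finite_energy_on_strong_closed[OF K that])
    show "radon_plus a b \<phi> = a \<phi> + b \<phi>" for a b using \<phi>(1) by simp
    show "radon_cmult t a \<phi> = t * a \<phi>" for a t using \<phi>(1) by simp
    show "a \<phi> \<le> (D * M) * sqrt (B a a)" if "a \<in> finite_energy_on \<kappa> K" for a by (rule bound[OF that])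
  qed
qed

lemma pos_integral_eq_on_carrier:
  assumes a: "a \<in> finite_energy_on \<kappa> K" and K: "compact K" and u: "lower_semicont u"
    and \<phi>: "\<phi> \<in> Cc" "\<forall>x. 0 \<le> \<phi> x" "\<forall>x\<in>K. u x = ennreal (\<phi> x)"
  shows "pos_integral a u = ennreal (a \<phi>)"
proof -
  have aE: "a \<in> Epos" "emeasure (radon_measure a) (-K) = 0" using a by (auto simp: finite_energy_on_iff[OF K])
  note p = Epos_pos[OF aE(1)]
  have "AE x in radon_measure a. u x = ennreal (\<phi> x)"
    using carrier_AE[OF p K aE(2)] by eventually_elim (use \<phi>(3) in blast)
  then have "pos_integral a u = pos_integral a (\<lambda>x. ennreal (\<phi> x))"
    by (rule pos_integral_AE_eq[OF p u lower_semicont_continuous[OF Cc_continuous[OF \<phi>(1)]]])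
  then show ?thesis using pos_integral_Cc[OF p \<phi>(1)] \<phi>(2) by simp
qed

text \<open>Applying the variational inequality to restrictions of \<open>a\<close> gives
  \<open>u \<le> U m\<close> a.e. For the converse with respect to \<open>m\<close>, the inequality
  is applied to the two parts of \<open>m\<close> on \<open>S\<close> and off \<open>S\<close>;
  equality for their sum forces the reverse inequality on each part.\<close>

lemma riesz_potential_AE:
  assumes K: "compact K" and m: "m \<in> finite_energy_on \<kappa> K" and u: "lower_semicont u"
    and L: "\<And>a. a \<in> finite_energy_on \<kappa> K \<Longrightarrow> pos_integral a u = ennreal (L a)" "\<And>a. a \<in> finite_energy_on \<kappa> K \<Longrightarrow> 0 \<le> L a"
    and le: "\<And>a. a \<in> finite_energy_on \<kappa> K \<Longrightarrow> L a \<le> B m a" and eq: "B m m = L m"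
  shows "AE x in radon_measure m. U m x \<le> u x" "\<And>a. a \<in> finite_energy_on \<kappa> K \<Longrightarrow> AE x in radon_measure a. u x \<le> U m x"
proof -
  have mE: "m \<in> Epos" using m finite_energy_on_Epos by blast
  note mp = Epos_pos[OF mE]
  have Um: "pos_integral a (U m) = ennreal (B m a)" if a: "a \<in> finite_energy_on \<kappa> K" for a
  proof -
    have aE: "a \<in> Epos" using a finite_energy_on_Epos by blast
    then show ?thesis using pos_energy_real[OF aE mE] pos_energy_eq[OF Epos_pos[OF aE] mp] energy_inner_commute[OF aE mE] by simp
  qed
  show "AE x in radon_measure a. u x \<le> U m x" if a: "a \<in> finite_energy_on \<kappa> K" for a
  proof (rule AE_le_if_restrictions_le[OF _ u _ potential_lsc[OF mp]])
    show p: "a \<in> radon_pos" using a finite_energy_on_Epos Epos_pos by blast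
    show "pos_integral a u < \<infinity>" "pos_integral a (U m) < \<infinity>" using L(1)[OF a] Um[OF a] by simp_all
    fix S assume "S \<in> sets (radon_measure a)"
    then have r: "radon_restrict a S \<in> finite_energy_on \<kappa> K" by (rule finite_energy_on_restrict_sets[OF K a])
    show "pos_integral (radon_restrict a S) u \<le> pos_integral (radon_restrict a S) (U m)"
      unfolding L(1)[OF r] Um[OF r] by (rule ennreal_leI[OF le[OF r]])
  qed
  show "AE x in radon_measure m. U m x \<le> u x"
  proof (rule AE_le_if_restrictions_le[OF mp potential_lsc[OF mp] _ u])
    show "pos_integral m u < \<infinity>" "pos_integral m (U m) < \<infinity>" using L(1)[OF m] Um[OF m] by simp_all
    fix S assume S: "S \<in> sets (radon_measure m)"
    then have S': "- S \<in> sets (radon_measure m)" using sets.compl_sets[OF S] by (simp add: Compl_eq_Diff_UNIV)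
    let ?a = "radon_restrict m S" and ?b = "radon_restrict m (- S)"
    have a: "?a \<in> finite_energy_on \<kappa> K" and b: "?b \<in> finite_energy_on \<kappa> K"
      by (rule finite_energy_on_restrict_sets[OF K m S], rule finite_energy_on_restrict_sets[OF K m S'])
    have ab: "radon_plus ?a ?b = m" by (rule radon_restrict_plus_compl[OF mp S])
    have E: "?a \<in> Epos" "?b \<in> Epos" using a b finite_energy_on_Epos by blast+
    have "B m m = B m ?a + B m ?b" using energy_inner_plus_right[OF E mE] ab by simp
    moreover have "ennreal (L m) = ennreal (L ?a) + ennreal (L ?b)"
      using pos_integral_radon_plus[OF Epos_pos[OF E(1)] Epos_pos[OF E(2)], of u] unfolding ab L(1)[OF m] L(1)[OF a] L(1)[OF b] .
    then have "L m = L ?a + L ?b" using L(2)[OF m] L(2)[OF a] L(2)[OF b] by (simp flip: ennreal_plus)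
    ultimately have "B m ?a \<le> L ?a" using eq le[OF b] by linarith
    then show "pos_integral ?a (U m) \<le> pos_integral ?a u" unfolding L(1)[OF a] Um[OF a] by (rule ennreal_leI)
  qed
qed

text \<open>
  \<open>m\<close> is the balayage of \<open>\<omega>\<close> onto the compact set \<open>K\<close>; the equality of the potentials n.e. on \<open>K\<close> is
  expressed by integration against the measures of finite energy carried by \<open>K\<close>.
\<close>

definition swept :: "'a functional \<Rightarrow> 'a set \<Rightarrow> 'a functional \<Rightarrow> bool" where
  "swept \<omega> K m \<longleftrightarrow> m \<in> finite_energy_on \<kappa> K \<and> (\<forall>x. U m x \<le> U \<omega> x) \<and>
     (\<forall>a\<in>finite_energy_on \<kappa> K. pos_integral a (U \<omega>) = E a m)"

lemma sweptD:
  assumes "swept \<omega> K m"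
  shows "m \<in> finite_energy_on \<kappa> K" "m \<in> Epos" "m \<in> radon_pos" "U m x \<le> U \<omega> x"
    "\<And>a. a \<in> finite_energy_on \<kappa> K \<Longrightarrow> pos_integral a (U \<omega>) = E a m"
  using assms finite_energy_on_Epos Epos_pos by (auto simp: swept_def)

lemma equal_if_same_inner:
  assumes "a \<in> Epos" "b \<in> Epos" "B a a = B a b" "B b a = B b b" shows "a = b"
  by (rule energy_gap_eq_zero[OF assms(1,2)]) (use assms energy_inner_commute[OF assms(1,2)] in \<open>simp add: energy_gap_def\<close>)

lemma swept_eqI:
  assumes m: "swept \<omega> K m" and n: "n \<in> finite_energy_on \<kappa> K"
    and eq: "\<And>a. a \<in> finite_energy_on \<kappa> K \<Longrightarrow> pos_integral a (U \<omega>) = E a n"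
  shows "n = m"
proof (rule equal_if_same_inner)
  note nE = subsetD[OF finite_energy_on_Epos n]
  have same: "B a n = B a m" if "a \<in> finite_energy_on \<kappa> K" for a
    using eq[OF that] sweptD(5)[OF m that] by (simp add: energy_inner_def)
  show "n \<in> Epos" "m \<in> Epos" by (rule nE, rule sweptD(2)[OF m])
  show "B n n = B n m" "B m n = B m m" using same[OF n] same[OF sweptD(1)[OF m]] by auto
qed

lemma swept_nearly_everywhere:
  assumes m: "swept \<omega> K m" and K: "compact K" and \<omega>: "\<omega> \<in> radon_pos"
  shows "nearly_everywhere \<kappa> K (\<lambda>x. potential \<kappa> m x = potential \<kappa> \<omega> x)"
proof (rule nearly_everywhere_eqI[OF \<omega> sweptD(3)[OF m] _ sweptD(4)[OF m]])
  show "nearly_everywhere \<kappa> K (\<lambda>x. potential \<kappa> \<omega> x \<le> potential \<kappa> m x)"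
  proof (rule nearly_everywhere_leI[OF \<omega> sweptD(2)[OF m]])
    fix K' \<rho> assume "compact K'" "K' \<subseteq> K" "\<rho> \<in> finite_energy_on \<kappa> K'"
    then have "\<rho> \<in> finite_energy_on \<kappa> K" using finite_energy_on_subset by blast
    then show "pos_integral \<rho> (U \<omega>) \<le> E \<rho> m" using sweptD(5)[OF m] by simp
  qed
qed

lemma nearly_everywhere_eqD:
  assumes \<omega>: "\<omega> \<in> radon_pos" and m: "m \<in> radon_pos"
    and ne: "nearly_everywhere \<kappa> A (\<lambda>x. potential \<kappa> m x = potential \<kappa> \<omega> x)"
    and K: "compact K" "K \<subseteq> A" and a: "a \<in> finite_energy_on \<kappa> K"
  shows "pos_integral a (U \<omega>) = E a m"
proof -
  have p: "a \<in> radon_pos" using a finite_energy_on_Epos Epos_pos by blast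
  have "AE x in radon_measure a. U m x = U \<omega> x"
    using ne[unfolded nearly_everywhere_potential_eq_iff[OF m \<omega>]] K a by blast
  from pos_integral_AE_eq[OF p potential_lsc[OF m] potential_lsc[OF \<omega>] this]
  show ?thesis using pos_energy_eq[OF p m] by simp
qed

lemma is_compact_balayage_iff_swept:
  assumes s: "swept \<omega> K m" and K: "compact K" and \<omega>: "\<omega> \<in> radon_pos"
  shows "is_compact_balayage \<kappa> \<omega> K n \<longleftrightarrow> n = m"
proof
  assume "is_compact_balayage \<kappa> \<omega> K n"
  then have n: "n \<in> finite_energy_on \<kappa> K" "nearly_everywhere \<kappa> K (\<lambda>x. potential \<kappa> n x = potential \<kappa> \<omega> x)"
    by (auto simp: is_compact_balayage_def)
  have "n \<in> radon_pos" using n(1) finite_energy_on_Epos Epos_pos by blast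
  from nearly_everywhere_eqD[OF \<omega> this n(2) K order.refl] show "n = m" by (rule swept_eqI[OF s n(1)])
next
  assume "n = m"
  then show "is_compact_balayage \<kappa> \<omega> K n"
    using sweptD(1)[OF s] swept_nearly_everywhere[OF s K \<omega>] by (simp add: is_compact_balayage_def)
qed

text \<open>Both inner products are strongly continuous in \<open>\<sigma>\<close>, so agreement on
  the dense family of measures carried by compact sets suffices.\<close>

lemma closure_test:
  assumes \<nu>: "\<nu> \<in> Epos" "\<nu>' \<in> Epos" and \<sigma>: "\<sigma> \<in> closure_on \<kappa> A"
    and eq: "\<And>K \<rho>. compact K \<Longrightarrow> K \<subseteq> A \<Longrightarrow> \<rho> \<in> finite_energy_on \<kappa> K \<Longrightarrow> B \<rho> \<nu> = B \<rho> \<nu>'"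
  shows "B \<sigma> \<nu> = B \<sigma> \<nu>'"
proof -
  have \<sigma>E: "\<sigma> \<in> Epos" using \<sigma> by (simp add: closure_on_iff)
  let ?c = "sqrt (B \<nu> \<nu>) + sqrt (B \<nu>' \<nu>')"
  have "\<bar>B \<sigma> \<nu> - B \<sigma> \<nu>'\<bar> \<le> 0 + e * ?c" if e: "0 < e" for e
  proof -
    obtain K \<rho> where K: "compact K" "K \<subseteq> A" "\<rho> \<in> finite_energy_on \<kappa> K" "sd \<sigma> \<rho> < e"
      using \<sigma> e unfolding closure_on_iff by blast
    have \<rho>: "\<rho> \<in> Epos" using K(3) finite_energy_on_Epos by blast
    have "sd \<sigma> \<rho> * sqrt (B \<nu> \<nu>) \<le> e * sqrt (B \<nu> \<nu>)" "sd \<sigma> \<rho> * sqrt (B \<nu>' \<nu>') \<le> e * sqrt (B \<nu>' \<nu>')"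
      using K(4) energy_inner_nonneg by (auto intro!: mult_right_mono)
    then show ?thesis
      using energy_inner_diff_le[OF \<sigma>E \<rho> \<nu>(1)] energy_inner_diff_le[OF \<sigma>E \<rho> \<nu>(2)] eq[OF K(1-3)]
      by (simp add: distrib_left)
  qed
  then have "\<bar>B \<sigma> \<nu> - B \<sigma> \<nu>'\<bar> \<le> 0"
    by (rule real_le_if_le_mult) (auto intro!: add_nonneg_nonneg real_sqrt_ge_zero energy_inner_nonneg)
  then show ?thesis by simp
qed

text \<open>The two candidates have the same inner product with every measure of finite energy on a
  compact subset of \<open>A\<close>, hence, by density, with each other and with
  themselves.\<close>

lemma closure_on_unique:
  assumes \<nu>: "\<nu> \<in> closure_on \<kappa> A" "\<nu>' \<in> closure_on \<kappa> A" and \<omega>: "\<omega> \<in> radon_pos"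
    and ne: "nearly_everywhere \<kappa> A (\<lambda>x. potential \<kappa> \<nu> x = potential \<kappa> \<omega> x)"
      "nearly_everywhere \<kappa> A (\<lambda>x. potential \<kappa> \<nu>' x = potential \<kappa> \<omega> x)"
  shows "\<nu> = \<nu>'"
proof (rule equal_if_same_inner)
  show E: "\<nu> \<in> Epos" "\<nu>' \<in> Epos" using \<nu> by (auto simp: closure_on_iff)
  have "B \<rho> \<nu> = B \<rho> \<nu>'" if "compact K" "K \<subseteq> A" "\<rho> \<in> finite_energy_on \<kappa> K" for K \<rho>
    using nearly_everywhere_eqD[OF \<omega> Epos_pos[OF E(1)] ne(1) that] nearly_everywhere_eqD[OF \<omega> Epos_pos[OF E(2)] ne(2) that]
    by (simp add: energy_inner_def)
  from closure_test[OF E \<nu>(1) this] closure_test[OF E \<nu>(2) this] show "B \<nu> \<nu> = B \<nu> \<nu>'" "B \<nu>' \<nu> = B \<nu>' \<nu>'" by auto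
qed

end

locale balayage_kernel = perfect_kernel T \<kappa> for T :: "'a::t2_space itself" and \<kappa> +
  assumes domination: "domination_principle \<kappa>"
begin

lemma dominationD:
  assumes \<mu>: "\<mu> \<in> Epos" and \<nu>: "\<nu> \<in> radon_pos" and le: "AE x in radon_measure \<mu>. U \<mu> x \<le> U \<nu> x"
  shows "U \<mu> x \<le> U \<nu> x"
proof -
  note p = Epos_pos[OF \<mu>]
  have iff: "potential \<kappa> \<mu> y \<le> potential \<kappa> \<nu> y \<longleftrightarrow> U \<mu> y \<le> U \<nu> y" for y
    by (simp add: potential_pos p \<nu> less_eq_ennreal.rep_eq)
  have "{x. \<not> U \<mu> x \<le> U \<nu> x} \<in> null_sets (radon_measure \<mu>)"
  proof -
    have "{x. U \<nu> x < U \<mu> x} \<in> sets borel" using borel_measurable_less[OF borel_potential[OF \<nu>] borel_potential[OF p]] by simp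
    then have S: "{x. \<not> U \<mu> x \<le> U \<nu> x} \<in> sets (radon_measure \<mu>)"
      using borel_in_sets_radon_measure[OF p] by (auto simp: not_le)
    show ?thesis using le AE_iff_measurable[OF S, of "\<lambda>x. U \<mu> x \<le> U \<nu> x"] S by auto
  qed
  then have "negligible_for \<mu> {x. \<not> potential \<kappa> \<mu> x \<le> potential \<kappa> \<nu> x}"
    unfolding iff using null_sets_radon_measure[OF p] by simp
  then have "potential \<kappa> \<mu> x \<le> potential \<kappa> \<nu> x"
    using domination \<mu> \<nu> unfolding domination_principle_def by blast
  then show ?thesis by (simp add: iff)
qed

text \<open>Only \<open>U m \<le> U \<omega>\<close> a.e. with respect to \<open>m\<close> comes
  from minimality; the domination principle spreads it to all of \<open>X\<close>, where it meets
  the opposite inequality a.e. for every \<open>a\<close> on \<open>K\<close>.\<close>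

lemma sweptI:
  assumes K: "compact K" and m: "m \<in> finite_energy_on \<kappa> K" and \<omega>: "\<omega> \<in> radon_pos"
    and L: "\<And>a. a \<in> finite_energy_on \<kappa> K \<Longrightarrow> pos_integral a (U \<omega>) = ennreal (L a)" "\<And>a. a \<in> finite_energy_on \<kappa> K \<Longrightarrow> 0 \<le> L a"
    and le: "\<And>a. a \<in> finite_energy_on \<kappa> K \<Longrightarrow> L a \<le> B m a" and eq: "B m m = L m"
  shows "swept \<omega> K m"
proof -
  have mE: "m \<in> Epos" using m finite_energy_on_Epos by blast
  have AE1: "AE x in radon_measure m. U m x \<le> U \<omega> x"
    by (rule riesz_potential_AE(1)[where L = L, OF K m potential_lsc[OF \<omega>]]) (use L le eq in auto)
  have AE2: "AE x in radon_measure a. U \<omega> x \<le> U m x" if a: "a \<in> finite_energy_on \<kappa> K" for a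
    by (rule riesz_potential_AE(2)[where L = L, OF K m potential_lsc[OF \<omega>] _ _ _ _ a]) (use L le eq in auto)
  have Ule: "U m x \<le> U \<omega> x" for x by (rule dominationD[OF mE \<omega> AE1])
  have "pos_integral a (U \<omega>) = E a m" if a: "a \<in> finite_energy_on \<kappa> K" for a
  proof -
    have p: "a \<in> radon_pos" using a finite_energy_on_Epos Epos_pos by blast
    have "AE x in radon_measure a. U \<omega> x = U m x" using AE2[OF a] by eventually_elim (rule antisym[OF _ Ule])
    from pos_integral_AE_eq[OF p potential_lsc[OF \<omega>] potential_lsc[OF Epos_pos[OF mE]] this]
    show ?thesis using pos_energy_eq[OF p Epos_pos[OF mE]] by simp
  qed
  then show ?thesis using m Ule by (simp add: swept_def)
qed

text \<open>For \<open>l\<close> of finite energy the functional \<open>a \<mapsto> B a l\<close> is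
  bounded and strongly continuous by the Cauchy-Schwarz inequality, so finite energy takes the place
  of continuity of the potential.\<close>

lemma swept_energy_exists:
  assumes K: "compact K" and l: "l \<in> Epos" obtains m where "swept l K m"
proof -
  have E: "a \<in> Epos" if "a \<in> finite_energy_on \<kappa> K" for a using that finite_energy_on_Epos by blast
  have "\<exists>m\<in>finite_energy_on \<kappa> K. (\<forall>a\<in>finite_energy_on \<kappa> K. B a l \<le> B m a) \<and> B m m = B m l"
  proof (rule cone_riesz[of "finite_energy_on \<kappa> K" "\<lambda>a. B a l" "sqrt (B l l)"])
    show "finite_energy_on \<kappa> K \<subseteq> Epos" by (rule finite_energy_on_Epos)
    show "radon_zero \<in> finite_energy_on \<kappa> K" by (rule finite_energy_on_zero[OF K])
    show "radon_plus a b \<in> finite_energy_on \<kappa> K" if "a \<in> finite_energy_on \<kappa> K" "b \<in> finite_energy_on \<kappa> K" for a b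
      by (rule finite_energy_on_plus[OF K that])
    show "radon_cmult t a \<in> finite_energy_on \<kappa> K" if "a \<in> finite_energy_on \<kappa> K" "0 \<le> t" for a t
      by (rule finite_energy_on_cmult[OF K that])
    show "n \<in> finite_energy_on \<kappa> K" if "\<And>i. s i \<in> finite_energy_on \<kappa> K" "n \<in> Epos" "(\<lambda>i. sd (s i) n) \<longlonglongrightarrow> 0" for s n
      by (rule finite_energy_on_strong_closed[OF K that])
    show "B (radon_plus a b) l = B a l + B b l" if "a \<in> finite_energy_on \<kappa> K" "b \<in> finite_energy_on \<kappa> K" for a b
      by (rule energy_inner_plus_left[OF E[OF that(1)] E[OF that(2)] l])
    show "B (radon_cmult t a) l = t * B a l" if "a \<in> finite_energy_on \<kappa> K" "0 \<le> t" for a t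
      by (rule energy_inner_cmult_left[OF E[OF that(1)] l that(2)])
    show "B a l \<le> sqrt (B l l) * sqrt (B a a)" if "a \<in> finite_energy_on \<kappa> K" for a
      using energy_inner_le[OF E[OF that] l] by (simp add: mult.commute)
    show "(\<lambda>i. B (s i) l) \<longlonglongrightarrow> B n l"
      if "\<And>i. s i \<in> finite_energy_on \<kappa> K" "n \<in> finite_energy_on \<kappa> K" "(\<lambda>i. sd (s i) n) \<longlonglongrightarrow> 0" for s n
      by (rule energy_inner_tendsto[OF E[OF that(1)] E[OF that(2)] that(3) l])
    fix m assume "m \<in> finite_energy_on \<kappa> K" "\<And>a. a \<in> finite_energy_on \<kappa> K \<Longrightarrow> B a l \<le> B m a" "B m m = B m l"
    then show ?thesis by blast
  qed
  then obtain m where m: "m \<in> finite_energy_on \<kappa> K" "\<forall>a\<in>finite_energy_on \<kappa> K. B a l \<le> B m a" "B m m = B m l" by blast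
  have "swept l K m"
  proof (rule sweptI[OF K m(1) Epos_pos[OF l], of "\<lambda>a. B a l"])
    show "pos_integral a (U l) = ennreal (B a l)" if "a \<in> finite_energy_on \<kappa> K" for a
      using pos_energy_real[OF E[OF that] l] pos_energy_eq[OF Epos_pos[OF E[OF that]] Epos_pos[OF l]] by simp
  qed (use m energy_inner_nonneg in auto)
  then show ?thesis by (rule that)
qed

text \<open>Since \<open>m\<close> has finite energy and is carried by \<open>K\<close>, an
  inequality n.e. on \<open>A\<close> holds a.e. for \<open>m\<close>; the domination principle does
  the rest.\<close>

lemma swept_dominated:
  assumes m: "swept \<omega> K m" and K: "compact K" "K \<subseteq> A" and \<omega>: "\<omega> \<in> radon_pos" and \<nu>: "\<nu> \<in> radon_pos"
    and ne: "nearly_everywhere \<kappa> A (\<lambda>x. potential \<kappa> \<omega> x \<le> potential \<kappa> \<nu> x)"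
  shows "U m x \<le> U \<nu> x"
proof (rule dominationD[OF sweptD(2)[OF m] \<nu>])
  have "AE x in radon_measure m. U \<omega> x \<le> U \<nu> x"
    using ne[unfolded nearly_everywhere_potential_le_iff[OF \<omega> \<nu>]] K sweptD(1)[OF m] by blast
  then show "AE x in radon_measure m. U m x \<le> U \<nu> x" by eventually_elim (rule order_trans[OF sweptD(4)[OF m]])
qed

lemma nearly_everywhere_eq_imp_le:
  assumes "\<mu> \<in> radon_pos" "\<nu> \<in> radon_pos" "nearly_everywhere \<kappa> A (\<lambda>x. potential \<kappa> \<nu> x = potential \<kappa> \<mu> x)"
  shows "nearly_everywhere \<kappa> A (\<lambda>x. potential \<kappa> \<mu> x \<le> potential \<kappa> \<nu> x)"
  unfolding nearly_everywhere_potential_le_iff[OF assms(1,2)]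
proof (intro allI impI)
  fix K \<rho> assume "compact K \<and> K \<subseteq> A \<and> \<rho> \<in> finite_energy_on \<kappa> K"
  then have "AE x in radon_measure \<rho>. U \<nu> x = U \<mu> x"
    using assms(3)[unfolded nearly_everywhere_potential_eq_iff[OF assms(2,1)]] by blast
  then show "AE x in radon_measure \<rho>. U \<mu> x \<le> U \<nu> x" by eventually_elim simp
qed

text \<open>Since \<open>m\<close> is also carried by \<open>K'\<close>, both \<open>E m m'\<close>
  and \<open>E m m\<close> equal the integral of \<open>U \<omega>\<close> with respect to
  \<open>m\<close>. The gap therefore reduces to a difference of energies, as in the theorem of
  Pythagoras.\<close>

lemma swept_mono:
  assumes m: "swept \<omega> K m" and m': "swept \<omega> K' m'" and K: "compact K" "compact K'" "K \<subseteq> K'" and \<omega>: "\<omega> \<in> radon_pos"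
  shows "U m x \<le> U m' x" "Q m m' = B m' m' - B m m" "B m m \<le> B m' m'"
proof -
  show "U m x \<le> U m' x"
    by (rule swept_dominated[OF m K(1,3) \<omega> sweptD(3)[OF m']])
      (rule nearly_everywhere_eq_imp_le[OF \<omega> sweptD(3)[OF m'] swept_nearly_everywhere[OF m' K(2) \<omega>]])
  have "m \<in> finite_energy_on \<kappa> K'" using sweptD(1)[OF m] finite_energy_on_subset[OF K(1,3)] by blast
  then have "E m m' = E m m" using sweptD(5)[OF m'] sweptD(5)[OF m sweptD(1)[OF m]] by simp
  then show Q: "Q m m' = B m' m' - B m m" by (simp add: energy_gap_def energy_inner_def)
  then show "B m m \<le> B m' m'" using energy_gap_nonneg[OF sweptD(2)[OF m] sweptD(2)[OF m']] by simp
qed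

section \<open>Limits along the net of compact sets\<close>

text \<open>Strong completeness concerns sequences, whereas the compact subsets form a net. A
  sequence of compact sets whose energies approach the supremum suffices: every larger compact set
  is then uniformly close to it.\<close>

lemma swept_limit:
  assumes \<omega>: "\<omega> \<in> radon_pos" and m': "\<forall>K. compact K \<and> K \<subseteq> A \<longrightarrow> swept \<omega> K (m K)"
    and bdd: "\<forall>K. compact K \<and> K \<subseteq> A \<longrightarrow> B (m K) (m K) \<le> c"
  obtains \<nu> where "limitin (strong_topology_pos \<kappa>) m \<nu> (compacts_at_top A)"
proof -
  have m: "swept \<omega> K (m K)" if "compact K" "K \<subseteq> A" for K using m' that by blast
  let ?\<K> = "{K. compact K \<and> K \<subseteq> A}"
  define S where "S = (SUP K\<in>?\<K>. B (m K) (m K))"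
  have ne: "?\<K> \<noteq> {}" using compact_empty by blast
  have bdd': "bdd_above ((\<lambda>K. B (m K) (m K)) ` ?\<K>)" by (rule bdd_aboveI2[of _ _ c]) (use bdd in auto)
  have S: "B (m K) (m K) \<le> S" if "compact K" "K \<subseteq> A" for K
    unfolding S_def by (rule cSUP_upper[OF _ bdd']) (use that in simp)
  have "\<exists>K\<in>?\<K>. S - inverse (real (Suc n)) < B (m K) (m K)" for n
    using less_cSUP_iff[OF ne bdd', of "S - inverse (real (Suc n))"] by (simp add: S_def)
  then obtain K where K': "\<forall>n. K n \<in> ?\<K> \<and> S - inverse (real (Suc n)) < B (m (K n)) (m (K n))" by metis
  then have K: "compact (K n)" "K n \<subseteq> A" "S - inverse (real (Suc n)) < B (m (K n)) (m (K n))" for n by auto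
  have mE: "m K \<in> Epos" if "compact K" "K \<subseteq> A" for K by (rule sweptD(2)[OF m[OF that]])
  have close: "Q (m (K n)) (m L) \<le> inverse (real (Suc n))" if L: "compact L" "K n \<subseteq> L" "L \<subseteq> A" for n L
    using swept_mono(2)[OF m[OF K(1,2)] m[OF L(1,3)] K(1) L(1,2) \<omega>] S[OF L(1,3)] K(3)[of n] by linarith
  have closed: "sd (m L) (m (K n)) \<le> sqrt (inverse (real (Suc n)))" if L: "compact L" "K n \<subseteq> L" "L \<subseteq> A" for n L
    using close[OF L] strong_dist_Epos[OF mE[OF L(1,3)] mE[OF K(1,2)[of n]]] energy_gap_commute[OF mE[OF L(1,3)] mE[OF K(1,2)[of n]]]
    by simp
  have small: "\<exists>N. \<forall>n\<ge>N. sqrt (inverse (real (Suc n))) < d" if d: "0 < d" for d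
  proof -
    have "0 < d\<^sup>2" using d by simp
    then obtain N where N: "inverse (real (Suc N)) < d\<^sup>2" using reals_Archimedean by blast
    have "sqrt (inverse (real (Suc n))) < d" if "N \<le> n" for n
    proof -
      have "inverse (real (Suc n)) \<le> inverse (real (Suc N))" using that by (intro le_imp_inverse_le) auto
      then have "inverse (real (Suc n)) < d\<^sup>2" using N by linarith
      then have "sqrt (inverse (real (Suc n))) < sqrt (d\<^sup>2)" by (rule real_sqrt_less_mono)
      then show ?thesis using d by simp
    qed
    then show ?thesis by blast
  qed
  have cauchy: "\<exists>N. \<forall>i\<ge>N. \<forall>j\<ge>N. Q (m (K i)) (m (K j)) < e" if e: "0 < e" for e
  proof -
    obtain N where N: "\<forall>n\<ge>N. sqrt (inverse (real (Suc n))) < sqrt e / 2" using small[of "sqrt e / 2"] e by auto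
    have "Q (m (K i)) (m (K j)) < e" if ij: "N \<le> i" "N \<le> j" for i j
    proof -
      \<comment> \<open>The sets \<open>K i\<close> and \<open>K j\<close> need not be nested; both
        are compared with their union.\<close>
      let ?L = "K i \<union> K j"
      have L: "compact ?L" "?L \<subseteq> A" using K by (auto intro: compact_Un)
      have "sd (m (K i)) (m (K j)) \<le> sd (m (K i)) (m ?L) + sd (m ?L) (m (K j))"
        by (rule SP.sub.triangle[OF mE[OF K(1,2)] mE[OF L] mE[OF K(1,2)]])
      also have "\<dots> < sqrt e / 2 + sqrt e / 2"
        using closed[OF L(1) _ L(2), of i] closed[OF L(1) _ L(2), of j] N ij SM.commute[of "m (K i)" "m ?L"]
        by (intro add_strict_mono) (auto intro: order_le_less_trans)
      finally have "sqrt (Q (m (K i)) (m (K j))) < sqrt e" using strong_dist_Epos[OF mE[OF K(1,2)[of i]] mE[OF K(1,2)[of j]]] by simp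
      then show ?thesis by simp
    qed
    then show ?thesis by blast
  qed
  obtain \<nu> where \<nu>: "\<nu> \<in> Epos" "(\<lambda>n. sd (m (K n)) \<nu>) \<longlonglongrightarrow> 0" by (rule strong_complete[OF mE[OF K(1,2)] cauchy])
  have "limitin (strong_topology_pos \<kappa>) m \<nu> (compacts_at_top A)"
    unfolding strong_topology_pos_eq SP.sub.limitin_metric
  proof (intro conjI allI impI)
    show "\<nu> \<in> Epos" by (rule \<nu>(1))
    fix e :: real assume e: "0 < e"
    obtain N where N: "\<forall>n\<ge>N. sqrt (inverse (real (Suc n))) < e / 2" using small[of "e / 2"] e by auto
    have "\<forall>\<^sub>F n in sequentially. sd (m (K n)) \<nu> < e / 2" using order_tendstoD(2)[OF \<nu>(2), of "e / 2"] e by simp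
    then obtain N' where N': "\<forall>n\<ge>N'. sd (m (K n)) \<nu> < e / 2" by (auto simp: eventually_sequentially)
    let ?n = "max N N'"
    have "m L \<in> Epos \<and> sd (m L) \<nu> < e" if L: "compact L" "K ?n \<subseteq> L" "L \<subseteq> A" for L
    proof -
      have "sd (m L) \<nu> \<le> sd (m L) (m (K ?n)) + sd (m (K ?n)) \<nu>"
        by (rule SP.sub.triangle[OF mE[OF L(1,3)] mE[OF K(1,2)] \<nu>(1)])
      moreover have "sd (m L) (m (K ?n)) < e / 2" using closed[OF L] N by (meson max.cobounded1 order_le_less_trans)
      moreover have "sd (m (K ?n)) \<nu> < e / 2" using N' by simp
      ultimately show ?thesis using mE[OF L(1,3)] by linarith
    qed
    then show "\<forall>\<^sub>F x in compacts_at_top A. m x \<in> Epos \<and> sd (m x) \<nu> < e"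
      unfolding eventually_compacts_at_top using K(1,2)[of ?n] by blast
  qed
  then show ?thesis by (rule that)
qed

text \<open>The pairing with a fixed measure on \<open>K\<close> is constant along the net from
  \<open>K\<close> on and so passes to the limit. The bound by \<open>U \<omega>\<close> comes from
  descent, which bounds the potential of the limit by the supremum of those in the net; the
  domination principle then shows that this supremum is attained from below.\<close>

lemma swept_limit_props:
  assumes \<omega>: "\<omega> \<in> radon_pos" and m': "\<forall>K. compact K \<and> K \<subseteq> A \<longrightarrow> swept \<omega> K (m K)"
    and lim: "limitin (strong_topology_pos \<kappa>) m \<nu> (compacts_at_top A)"
  shows "\<nu> \<in> Epos" "\<And>K a. compact K \<Longrightarrow> K \<subseteq> A \<Longrightarrow> a \<in> finite_energy_on \<kappa> K \<Longrightarrow> pos_integral a (U \<omega>) = E a \<nu>"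
    "\<And>x. U \<nu> x \<le> U \<omega> x" "nearly_everywhere \<kappa> A (\<lambda>x. potential \<kappa> \<nu> x = potential \<kappa> \<omega> x)"
    "\<And>K x. compact K \<Longrightarrow> K \<subseteq> A \<Longrightarrow> U (m K) x \<le> U \<nu> x"
    "\<And>x. U \<nu> x = (SUP K\<in>{K. compact K \<and> K \<subseteq> A}. U (m K) x)"
    "\<nu> \<in> closure_on \<kappa> A"
proof -
  have m: "swept \<omega> K (m K)" if "compact K" "K \<subseteq> A" for K using m' that by blast
  show \<nu>: "\<nu> \<in> Epos" using lim by (simp add: limitin_strong_iff)
  note p = Epos_pos[OF \<nu>]
  have near: "\<exists>K. compact K \<and> K \<subseteq> A \<and> (\<forall>K'. compact K' \<and> K \<subseteq> K' \<and> K' \<subseteq> A \<longrightarrow> sd (m K') \<nu> < e)" if "0 < e" for e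
  proof -
    have "\<forall>\<^sub>F K in compacts_at_top A. sd (m K) \<nu> < e"
      using lim that order_tendstoD(2)[of "\<lambda>K. sd (m K) \<nu>" 0 _ e] by (simp add: limitin_strong_iff)
    then show ?thesis by (simp add: eventually_compacts_at_top)
  qed
  show test: "pos_integral a (U \<omega>) = E a \<nu>" if K: "compact K" "K \<subseteq> A" and a: "a \<in> finite_energy_on \<kappa> K" for K a
  proof -
    have aE: "a \<in> Epos" using a finite_energy_on_Epos by blast
    have mK: "m K \<in> Epos" by (rule sweptD(2)[OF m[OF K]])
    \<comment> \<open>On any compact set containing \<open>K\<close> the pairing with
      \<open>a\<close> still equals the integral of \<open>U \<omega>\<close>, so \<open>m K\<close>
      may be replaced by a measure close to \<open>\<nu>\<close>.\<close>
    have "\<bar>B a \<nu> - B a (m K)\<bar> \<le> 0 + e * sqrt (B a a)" if e: "0 < e" for e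
    proof -
      obtain L where L: "compact L" "L \<subseteq> A" "\<forall>K'. compact K' \<and> L \<subseteq> K' \<and> K' \<subseteq> A \<longrightarrow> sd (m K') \<nu> < e"
        using near[OF e] by blast
      let ?M = "L \<union> K"
      have M: "compact ?M" "?M \<subseteq> A" "K \<subseteq> ?M" using K L by (auto intro: compact_Un)
      have mM: "m ?M \<in> Epos" by (rule sweptD(2)[OF m[OF M(1,2)]])
      have d: "sd (m ?M) \<nu> < e" using L(3) M by blast
      have "a \<in> finite_energy_on \<kappa> ?M" using a finite_energy_on_subset[OF K(1) M(3)] by blast
      then have "E a (m ?M) = E a (m K)" using sweptD(5)[OF m[OF M(1,2)]] sweptD(5)[OF m[OF K] a] by simp
      then have eq: "B a (m ?M) = B a (m K)" by (simp add: energy_inner_def)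
      have "\<bar>B (m ?M) a - B \<nu> a\<bar> \<le> sd (m ?M) \<nu> * sqrt (B a a)" by (rule energy_inner_diff_le[OF mM \<nu> aE])
      also have "\<dots> \<le> e * sqrt (B a a)" using d energy_inner_nonneg[of a a] by (intro mult_right_mono) auto
      finally show ?thesis using eq energy_inner_commute[OF mM aE] energy_inner_commute[OF \<nu> aE] by (simp add: abs_minus_commute)
    qed
    then have "\<bar>B a \<nu> - B a (m K)\<bar> \<le> 0"
      by (rule real_le_if_le_mult) (auto intro!: real_sqrt_ge_zero energy_inner_nonneg)
    then have "B a \<nu> = B a (m K)" by simp
    then show ?thesis using sweptD(5)[OF m[OF K] a] pos_energy_real[OF aE \<nu>] pos_energy_real[OF aE mK] by simp
  qed
  have lsc: "\<forall>\<^sub>F K in compacts_at_top A. a < U (m K) x" if "a < U \<nu> x" for a x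
    using that unfolding pos_potential_def
    by (rule pos_integral_vague_lsc[rotated]) (rule strong_imp_pointwise[OF lim])
  have Ule: "U \<nu> x \<le> (SUP K\<in>{K. compact K \<and> K \<subseteq> A}. U (m K) x)" for x
  proof (rule dense_le)
    fix a assume "a < U \<nu> x"
    then obtain K where "compact K" "K \<subseteq> A" "a < U (m K) x"
      using lsc unfolding eventually_compacts_at_top by blast
    then show "a \<le> (SUP K\<in>{K. compact K \<and> K \<subseteq> A}. U (m K) x)" by (intro SUP_upper2[of K]) auto
  qed
  show le: "U \<nu> x \<le> U \<omega> x" for x
    by (rule order_trans[OF Ule SUP_least]) (use sweptD(4)[OF m] in auto)
  show ne: "nearly_everywhere \<kappa> A (\<lambda>x. potential \<kappa> \<nu> x = potential \<kappa> \<omega> x)"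
    by (rule nearly_everywhere_eqI[OF \<omega> p nearly_everywhere_leI[OF \<omega> \<nu>] le]) (simp add: test)
  show up: "U (m K) x \<le> U \<nu> x" if "compact K" "K \<subseteq> A" for K x
    by (rule swept_dominated[OF m[OF that] that \<omega> p nearly_everywhere_eq_imp_le[OF \<omega> p ne]])
  show "U \<nu> x = (SUP K\<in>{K. compact K \<and> K \<subseteq> A}. U (m K) x)" for x
    by (rule antisym[OF Ule SUP_least]) (use up in auto)
  show "\<nu> \<in> closure_on \<kappa> A"
    unfolding closure_on_iff
  proof (intro conjI allI impI \<nu>)
    fix e :: real assume "0 < e"
    then obtain K where K: "compact K" "K \<subseteq> A" "sd (m K) \<nu> < e" using near by blast
    then show "\<exists>K. compact K \<and> K \<subseteq> A \<and> (\<exists>\<rho>\<in>finite_energy_on \<kappa> K. sd \<nu> \<rho> < e)"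
      using sweptD(1)[OF m[OF K(1,2)]] SM.commute[of \<nu> "m K"]
      by (intro exI[of _ K] conjI bexI[of _ "m K"]) simp_all
  qed
qed

text \<open>Here \<open>\<tau>\<close> may have infinite energy, as \<open>\<omega>\<close> may, so
  strong convergence says nothing about \<open>E \<tau> (m K)\<close>. The potentials increase along
  the net, and integration commutes with directed suprema.\<close>

lemma pos_energy_swept_limit:
  assumes \<omega>: "\<omega> \<in> radon_pos" and m': "\<forall>K. compact K \<and> K \<subseteq> A \<longrightarrow> swept \<omega> K (m K)"
    and lim: "limitin (strong_topology_pos \<kappa>) m \<nu> (compacts_at_top A)" and \<tau>: "\<tau> \<in> radon_pos"
  shows "E \<tau> \<nu> = (SUP K\<in>{K. compact K \<and> K \<subseteq> A}. E \<tau> (m K))"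
proof -
  have m: "swept \<omega> K (m K)" if "compact K" "K \<subseteq> A" for K using m' that by blast
  let ?\<K> = "{K. compact K \<and> K \<subseteq> A}"
  note props = swept_limit_props[OF \<omega> m' lim]
  have mp: "m K \<in> radon_pos" if "K \<in> ?\<K>" for K using sweptD(3)[OF m] that by simp
  have "U \<nu> = (\<lambda>x. SUP g\<in>(\<lambda>K. U (m K)) ` ?\<K>. g x)"
    unfolding image_image using props(6) by (rule ext)
  moreover have "pos_integral \<tau> (\<lambda>x. SUP g\<in>(\<lambda>K. U (m K)) ` ?\<K>. g x) = (SUP g\<in>(\<lambda>K. U (m K)) ` ?\<K>. pos_integral \<tau> g)"
  proof (rule pos_integral_directed_SUP[OF \<tau>])
    show "(\<lambda>K. U (m K)) ` ?\<K> \<noteq> {}" using compact_empty by blast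
    show "lower_semicont g" if "g \<in> (\<lambda>K. U (m K)) ` ?\<K>" for g using that potential_lsc[OF mp] by auto
    fix f g assume "f \<in> (\<lambda>K. U (m K)) ` ?\<K>" "g \<in> (\<lambda>K. U (m K)) ` ?\<K>"
    then obtain K L where KL: "K \<in> ?\<K>" "L \<in> ?\<K>" "f = U (m K)" "g = U (m L)" by blast
    let ?M = "K \<union> L"
    have M: "?M \<in> ?\<K>" using KL by (auto intro: compact_Un)
    have "U (m K) x \<le> U (m ?M) x" "U (m L) x \<le> U (m ?M) x" for x
      using swept_mono(1)[OF m m _ _ _ \<omega>, of K ?M] swept_mono(1)[OF m m _ _ _ \<omega>, of L ?M] KL(1,2) M by auto
    then show "\<exists>k\<in>(\<lambda>K. U (m K)) ` ?\<K>. \<forall>x. f x \<le> k x \<and> g x \<le> k x" using M KL(3,4) by blast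
  qed
  moreover have "E \<tau> \<nu> = pos_integral \<tau> (U \<nu>)" by (rule pos_energy_eq[OF \<tau> Epos_pos[OF props(1)]])
  moreover have "E \<tau> (m K) = pos_integral \<tau> (U (m K))" if "K \<in> ?\<K>" for K by (rule pos_energy_eq[OF \<tau> mp[OF that]])
  ultimately show ?thesis by (simp add: image_image)
qed

section \<open>Existence and uniqueness of the inner balayage\<close>

text \<open>Justifies the definite description in \<open>energy_balayage\<close> and exhibits its
  value as a limit of balayages onto compact sets. The energies are bounded by that of
  \<open>l\<close>, because \<open>m K\<close> is the orthogonal foot of \<open>l\<close> along
  itself: \<open>B (m K) l = B (m K) (m K)\<close>.\<close>

lemma energy_balayage_limit:
  assumes l: "l \<in> Epos"
  obtains m where "\<forall>K. compact K \<and> K \<subseteq> A \<longrightarrow> swept l K (m K)"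
    "limitin (strong_topology_pos \<kappa>) m (energy_balayage \<kappa> A l) (compacts_at_top A)"
proof -
  define m where "m = (\<lambda>K. SOME n. swept l K n)"
  have m: "swept l K (m K)" if K: "compact K" "K \<subseteq> A" for K
  proof -
    obtain n where "swept l K n" by (rule swept_energy_exists[OF K(1) l])
    then show ?thesis unfolding m_def by (rule someI[of "swept l K"])
  qed
  then have m': "\<forall>K. compact K \<and> K \<subseteq> A \<longrightarrow> swept l K (m K)" by blast
  have "B (m K) (m K) \<le> B l l" if K: "compact K" "K \<subseteq> A" for K
  proof -
    note mE = sweptD(2)[OF m[OF K]]
    have "E (m K) l = E (m K) (m K)"
      using sweptD(5)[OF m[OF K] sweptD(1)[OF m[OF K]]] pos_energy_eq[OF Epos_pos[OF mE] Epos_pos[OF l]] by simp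
    then have "B (m K) l = B (m K) (m K)" by (simp add: energy_inner_def)
    then show ?thesis using energy_gap_nonneg[OF mE l] by (simp add: energy_gap_def)
  qed
  then have bdd: "\<forall>K. compact K \<and> K \<subseteq> A \<longrightarrow> B (m K) (m K) \<le> B l l" by blast
  obtain \<nu> where lim: "limitin (strong_topology_pos \<kappa>) m \<nu> (compacts_at_top A)"
    by (rule swept_limit[OF Epos_pos[OF l] m' bdd])
  note props = swept_limit_props[OF Epos_pos[OF l] m' lim]
  have "energy_balayage \<kappa> A l = \<nu>"
    unfolding energy_balayage_def
  proof (rule the_equality)
    show "\<nu> \<in> closure_on \<kappa> A \<and> nearly_everywhere \<kappa> A (\<lambda>x. potential \<kappa> \<nu> x = potential \<kappa> l x)" using props(4,7) by simp
    show "\<nu>' = \<nu>" if "\<nu>' \<in> closure_on \<kappa> A \<and> nearly_everywhere \<kappa> A (\<lambda>x. potential \<kappa> \<nu>' x = potential \<kappa> l x)" for \<nu>'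
      using closure_on_unique[OF _ props(7) Epos_pos[OF l] _ props(4)] that by blast
  qed
  then show ?thesis using that[OF m'] lim by blast
qed

text \<open>The symmetry relation is proved by sweeping the test measure too. With
  \<open>n K\<close> the balayage of \<open>l\<close> onto \<open>K\<close>, the pairings of
  \<open>n K\<close> with \<open>\<nu>\<close> and with \<open>\<omega>\<close> coincide; suprema
  over \<open>K\<close> give the same for the balayage of \<open>l\<close> onto \<open>A\<close>.
  Conversely the pairings with all \<open>l\<close> determine a measure of finite energy.\<close>

lemma swept_limit_is_inner_balayage:
  assumes \<omega>: "\<omega> \<in> radon_pos" and m': "\<forall>K. compact K \<and> K \<subseteq> A \<longrightarrow> swept \<omega> K (m K)"
    and lim: "limitin (strong_topology_pos \<kappa>) m \<nu> (compacts_at_top A)"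
  shows "is_inner_balayage \<kappa> A \<omega> \<nu>' \<longleftrightarrow> \<nu>' = \<nu>"
proof -
  note props = swept_limit_props[OF \<omega> m' lim]
  note p = Epos_pos[OF props(1)]
  have main: "mutual_energy \<kappa> \<nu> l = mutual_energy \<kappa> (energy_balayage \<kappa> A l) \<omega>" if l: "l \<in> Epos" for l
  proof -
    let ?l = "energy_balayage \<kappa> A l" and ?\<K> = "{K. compact K \<and> K \<subseteq> A}"
    obtain n where n': "\<forall>K. compact K \<and> K \<subseteq> A \<longrightarrow> swept l K (n K)"
        and lim': "limitin (strong_topology_pos \<kappa>) n ?l (compacts_at_top A)" by (rule energy_balayage_limit[OF l])
    have n: "swept l K (n K)" if "compact K" "K \<subseteq> A" for K using n' that by blast
    note lprops = swept_limit_props[OF Epos_pos[OF l] n' lim']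
    note lp = Epos_pos[OF lprops(1)]
    \<comment> \<open>Replacing \<open>l\<close> by its balayage is permitted against
      \<open>\<nu>\<close>, since \<open>\<nu>\<close> lies in the strong closure and the two
      potentials agree n.e. on \<open>A\<close>.\<close>
    have "B \<nu> l = B \<nu> ?l"
    proof (rule closure_test[OF l lprops(1) props(7)])
      fix K \<rho> assume K: "compact K" "K \<subseteq> A" "\<rho> \<in> finite_energy_on \<kappa> K"
      have "\<rho> \<in> Epos" using K(3) finite_energy_on_Epos by blast
      then show "B \<rho> l = B \<rho> ?l"
        using lprops(2)[OF K] pos_energy_eq[OF Epos_pos Epos_pos[OF l], of \<rho>] by (simp add: energy_inner_def)
    qed
    then have 1: "E \<nu> l = E \<nu> ?l" using pos_energy_real[OF props(1) l] pos_energy_real[OF props(1) lprops(1)] by simp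
    have "E \<nu> ?l = (SUP K\<in>?\<K>. E \<nu> (n K))" by (rule pos_energy_swept_limit[OF Epos_pos[OF l] n' lim' p])
    moreover have "E \<omega> ?l = (SUP K\<in>?\<K>. E \<omega> (n K))" by (rule pos_energy_swept_limit[OF Epos_pos[OF l] n' lim' \<omega>])
    \<comment> \<open>\<open>n K\<close> is itself a measure of finite energy carried by
      \<open>K\<close>, so it may serve as a test measure for \<open>\<nu>\<close>.\<close>
    moreover have "E \<nu> (n K) = E \<omega> (n K)" if "K \<in> ?\<K>" for K
    proof -
      have K: "compact K" "K \<subseteq> A" using that by auto
      note np = sweptD(3)[OF n[OF K]]
      have "E (n K) \<omega> = E (n K) \<nu>" using props(2)[OF K sweptD(1)[OF n[OF K]]] pos_energy_eq[OF np \<omega>] by simp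
      then show ?thesis using pos_energy_commute[OF np \<omega>] pos_energy_commute[OF np p] by simp
    qed
    ultimately have "E \<nu> ?l = E \<omega> ?l" by simp
    then show ?thesis
      using 1 pos_energy_commute[OF \<omega> lp] by (simp add: mutual_energy_pos[OF p Epos_pos[OF l]] mutual_energy_pos[OF lp \<omega>])
  qed
  show ?thesis
  proof
    assume ib: "is_inner_balayage \<kappa> A \<omega> \<nu>'"
    then have \<nu>': "\<nu>' \<in> Epos" by (simp add: is_inner_balayage_def closure_on_iff)
    have "mutual_energy \<kappa> \<nu>' l = mutual_energy \<kappa> \<nu> l" if "l \<in> Epos" for l
      using ib main[OF that] that by (simp add: is_inner_balayage_def)
    then have same: "B \<nu>' l = B \<nu> l" if "l \<in> Epos" for l
      using that by (simp add: mutual_energy_pos Epos_pos \<nu>' p energy_inner_def enn2ereal_inject)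
    show "\<nu>' = \<nu>"
      by (rule equal_if_same_inner[OF \<nu>' props(1)])
        (use same[OF \<nu>'] same[OF props(1)] energy_inner_commute[OF \<nu>' props(1)] in auto)
  next
    assume "\<nu>' = \<nu>"
    then show "is_inner_balayage \<kappa> A \<omega> \<nu>'" using props(7) main by (simp add: is_inner_balayage_def)
  qed
qed

end

section \<open>Balayage of a measure with continuous potential\<close>

context lch_space
begin

text \<open>Tietze's theorem into \<open>[0,\<infinity>)\<close> keeps the extension nonnegative; a
  cutoff that is \<open>1\<close> on \<open>K\<close> then makes its support compact.\<close>

lemma Cc_extension:
  fixes f :: "'a \<Rightarrow> real"
  assumes K: "compact K" and f: "continuous_on K f" "\<forall>x\<in>K. 0 \<le> f x"
  obtains \<phi> where "\<phi> \<in> Cc" "\<forall>x. 0 \<le> \<phi> x" "\<forall>x\<in>K. \<phi> x = f x"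
proof -
  obtain \<eta> where \<eta>: "\<eta> \<in> Cc" "\<forall>x. 0 \<le> \<eta> x" "\<forall>x. \<eta> x \<le> 1" "\<forall>x\<in>K. \<eta> x = 1" by (rule cutoff[OF K])
  have cont: "continuous_map (subtopology euclidean K) euclidean f" using f(1) by simp
  obtain g where g: "continuous_map euclidean euclideanreal g" "g ` topspace (euclidean :: 'a topology) \<subseteq> {0..}" "\<And>x. x \<in> K \<Longrightarrow> g x = f x"
    by (rule Tietze_extension_completely_regular[OF completely_regular _ _ _ cont, of "{0..}"])
      (use K f(2) in \<open>auto simp: is_interval_ci\<close>)
  have gc: "continuous_on UNIV g" using g(1) by simp
  have g0: "0 \<le> g x" for x using g(2) by auto
  show ?thesis
  proof (rule that[of "\<lambda>x. g x * \<eta> x"])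
    show "(\<lambda>x. g x * \<eta> x) \<in> Cc" by (rule Cc_mult_continuous[OF \<eta>(1) gc])
    show "\<forall>x. 0 \<le> g x * \<eta> x" using g0 \<eta>(2) by simp
    show "\<forall>x\<in>K. g x * \<eta> x = f x" using g(3) \<eta>(4) by simp
  qed
qed

end

context perfect_kernel
begin

section \<open>Equilibrium measures, mass bounds and the Gauss functional\<close>

text \<open>The measure represents the mass functional on the cone of measures carried by
  \<open>K\<close>; in \<open>riesz_potential_AE\<close> the constant \<open>1\<close> takes the
  place of a potential.\<close>

lemma equilibrium_exists:
  assumes K: "compact K"
  obtains g where "g \<in> finite_energy_on \<kappa> K" "\<forall>a\<in>finite_energy_on \<kappa> K. mass a \<le> E a g" "AE x in radon_measure g. U g x \<le> 1"
proof -
  obtain \<eta> where \<eta>: "\<eta> \<in> Cc" "\<forall>x. 0 \<le> \<eta> x" "\<forall>x. \<eta> x \<le> 1" "\<forall>x\<in>K. \<eta> x = 1" by (rule cutoff[OF K])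
  obtain g where g: "g \<in> finite_energy_on \<kappa> K" "\<forall>a\<in>finite_energy_on \<kappa> K. a \<eta> \<le> B g a" "B g g = g \<eta>"
    by (rule compact_riesz[OF K \<eta>(1,2)])
  have gE: "g \<in> Epos" using g(1) finite_energy_on_Epos by blast
  have \<eta>1: "\<forall>x\<in>K. (1::ennreal) = ennreal (\<eta> x)" using \<eta>(4) by simp
  have m: "pos_integral a (\<lambda>_. 1) = ennreal (a \<eta>)" if "a \<in> finite_energy_on \<kappa> K" for a
    by (rule pos_integral_eq_on_carrier[OF that K lower_semicont_const \<eta>(1,2) \<eta>1])
  have nonneg: "0 \<le> a \<eta>" if "a \<in> finite_energy_on \<kappa> K" for a
    using that finite_energy_on_Epos Epos_pos radon_pos_nonneg[OF _ \<eta>(1), of a] \<eta>(2) by blast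
  show ?thesis
  proof (rule that[OF g(1)])
    show "\<forall>a\<in>finite_energy_on \<kappa> K. mass a \<le> E a g"
    proof
      fix a assume a: "a \<in> finite_energy_on \<kappa> K"
      then have aE: "a \<in> Epos" using finite_energy_on_Epos by blast
      have "a \<eta> \<le> B g a" using g(2) a by blast
      then have "a \<eta> \<le> B a g" unfolding energy_inner_commute[OF gE aE] .
      then show "mass a \<le> E a g"
        unfolding mass_def m[OF a] pos_energy_real[OF aE gE] by (rule ennreal_leI)
    qed
    show "AE x in radon_measure g. U g x \<le> 1"
      by (rule riesz_potential_AE(1)[where L = "\<lambda>a. a \<eta>", OF K g(1) lower_semicont_const])
        (use m nonneg g(2,3) in auto)
  qed
qed

lemma ugaheriD:
  assumes h: "ugaheri_principle h \<kappa>" and \<mu>: "\<mu> \<in> Epos" and le: "AE x in radon_measure \<mu>. U \<mu> x \<le> 1"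
  shows "U \<mu> x \<le> ennreal h"
proof -
  note p = Epos_pos[OF \<mu>]
  have iff: "potential \<kappa> \<mu> y \<le> ereal 1 \<longleftrightarrow> U \<mu> y \<le> 1" for y
    by (simp add: potential_pos[OF p] less_eq_ennreal.rep_eq one_ennreal.rep_eq one_ereal_def)
  have "{x. \<not> U \<mu> x \<le> 1} \<in> null_sets (radon_measure \<mu>)"
  proof -
    have "{x. 1 < U \<mu> x} \<in> sets borel" using borel_measurable_less[OF measurable_const borel_potential[OF p], of 1] by simp
    then have S: "{x. \<not> U \<mu> x \<le> 1} \<in> sets (radon_measure \<mu>)"
      using borel_in_sets_radon_measure[OF p] by (auto simp: not_le)
    show ?thesis using le AE_iff_measurable[OF S, of "\<lambda>x. U \<mu> x \<le> 1"] S by auto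
  qed
  then have "negligible_for \<mu> {x. \<not> potential \<kappa> \<mu> x \<le> ereal 1}"
    unfolding iff using null_sets_radon_measure[OF p] by simp
  then have "potential \<kappa> \<mu> x \<le> ereal (h * 1)"
    using h \<mu> unfolding ugaheri_principle_def by (meson zero_less_one)
  then have "e2ennreal (enn2ereal (U \<mu> x)) \<le> e2ennreal (ereal h)"
    unfolding potential_pos[OF p] by (intro e2ennreal_mono) simp
  then show ?thesis by simp
qed

lemma swept_mass_le:
  assumes s: "swept \<omega> K m" and K: "compact K" and \<omega>: "\<omega> \<in> radon_pos"
    and h: "ugaheri_principle h \<kappa>" "1 \<le> h"
  shows "mass m \<le> ennreal h * mass \<omega>"
proof -
  obtain g where g: "g \<in> finite_energy_on \<kappa> K" "\<forall>a\<in>finite_energy_on \<kappa> K. mass a \<le> E a g" "AE x in radon_measure g. U g x \<le> 1"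
    by (rule equilibrium_exists[OF K])
  have gE: "g \<in> Epos" using g(1) finite_energy_on_Epos by blast
  note gp = Epos_pos[OF gE] and mp = sweptD(3)[OF s]
  have "mass m \<le> E m g" using g(2) sweptD(1)[OF s] by blast
  also have "E m g = pos_integral g (U \<omega>)" using pos_energy_commute[OF mp gp] sweptD(5)[OF s g(1)] by simp
  also have "pos_integral g (U \<omega>) = E \<omega> g" using pos_energy_eq[OF gp \<omega>] pos_energy_commute[OF gp \<omega>] by simp
  also have "E \<omega> g = pos_integral \<omega> (U g)" by (rule pos_energy_eq[OF \<omega> gp])
  also have "pos_integral \<omega> (U g) \<le> pos_integral \<omega> (\<lambda>x. ennreal h * 1)"
    by (rule pos_integral_mono) (use ugaheriD[OF h(1) gE g(3)] in simp)
  also have "pos_integral \<omega> (\<lambda>x. ennreal h * 1) = ennreal h * mass \<omega>"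
    unfolding mass_def by (rule pos_integral_scale[OF \<omega>]) (use h(2) in simp)
  finally show ?thesis .
qed

lemma swept_energy_le:
  assumes s: "swept \<omega> K m" and K: "compact K" and \<omega>: "\<omega> \<in> radon_pos"
    and c: "0 < c" "\<forall>x\<in>K. U \<omega> x \<le> ennreal c" and H: "mass m \<le> H" "H < \<infinity>"
  shows "B m m \<le> c * enn2real H"
proof -
  note mp = sweptD(3)[OF s]
  have n: "emeasure (radon_measure m) (-K) = 0" using sweptD(1)[OF s] by (simp add: finite_energy_on_iff[OF K])
  have "AE x in radon_measure m. U \<omega> x \<le> ennreal c * 1"
    using carrier_AE[OF mp K n] by eventually_elim (use c(2) in simp)
  then have "pos_integral m (U \<omega>) \<le> pos_integral m (\<lambda>x. ennreal c * 1)"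
    by (rule pos_integral_AE_le[OF mp potential_lsc[OF \<omega>] lower_semicont_const])
  also have "pos_integral m (\<lambda>x. ennreal c * 1) = ennreal c * mass m"
    unfolding mass_def by (rule pos_integral_scale[OF mp c(1)])
  also have "\<dots> \<le> ennreal c * H" using H(1) by (rule mult_left_mono) simp
  also have "\<dots> = ennreal (c * enn2real H)" using H(2) c(1) by (simp add: ennreal_mult)
  finally have "E m m \<le> ennreal (c * enn2real H)" using sweptD(5)[OF s sweptD(1)[OF s]] by simp
  then show ?thesis unfolding energy_inner_def by (rule enn2real_leI[rotated]) (use c(1) in simp)
qed

text \<open>Completing the square: the linear term is \<open>- 2 * B \<mu> m\<close>, so the
  functional is the squared distance to \<open>m\<close> minus a constant.\<close>

lemma gauss_functional_swept:
  assumes s: "swept \<omega> K m" and \<omega>: "\<omega> \<in> radon_pos" and \<mu>: "\<mu> \<in> finite_energy_on \<kappa> K"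
  shows "gauss_functional \<kappa> (\<lambda>x. - potential \<kappa> \<omega> x) \<mu> = ereal (Q \<mu> m - B m m)"
proof -
  have \<mu>E: "\<mu> \<in> Epos" using \<mu> finite_energy_on_Epos by blast
  note \<mu>p = Epos_pos[OF \<mu>E] and mE = sweptD(2)[OF s]
  have "upper_integral \<mu> (\<lambda>x. e2ennreal (- potential \<kappa> \<omega> x)) = 0"
    using upper_integral_lower_semicont[OF lower_semicont_const, of \<mu> 0] pos_integral_zero[OF \<mu>p]
    by (simp add: potential_pos[OF \<omega>] e2ennreal_neg)
  moreover have "upper_integral \<mu> (\<lambda>x. e2ennreal (- (- potential \<kappa> \<omega> x))) = ennreal (B \<mu> m)"
    using upper_integral_lower_semicont[OF potential_lsc[OF \<omega>], of \<mu>] sweptD(5)[OF s \<mu>] pos_energy_real[OF \<mu>E mE]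
    by (simp add: potential_pos[OF \<omega>])
  ultimately have "ext_integral \<mu> (\<lambda>x. - potential \<kappa> \<omega> x) = ereal (- B \<mu> m)"
    unfolding ext_integral_def by (simp add: enn2ereal_ennreal[OF energy_inner_nonneg] zero_ennreal.rep_eq)
  moreover have "(energy_norm \<kappa> \<mu>)\<^sup>2 = B \<mu> \<mu>"
    using energy_norm_Epos[OF \<mu>E] energy_inner_nonneg[of \<mu> \<mu>] by simp
  ultimately show ?thesis
    by (simp add: gauss_functional_def energy_gap_def)
qed

text \<open>Formulated for any class inside the cone that contains \<open>m\<close>, so that the
  full cone and its part of bounded mass are both instances. Uniqueness is the definiteness of
  \<open>Q\<close>.\<close>

lemma gauss_minimizer_iff:
  assumes s: "swept \<omega> K m" and \<omega>: "\<omega> \<in> radon_pos" and C: "C \<subseteq> finite_energy_on \<kappa> K" "m \<in> C"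
  shows "is_arg_min (gauss_functional \<kappa> (\<lambda>x. - potential \<kappa> \<omega> x)) (\<lambda>\<mu>. \<mu> \<in> C) \<mu> \<longleftrightarrow> \<mu> = m"
proof -
  note G = gauss_functional_swept[OF s \<omega> subsetD[OF C(1)]]
  have E: "\<mu> \<in> Epos" if "\<mu> \<in> C" for \<mu> using that C(1) finite_energy_on_Epos by blast
  have m0: "Q m m = 0" by (simp add: energy_gap_def)
  show ?thesis
  proof
    assume a: "is_arg_min (gauss_functional \<kappa> (\<lambda>x. - potential \<kappa> \<omega> x)) (\<lambda>\<mu>. \<mu> \<in> C) \<mu>"
    then have \<mu>: "\<mu> \<in> C" by (simp add: is_arg_min_def)
    have "\<not> gauss_functional \<kappa> (\<lambda>x. - potential \<kappa> \<omega> x) m < gauss_functional \<kappa> (\<lambda>x. - potential \<kappa> \<omega> x) \<mu>"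
      using a C(2) unfolding is_arg_min_def by blast
    then have "Q \<mu> m \<le> 0" using m0 by (simp add: G[OF \<mu>] G[OF C(2)])
    then show "\<mu> = m" using energy_gap_nonneg[OF E[OF \<mu>] E[OF C(2)]] energy_gap_eq_zero[OF E[OF \<mu>] E[OF C(2)]] by simp
  next
    assume "\<mu> = m"
    then show "is_arg_min (gauss_functional \<kappa> (\<lambda>x. - potential \<kappa> \<omega> x)) (\<lambda>\<mu>. \<mu> \<in> C) \<mu>"
      using C(2) m0 energy_gap_nonneg[OF E E[OF C(2)]] by (auto simp: is_arg_min_def G not_less)
  qed
qed

lemma closure_mass_on_iff:
  "\<nu> \<in> closure_mass_on \<kappa> H A \<longleftrightarrow> \<nu> \<in> Epos \<and> (\<forall>e>0. \<exists>\<mu>\<in>finite_energy_mass_on \<kappa> H A. sd \<nu> \<mu> < e)"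
  unfolding closure_mass_on_def
  by (rule closure_of_strong_iff) (use finite_energy_on_Epos in \<open>auto simp: finite_energy_mass_on_def\<close>)

lemma closure_mass_on_subset: "closure_mass_on \<kappa> H A \<subseteq> closure_on \<kappa> A"
  unfolding closure_mass_on_def closure_on_def
  by (rule closure_of_mono) (auto simp: finite_energy_mass_on_def)

text \<open>Integrating the equal potentials against \<open>\<nu>\<close> and \<open>\<nu>'\<close>
  gives the coincidence of all mutual energies, and the energy principle separates.\<close>

lemma equal_if_same_potential:
  assumes \<nu>: "\<nu> \<in> Epos" "\<nu>' \<in> Epos" and eq: "\<And>x. potential \<kappa> \<nu> x = potential \<kappa> \<nu>' x"
  shows "\<nu> = \<nu>'"
proof (rule equal_if_same_inner[OF \<nu>])
  have "U \<nu> x = U \<nu>' x" for x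
    using eq[of x] by (simp add: potential_pos Epos_pos \<nu> enn2ereal_inject)
  then have "U \<nu> = U \<nu>'" by (rule ext)
  then show "B \<nu> \<nu> = B \<nu> \<nu>'" "B \<nu>' \<nu> = B \<nu>' \<nu>'"
    by (simp_all add: energy_inner_def pos_energy_eq Epos_pos \<nu>)
qed

end

context balayage_kernel
begin

lemma swept_continuous_exists:
  assumes K: "compact K" and \<omega>: "\<omega> \<in> radon_pos" and cont: "continuous_on K (potential \<kappa> \<omega>)"
    and fin: "\<forall>x\<in>K. U \<omega> x < \<infinity>"
  obtains m where "swept \<omega> K m"
proof -
  have P: "potential \<kappa> \<omega> x = ereal (enn2real (U \<omega> x))" "U \<omega> x = ennreal (enn2real (U \<omega> x))" if "x \<in> K" for x
  proof -
    show e: "U \<omega> x = ennreal (enn2real (U \<omega> x))" using fin that by simp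
    show "potential \<kappa> \<omega> x = ereal (enn2real (U \<omega> x))"
      unfolding potential_pos[OF \<omega>] by (subst e) (simp add: enn2ereal_ennreal)
  qed
  \<comment> \<open>Continuity is given for extended real values. Finiteness on \<open>K\<close>
    transfers it to a real function, the form in which Tietze's theorem applies.\<close>
  have "continuous_on K (real_of_ereal \<circ> potential \<kappa> \<omega>)"
    using cont by (subst continuous_on_iff_real[symmetric]) (simp_all add: P(1))
  then have "continuous_on K (\<lambda>x. enn2real (U \<omega> x))"
    by (rule continuous_on_eq) (simp add: P(1))
  then obtain \<phi> where \<phi>: "\<phi> \<in> Cc" "\<forall>x. 0 \<le> \<phi> x" "\<forall>x\<in>K. \<phi> x = enn2real (U \<omega> x)"
    by (rule Cc_extension[OF K]) simp
  have U\<phi>: "\<forall>x\<in>K. U \<omega> x = ennreal (\<phi> x)" using \<phi>(3) P(2) by simp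
  obtain m where m: "m \<in> finite_energy_on \<kappa> K" "\<forall>a\<in>finite_energy_on \<kappa> K. a \<phi> \<le> B m a" "B m m = m \<phi>"
    by (rule compact_riesz[OF K \<phi>(1,2)])
  have "swept \<omega> K m"
  proof (rule sweptI[OF K m(1) \<omega>, of "\<lambda>a. a \<phi>"])
    show "pos_integral a (U \<omega>) = ennreal (a \<phi>)" if "a \<in> finite_energy_on \<kappa> K" for a
      by (rule pos_integral_eq_on_carrier[OF that K potential_lsc[OF \<omega>] \<phi>(1,2) U\<phi>])
    show "0 \<le> a \<phi>" if "a \<in> finite_energy_on \<kappa> K" for a
      using that finite_energy_on_Epos Epos_pos radon_pos_nonneg[OF _ \<phi>(1), of a] \<phi>(2) by blast
    show "a \<phi> \<le> B m a" if "a \<in> finite_energy_on \<kappa> K" for a using m(2) that by blast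
    show "B m m = m \<phi>" by (rule m(3))
  qed
  then show ?thesis by (rule that)
qed

end

section \<open>The characterisations of the limit\<close>

text \<open>Collects what remains of the hypotheses once the net is known to converge with bounded
  masses; every characterisation is then proved for its limit \<open>W\<close> in the form of an
  equivalence.\<close>

locale swept_net = balayage_kernel T \<kappa> for T :: "'a::t2_space itself" and \<kappa> +
  fixes A :: "'a set" and \<omega> :: "'a functional" and m :: "'a set \<Rightarrow> 'a functional" and W :: "'a functional"
    and H :: ennreal
  assumes \<omega>_pos: "\<omega> \<in> radon_pos" and net_swept: "\<forall>K. compact K \<and> K \<subseteq> A \<longrightarrow> swept \<omega> K (m K)"
    and net_limit: "limitin (strong_topology_pos \<kappa>) m W (compacts_at_top A)"
    and net_mass: "\<forall>K. compact K \<and> K \<subseteq> A \<longrightarrow> mass (m K) \<le> H"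
begin

lemmas limit_props = swept_limit_props[OF \<omega>_pos net_swept net_limit]
lemmas limit_Epos = limit_props(1)
lemmas limit_pos = Epos_pos[OF limit_Epos]

lemma limit_closure_mass_on: "W \<in> closure_mass_on \<kappa> H A"
  unfolding closure_mass_on_iff
proof (intro conjI allI impI limit_Epos)
  fix e :: real assume "0 < e"
  have "\<forall>\<^sub>F K in compacts_at_top A. sd (m K) W < e"
    using net_limit \<open>0 < e\<close> order_tendstoD(2)[of "\<lambda>K. sd (m K) W" 0 _ e] by (simp add: limitin_strong_iff)
  then obtain K where K: "compact K" "K \<subseteq> A" "sd (m K) W < e" unfolding eventually_compacts_at_top by blast
  have "swept \<omega> K (m K)" "mass (m K) \<le> H" using net_swept net_mass K by blast+
  then have "m K \<in> finite_energy_mass_on \<kappa> H A"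
    using sweptD(1) finite_energy_on_subset[OF K(1,2)] by (auto simp: finite_energy_mass_on_def)
  then show "\<exists>\<mu>\<in>finite_energy_mass_on \<kappa> H A. sd W \<mu> < e" using K(3) by (intro bexI[of _ "m K"]) (simp_all add: SM.commute[of W "m K"])
qed

text \<open>Membership of \<open>W\<close> uses the mass bound along the net; uniqueness is
  inherited from the larger class \<open>closure_on\<close>.\<close>

lemma limit_iff_nearly_everywhere:
  "\<nu> = W \<longleftrightarrow> \<nu> \<in> closure_mass_on \<kappa> H A \<and> nearly_everywhere \<kappa> A (\<lambda>x. potential \<kappa> \<nu> x = potential \<kappa> \<omega> x)"
proof (intro iffI conjI)
  show "\<nu> \<in> closure_mass_on \<kappa> H A" if "\<nu> = W" using that limit_closure_mass_on by simp
  show "nearly_everywhere \<kappa> A (\<lambda>x. potential \<kappa> \<nu> x = potential \<kappa> \<omega> x)" if "\<nu> = W" using that limit_props(4) by simp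
  assume "\<nu> \<in> closure_mass_on \<kappa> H A \<and> nearly_everywhere \<kappa> A (\<lambda>x. potential \<kappa> \<nu> x = potential \<kappa> \<omega> x)"
  then have "\<nu> \<in> closure_on \<kappa> A" "nearly_everywhere \<kappa> A (\<lambda>x. potential \<kappa> \<nu> x = potential \<kappa> \<omega> x)"
    using closure_mass_on_subset by blast+
  from closure_on_unique[OF this(1) limit_props(7) \<omega>_pos this(2) limit_props(4)] show "\<nu> = W" .
qed

lemma limit_iff_strong:
  "\<nu> = W \<longleftrightarrow> \<nu> \<in> closure_mass_on \<kappa> H A \<and> limitin (strong_topology_pos \<kappa>) m \<nu> (compacts_at_top A)"
proof (intro iffI conjI)
  show "\<nu> \<in> closure_mass_on \<kappa> H A" if "\<nu> = W" using that limit_closure_mass_on by simp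
  show "limitin (strong_topology_pos \<kappa>) m \<nu> (compacts_at_top A)" if "\<nu> = W" using that net_limit by simp
  assume "\<nu> \<in> closure_mass_on \<kappa> H A \<and> limitin (strong_topology_pos \<kappa>) m \<nu> (compacts_at_top A)"
  then show "\<nu> = W"
    using SP.sub.limitin_metric_unique[of m \<nu> "compacts_at_top A" W] net_limit compacts_at_top_neq_bot
    unfolding strong_topology_pos_eq by blast
qed

lemma limit_iff_vague:
  "\<nu> = W \<longleftrightarrow> \<nu> \<in> closure_mass_on \<kappa> H A \<and> limitin (subtopology vague_topology radon_pos) m \<nu> (compacts_at_top A)"
proof (intro iffI conjI)
  show "\<nu> \<in> closure_mass_on \<kappa> H A" if "\<nu> = W" using that limit_closure_mass_on by simp
  show "limitin (subtopology vague_topology radon_pos) m \<nu> (compacts_at_top A)" if "\<nu> = W"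
    using that strong_imp_vague[OF net_limit] by simp
  assume "\<nu> \<in> closure_mass_on \<kappa> H A \<and> limitin (subtopology vague_topology radon_pos) m \<nu> (compacts_at_top A)"
  then have "limitin vague_topology m \<nu> (compacts_at_top A)" by (simp add: limitin_subtopology)
  moreover have "limitin vague_topology m W (compacts_at_top A)"
    using strong_imp_vague[OF net_limit] by (simp add: limitin_subtopology)
  ultimately show "\<nu> = W" using vague_limit_unique compacts_at_top_neq_bot by blast
qed

text \<open>From below by vague lower semicontinuity, from above because every
  \<open>U (m K)\<close> is bounded by \<open>U W\<close>.\<close>

lemma limit_potential_tendsto: "((\<lambda>K. U (m K) x) \<longlongrightarrow> U W x) (compacts_at_top A)"
proof (rule order_tendstoI)
  fix a assume "a < U W x"
  then show "\<forall>\<^sub>F K in compacts_at_top A. a < U (m K) x"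
    unfolding pos_potential_def
    by (rule pos_integral_vague_lsc[rotated]) (rule strong_imp_pointwise[OF net_limit])
next
  fix a assume a: "U W x < a"
  have "U (m K) x < a" if "compact K" "K \<subseteq> A" for K by (rule order_le_less_trans[OF limit_props(5)[OF that] a])
  then show "\<forall>\<^sub>F K in compacts_at_top A. U (m K) x < a"
    unfolding eventually_compacts_at_top by (intro exI[of _ "{}"]) simp
qed

text \<open>Pointwise limits along a nontrivial filter are unique, so \<open>\<nu>\<close> and
  \<open>W\<close> share their potential, which determines a measure of finite energy.\<close>

lemma limit_iff_increasing:
  "\<nu> = W \<longleftrightarrow> \<nu> \<in> closure_mass_on \<kappa> H A \<and> increases_pointwise_to A (\<lambda>K. potential \<kappa> (m K)) (potential \<kappa> \<nu>)"
proof (intro iffI conjI)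
  have ev: "\<forall>\<^sub>F K in compacts_at_top A. potential \<kappa> (m K) x = enn2ereal (U (m K) x)" for x
    unfolding eventually_compacts_at_top
    by (rule exI[of _ "{}"]) (use net_swept in \<open>auto simp: potential_pos dest!: sweptD(3)\<close>)
  have "((\<lambda>K. enn2ereal (U (m K) x)) \<longlongrightarrow> enn2ereal (U W x)) (compacts_at_top A)" for x
    using limit_potential_tendsto by simp
  then have lim: "((\<lambda>K. potential \<kappa> (m K) x) \<longlongrightarrow> potential \<kappa> W x) (compacts_at_top A)" for x
    unfolding tendsto_cong[OF ev] potential_pos[OF limit_pos] .
  show "\<nu> \<in> closure_mass_on \<kappa> H A" if "\<nu> = W" using that limit_closure_mass_on by simp
  show "increases_pointwise_to A (\<lambda>K. potential \<kappa> (m K)) (potential \<kappa> \<nu>)" if "\<nu> = W"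
    unfolding increases_pointwise_to_def
  proof (intro conjI allI impI)
    show "((\<lambda>K. potential \<kappa> (m K) x) \<longlongrightarrow> potential \<kappa> \<nu> x) (compacts_at_top A)" for x using lim \<open>\<nu> = W\<close> by simp
    fix K K' x assume K: "compact K \<and> compact K' \<and> K \<subseteq> K' \<and> K' \<subseteq> A"
    have s: "swept \<omega> K (m K)" "swept \<omega> K' (m K')" using net_swept K by blast+
    have "U (m K) x \<le> U (m K') x" by (rule swept_mono(1)[OF s _ _ _ \<omega>_pos]) (use K in auto)
    then show "potential \<kappa> (m K) x \<le> potential \<kappa> (m K') x"
      by (simp add: potential_pos sweptD(3)[OF s(1)] sweptD(3)[OF s(2)] less_eq_ennreal.rep_eq)
  qed
  assume a: "\<nu> \<in> closure_mass_on \<kappa> H A \<and> increases_pointwise_to A (\<lambda>K. potential \<kappa> (m K)) (potential \<kappa> \<nu>)"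
  then have "((\<lambda>K. potential \<kappa> (m K) x) \<longlongrightarrow> potential \<kappa> \<nu> x) (compacts_at_top A)" for x
    by (simp add: increases_pointwise_to_def)
  then have eq: "potential \<kappa> \<nu> x = potential \<kappa> W x" for x
    using tendsto_unique[OF compacts_at_top_neq_bot _ lim] by blast
  have "\<nu> \<in> Epos" using a by (simp add: closure_mass_on_iff)
  then show "\<nu> = W" by (rule equal_if_same_potential[OF _ limit_Epos eq])
qed

lemma limit_majorant: "W \<in> majorant_class \<kappa> A \<omega>"
  using limit_Epos nearly_everywhere_eq_imp_le[OF \<omega>_pos limit_pos limit_props(4)] by (simp add: majorant_class_def)

lemma limit_potential_le:
  assumes "\<nu> \<in> majorant_class \<kappa> A \<omega>"
  shows "U W x \<le> U \<nu> x"
  unfolding limit_props(6)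
proof (rule SUP_least)
  have \<nu>: "\<nu> \<in> radon_pos" "nearly_everywhere \<kappa> A (\<lambda>x. potential \<kappa> \<omega> x \<le> potential \<kappa> \<nu> x)"
    using assms Epos_pos by (auto simp: majorant_class_def)
  fix K assume "K \<in> {K. compact K \<and> K \<subseteq> A}"
  then have K: "compact K" "K \<subseteq> A" by auto
  then have s: "swept \<omega> K (m K)" using net_swept by blast
  show "U (m K) x \<le> U \<nu> x" by (rule swept_dominated[OF s K \<omega>_pos \<nu>])
qed

lemma limit_iff_least_potential:
  "\<nu> = W \<longleftrightarrow> \<nu> \<in> majorant_class \<kappa> A \<omega> \<and>
    (\<forall>x. is_arg_min (\<lambda>\<mu>. potential \<kappa> \<mu> x) (\<lambda>\<mu>. \<mu> \<in> majorant_class \<kappa> A \<omega>) \<nu>)"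
proof -
  have E: "\<mu> \<in> Epos" if "\<mu> \<in> majorant_class \<kappa> A \<omega>" for \<mu> using that by (simp add: majorant_class_def)
  have le: "potential \<kappa> W x \<le> potential \<kappa> \<mu> x" if "\<mu> \<in> majorant_class \<kappa> A \<omega>" for \<mu> x
    using limit_potential_le[OF that, of x] by (simp add: potential_pos limit_pos Epos_pos[OF E[OF that]] less_eq_ennreal.rep_eq)
  show ?thesis
  proof
    show "\<nu> \<in> majorant_class \<kappa> A \<omega> \<and> (\<forall>x. is_arg_min (\<lambda>\<mu>. potential \<kappa> \<mu> x) (\<lambda>\<mu>. \<mu> \<in> majorant_class \<kappa> A \<omega>) \<nu>)" if "\<nu> = W"
      using that limit_majorant le by (auto simp: is_arg_min_def not_less)
    assume a: "\<nu> \<in> majorant_class \<kappa> A \<omega> \<and> (\<forall>x. is_arg_min (\<lambda>\<mu>. potential \<kappa> \<mu> x) (\<lambda>\<mu>. \<mu> \<in> majorant_class \<kappa> A \<omega>) \<nu>)"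
    then have \<nu>: "\<nu> \<in> majorant_class \<kappa> A \<omega>" by blast
    have "potential \<kappa> \<nu> x \<le> potential \<kappa> W x" for x
      using a limit_majorant unfolding is_arg_min_def not_less[symmetric] by blast
    then have "potential \<kappa> \<nu> x = potential \<kappa> W x" for x using le[OF \<nu>, of x] by (rule antisym)
    then show "\<nu> = W" by (rule equal_if_same_potential[OF E[OF \<nu>] limit_Epos])
  qed
qed

text \<open>Integrating \<open>U W \<le> U \<mu>\<close> against \<open>W\<close> and against
  \<open>\<mu>\<close> gives \<open>B W W \<le> B \<mu> W \<le> B \<mu> \<mu>\<close>. For a
  minimiser the outer terms agree, so the gap to \<open>W\<close> vanishes.\<close>

lemma limit_iff_least_norm:
  "\<nu> = W \<longleftrightarrow> \<nu> \<in> majorant_class \<kappa> A \<omega> \<and> is_arg_min (energy_norm \<kappa>) (\<lambda>\<mu>. \<mu> \<in> majorant_class \<kappa> A \<omega>) \<nu>"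
proof -
  have E: "\<mu> \<in> Epos" if "\<mu> \<in> majorant_class \<kappa> A \<omega>" for \<mu> using that by (simp add: majorant_class_def)
  have inner: "B \<rho> W \<le> B \<rho> \<mu>" if \<mu>: "\<mu> \<in> majorant_class \<kappa> A \<omega>" and \<rho>: "\<rho> \<in> Epos" for \<mu> \<rho>
  proof -
    have "E \<rho> W \<le> E \<rho> \<mu>"
      unfolding pos_energy_eq[OF Epos_pos[OF \<rho>] limit_pos] pos_energy_eq[OF Epos_pos[OF \<rho>] Epos_pos[OF E[OF \<mu>]]]
      by (rule pos_integral_mono) (rule limit_potential_le[OF \<mu>])
    then show ?thesis
      by (simp add: pos_energy_real[OF \<rho> limit_Epos] pos_energy_real[OF \<rho> E[OF \<mu>]] ennreal_le_iff energy_inner_nonneg)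
  qed
  have norm: "energy_norm \<kappa> \<mu> = sqrt (B \<mu> \<mu>)" if "\<mu> \<in> majorant_class \<kappa> A \<omega>" for \<mu>
    by (rule energy_norm_Epos[OF E[OF that]])
  have le: "B W W \<le> B \<mu> W" "B \<mu> W \<le> B \<mu> \<mu>" if \<mu>: "\<mu> \<in> majorant_class \<kappa> A \<omega>" for \<mu>
    using inner[OF \<mu> limit_Epos] inner[OF \<mu> E[OF \<mu>]] energy_inner_commute[OF E[OF \<mu>] limit_Epos] by simp_all
  show ?thesis
  proof
    have "energy_norm \<kappa> W \<le> energy_norm \<kappa> \<mu>" if "\<mu> \<in> majorant_class \<kappa> A \<omega>" for \<mu>
      using le[OF that] by (simp add: norm[OF that] norm[OF limit_majorant])
    then show "\<nu> \<in> majorant_class \<kappa> A \<omega> \<and> is_arg_min (energy_norm \<kappa>) (\<lambda>\<mu>. \<mu> \<in> majorant_class \<kappa> A \<omega>) \<nu>" if "\<nu> = W"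
      using that limit_majorant by (auto simp: is_arg_min_def not_less)
    assume a: "\<nu> \<in> majorant_class \<kappa> A \<omega> \<and> is_arg_min (energy_norm \<kappa>) (\<lambda>\<mu>. \<mu> \<in> majorant_class \<kappa> A \<omega>) \<nu>"
    then have \<nu>: "\<nu> \<in> majorant_class \<kappa> A \<omega>" by blast
    have "energy_norm \<kappa> \<nu> \<le> energy_norm \<kappa> W"
      using a limit_majorant unfolding is_arg_min_def not_less[symmetric] by blast
    then have "B \<nu> \<nu> \<le> B W W" by (simp add: norm[OF \<nu>] norm[OF limit_majorant])
    then have "Q \<nu> W = 0"
      using le[OF \<nu>] energy_gap_nonneg[OF E[OF \<nu>] limit_Epos] by (simp add: energy_gap_def)
    then show "\<nu> = W" by (rule energy_gap_eq_zero[OF E[OF \<nu>] limit_Epos])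
  qed
qed

end

theorem theorem2p5:
  fixes \<kappa> :: "'a::t2_space \<times> 'a \<Rightarrow> ennreal"
    and h :: real and H :: ennreal
    and A :: "'a set"
    and \<omega> :: "'a functional"
    and f :: "'a \<Rightarrow> ereal"
  assumes "locally_compact_space (euclidean :: 'a topology)"
    and "perfect \<kappa>"
    and "domination_principle \<kappa>"
    and "1 \<le> h"
    and "ugaheri_principle h \<kappa>"
    and "inner_cap \<kappa> A > 0"
    and "\<omega> \<in> radon_pos" and "\<omega> \<noteq> radon_zero"
    and "mass \<omega> < \<infinity>"
    and "\<And>K. compact K \<Longrightarrow> K \<subseteq> A \<Longrightarrow> continuous_on K (potential \<kappa> \<omega>)"
    and "(SUP x\<in>A. potential \<kappa> \<omega> x) < \<infinity>"
    and H: "H = ennreal h * mass \<omega>"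
    and f: "f = (\<lambda>x. - potential \<kappa> \<omega> x)"
  shows
    \<comment> \<open>the inner balayage exists and is unique\<close>
    "(\<exists>!\<nu>. is_inner_balayage \<kappa> A \<omega> \<nu>) \<and>
     \<comment> \<open>(i)\<close>
     (\<forall>\<nu>. is_inner_balayage \<kappa> A \<omega> \<nu> \<longleftrightarrow>
        \<nu> \<in> closure_mass_on \<kappa> H A \<and>
        nearly_everywhere \<kappa> A (\<lambda>x. potential \<kappa> \<nu> x = potential \<kappa> \<omega> x)) \<and>
     \<comment> \<open>(ii): the measures on compact sets, and the three limit relations\<close>
     (\<forall>K. compact K \<and> K \<subseteq> A \<longrightarrow>
        (\<exists>!\<mu>. is_compact_balayage \<kappa> \<omega> K \<mu>) \<and>
        (\<forall>\<mu>\<in>finite_energy_on \<kappa> K.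
           is_compact_balayage \<kappa> \<omega> K \<mu> \<longleftrightarrow>
           is_arg_min (gauss_functional \<kappa> f) (\<lambda>\<mu>'. \<mu>' \<in> finite_energy_on \<kappa> K) \<mu> \<and>
           is_arg_min (gauss_functional \<kappa> f) (\<lambda>\<mu>'. \<mu>' \<in> finite_energy_mass_on \<kappa> H K) \<mu>)) \<and>
     (\<forall>\<nu>. is_inner_balayage \<kappa> A \<omega> \<nu> \<longleftrightarrow>
        \<nu> \<in> closure_mass_on \<kappa> H A \<and>
        limitin (strong_topology_pos \<kappa>) (compact_balayage \<kappa> \<omega>) \<nu> (compacts_at_top A)) \<and>
     (\<forall>\<nu>. is_inner_balayage \<kappa> A \<omega> \<nu> \<longleftrightarrow>
        \<nu> \<in> closure_mass_on \<kappa> H A \<and>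
        limitin (subtopology vague_topology radon_pos) (compact_balayage \<kappa> \<omega>) \<nu>
          (compacts_at_top A)) \<and>
     (\<forall>\<nu>. is_inner_balayage \<kappa> A \<omega> \<nu> \<longleftrightarrow>
        \<nu> \<in> closure_mass_on \<kappa> H A \<and>
        increases_pointwise_to A (\<lambda>K. potential \<kappa> (compact_balayage \<kappa> \<omega> K)) (potential \<kappa> \<nu>)) \<and>
     \<comment> \<open>(iii)\<close>
     (\<forall>\<nu>. is_inner_balayage \<kappa> A \<omega> \<nu> \<longleftrightarrow>
        \<nu> \<in> majorant_class \<kappa> A \<omega> \<and>
        (\<forall>x. is_arg_min (\<lambda>\<mu>. potential \<kappa> \<mu> x) (\<lambda>\<mu>. \<mu> \<in> majorant_class \<kappa> A \<omega>) \<nu>)) \<and>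
     \<comment> \<open>(iv)\<close>
     (\<forall>\<nu>. is_inner_balayage \<kappa> A \<omega> \<nu> \<longleftrightarrow>
        \<nu> \<in> majorant_class \<kappa> A \<omega> \<and>
        is_arg_min (energy_norm \<kappa>) (\<lambda>\<mu>. \<mu> \<in> majorant_class \<kappa> A \<omega>) \<nu>)"
proof -
  interpret balayage_kernel "TYPE('a)" \<kappa> by unfold_locales (use assms in auto)
  note \<omega> = assms(7)
  have H_fin: "H < \<infinity>" using assms(9) by (simp add: H ennreal_mult_less_top)
  \<comment> \<open>The maximum with \<open>1\<close> provides a positive bound even when the
    potential vanishes on \<open>A\<close>.\<close>
  define c where "c = max 1 (real_of_ereal (SUP x\<in>A. potential \<kappa> \<omega> x))"
  have c: "0 < c" by (simp add: c_def)
  have Uc: "U \<omega> x \<le> ennreal c" if x: "x \<in> A" for x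
  proof -
    have le: "potential \<kappa> \<omega> x \<le> (SUP x\<in>A. potential \<kappa> \<omega> x)" using x by (rule SUP_upper)
    moreover have "0 \<le> potential \<kappa> \<omega> x" by (simp add: potential_pos[OF \<omega>])
    ultimately have "\<bar>SUP x\<in>A. potential \<kappa> \<omega> x\<bar> \<noteq> \<infinity>" using assms(11) by auto
    then have "(SUP x\<in>A. potential \<kappa> \<omega> x) \<le> ereal c" by (simp add: c_def ereal_real)
    then have "e2ennreal (enn2ereal (U \<omega> x)) \<le> e2ennreal (ereal c)"
      using le unfolding potential_pos[OF \<omega>] by (intro e2ennreal_mono) (rule order_trans)
    then show ?thesis by simp
  qed
  have Ufin: "U \<omega> x < \<infinity>" if "x \<in> A" for x using Uc[OF that] by (simp add: order_le_less_trans)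
  let ?m = "compact_balayage \<kappa> \<omega>"
  have compact_bal: "swept \<omega> K (?m K) \<and> (\<forall>\<mu>. is_compact_balayage \<kappa> \<omega> K \<mu> \<longleftrightarrow> \<mu> = ?m K)" if K: "compact K" "K \<subseteq> A" for K
  proof -
    have fin: "\<forall>x\<in>K. U \<omega> x < \<infinity>" using Ufin K(2) by blast
    obtain n where n: "swept \<omega> K n" by (rule swept_continuous_exists[OF K(1) \<omega> assms(10)[OF K] fin])
    note iff = is_compact_balayage_iff_swept[OF n K(1) \<omega>]
    \<comment> \<open>Uniqueness identifies the definite description with the constructed measure,
      so the net of the statement is a net of swept measures.\<close>
    then have "?m K = n" unfolding compact_balayage_def by (intro the_equality) auto
    then show ?thesis using n iff by simp
  qed
  then have s: "\<forall>K. compact K \<and> K \<subseteq> A \<longrightarrow> swept \<omega> K (?m K)" by blast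
  have mass_le: "\<forall>K. compact K \<and> K \<subseteq> A \<longrightarrow> mass (?m K) \<le> H"
    unfolding H
  proof (intro allI impI)
    fix K assume K: "compact K \<and> K \<subseteq> A"
    then have "swept \<omega> K (?m K)" using s by blast
    then show "mass (?m K) \<le> ennreal h * mass \<omega>" by (rule swept_mass_le[OF _ _ \<omega> assms(5,4)]) (use K in blast)
  qed
  have bdd: "\<forall>K. compact K \<and> K \<subseteq> A \<longrightarrow> B (?m K) (?m K) \<le> c * enn2real H"
  proof (intro allI impI)
    fix K assume K: "compact K \<and> K \<subseteq> A"
    show "B (?m K) (?m K) \<le> c * enn2real H"
      by (rule swept_energy_le[of \<omega> K]) (use K s \<omega> c Uc mass_le H_fin in auto)
  qed
  obtain W where lim: "limitin (strong_topology_pos \<kappa>) ?m W (compacts_at_top A)"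
    by (rule swept_limit[OF \<omega> s bdd])
  interpret swept_net "TYPE('a)" \<kappa> A \<omega> ?m W H
    by unfold_locales (rule \<omega>, rule s, rule lim, rule mass_le)
  note bal = swept_limit_is_inner_balayage[OF \<omega> s lim]
  have gauss: "is_arg_min (gauss_functional \<kappa> f) (\<lambda>\<mu>'. \<mu>' \<in> finite_energy_on \<kappa> K) \<mu> \<longleftrightarrow> \<mu> = ?m K"
      "is_arg_min (gauss_functional \<kappa> f) (\<lambda>\<mu>'. \<mu>' \<in> finite_energy_mass_on \<kappa> H K) \<mu> \<longleftrightarrow> \<mu> = ?m K"
    if K: "compact K" "K \<subseteq> A" for K \<mu>
  proof -
    have sK: "swept \<omega> K (?m K)" and mK: "mass (?m K) \<le> H" using s mass_le K by blast+
    show "is_arg_min (gauss_functional \<kappa> f) (\<lambda>\<mu>'. \<mu>' \<in> finite_energy_on \<kappa> K) \<mu> \<longleftrightarrow> \<mu> = ?m K"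
      unfolding f by (rule gauss_minimizer_iff[OF sK \<omega> order.refl sweptD(1)[OF sK]])
    show "is_arg_min (gauss_functional \<kappa> f) (\<lambda>\<mu>'. \<mu>' \<in> finite_energy_mass_on \<kappa> H K) \<mu> \<longleftrightarrow> \<mu> = ?m K"
      unfolding f by (rule gauss_minimizer_iff[OF sK \<omega>])
        (use sweptD(1)[OF sK] mK in \<open>auto simp: finite_energy_mass_on_def\<close>)
  qed
  show ?thesis
  proof (intro conjI)
    show "\<exists>!\<nu>. is_inner_balayage \<kappa> A \<omega> \<nu>" by (simp add: bal)
    show "\<forall>K. compact K \<and> K \<subseteq> A \<longrightarrow>
        (\<exists>!\<mu>. is_compact_balayage \<kappa> \<omega> K \<mu>) \<and>
        (\<forall>\<mu>\<in>finite_energy_on \<kappa> K.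
           is_compact_balayage \<kappa> \<omega> K \<mu> \<longleftrightarrow>
           is_arg_min (gauss_functional \<kappa> f) (\<lambda>\<mu>'. \<mu>' \<in> finite_energy_on \<kappa> K) \<mu> \<and>
           is_arg_min (gauss_functional \<kappa> f) (\<lambda>\<mu>'. \<mu>' \<in> finite_energy_mass_on \<kappa> H K) \<mu>)"
      using compact_bal by (simp add: gauss)
  qed (use bal limit_iff_nearly_everywhere limit_iff_strong limit_iff_vague limit_iff_increasing
      limit_iff_least_potential limit_iff_least_norm in blast)+
qed

end
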